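(* Let $\{X_n\}$ be a stationary Gaussian sequence with mean $0$, variance $1$ and auto-covariance $\gamma(n)=L(n)n^{2d-1}$, where $0<d<1/2$ and $L$ is slowly varying at infinity. Let $G_1,\dots,G_J\in L^2(\phi)$ with $\mathbb{E}G_j(X_n)=0$, with Hermite ranks $k_1,\dots,k_J$ and Hermite expansions $G_j=\sum_{m\ge k_j} g_{m,j}H_m$. Suppose $$d<\tfrac12\Big(1-\tfrac1{k_j}\Big),\qquad j=1,\dots,J .$$ Let $A_j(N)=a_jN^{1/2}$, with constants $a_j>0$, be such that $\lim_{N\to\infty}\mathrm{Var}\big(A_j(N)^{-1}\sum_{n=1}^N G_j(X_n)\big)=1$ for $j=1,\dots,J$, and put $$\mathbf{V}_N(t)=\Big(\frac1{A_j(N)}\sum_{n=1}^{[Nt]}G_j(X_n)\Big)_{j=1,\dots,J},\qquad t>0 .$$ Then, as $N\to\infty$, the finite-dimensional distributions (in $t>0$) of $\mathbf{V}_N(t)$ converge to those of $\mathbf{B}(t)=(B_1(t),\dots,B_J(t))$, a multivariate Gaussian process whose marginals $B_j$ are standard Brownian motions and whose cross-covariances are $$\mathrm{Cov}(B_{j_1}(t_1),B_{j_2}(t_2))=\lim_{N\to\infty}\mathrm{Cov}(V_{N,j_1}(t_1),V_{N,j_2}(t_2))=(t_1\wedge t_2)\,\frac{1}{\sigma_{j_1}\sigma_{j_2}}\sum_{m=k_{j_1}\vee k_{j_2}}^\infty g_{m,j_1}g_{m,j_2}\,m!\sum_{n=-\infty}^\infty\gamma(n)^m ,$$ where $\sigma_j>0$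 and $\sigma_j^2=\sum_{m=k_j}^\infty g_{m,j}^2\,m!\sum_{n=-\infty}^\infty\gamma(n)^m$.
   Context: $\phi$ is the standard Gaussian measure on $\mathbb{R}$. $H_m(x)=(-1)^m e^{x^2/2}\frac{d^m}{dx^m}e^{-x^2/2}$ is the $m$-th Hermite polynomial; $\{H_m\}_{m\ge0}$ is a complete orthogonal basis of $L^2(\phi)$, and each $G\in L^2(\phi)$ has the expansion $G=\sum_{m\ge0}g_mH_m$, $g_m=(m!)^{-1}\int G H_m\,d\phi$. The Hermite rank of $G$ is the smallest $k\ge1$ with $g_k\ne0$ (functions are centered, so $g_0=0$). $\gamma(n)=\mathbb{E}X_nX_0$ for $n\in\mathbb{Z}$ (so $\gamma(-n)=\gamma(n)$; the formula $L(n)n^{2d-1}$ is for $n\ge1$). $[x]$ is the integer part, $a\wedge b=\min$, $a\vee b=\max$. *)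

theory Defs
  imports "HOL-Probability.Probability"
begin

definition hermite :: "nat \<Rightarrow> real \<Rightarrow> real" where
  "hermite m x = (- 1) ^ m * exp (x\<^sup>2 / 2) * (deriv ^^ m) (\<lambda>y. exp (- y\<^sup>2 / 2)) x"

definition L2_gauss :: "(real \<Rightarrow> real) set" where
  "L2_gauss = {G. G \<in> borel_measurable borel \<and> integrable std_normal_distribution (\<lambda>x. (G x)\<^sup>2)}"

definition hermite_coeff :: "(real \<Rightarrow> real) \<Rightarrow> nat \<Rightarrow> real" where
  "hermite_coeff G m = inverse (fact m) * (\<integral>x. G x * hermite m x \<partial>std_normal_distribution)"

definition has_hermite_rank :: "(real \<Rightarrow> real) \<Rightarrow> nat \<Rightarrow> bool" where
  "has_hermite_rank G k \<longleftrightarrow>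
     1 \<le> k \<and> hermite_coeff G k \<noteq> 0 \<and> (\<forall>i. 1 \<le> i \<and> i < k \<longrightarrow> hermite_coeff G i = 0)"

text \<open>As in Karamata's theory, \<open>L\<close> has to be positive and measurable only in a
  neighbourhood of infinity.\<close>

definition slowly_varying :: "(real \<Rightarrow> real) \<Rightarrow> bool" where
  "slowly_varying L \<longleftrightarrow>
     (\<exists>x0. (\<forall>x\<ge>x0. 0 < L x) \<and> L \<in> borel_measurable (restrict_space borel {x0..})) \<and>
     (\<forall>c>0. ((\<lambda>x. L (c * x) / L x) \<longlongrightarrow> 1) at_top)"

text \<open>The normal law with mean \<open>\<mu>\<close> and standard deviation \<open>\<sigma>\<close>; for \<open>\<sigma> = 0\<close> it is
  the point mass at \<open>\<mu>\<close>, so that linearly dependent Gaussian vectors are covered.\<close>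

definition normal_law :: "real \<Rightarrow> real \<Rightarrow> real measure" where
  "normal_law \<mu> \<sigma> = (if \<sigma> = 0 then return borel \<mu> else density lborel (normal_density \<mu> \<sigma>))"

definition gaussian_process :: "'a measure \<Rightarrow> 'i set \<Rightarrow> ('i \<Rightarrow> 'a \<Rightarrow> real) \<Rightarrow> bool" where
  "gaussian_process M I Z \<longleftrightarrow>
     (\<forall>i\<in>I. Z i \<in> borel_measurable M) \<and>
     (\<forall>F c. finite F \<and> F \<subseteq> I \<longrightarrow>
       (\<exists>\<mu> \<sigma>. 0 \<le> \<sigma> \<and> distr M borel (\<lambda>\<omega>. \<Sum>i\<in>F. c i * Z i \<omega>) = normal_law \<mu> \<sigma>))"

definition stationary_seq :: "'a measure \<Rightarrow> (int \<Rightarrow> 'a \<Rightarrow> real) \<Rightarrow> bool" where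
  "stationary_seq M X \<longleftrightarrow>
     (\<forall>n. X n \<in> borel_measurable M) \<and>
     (\<forall>F h. finite F \<longrightarrow>
        distr M (Pi\<^sub>M F (\<lambda>_. borel)) (\<lambda>\<omega>. \<lambda>n\<in>F. X (n + h) \<omega>) =
        distr M (Pi\<^sub>M F (\<lambda>_. borel)) (\<lambda>\<omega>. \<lambda>n\<in>F. X n \<omega>))"

definition covariance :: "'a measure \<Rightarrow> ('a \<Rightarrow> real) \<Rightarrow> ('a \<Rightarrow> real) \<Rightarrow> real" where
  "covariance M Y Z =
     (\<integral>\<omega>. (Y \<omega> - (\<integral>\<omega>'. Y \<omega>' \<partial>M)) * (Z \<omega> - (\<integral>\<omega>'. Z \<omega>' \<partial>M)) \<partial>M)"

definition standard_brownian_motion :: "'a measure \<Rightarrow> (real \<Rightarrow> 'a \<Rightarrow> real) \<Rightarrow> bool" where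
  "standard_brownian_motion M W \<longleftrightarrow>
     prob_space M \<and>
     (\<forall>t\<ge>0. W t \<in> borel_measurable M) \<and>
     (AE \<omega> in M. W 0 \<omega> = 0) \<and>
     (\<forall>n t. 0 \<le> t 0 \<and> (\<forall>i<n. t i < t (Suc i)) \<longrightarrow>
        prob_space.indep_vars M (\<lambda>_. borel) (\<lambda>i \<omega>. W (t (Suc i)) \<omega> - W (t i) \<omega>) {..<n::nat}) \<and>
     (\<forall>s t. 0 \<le> s \<and> s < t \<longrightarrow>
        distributed M lborel (\<lambda>\<omega>. W t \<omega> - W s \<omega>) (normal_density 0 (sqrt (t - s)))) \<and>
     (AE \<omega> in M. continuous_on {0..} (\<lambda>t. W t \<omega>))"

text \<open>Convergence in distribution of random vectors with the finite index set \<open>I\<close>.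
  The set \<open>I \<rightarrow>\<^sub>E UNIV\<close>, with the topology of pointwise convergence, is a copy of
  Euclidean space of dimension \<open>card I\<close>.\<close>

definition vec_conv_in_dist ::
  "'a measure \<Rightarrow> (nat \<Rightarrow> 'i \<Rightarrow> 'a \<Rightarrow> real) \<Rightarrow> 'b measure \<Rightarrow> ('i \<Rightarrow> 'b \<Rightarrow> real) \<Rightarrow> 'i set \<Rightarrow> bool" where
  "vec_conv_in_dist M Y P Z I \<longleftrightarrow>
     (\<forall>i\<in>I. \<forall>N. Y N i \<in> borel_measurable M) \<and> (\<forall>i\<in>I. Z i \<in> borel_measurable P) \<and>
     (\<forall>f :: ('i \<Rightarrow> real) \<Rightarrow> real.
        continuous_on (I \<rightarrow>\<^sub>E UNIV) f \<and> bounded (f ` (I \<rightarrow>\<^sub>E UNIV)) \<longrightarrow>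
        (\<lambda>N. \<integral>\<omega>. f (\<lambda>i\<in>I. Y N i \<omega>) \<partial>M) \<longlonglongrightarrow> (\<integral>\<omega>. f (\<lambda>i\<in>I. Z i \<omega>) \<partial>P))"

text \<open>Processes with time parameter \<open>t > 0\<close> and components \<open>j \<in> K\<close>.\<close>

definition fdd_converge ::
  "'k set \<Rightarrow> 'a measure \<Rightarrow> (nat \<Rightarrow> 'k \<Rightarrow> real \<Rightarrow> 'a \<Rightarrow> real) \<Rightarrow>
   'b measure \<Rightarrow> ('k \<Rightarrow> real \<Rightarrow> 'b \<Rightarrow> real) \<Rightarrow> bool" where
  "fdd_converge K M V P B \<longleftrightarrow>
     (\<forall>T. finite T \<and> T \<subseteq> {0<..} \<longrightarrow>
        vec_conv_in_dist M (\<lambda>N (j, t). V N j t) P (\<lambda>(j, t). B j t) (K \<times> T))"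

definition partial_sum_process ::
  "(int \<Rightarrow> 'a \<Rightarrow> real) \<Rightarrow> (nat \<Rightarrow> real \<Rightarrow> real) \<Rightarrow> (nat \<Rightarrow> nat \<Rightarrow> real) \<Rightarrow>
   nat \<Rightarrow> nat \<Rightarrow> real \<Rightarrow> 'a \<Rightarrow> real" where
  "partial_sum_process X G A N j t \<omega> =
     1 / A j N * (\<Sum>n\<in>{1..\<lfloor>real N * t\<rfloor>}. G j (X n \<omega>))"

definition cov_term :: "(int \<Rightarrow> real) \<Rightarrow> (real \<Rightarrow> real) \<Rightarrow> (real \<Rightarrow> real) \<Rightarrow> nat \<Rightarrow> real" where
  "cov_term \<gamma> G H m =
     hermite_coeff G m * hermite_coeff H m * fact m * (\<Sum>\<^sub>\<infinity>n\<in>UNIV. \<gamma> n ^ m)"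

end

theory Submission
  imports Defs
begin

text \<open>Let \<open>k\<close> be the smallest of the ranks. The long memory condition and a growth bound for slowly
  varying functions make \<open>\<bar>\<gamma>\<bar> ^ k\<close> summable, so the sum of a function of rank at least \<open>k\<close> over
  \<open>N\<close> indices has variance at most \<open>N\<close> times a constant times its squared norm. Hence it suffices to
  treat finite Hermite expansions. For a normalized sum \<open>S\<close> of those, Gaussian integration by parts gives
  \<open>E (S * cis (\<theta> * S)) = \<i> * \<theta> * E (T * cis (\<theta> * S))\<close> for a random variable \<open>T\<close>, quadratic in Hermite
  polynomials of the \<open>X n\<close>, whose mean converges to the limit variance \<open>\<tau>\<close>. A bound for the covariances
  of products of two Hermite polynomials, by a sum over multigraphs on four vertices, shows that the
  variance of \<open>T\<close> tends to \<open>0\<close>; so the characteristic function \<open>\<phi>\<close> of \<open>S\<close> almost solves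
  \<open>\<phi>' = - \<theta> * \<tau> * \<phi>\<close>. The limit is a linear image of independent Brownian motions, built from Schauder
  functions on a space of independent normal variables, and the normalization forces \<open>\<sigma> j = a j\<close>.\<close>

section \<open>Characteristic functions of random vectors\<close>

text \<open>Weak convergence is tested by all bounded continuous functions of a vector indexed by
  components and times. Multivariate characteristic functions turn this into the study of one scalar
  sum whose coefficients vary with the index. The limit may be degenerate, as the functions may be
  linearly dependent, so neither a joint density nor a positive limit variance is available:
  integration by parts comes from resampling one coordinate, and the differential equation is
  integrated for every real \<open>\<tau>\<close>. The condition on \<open>d\<close> says that
  \<open>(1 - 2 * d) * k\<close> exceeds 1; the surplus pays for the slowly varying factor. As
  \<open>\<bar>\<gamma>\<bar>\<close> is at most 1, summability passes to all higher powers and one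
  exponent serves every component. The obstacle is that \<open>\<gamma>\<close> itself need not be
  summable, so mixed products along the edges of a graph cannot be summed edge by edge. Bounding
  them by pure powers only gives the square of the window size, the order to be beaten; the gain
  comes from edges between the two pairs of vertices, by Young's inequality and a split into near
  and far lags.\<close>

inductive_set trig_poly :: "'i set \<Rightarrow> (('i \<Rightarrow> real) \<Rightarrow> complex) set" for I where
  cis: "(\<lambda>x. cis (\<Sum>i\<in>I. c i * x i)) \<in> trig_poly I"
| add: "u \<in> trig_poly I \<Longrightarrow> v \<in> trig_poly I \<Longrightarrow> (\<lambda>x. u x + v x) \<in> trig_poly I"
| scale: "u \<in> trig_poly I \<Longrightarrow> (\<lambda>x. w * u x) \<in> trig_poly I"

text \<open>Frequencies add under multiplication. Closure under products makes these functions an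
  algebra, as Stone-Weierstrass demands, while linearity alone carries the convergence of
  characteristic functions over to them.\<close>

lemma trig_poly_mult:
  assumes "u \<in> trig_poly I" "v \<in> trig_poly I"
  shows "(\<lambda>x. u x * v x) \<in> trig_poly I"
  using assms(1)
proof induction
  case (cis c)
  show ?case using assms(2)
  proof induction
    case (cis c')
    have "(\<lambda>x. cis (\<Sum>i\<in>I. c i * x i) * cis (\<Sum>i\<in>I. c' i * x i)) =
        (\<lambda>x. cis (\<Sum>i\<in>I. (c i + c' i) * x i))"
      by (simp add: cis_mult sum.distrib distrib_right)
    then show ?case by (simp only: trig_poly.cis)
  next
    case (add u v)
    then show ?case by (simp add: distrib_left trig_poly.add)
  next
    case (scale u w)
    have "(\<lambda>x. cis (\<Sum>i\<in>I. c i * x i) * (w * u x)) = (\<lambda>x. w * (cis (\<Sum>i\<in>I. c i * x i) * u x))"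
      by (simp add: ac_simps)
    with scale show ?case by (simp only: trig_poly.scale)
  qed
next
  case (add u u')
  then show ?case by (simp add: distrib_right trig_poly.add)
next
  case (scale u w)
  then show ?case by (simp add: mult.assoc trig_poly.scale)
qed

lemma trig_poly_const: "(\<lambda>x. w) \<in> trig_poly I"
  using trig_poly.scale[OF trig_poly.cis[where c = "\<lambda>_. 0"], of w I] by simp

text \<open>A sine is a combination of two exponentials. Sines of single coordinates are what
  separates points in the Stone-Weierstrass argument.\<close>

lemma trig_poly_sin:
  assumes "finite I" "i \<in> I"
  shows "(\<lambda>x. of_real (sin (r * x i))) \<in> trig_poly I"
proof -
  have *: "(\<Sum>j\<in>I. (if j = i then s else 0) * x j) = s * x i" for s and x :: "'a \<Rightarrow> real"
    using assms by (simp add: if_distrib[of "\<lambda>c. c * _"] cong: if_cong)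
  have cis: "(\<lambda>x. cis (s * x i)) \<in> trig_poly I" for s
    using trig_poly.cis[of "\<lambda>j. if j = i then s else 0" I] unfolding * .
  have "complex_of_real (sin t) = (1 / (2 * \<i>)) * cis t + (- 1 / (2 * \<i>)) * cis (- t)" for t
    by (simp add: complex_eq_iff Re_divide Im_divide power2_eq_square)
  then have "(\<lambda>x. complex_of_real (sin (r * x i))) =
      (\<lambda>x. (1 / (2 * \<i>)) * cis (r * x i) + (- 1 / (2 * \<i>)) * cis ((- r) * x i))"
    by auto
  then show ?thesis
    using trig_poly.add[OF trig_poly.scale[OF cis] trig_poly.scale[OF cis]] by presburger
qed

lemma trig_poly_measurable:
  assumes "u \<in> trig_poly I" "\<And>i. i \<in> I \<Longrightarrow> Y i \<in> borel_measurable M"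
  shows "(\<lambda>\<omega>. u (\<lambda>i\<in>I. Y i \<omega>)) \<in> borel_measurable M"
  using assms(1)
proof induction
  case (cis c)
  have [measurable]: "cis \<in> borel_measurable borel"
    by (intro borel_measurable_continuous_onI continuous_intros)
  have "(\<lambda>\<omega>. cis (\<Sum>i\<in>I. c i * Y i \<omega>)) \<in> borel_measurable M"
    using assms(2) by measurable
  then show ?case by simp
qed auto

lemma trig_poly_bounded: "u \<in> trig_poly I \<Longrightarrow> \<exists>B. \<forall>x. norm (u x) \<le> B"
proof (induction rule: trig_poly.induct)
  case (cis c)
  then show ?case by auto
next
  case (add u v)
  then obtain B B' where "\<forall>x. norm (u x) \<le> B" "\<forall>x. norm (v x) \<le> B'" by auto
  then have "\<forall>x. norm (u x + v x) \<le> B + B'"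
    by (meson add_mono norm_triangle_le)
  then show ?case ..
next
  case (scale u w)
  then obtain B where "\<forall>x. norm (u x) \<le> B" by auto
  then have "\<forall>x. norm (w * u x) \<le> norm w * B"
    by (simp add: norm_mult mult_left_mono)
  then show ?case ..
qed

lemma (in prob_space) trig_poly_integrable:
  assumes "u \<in> trig_poly I" "\<And>i. i \<in> I \<Longrightarrow> Y i \<in> borel_measurable M"
  shows "integrable M (\<lambda>\<omega>. u (\<lambda>i\<in>I. Y i \<omega>))"
proof -
  obtain B where "\<forall>x. norm (u x) \<le> B" using trig_poly_bounded[OF assms(1)] ..
  then show ?thesis
    by (intro integrable_const_bound[where B = B] trig_poly_measurable assms) auto
qed

text \<open>Outside \<open>I\<close> every element takes the value \<open>undefined\<close>, so the
  cube is a product of compact sets over the whole type and Tychonoff's theorem applies.\<close>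

lemma compact_PiE_cube: "compact (I \<rightarrow>\<^sub>E {a..b::real})"
proof -
  have "(I \<rightarrow>\<^sub>E {a..b}) = (\<Pi>\<^sub>E i\<in>UNIV. if i \<in> I then {a..b} else {undefined})"
    by (auto simp: PiE_iff extensional_def split: if_splits)
  moreover have "compactin (product_topology (\<lambda>_. euclidean) UNIV)
      (\<Pi>\<^sub>E i\<in>UNIV. if i \<in> I then {a..b} else {undefined})"
    by (subst compactin_PiE) auto
  ultimately show ?thesis
    by (simp add: euclidean_product_topology)
qed

text \<open>Substituting \<open>s = sin (x / R)\<close> turns \<open>f\<close> on the box of radius \<open>R\<close> into a continuous function
  on a cube, and polynomial approximants on the cube into trigonometric polynomials
  that stay bounded on the whole space.\<close>

lemma trig_poly_approx:
  fixes f :: "('i \<Rightarrow> real) \<Rightarrow> real"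
  assumes I: "finite I" and f: "continuous_on (I \<rightarrow>\<^sub>E UNIV) f"
    and C: "\<And>x. x \<in> I \<rightarrow>\<^sub>E UNIV \<Longrightarrow> \<bar>f x\<bar> \<le> C" and R: "0 < R" and e: "0 < e"
  obtains u where "(\<lambda>x. of_real (u x)) \<in> trig_poly I"
    "\<And>x. x \<in> I \<rightarrow>\<^sub>E UNIV \<Longrightarrow> (\<And>i. i \<in> I \<Longrightarrow> \<bar>x i\<bar> \<le> R) \<Longrightarrow> \<bar>u x - f x\<bar> < e"
    "\<And>x. \<bar>u x\<bar> \<le> C + e"
proof -
  \<comment> \<open>The coordinates are relabelled by natural numbers: functions on a countable type
    form a metric space, hence a Hausdorff space as \<open>function_ring_on\<close>
    requires.\<close>
  obtain b where b: "bij_betw b {..<card I} I"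
    using I ex_bij_betw_nat_finite[of I] by (auto simp: atLeast0LessThan)
  define b' where "b' = the_inv_into {..<card I} b"
  have b_in: "b k \<in> I" if "k < card I" for k using b that by (auto simp: bij_betw_def)
  have b'_in: "b' i < card I" if "i \<in> I" for i
    using the_inv_into_into[of b "{..<card I}" i] b that by (auto simp: bij_betw_def b'_def)
  have bb': "b (b' i) = i" if "i \<in> I" for i
    unfolding b'_def using b that by (auto simp: bij_betw_def intro!: f_the_inv_into_f)
  define K where "K = ({..<card I} \<rightarrow>\<^sub>E {-1..1::real})"
  define sn where "sn x = (\<lambda>k\<in>{..<card I}. sin (1 / R * x (b k)))" for x :: "'i \<Rightarrow> real"
  \<comment> \<open>Membership asks for a trigonometric pullback along \<open>sn\<close>, so that an
    approximant on the cube is at once a trigonometric polynomial on the whole space.\<close>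
  define RR where "RR = {h. continuous_on K h \<and> (\<lambda>x. complex_of_real (h (sn x))) \<in> trig_poly I}"
  define F where "F s = f (\<lambda>i\<in>I. R * arcsin (s (b' i)))" for s
  have sn_K: "sn x \<in> K" for x by (auto simp: sn_def K_def)
  interpret function_ring_on RR K
  proof
    show "compact K" unfolding K_def by (rule compact_PiE_cube)
    show "continuous_on K h" if "h \<in> RR" for h using that by (simp add: RR_def)
    show "(\<lambda>x. h x + g x) \<in> RR" if "h \<in> RR" "g \<in> RR" for h g
      using that trig_poly.add[of "\<lambda>x. complex_of_real (h (sn x))" I "\<lambda>x. complex_of_real (g (sn x))"]
      by (auto simp: RR_def intro!: continuous_intros)
    show "(\<lambda>x. h x * g x) \<in> RR" if "h \<in> RR" "g \<in> RR" for h g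
      using that trig_poly_mult[of "\<lambda>x. complex_of_real (h (sn x))" I "\<lambda>x. complex_of_real (g (sn x))"]
      by (auto simp: RR_def intro!: continuous_intros)
    show "(\<lambda>_. c) \<in> RR" for c by (auto simp: RR_def trig_poly_const)
    show "\<exists>h\<in>RR. h x \<noteq> h y" if "x \<in> K" "y \<in> K" "x \<noteq> y" for x y
    proof -
      from that obtain k where k: "k < card I" "x k \<noteq> y k"
        unfolding K_def by (metis PiE_ext lessThan_iff)
      have "continuous_on K (\<lambda>x. x k)"
        using continuous_on_product_coordinates[of k] continuous_on_subset by blast
      then have "(\<lambda>x. x k) \<in> RR"
        using trig_poly_sin[OF I b_in[OF k(1)], of "1 / R"] k(1)
        by (simp add: RR_def sn_def)
      with k(2) show ?thesis by (intro bexI[of _ "\<lambda>x. x k"])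
    qed
  qed
  have "continuous_on K F"
    unfolding F_def
  proof (rule continuous_on_compose2[OF f])
    show "continuous_on K (\<lambda>s. \<lambda>i\<in>I. R * arcsin (s (b' i)))"
    proof (rule continuous_on_coordinatewise_then_product)
      fix i
      show "continuous_on K (\<lambda>s. (\<lambda>i\<in>I. R * arcsin (s (b' i))) i)"
      proof (cases "i \<in> I")
        case True
        have "continuous_on K (\<lambda>s. s (b' i))"
          using continuous_on_product_coordinates[of "b' i"] continuous_on_subset by blast
        moreover have "\<forall>s\<in>K. - 1 \<le> s (b' i) \<and> s (b' i) \<le> 1"
          using b'_in[OF True] by (auto simp: K_def PiE_iff)
        ultimately have "continuous_on K (\<lambda>s. R * arcsin (s (b' i)))"
          by (intro continuous_on_mult_left continuous_on_arcsin)
        with True show ?thesis by simp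
      qed simp
    qed
  qed auto
  from Stone_Weierstrass_basic[OF this e] obtain g where
    g: "g \<in> RR" and close: "\<And>s. s \<in> K \<Longrightarrow> \<bar>F s - g s\<bar> < e" by blast
  show ?thesis
  proof
    show "(\<lambda>x. of_real ((g \<circ> sn) x)) \<in> trig_poly I" using g by (simp add: RR_def)
    show "\<bar>(g \<circ> sn) x\<bar> \<le> C + e" for x
      using close[OF sn_K[of x]] C[of "\<lambda>i\<in>I. R * arcsin (sn x (b' i))"] by (auto simp: F_def)
    show "\<bar>(g \<circ> sn) x - f x\<bar> < e" if x: "x \<in> I \<rightarrow>\<^sub>E UNIV" "\<And>i. i \<in> I \<Longrightarrow> \<bar>x i\<bar> \<le> R" for x
    proof -
      have "R * arcsin (sn x (b' i)) = x i" if "i \<in> I" for i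
      proof -
        \<comment> \<open>Division by \<open>R\<close> keeps the angle in [-1, 1], inside the
          interval where \<open>arcsin\<close> inverts the sine.\<close>
        have "\<bar>x i / R\<bar> \<le> 1" using x(2)[OF that] R by (simp add: divide_le_eq)
        then have "arcsin (sin (x i / R)) = x i / R"
          using pi_gt3 unfolding abs_le_iff by (intro arcsin_sin) linarith+
        then show ?thesis using R that by (simp add: sn_def b'_in bb')
      qed
      then have "F (sn x) = f x"
        unfolding F_def using x(1)
        by (intro arg_cong[of _ _ f]) (auto simp: fun_eq_iff PiE_iff extensional_def)
      then show ?thesis using close[OF sn_K[of x]] by (simp add: abs_minus_commute)
    qed
  qed
qed

text \<open>Continuity refers to the product topology, whereas the \<open>Y i\<close> are measurable
  one by one. A pointwise limit of trigonometric polynomials, on boxes that grow while the error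
  shrinks, bridges the two.\<close>

lemma measurable_continuous_on_PiE:
  fixes f :: "('i \<Rightarrow> real) \<Rightarrow> real"
  assumes I: "finite I" and f: "continuous_on (I \<rightarrow>\<^sub>E UNIV) f"
    and C: "\<And>x. x \<in> I \<rightarrow>\<^sub>E UNIV \<Longrightarrow> \<bar>f x\<bar> \<le> C"
    and Y: "\<And>i. i \<in> I \<Longrightarrow> Y i \<in> borel_measurable M"
  shows "(\<lambda>\<omega>. f (\<lambda>i\<in>I. Y i \<omega>)) \<in> borel_measurable M"
proof -
  have "\<exists>u. (\<lambda>x. complex_of_real (u x)) \<in> trig_poly I \<and>
      (\<forall>x \<in> I \<rightarrow>\<^sub>E UNIV. (\<forall>i\<in>I. \<bar>x i\<bar> \<le> real (Suc n)) \<longrightarrow> \<bar>u x - f x\<bar> < 1 / Suc n)" for n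
    by (rule trig_poly_approx[OF I f C, of "real (Suc n)" "1 / Suc n"]) auto
  then obtain u where u: "\<And>n. (\<lambda>x. complex_of_real (u n x)) \<in> trig_poly I"
    "\<And>n x. x \<in> I \<rightarrow>\<^sub>E UNIV \<Longrightarrow> (\<And>i. i \<in> I \<Longrightarrow> \<bar>x i\<bar> \<le> real (Suc n)) \<Longrightarrow> \<bar>u n x - f x\<bar> < 1 / Suc n"
    by metis
  show ?thesis
  proof (rule borel_measurable_LIMSEQ_metric)
    show "(\<lambda>\<omega>. u n (\<lambda>i\<in>I. Y i \<omega>)) \<in> borel_measurable M" for n
      using measurable_compose[OF trig_poly_measurable[OF u(1)[of n], of Y M] borel_measurable_Re] Y by simp
    fix \<omega>
    let ?x = "\<lambda>i\<in>I. Y i \<omega>"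
    show "(\<lambda>n. u n ?x) \<longlonglongrightarrow> f ?x"
    proof (rule LIM_zero_cancel, rule tendsto_rabs_zero_cancel,
        rule tendsto_sandwich[of "\<lambda>_. 0" _ _ "\<lambda>n. 1 / real (Suc n)"])
      obtain n0 :: nat where n0: "(\<Sum>i\<in>I. \<bar>Y i \<omega>\<bar>) \<le> real n0"
        using real_arch_simple by blast
      have "\<bar>u n ?x - f ?x\<bar> \<le> 1 / Suc n" if "n \<ge> n0" for n
      proof (rule less_imp_le, rule u(2))
        fix i assume "i \<in> I"
        then have "\<bar>Y i \<omega>\<bar> \<le> (\<Sum>i\<in>I. \<bar>Y i \<omega>\<bar>)" using I by (intro member_le_sum) auto
        then show "\<bar>?x i\<bar> \<le> real (Suc n)" using n0 that \<open>i \<in> I\<close> by simp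
      qed auto
      then show "\<forall>\<^sub>F n in sequentially. \<bar>u n ?x - f ?x\<bar> \<le> 1 / Suc n"
        by (auto simp: eventually_sequentially)
      show "(\<lambda>n. 1 / real (Suc n)) \<longlonglongrightarrow> 0" by (rule LIMSEQ_Suc) (rule lim_1_over_n)
    qed auto
  qed
qed

text \<open>Off an event of probability at most \<open>e\<close> the integrands differ by less than
  \<open>e\<close>; on it they are bounded by \<open>C + e\<close> and \<open>C\<close>. With
  \<open>e \<le> 1\<close> this adds up to \<open>e + (2 * C + 1) * e\<close>.\<close>

lemma (in prob_space) trig_approx_integral_error:
  fixes f u :: "('i \<Rightarrow> real) \<Rightarrow> real"
  assumes I: "finite I" and f: "continuous_on (I \<rightarrow>\<^sub>E UNIV) f"
    and C: "\<And>x. x \<in> I \<rightarrow>\<^sub>E UNIV \<Longrightarrow> \<bar>f x\<bar> \<le> C" "0 \<le> C" and e: "0 < e" "e \<le> 1"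
    and u: "(\<lambda>x. of_real (u x)) \<in> trig_poly I"
    "\<And>x. x \<in> I \<rightarrow>\<^sub>E UNIV \<Longrightarrow> (\<And>i. i \<in> I \<Longrightarrow> \<bar>x i\<bar> \<le> R) \<Longrightarrow> \<bar>u x - f x\<bar> < e"
    "\<And>x. \<bar>u x\<bar> \<le> C + e"
    and Y[measurable]: "\<And>i. i \<in> I \<Longrightarrow> Y i \<in> borel_measurable M"
    and out: "prob {\<omega>\<in>space M. \<exists>i\<in>I. R < \<bar>Y i \<omega>\<bar>} \<le> e"
  shows "\<bar>(\<integral>\<omega>. u (\<lambda>i\<in>I. Y i \<omega>) \<partial>M) - (\<integral>\<omega>. f (\<lambda>i\<in>I. Y i \<omega>) \<partial>M)\<bar> \<le> e * (2 * C + 2)"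
proof -
  define A where "A = {\<omega>\<in>space M. \<exists>i\<in>I. R < \<bar>Y i \<omega>\<bar>}"
  have A[measurable]: "A \<in> sets M" unfolding A_def using I by measurable
  have int_u: "integrable M (\<lambda>\<omega>. u (\<lambda>i\<in>I. Y i \<omega>))"
    using integrable_Re[OF trig_poly_integrable[OF u(1) Y]] by simp
  have int_f: "integrable M (\<lambda>\<omega>. f (\<lambda>i\<in>I. Y i \<omega>))"
    using C by (intro integrable_const_bound[where B = C] measurable_continuous_on_PiE[OF I f C(1) Y]) auto
  have int_A: "integrable M (indicat_real A)"
    by (rule integrable_real_indicator) (simp_all add: emeasure_eq_measure)
  have "\<bar>(\<integral>\<omega>. u (\<lambda>i\<in>I. Y i \<omega>) \<partial>M) - (\<integral>\<omega>. f (\<lambda>i\<in>I. Y i \<omega>) \<partial>M)\<bar> =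
      \<bar>\<integral>\<omega>. u (\<lambda>i\<in>I. Y i \<omega>) - f (\<lambda>i\<in>I. Y i \<omega>) \<partial>M\<bar>"
    using int_u int_f by simp
  also have "\<dots> \<le> (\<integral>\<omega>. \<bar>u (\<lambda>i\<in>I. Y i \<omega>) - f (\<lambda>i\<in>I. Y i \<omega>)\<bar> \<partial>M)"
    by (rule integral_abs_bound)
  also have "\<dots> \<le> (\<integral>\<omega>. e + (2 * C + 1) * indicator A \<omega> \<partial>M)"
  proof (rule integral_mono)
    fix \<omega> assume \<omega>: "\<omega> \<in> space M"
    let ?x = "\<lambda>i\<in>I. Y i \<omega>"
    show "\<bar>u ?x - f ?x\<bar> \<le> e + (2 * C + 1) * indicator A \<omega>"
    proof (cases "\<omega> \<in> A")
      case True
      have "\<bar>u ?x - f ?x\<bar> \<le> (C + e) + C"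
        using u(3)[of ?x] C(1)[of ?x] by fastforce
      with True e show ?thesis by simp
    next
      case False
      then have "\<bar>u ?x - f ?x\<bar> < e" using \<omega> by (intro u(2)) (auto simp: not_less A_def)
      with False show ?thesis by simp
    qed
  qed (use int_u int_f int_A in auto)
  also have "\<dots> = e + (2 * C + 1) * prob A"
    using int_A by (simp add: prob_space)
  also have "\<dots> \<le> e + (2 * C + 1) * e"
    using out C unfolding A_def[symmetric] by (intro add_left_mono mult_left_mono) auto
  finally show ?thesis by (simp add: algebra_simps)
qed

text \<open>The events decrease to the empty set as the radius grows, so continuity of the measure
  from above suffices.\<close>

lemma (in prob_space) finite_family_tight:
  fixes Y :: "'i \<Rightarrow> 'a \<Rightarrow> real"
  assumes I: "finite I" and Y[measurable]: "\<And>i. i \<in> I \<Longrightarrow> Y i \<in> borel_measurable M" and e: "0 < e"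
  shows "\<exists>R. \<forall>R'\<ge>R. prob {\<omega>\<in>space M. \<exists>i\<in>I. R' < \<bar>Y i \<omega>\<bar>} \<le> e"
proof -
  define A where "A n = {\<omega>\<in>space M. \<exists>i\<in>I. real n < \<bar>Y i \<omega>\<bar>}" for n
  have A[measurable]: "A n \<in> sets M" for n unfolding A_def using I by measurable
  have "(\<lambda>n. prob (A n)) \<longlonglongrightarrow> prob (\<Inter>n. A n)"
    proof (rule finite_Lim_measure_decseq)
    show "decseq A"
      by (auto simp: decseq_def A_def) (meson le_less_trans of_nat_le_iff)
  qed auto
  moreover have "(\<Inter>n. A n) = {}"
  proof (rule ccontr)
    assume "(\<Inter>n. A n) \<noteq> {}"
    then obtain \<omega> where \<omega>: "\<And>n. \<omega> \<in> A n" by auto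
    obtain n where n: "(\<Sum>i\<in>I. \<bar>Y i \<omega>\<bar>) \<le> real n" using real_arch_simple by blast
    from \<omega>[of n] obtain i where i: "i \<in> I" "real n < \<bar>Y i \<omega>\<bar>" by (auto simp: A_def)
    have "\<bar>Y i \<omega>\<bar> \<le> (\<Sum>i\<in>I. \<bar>Y i \<omega>\<bar>)" using I i by (intro member_le_sum) auto
    with n i show False by simp
  qed
  ultimately have "(\<lambda>n. prob (A n)) \<longlonglongrightarrow> 0" by simp
  from order_tendstoD(2)[OF this e] obtain n where n: "prob (A n) < e"
    by (auto simp: eventually_sequentially)
  have "prob {\<omega>\<in>space M. \<exists>i\<in>I. R' < \<bar>Y i \<omega>\<bar>} \<le> prob (A n)" if "R' \<ge> real n" for R'
    proof (rule finite_measure_mono)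
    show "{\<omega>\<in>space M. \<exists>i\<in>I. R' < \<bar>Y i \<omega>\<bar>} \<subseteq> A n"
      using that by (auto simp: A_def intro: le_less_trans)
  qed simp
  with n show ?thesis by (meson less_imp_le order_trans)
qed

text \<open>One direction of Levy's continuity theorem in several dimensions. Tightness is assumed:
  bounded second moments supply it in the application, and then one trigonometric approximant on a
  common box controls all the integrals at once.\<close>

lemma vec_levy_continuity:
  fixes f :: "('i \<Rightarrow> real) \<Rightarrow> real"
  assumes M: "\<And>N. prob_space (M N)" and P: "prob_space P" and I: "finite I"
    and Y[measurable]: "\<And>N i. i \<in> I \<Longrightarrow> Y N i \<in> borel_measurable (M N)"
    and Z[measurable]: "\<And>i. i \<in> I \<Longrightarrow> Z i \<in> borel_measurable P"
    and char: "\<And>c. (\<lambda>N. \<integral>\<omega>. cis (\<Sum>i\<in>I. c i * Y N i \<omega>) \<partial>M N) \<longlonglongrightarrow>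
        (\<integral>\<omega>. cis (\<Sum>i\<in>I. c i * Z i \<omega>) \<partial>P)"
    and tight: "\<And>e. 0 < e \<Longrightarrow> \<exists>R. \<forall>R'\<ge>R. \<forall>N. measure (M N) {\<omega>\<in>space (M N). \<exists>i\<in>I. R' < \<bar>Y N i \<omega>\<bar>} \<le> e"
    and f: "continuous_on (I \<rightarrow>\<^sub>E UNIV) f" "bounded (f ` (I \<rightarrow>\<^sub>E UNIV))"
  shows "(\<lambda>N. \<integral>\<omega>. f (\<lambda>i\<in>I. Y N i \<omega>) \<partial>M N) \<longlonglongrightarrow> (\<integral>\<omega>. f (\<lambda>i\<in>I. Z i \<omega>) \<partial>P)"
proof -
  interpret M: prob_space "M N" for N by (rule M)
  interpret P: prob_space P by (rule P)
  obtain C where C: "\<And>x. x \<in> I \<rightarrow>\<^sub>E UNIV \<Longrightarrow> \<bar>f x\<bar> \<le> C" "0 \<le> C"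
  proof -
    from f(2) obtain C where "\<And>x. x \<in> I \<rightarrow>\<^sub>E UNIV \<Longrightarrow> \<bar>f x\<bar> \<le> C" by (auto simp: bounded_iff)
    then have "\<And>x. x \<in> I \<rightarrow>\<^sub>E UNIV \<Longrightarrow> \<bar>f x\<bar> \<le> \<bar>C\<bar>" by (meson abs_ge_self order_trans)
    then show ?thesis using that[of "\<bar>C\<bar>"] by auto
  qed
  have trig: "(\<lambda>N. \<integral>\<omega>. u (\<lambda>i\<in>I. Y N i \<omega>) \<partial>M N) \<longlonglongrightarrow> (\<integral>\<omega>. u (\<lambda>i\<in>I. Z i \<omega>) \<partial>P)"
    if "u \<in> trig_poly I" for u
    using that
  proof induction
    case (cis c)
    then show ?case using char[of c] by simp
  next
    case (add u v)
    have "(\<integral>\<omega>. u (\<lambda>i\<in>I. Y N i \<omega>) + v (\<lambda>i\<in>I. Y N i \<omega>) \<partial>M N) =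
        (\<integral>\<omega>. u (\<lambda>i\<in>I. Y N i \<omega>) \<partial>M N) + (\<integral>\<omega>. v (\<lambda>i\<in>I. Y N i \<omega>) \<partial>M N)" for N
      using add Y by (intro Bochner_Integration.integral_add M.trig_poly_integrable)
    moreover have "(\<integral>\<omega>. u (\<lambda>i\<in>I. Z i \<omega>) + v (\<lambda>i\<in>I. Z i \<omega>) \<partial>P) =
        (\<integral>\<omega>. u (\<lambda>i\<in>I. Z i \<omega>) \<partial>P) + (\<integral>\<omega>. v (\<lambda>i\<in>I. Z i \<omega>) \<partial>P)"
      using add Z by (intro Bochner_Integration.integral_add P.trig_poly_integrable)
    ultimately show ?case using add.IH by (simp only: tendsto_add)
  next
    case (scale u w)
    then show ?case by (simp add: tendsto_mult_left)
  qed
  show ?thesis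
  proof (rule LIMSEQ_I)
    fix \<epsilon> :: real assume \<epsilon>: "0 < \<epsilon>"
    define D where "D = 2 * C + 2"
    have D: "0 < D" using C(2) by (simp add: D_def)
    \<comment> \<open>\<open>trig_approx_integral_error\<close> costs \<open>e * D\<close>; this
      choice keeps it below a third of \<epsilon>, for the sequence and for the limit alike.\<close>
    define e where "e = min 1 (\<epsilon> / (3 * D))"
    have e: "0 < e" "e \<le> 1" using \<epsilon> D by (auto simp: e_def)
    have "e * D \<le> \<epsilon> / (3 * D) * D"
      using D by (intro mult_right_mono) (auto simp: e_def)
    then have e3: "e * (2 * C + 2) \<le> \<epsilon> / 3" using D by (simp add: D_def[symmetric])
    obtain R1 where R1: "\<And>R' N. R' \<ge> R1 \<Longrightarrow> measure (M N) {\<omega>\<in>space (M N). \<exists>i\<in>I. R' < \<bar>Y N i \<omega>\<bar>} \<le> e"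
      using tight[OF e(1)] by blast
    obtain R2 where R2: "\<And>R'. R' \<ge> R2 \<Longrightarrow> measure P {\<omega>\<in>space P. \<exists>i\<in>I. R' < \<bar>Z i \<omega>\<bar>} \<le> e"
      using P.finite_family_tight[OF I _ e(1), where Y = Z] Z by blast
    define R where "R = max 1 (max R1 R2)"
    have R: "0 < R" "R1 \<le> R" "R2 \<le> R" by (auto simp: R_def)
    obtain u where u: "(\<lambda>x. of_real (u x)) \<in> trig_poly I"
      "\<And>x. x \<in> I \<rightarrow>\<^sub>E UNIV \<Longrightarrow> (\<And>i. i \<in> I \<Longrightarrow> \<bar>x i\<bar> \<le> R) \<Longrightarrow> \<bar>u x - f x\<bar> < e"
      "\<And>x. \<bar>u x\<bar> \<le> C + e"
      using trig_poly_approx[OF I f(1) C(1) R(1) e(1)] by blast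
    have eY: "\<bar>(\<integral>\<omega>. u (\<lambda>i\<in>I. Y N i \<omega>) \<partial>M N) - (\<integral>\<omega>. f (\<lambda>i\<in>I. Y N i \<omega>) \<partial>M N)\<bar> \<le> \<epsilon> / 3" for N
      by (rule order_trans[OF M.trig_approx_integral_error[OF I f(1) C e u Y R1[OF R(2)]] e3])
    have eZ: "\<bar>(\<integral>\<omega>. u (\<lambda>i\<in>I. Z i \<omega>) \<partial>P) - (\<integral>\<omega>. f (\<lambda>i\<in>I. Z i \<omega>) \<partial>P)\<bar> \<le> \<epsilon> / 3"
      by (rule order_trans[OF P.trig_approx_integral_error[OF I f(1) C e u Z R2[OF R(3)]] e3])
    have "(\<lambda>N. complex_of_real (\<integral>\<omega>. u (\<lambda>i\<in>I. Y N i \<omega>) \<partial>M N)) \<longlonglongrightarrow>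
        complex_of_real (\<integral>\<omega>. u (\<lambda>i\<in>I. Z i \<omega>) \<partial>P)"
      using trig[OF u(1)] by simp
    then have "(\<lambda>N. \<integral>\<omega>. u (\<lambda>i\<in>I. Y N i \<omega>) \<partial>M N) \<longlonglongrightarrow> (\<integral>\<omega>. u (\<lambda>i\<in>I. Z i \<omega>) \<partial>P)"
      by (simp only: tendsto_of_real_iff)
    from LIMSEQ_D[OF this, of "\<epsilon> / 3"] \<epsilon> obtain N0 where
      N0: "\<And>N. N \<ge> N0 \<Longrightarrow> \<bar>(\<integral>\<omega>. u (\<lambda>i\<in>I. Y N i \<omega>) \<partial>M N) - (\<integral>\<omega>. u (\<lambda>i\<in>I. Z i \<omega>) \<partial>P)\<bar> < \<epsilon> / 3"
      by auto
    have "norm ((\<integral>\<omega>. f (\<lambda>i\<in>I. Y N i \<omega>) \<partial>M N) - (\<integral>\<omega>. f (\<lambda>i\<in>I. Z i \<omega>) \<partial>P)) < \<epsilon>" if "N \<ge> N0" for N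
      using eY[of N] eZ N0[OF that] unfolding real_norm_def by argo
    then show "\<exists>N0. \<forall>N\<ge>N0. norm ((\<integral>\<omega>. f (\<lambda>i\<in>I. Y N i \<omega>) \<partial>M N) - (\<integral>\<omega>. f (\<lambda>i\<in>I. Z i \<omega>) \<partial>P)) < \<epsilon>"
      by blast
  qed
qed

text \<open>Uniqueness is the continuity theorem for a constant sequence.\<close>

lemma vec_char_eq_imp_integral_eq_bounded:
  fixes f :: "('i \<Rightarrow> real) \<Rightarrow> real"
  assumes M: "prob_space M" and P: "prob_space P" and I: "finite I"
    and Y: "\<And>i. i \<in> I \<Longrightarrow> Y i \<in> borel_measurable M"
    and Z: "\<And>i. i \<in> I \<Longrightarrow> Z i \<in> borel_measurable P"
    and char: "\<And>c. (\<integral>\<omega>. cis (\<Sum>i\<in>I. c i * Y i \<omega>) \<partial>M) = (\<integral>\<omega>. cis (\<Sum>i\<in>I. c i * Z i \<omega>) \<partial>P)"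
    and f: "continuous_on (I \<rightarrow>\<^sub>E UNIV) f" "bounded (f ` (I \<rightarrow>\<^sub>E UNIV))"
  shows "(\<integral>\<omega>. f (\<lambda>i\<in>I. Y i \<omega>) \<partial>M) = (\<integral>\<omega>. f (\<lambda>i\<in>I. Z i \<omega>) \<partial>P)"
proof -
  have "(\<lambda>N::nat. \<integral>\<omega>. f (\<lambda>i\<in>I. Y i \<omega>) \<partial>M) \<longlonglongrightarrow> (\<integral>\<omega>. f (\<lambda>i\<in>I. Z i \<omega>) \<partial>P)"
    using prob_space.finite_family_tight[OF M I Y]
    by (intro vec_levy_continuity[OF M P I Y Z _ _ f]) (auto simp: char)
  then show ?thesis by (simp add: LIMSEQ_const_iff)
qed

text \<open>Clipping \<open>f\<close> at level \<open>n\<close> reduces to bounded functions, and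
  dominated convergence removes the clipping. Unbounded \<open>f\<close> occur in integration by
  parts, where polynomials in the variables must be transferred.\<close>

lemma vec_char_eq_imp_integral_eq:
  fixes f :: "('i \<Rightarrow> real) \<Rightarrow> real"
  assumes M: "prob_space M" and P: "prob_space P" and I: "finite I"
    and Y: "\<And>i. i \<in> I \<Longrightarrow> Y i \<in> borel_measurable M"
    and Z: "\<And>i. i \<in> I \<Longrightarrow> Z i \<in> borel_measurable P"
    and char: "\<And>c. (\<integral>\<omega>. cis (\<Sum>i\<in>I. c i * Y i \<omega>) \<partial>M) = (\<integral>\<omega>. cis (\<Sum>i\<in>I. c i * Z i \<omega>) \<partial>P)"
    and f: "continuous_on (I \<rightarrow>\<^sub>E UNIV) f"
    and int: "integrable M (\<lambda>\<omega>. f (\<lambda>i\<in>I. Y i \<omega>))" "integrable P (\<lambda>\<omega>. f (\<lambda>i\<in>I. Z i \<omega>))"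
  shows "(\<integral>\<omega>. f (\<lambda>i\<in>I. Y i \<omega>) \<partial>M) = (\<integral>\<omega>. f (\<lambda>i\<in>I. Z i \<omega>) \<partial>P)"
proof -
  define g where "g n x = max (- real n) (min (real n) (f x))" for n x
  have lim: "(\<lambda>n. \<integral>\<omega>. g n (\<lambda>i\<in>I. W i \<omega>) \<partial>Q) \<longlonglongrightarrow> (\<integral>\<omega>. f (\<lambda>i\<in>I. W i \<omega>) \<partial>Q)"
    if [measurable]: "integrable Q (\<lambda>\<omega>. f (\<lambda>i\<in>I. W i \<omega>))" for Q :: "'c measure" and W
  proof (rule integral_dominated_convergence[where w = "\<lambda>\<omega>. \<bar>f (\<lambda>i\<in>I. W i \<omega>)\<bar>"])
    show "AE \<omega> in Q. (\<lambda>n. g n (\<lambda>i\<in>I. W i \<omega>)) \<longlonglongrightarrow> f (\<lambda>i\<in>I. W i \<omega>)"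
    proof (intro AE_I2 tendsto_eventually)
      fix \<omega>
      obtain n0 :: nat where "\<bar>f (\<lambda>i\<in>I. W i \<omega>)\<bar> \<le> real n0" using real_arch_simple by blast
      then have "g n (\<lambda>i\<in>I. W i \<omega>) = f (\<lambda>i\<in>I. W i \<omega>)" if "n \<ge> n0" for n
        using that by (auto simp: g_def abs_le_iff)
      then show "\<forall>\<^sub>F n in sequentially. g n (\<lambda>i\<in>I. W i \<omega>) = f (\<lambda>i\<in>I. W i \<omega>)"
        by (auto simp: eventually_sequentially)
    qed
  qed (use that in \<open>auto simp: g_def\<close>)
  have "(\<integral>\<omega>. g n (\<lambda>i\<in>I. Y i \<omega>) \<partial>M) = (\<integral>\<omega>. g n (\<lambda>i\<in>I. Z i \<omega>) \<partial>P)" for n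
  proof (rule vec_char_eq_imp_integral_eq_bounded[OF M P I Y Z char])
    show "continuous_on (I \<rightarrow>\<^sub>E UNIV) (g n)"
      unfolding g_def using f by (intro continuous_intros)
    show "bounded (g n ` (I \<rightarrow>\<^sub>E UNIV))"
      by (auto simp: bounded_iff g_def intro!: exI[of _ "real n"])
  qed auto
  then have "(\<lambda>n. \<integral>\<omega>. g n (\<lambda>i\<in>I. Y i \<omega>) \<partial>M) \<longlonglongrightarrow> (\<integral>\<omega>. f (\<lambda>i\<in>I. Z i \<omega>) \<partial>P)"
    using lim[OF int(2)] by presburger
  with lim[OF int(1)] show ?thesis by (rule LIMSEQ_unique)
qed

section \<open>The Cauchy-Schwarz inequality for integrals\<close>

lemma integral_Cauchy_Schwarz:
  fixes f g :: "'a \<Rightarrow> real"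
  assumes [measurable]: "f \<in> borel_measurable M" "g \<in> borel_measurable M"
    and int: "integrable M (\<lambda>x. (f x)\<^sup>2)" "integrable M (\<lambda>x. (g x)\<^sup>2)"
  shows "integrable M (\<lambda>x. f x * g x)"
    "\<bar>\<integral>x. f x * g x \<partial>M\<bar> \<le> sqrt (\<integral>x. (f x)\<^sup>2 \<partial>M) * sqrt (\<integral>x. (g x)\<^sup>2 \<partial>M)"
proof -
  show fg: "integrable M (\<lambda>x. f x * g x)"
  proof (rule Bochner_Integration.integrable_bound)
    show "integrable M (\<lambda>x. (f x)\<^sup>2 + (g x)\<^sup>2)" using int by simp
    have "\<bar>a * b\<bar> \<le> a\<^sup>2 + b\<^sup>2" for a b :: real
    proof -
      have "2 * (\<bar>a\<bar> * \<bar>b\<bar>) \<le> a\<^sup>2 + b\<^sup>2"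
        using sum_squares_bound[of "\<bar>a\<bar>" "\<bar>b\<bar>"] by (simp add: mult.assoc)
      moreover have "0 \<le> \<bar>a\<bar> * \<bar>b\<bar>" by simp
      ultimately show ?thesis unfolding abs_mult by linarith
    qed
    then show "AE x in M. norm (f x * g x) \<le> norm ((f x)\<^sup>2 + (g x)\<^sup>2)" by simp
  qed simp
  define A B I where "A = (\<integral>x. (f x)\<^sup>2 \<partial>M)" and "B = (\<integral>x. (g x)\<^sup>2 \<partial>M)" and "I = (\<integral>x. f x * g x \<partial>M)"
  have "0 \<le> A" "0 \<le> B" unfolding A_def B_def by (auto intro!: integral_nonneg_AE)
  have quad: "0 \<le> A - 2 * t * I + t\<^sup>2 * B" for t
  proof -
    have "0 \<le> (\<integral>x. (f x - t * g x)\<^sup>2 \<partial>M)" by (auto intro!: integral_nonneg_AE)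
    also have "(\<lambda>x. (f x - t * g x)\<^sup>2) = (\<lambda>x. ((f x)\<^sup>2 - 2 * t * (f x * g x)) + t\<^sup>2 * (g x)\<^sup>2)"
      by (auto simp: power2_eq_square algebra_simps)
    also have "(\<integral>x. ((f x)\<^sup>2 - 2 * t * (f x * g x)) + t\<^sup>2 * (g x)\<^sup>2 \<partial>M) = A - 2 * t * I + t\<^sup>2 * B"
      using int fg by (simp add: A_def B_def I_def)
    finally show ?thesis .
  qed
  have "I\<^sup>2 \<le> A * B"
  proof (cases "B = 0")
    case True
    have "I = 0"
    proof (rule ccontr)
      assume "I \<noteq> 0"
      \<comment> \<open>With \<open>B = 0\<close> the quadratic is affine in \<open>t\<close> and
        takes the value -1 at this point.\<close>
      then show False using quad[of "(A + 1) / (2 * I)"] \<open>B = 0\<close> \<open>0 \<le> A\<close> by simp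
    qed
    then show ?thesis using True by simp
  next
    case False
    with \<open>0 \<le> B\<close> have "0 < B" by simp
    have "A - 2 * (I / B) * I + (I / B)\<^sup>2 * B = A - I\<^sup>2 / B"
      using \<open>0 < B\<close> by (simp add: power2_eq_square)
    then have "I\<^sup>2 / B \<le> A" using quad[of "I / B"] by linarith
    then show ?thesis using \<open>0 < B\<close> by (simp add: pos_divide_le_eq)
  qed
  then have "sqrt (I\<^sup>2) \<le> sqrt (A * B)" by (rule real_sqrt_le_mono)
  then show "\<bar>\<integral>x. f x * g x \<partial>M\<bar> \<le> sqrt (\<integral>x. (f x)\<^sup>2 \<partial>M) * sqrt (\<integral>x. (g x)\<^sup>2 \<partial>M)"
    by (simp add: A_def B_def I_def real_sqrt_mult)
qed

lemma (in prob_space) expectation_abs_le_sqrt: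
  fixes f :: "'a \<Rightarrow> real"
  assumes "f \<in> borel_measurable M" "integrable M (\<lambda>x. (f x)\<^sup>2)"
  shows "integrable M f" "expectation (\<lambda>x. \<bar>f x\<bar>) \<le> sqrt (expectation (\<lambda>x. (f x)\<^sup>2))"
  using integral_Cauchy_Schwarz[of "\<lambda>_. 1" M f] integral_Cauchy_Schwarz[of "\<lambda>_. 1" M "\<lambda>x. \<bar>f x\<bar>"] assms
  by (auto simp: prob_space)

section \<open>Hermite polynomials\<close>

text \<open>The recursion records what one derivative does to a polynomial times
  \<open>exp (- x\<^sup>2 / 2)\<close>, up to sign.\<close>

fun hermite_poly :: "nat \<Rightarrow> real poly" where
  "hermite_poly 0 = 1"
| "hermite_poly (Suc m) = [:0, 1:] * hermite_poly m - pderiv (hermite_poly m)"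

lemma deriv_gauss_hermite_poly:
  "(deriv ^^ m) (\<lambda>y. exp (- y\<^sup>2 / 2)) = (\<lambda>x. (- 1) ^ m * poly (hermite_poly m) x * exp (- x\<^sup>2 / 2))"
proof (induction m)
  case (Suc m)
  have "((\<lambda>x. (- 1) ^ m * poly (hermite_poly m) x * exp (- x\<^sup>2 / 2)) has_real_derivative
      (- 1) ^ Suc m * poly (hermite_poly (Suc m)) x * exp (- x\<^sup>2 / 2)) (at x)" for x
    by (auto intro!: derivative_eq_intros simp: algebra_simps)
  then have "deriv ((deriv ^^ m) (\<lambda>y. exp (- y\<^sup>2 / 2))) x =
      (- 1) ^ Suc m * poly (hermite_poly (Suc m)) x * exp (- x\<^sup>2 / 2)" for x
    unfolding Suc by (rule DERIV_imp_deriv)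
  then show ?case by (intro ext) (simp only: funpow.simps comp_apply)
qed simp

lemma hermite_eq_poly: "hermite m x = poly (hermite_poly m) x"
proof -
  have "(- 1) ^ m * (- 1) ^ m = (1::real)" by (simp flip: power_mult_distrib)
  moreover have "exp (x\<^sup>2 / 2) * exp (- x\<^sup>2 / 2) = 1" by (simp flip: exp_add)
  ultimately have "((- 1) ^ m * (- 1) ^ m) * poly (hermite_poly m) x * (exp (x\<^sup>2 / 2) * exp (- x\<^sup>2 / 2)) =
      poly (hermite_poly m) x" by simp
  then show ?thesis unfolding hermite_def deriv_gauss_hermite_poly by (simp only: ac_simps)
qed

lemma pderiv_hermite_poly_Suc: "pderiv (hermite_poly (Suc m)) = smult (of_nat (Suc m)) (hermite_poly m)"
proof (induction m)
  case 0
  then show ?case by (simp add: pderiv_pCons)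
next
  case (Suc m)
  have *: "pderiv (hermite_poly (Suc (Suc m))) = hermite_poly (Suc m)
      + ([:0, 1:] * pderiv (hermite_poly (Suc m)) - pderiv (pderiv (hermite_poly (Suc m))))"
    by (simp only: hermite_poly.simps(2)[of "Suc m"] pderiv_diff pderiv_mult)
      (simp add: pderiv_pCons)
  also have "[:0, 1:] * pderiv (hermite_poly (Suc m)) - pderiv (pderiv (hermite_poly (Suc m))) =
      smult (of_nat (Suc m)) (hermite_poly (Suc m))"
    unfolding Suc pderiv_smult
    by (simp only: hermite_poly.simps(2)[of m] mult_smult_right smult_diff_right)
  finally show ?case
    by (simp only: of_nat_Suc smult_add_left) (simp del: hermite_poly.simps)
qed

lemma hermite_0 [simp]: "hermite 0 x = 1"
  by (simp add: hermite_eq_poly)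

lemma DERIV_hermite:
  "(hermite m has_real_derivative real m * hermite (m - 1) x) (at x)"
proof -
  have "(poly (hermite_poly m) has_real_derivative poly (pderiv (hermite_poly m)) x) (at x)"
    by (rule poly_DERIV)
  moreover have "poly (pderiv (hermite_poly m)) x = real m * hermite (m - 1) x"
    by (cases m) (auto simp: pderiv_hermite_poly_Suc hermite_eq_poly simp del: hermite_poly.simps(2))
  moreover have "poly (hermite_poly m) = hermite m" by (simp add: fun_eq_iff hermite_eq_poly)
  ultimately show ?thesis by simp
qed

lemma hermite_Suc: "hermite (Suc m) x = x * hermite m x - real m * hermite (m - 1) x"
proof -
  have "poly (pderiv (hermite_poly m)) x = real m * hermite (m - 1) x"
    by (cases m) (auto simp: pderiv_hermite_poly_Suc hermite_eq_poly simp del: hermite_poly.simps(2))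
  then show ?thesis by (simp add: hermite_eq_poly)
qed

lemma continuous_on_hermite [continuous_intros]:
  "continuous_on S f \<Longrightarrow> continuous_on S (\<lambda>x. hermite m (f x))"
  by (auto simp: hermite_eq_poly intro!: continuous_intros)

lemma borel_measurable_hermite [measurable]: "hermite m \<in> borel_measurable borel"
  by (intro borel_measurable_continuous_onI continuous_intros)

text \<open>Bounds of this shape are what integrability and the vanishing of boundary terms rest on
  in every later integration by parts.\<close>

lemma hermite_growth: "\<exists>C\<ge>0. \<forall>x. \<bar>hermite m x\<bar> \<le> C * (1 + \<bar>x\<bar>) ^ m"
proof (induction m rule: less_induct)
  case (less m)
  show ?case
  proof (cases m)
    case 0
    then show ?thesis by (auto intro!: exI[of _ 1])
  next
    case (Suc n)
    obtain C where C: "0 \<le> C" "\<And>x. \<bar>hermite n x\<bar> \<le> C * (1 + \<bar>x\<bar>) ^ n"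
      using less[of n] Suc by auto
    have "n - 1 < m" using Suc by simp
    from less[OF this] obtain C' where C': "0 \<le> C'"
      "\<And>x. \<bar>hermite (n - 1) x\<bar> \<le> C' * (1 + \<bar>x\<bar>) ^ (n - 1)" by auto
    have "\<bar>hermite m x\<bar> \<le> (C + real n * C') * (1 + \<bar>x\<bar>) ^ m" for x
    proof -
      have "\<bar>hermite m x\<bar> \<le> \<bar>x\<bar> * \<bar>hermite n x\<bar> + real n * \<bar>hermite (n - 1) x\<bar>"
        unfolding Suc hermite_Suc by (rule order_trans[OF abs_triangle_ineq4]) (simp add: abs_mult)
      also have "\<bar>x\<bar> * \<bar>hermite n x\<bar> \<le> (1 + \<bar>x\<bar>) * (C * (1 + \<bar>x\<bar>) ^ n)"
        by (intro mult_mono C) auto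
      also have "real n * \<bar>hermite (n - 1) x\<bar> \<le> real n * (C' * (1 + \<bar>x\<bar>) ^ m)"
      proof (intro mult_left_mono order_trans[OF C'(2)] power_increasing)
        show "n - 1 \<le> m" using Suc by simp
      qed (use C' in auto)
      finally show ?thesis using Suc by (simp add: algebra_simps)
    qed
    then show ?thesis using C(1) C'(1) by (intro exI[of _ "C + real n * C'"]) auto
  qed
qed

lemma integrable_std_normal_growth: "integrable std_normal_distribution (\<lambda>x. (1 + \<bar>x\<bar>) ^ p)"
proof -
  have "integrable std_normal_distribution (\<lambda>x. \<bar>x\<bar> ^ k)" for k
    using integrable_std_normal_moment_abs[of k] by (simp add: integrable_density)
  then have "integrable std_normal_distribution (\<lambda>x. \<Sum>k\<le>p. real (p choose k) * 1 ^ k * \<bar>x\<bar> ^ (p - k))"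
    by auto
  then show ?thesis by (simp only: binomial_ring)
qed

lemma integrable_std_normal_bound:
  fixes h :: "real \<Rightarrow> 'b::{banach, second_countable_topology}"
  assumes "h \<in> borel_measurable borel" "\<And>x. norm (h x) \<le> C * (1 + \<bar>x\<bar>) ^ p"
  shows "integrable std_normal_distribution h"
proof (rule Bochner_Integration.integrable_bound)
  show "integrable std_normal_distribution (\<lambda>x. C * (1 + \<bar>x\<bar>) ^ p)"
    by (intro integrable_mult_right integrable_std_normal_growth)
  show "AE x in std_normal_distribution. norm (h x) \<le> norm (C * (1 + \<bar>x\<bar>) ^ p)"
    using assms(2) by (auto intro: order_trans[OF _ abs_ge_self])
qed (use assms in simp)

text \<open>From \<open>0 \<le> (\<bar>x\<bar> - 1)\<^sup>2\<close> the Gaussian exponent is at most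
  \<open>3 / 2 - (1 + \<bar>x\<bar>)\<close>, which leaves a polynomial against an
  exponential.\<close>

lemma std_normal_density_growth_tendsto_0:
  "((\<lambda>x. std_normal_density x * (1 + \<bar>x\<bar>) ^ p) \<longlongrightarrow> 0) at_infinity"
proof (rule tendsto_sandwich[of "\<lambda>_. 0"])
  have bound: "std_normal_density x * (1 + \<bar>x\<bar>) ^ p \<le> exp (3 / 2) * ((1 + \<bar>x\<bar>) ^ p / exp (1 + \<bar>x\<bar>))" for x
  proof -
    have "1 \<le> sqrt (2 * pi)" using pi_gt3 by simp
    then have "1 / sqrt (2 * pi) \<le> 1" by simp
    then have "std_normal_density x \<le> 1 * exp (- x\<^sup>2 / 2)"
      unfolding std_normal_density_def by (intro mult_right_mono) auto
    also have "0 \<le> (\<bar>x\<bar> - 1)\<^sup>2" by simp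
    then have "- x\<^sup>2 / 2 \<le> 3 / 2 - (1 + \<bar>x\<bar>)" by (simp add: power2_diff)
    then have "1 * exp (- x\<^sup>2 / 2) \<le> exp (3 / 2 - (1 + \<bar>x\<bar>))" by simp
    finally have "std_normal_density x * (1 + \<bar>x\<bar>) ^ p \<le> exp (3 / 2 - (1 + \<bar>x\<bar>)) * (1 + \<bar>x\<bar>) ^ p"
      by (intro mult_right_mono) auto
    then show ?thesis by (simp only: exp_diff times_divide_eq_left times_divide_eq_right)
  qed
  then show "\<forall>\<^sub>F x in at_infinity. std_normal_density x * (1 + \<bar>x\<bar>) ^ p \<le>
      exp (3 / 2) * ((1 + \<bar>x\<bar>) ^ p / exp (1 + \<bar>x\<bar>))" by simp
  have "filterlim (\<lambda>x::real. 1 + \<bar>x\<bar>) at_top at_infinity"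
    using filterlim_norm_at_top[where 'a = real]
    by (intro filterlim_tendsto_add_at_top[OF tendsto_const]) (simp add: real_norm_def[abs_def])
  from tendsto_mult_left[OF filterlim_compose[OF tendsto_power_div_exp_0 this]]
  show "((\<lambda>x::real. exp (3 / 2) * ((1 + \<bar>x\<bar>) ^ p / exp (1 + \<bar>x\<bar>))) \<longlongrightarrow> 0) at_infinity"
    by simp
qed auto

text \<open>The density has derivative \<open>- x\<close> times itself, and its product with
  \<open>h\<close> vanishes at both ends by polynomial growth; the rest is the fundamental theorem
  of calculus. Vector values are allowed so that complex exponentials can be inserted.\<close>

lemma std_normal_integration_by_parts:
  fixes h h' :: "real \<Rightarrow> 'b::euclidean_space"
  assumes h: "\<And>x. (h has_vector_derivative h' x) (at x)" and h': "continuous_on UNIV h'"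
    and C: "\<And>x. norm (h x) \<le> C * (1 + \<bar>x\<bar>) ^ p" "\<And>x. norm (h' x) \<le> C * (1 + \<bar>x\<bar>) ^ p"
  shows "integrable std_normal_distribution (\<lambda>x. x *\<^sub>R h x)" "integrable std_normal_distribution h'"
    "(\<integral>x. x *\<^sub>R h x \<partial>std_normal_distribution) = (\<integral>x. h' x \<partial>std_normal_distribution)"
proof -
  let ?\<phi> = std_normal_density
  have ch: "continuous_on UNIV h"
    using h by (meson continuous_at_imp_continuous_on has_vector_derivative_continuous)
  have [measurable]: "h \<in> borel_measurable borel" "h' \<in> borel_measurable borel"
    using ch h' by (auto intro: borel_measurable_continuous_onI)
  have "0 \<le> C" using C(1)[of 0] by (auto intro: order_trans[OF norm_ge_zero])
  show 1: "integrable std_normal_distribution h'"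
    by (rule integrable_std_normal_bound[OF _ C(2)]) simp
  show 2: "integrable std_normal_distribution (\<lambda>x. x *\<^sub>R h x)"
  proof (rule integrable_std_normal_bound[where p = "Suc p"])
    fix x
    have "\<bar>x\<bar> * norm (h x) \<le> (1 + \<bar>x\<bar>) * (C * (1 + \<bar>x\<bar>) ^ p)"
      using C(1) by (intro mult_mono) auto
    then show "norm (x *\<^sub>R h x) \<le> C * (1 + \<bar>x\<bar>) ^ Suc p" by (simp add: ac_simps)
  qed simp
  have int: "integrable lborel (\<lambda>x. ?\<phi> x *\<^sub>R h' x)" "integrable lborel (\<lambda>x. ?\<phi> x *\<^sub>R (x *\<^sub>R h x))"
    using 1 2 by (simp_all add: integrable_density)
  define f where "f x = ?\<phi> x *\<^sub>R h' x - ?\<phi> x *\<^sub>R (x *\<^sub>R h x)" for x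
  have int_f: "integrable lborel f" unfolding f_def using int by simp
  have d\<phi>: "(?\<phi> has_real_derivative (- x * ?\<phi> x)) (at x)" for x
  proof -
    have "((\<lambda>x. c * exp (- x\<^sup>2 / 2)) has_real_derivative - x * (c * exp (- x\<^sup>2 / 2))) (at x)" for c :: real
      by (auto intro!: derivative_eq_intros)
    then show ?thesis unfolding std_normal_density_def[abs_def] .
  qed
  have lim: "((\<lambda>x. ?\<phi> x *\<^sub>R h x) \<longlongrightarrow> 0) F" if "F \<le> at_infinity" for F
  proof (rule tendsto_norm_zero_cancel, rule tendsto_sandwich[of "\<lambda>_. 0"])
    show "((\<lambda>x. C * (?\<phi> x * (1 + \<bar>x\<bar>) ^ p)) \<longlongrightarrow> 0) F"
      using tendsto_mult_left[OF tendsto_mono[OF that std_normal_density_growth_tendsto_0], of C p] by simp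
    show "\<forall>\<^sub>F x in F. norm (?\<phi> x *\<^sub>R h x) \<le> C * (?\<phi> x * (1 + \<bar>x\<bar>) ^ p)"
    proof (intro always_eventually allI)
      fix x
      have "?\<phi> x * norm (h x) \<le> ?\<phi> x * (C * (1 + \<bar>x\<bar>) ^ p)"
        by (intro mult_left_mono C) auto
      then show "norm (?\<phi> x *\<^sub>R h x) \<le> C * (?\<phi> x * (1 + \<bar>x\<bar>) ^ p)" by (simp add: ac_simps)
    qed
  qed auto
  have "(LBINT x=-\<infinity>..\<infinity>. f x) = 0 - 0"
  proof (rule interval_integral_FTC_integrable[where F = "\<lambda>x. ?\<phi> x *\<^sub>R h x"])
    show "((\<lambda>x. ?\<phi> x *\<^sub>R h x) has_vector_derivative f x) (at x)" for x
    proof -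
      from has_vector_derivative_scaleR[OF d\<phi> h]
      show ?thesis by (simp add: f_def ac_simps)
    qed
    have c\<phi>: "continuous_on UNIV ?\<phi>" unfolding std_normal_density_def[abs_def] by (intro continuous_intros) auto
    show "isCont f x" for x
    proof -
      have "continuous_on UNIV f" unfolding f_def using ch h' c\<phi> by (intro continuous_intros)
      then show ?thesis by (simp add: continuous_on_eq_continuous_at)
    qed
    show "set_integrable lborel (einterval (- \<infinity>) \<infinity>) f"
      using int_f by (simp add: set_integrable_def)
    show "(((\<lambda>x. ?\<phi> x *\<^sub>R h x) \<circ> real_of_ereal) \<longlongrightarrow> 0) (at_right (- \<infinity>))"
      using lim[of at_bot] by (simp add: ereal_tendsto_simps1 at_infinity_eq_at_top_bot)
    show "(((\<lambda>x. ?\<phi> x *\<^sub>R h x) \<circ> real_of_ereal) \<longlongrightarrow> 0) (at_left \<infinity>)"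
      using lim[of at_top] by (simp add: ereal_tendsto_simps1 at_infinity_eq_at_top_bot)
  qed auto
  then have "(\<integral>x. f x \<partial>lborel) = 0"
    by (simp add: interval_lebesgue_integral_def set_lebesgue_integral_def)
  then have "(\<integral>x. ?\<phi> x *\<^sub>R h' x \<partial>lborel) = (\<integral>x. ?\<phi> x *\<^sub>R (x *\<^sub>R h x) \<partial>lborel)"
    unfolding f_def using int by simp
  then show "(\<integral>x. x *\<^sub>R h x \<partial>std_normal_distribution) = (\<integral>x. h' x \<partial>std_normal_distribution)"
    by (simp add: integral_density)
qed

text \<open>Integration by parts shows that raising \<open>a\<close> by one amounts to lowering
  \<open>b\<close> by one, with factor \<open>b\<close>: the derivative of the first polynomial
  cancels against the three-term recursion. Descending to degree 0 gives the factorial or 0.\<close>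

lemma hermite_orthogonal:
  "integrable std_normal_distribution (\<lambda>x. hermite a x * hermite b x)"
  "(\<integral>x. hermite a x * hermite b x \<partial>std_normal_distribution) = (if a = b then fact a else 0)"
proof -
  have growth: "\<exists>C\<ge>0. \<forall>x. \<bar>hermite a x * hermite b x\<bar> \<le> C * (1 + \<bar>x\<bar>) ^ (a + b)" for a b
  proof -
    obtain C where C: "0 \<le> C" "\<And>x. \<bar>hermite a x\<bar> \<le> C * (1 + \<bar>x\<bar>) ^ a" using hermite_growth[of a] by auto
    obtain C' where C': "0 \<le> C'" "\<And>x. \<bar>hermite b x\<bar> \<le> C' * (1 + \<bar>x\<bar>) ^ b" using hermite_growth[of b] by auto
    have "\<bar>hermite a x * hermite b x\<bar> \<le> (C * (1 + \<bar>x\<bar>) ^ a) * (C' * (1 + \<bar>x\<bar>) ^ b)" for x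
      unfolding abs_mult using C C' by (intro mult_mono) auto
    then show ?thesis using C(1) C'(1) by (intro exI[of _ "C * C'"]) (auto simp: power_add ac_simps)
  qed
  show int: "integrable std_normal_distribution (\<lambda>x. hermite a x * hermite b x)" for a b
  proof -
    obtain C where "\<And>x. \<bar>hermite a x * hermite b x\<bar> \<le> C * (1 + \<bar>x\<bar>) ^ (a + b)" using growth by blast
    then show ?thesis by (intro integrable_std_normal_bound) auto
  qed
  have rec: "(\<integral>x. hermite (Suc a) x * hermite b x \<partial>std_normal_distribution) =
      real b * (\<integral>x. hermite a x * hermite (b - 1) x \<partial>std_normal_distribution)" for a b
  proof -
    define h where "h x = hermite a x * hermite b x" for x
    define h' where "h' x = real a * (hermite (a - 1) x * hermite b x) + real b * (hermite a x * hermite (b - 1) x)" for x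
    obtain C1 where C1: "0 \<le> C1" "\<And>x. \<bar>hermite a x * hermite b x\<bar> \<le> C1 * (1 + \<bar>x\<bar>) ^ (a + b)"
      using growth[of a b] by auto
    obtain C2 where C2: "0 \<le> C2" "\<And>x. \<bar>hermite (a - 1) x * hermite b x\<bar> \<le> C2 * (1 + \<bar>x\<bar>) ^ (a - 1 + b)"
      using growth[of "a - 1" b] by auto
    obtain C3 where C3: "0 \<le> C3" "\<And>x. \<bar>hermite a x * hermite (b - 1) x\<bar> \<le> C3 * (1 + \<bar>x\<bar>) ^ (a + (b - 1))"
      using growth[of a "b - 1"] by auto
    let ?C = "C1 + real a * C2 + real b * C3"
    have "(\<integral>x. x *\<^sub>R h x \<partial>std_normal_distribution) = (\<integral>x. h' x \<partial>std_normal_distribution)"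
    proof (rule std_normal_integration_by_parts(3)[where C = ?C and p = "a + b"])
      show "(h has_vector_derivative h' x) (at x)" for x
        unfolding h_def[abs_def] h'_def has_real_derivative_iff_has_vector_derivative[symmetric]
        by (auto intro!: derivative_eq_intros DERIV_hermite simp: algebra_simps)
      show "continuous_on UNIV h'" unfolding h'_def by (intro continuous_intros)
      fix x
      have "C1 * (1 + \<bar>x\<bar>) ^ (a + b) \<le> ?C * (1 + \<bar>x\<bar>) ^ (a + b)"
        using C2(1) C3(1) by (intro mult_right_mono) auto
      from order_trans[OF C1(2) this] show "norm (h x) \<le> ?C * (1 + \<bar>x\<bar>) ^ (a + b)"
        by (simp only: h_def real_norm_def)
      have 2: "\<bar>hermite (a - 1) x * hermite b x\<bar> \<le> C2 * (1 + \<bar>x\<bar>) ^ (a + b)"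
        by (rule order_trans[OF C2(2)]) (use C2(1) in \<open>auto intro!: mult_left_mono power_increasing\<close>)
      have 3: "\<bar>hermite a x * hermite (b - 1) x\<bar> \<le> C3 * (1 + \<bar>x\<bar>) ^ (a + b)"
        by (rule order_trans[OF C3(2)]) (use C3(1) in \<open>auto intro!: mult_left_mono power_increasing\<close>)
      have "norm (h' x) \<le> real a * \<bar>hermite (a - 1) x * hermite b x\<bar> + real b * \<bar>hermite a x * hermite (b - 1) x\<bar>"
        unfolding h'_def real_norm_def by (rule order_trans[OF abs_triangle_ineq]) (simp only: abs_mult abs_of_nat order_refl)
      also have "\<dots> \<le> real a * (C2 * (1 + \<bar>x\<bar>) ^ (a + b)) + real b * (C3 * (1 + \<bar>x\<bar>) ^ (a + b))"
        using 2 3 by (intro add_mono mult_left_mono) auto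
      also have "\<dots> \<le> ?C * (1 + \<bar>x\<bar>) ^ (a + b)" using C1(1) by (simp add: algebra_simps)
      finally show "norm (h' x) \<le> ?C * (1 + \<bar>x\<bar>) ^ (a + b)" .
    qed
    moreover have "(\<integral>x. h' x \<partial>std_normal_distribution) =
        real a * (\<integral>x. hermite (a - 1) x * hermite b x \<partial>std_normal_distribution) +
        real b * (\<integral>x. hermite a x * hermite (b - 1) x \<partial>std_normal_distribution)"
      unfolding h'_def using int by simp
    moreover have "(\<integral>x. x *\<^sub>R h x \<partial>std_normal_distribution) =
        (\<integral>x. hermite (Suc a) x * hermite b x + real a * (hermite (a - 1) x * hermite b x) \<partial>std_normal_distribution)"
      by (intro Bochner_Integration.integral_cong) (auto simp: h_def hermite_Suc algebra_simps)
    moreover have "\<dots> = (\<integral>x. hermite (Suc a) x * hermite b x \<partial>std_normal_distribution) +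
        real a * (\<integral>x. hermite (a - 1) x * hermite b x \<partial>std_normal_distribution)"
      using int by (subst Bochner_Integration.integral_add) auto
    ultimately show ?thesis by simp
  qed
  have zero: "(\<integral>x. hermite (Suc b) x \<partial>std_normal_distribution) = 0" for b
    using rec[of b 0] by simp
  interpret prob_space std_normal_distribution by (rule prob_space_normal_density) simp
  show "(\<integral>x. hermite a x * hermite b x \<partial>std_normal_distribution) = (if a = b then fact a else 0)"
  proof (induction a arbitrary: b)
    case 0
    then show ?case using zero prob_space by (cases b) auto
  next
    case (Suc a)
    show ?case
    proof (cases b)
      case 0
      then show ?thesis using zero[of a] by simp
    next
      case (Suc c)
      then show ?thesis using rec[of a b] Suc.IH[of c] by simp
    qed
  qed
qed

section \<open>Completeness of the Hermite polynomials\<close>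

lemma L2_gaussD:
  assumes "G \<in> L2_gauss"
  shows "G \<in> borel_measurable borel" "integrable std_normal_distribution (\<lambda>x. (G x)\<^sup>2)"
  using assms by (auto simp: L2_gauss_def)

lemma L2_gauss_mult:
  assumes "G \<in> L2_gauss" "H \<in> L2_gauss"
  shows "integrable std_normal_distribution (\<lambda>x. G x * H x)"
    "\<bar>\<integral>x. G x * H x \<partial>std_normal_distribution\<bar> \<le>
      sqrt (\<integral>x. (G x)\<^sup>2 \<partial>std_normal_distribution) * sqrt (\<integral>x. (H x)\<^sup>2 \<partial>std_normal_distribution)"
  using integral_Cauchy_Schwarz[of G std_normal_distribution H] L2_gaussD[OF assms(1)] L2_gaussD[OF assms(2)]
  by simp_all

lemma L2_gauss_add:
  assumes "G \<in> L2_gauss" "H \<in> L2_gauss"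
  shows "(\<lambda>x. G x + H x) \<in> L2_gauss"
proof -
  have "integrable std_normal_distribution (\<lambda>x. (G x)\<^sup>2 + 2 * (G x * H x) + (H x)\<^sup>2)"
    using L2_gaussD[OF assms(1)] L2_gaussD[OF assms(2)] L2_gauss_mult[OF assms] by simp
  then have "integrable std_normal_distribution (\<lambda>x. (G x + H x)\<^sup>2)"
    by (simp add: power2_sum ac_simps)
  then show ?thesis using L2_gaussD[OF assms(1)] L2_gaussD[OF assms(2)] by (simp add: L2_gauss_def)
qed

lemma L2_gauss_cmult: "G \<in> L2_gauss \<Longrightarrow> (\<lambda>x. c * G x) \<in> L2_gauss"
  by (auto simp: L2_gauss_def power_mult_distrib)

lemma L2_gauss_diff:
  assumes "G \<in> L2_gauss" "H \<in> L2_gauss"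
  shows "(\<lambda>x. G x - H x) \<in> L2_gauss"
  using L2_gauss_add[OF assms(1) L2_gauss_cmult[OF assms(2), of "- 1"]] by simp

lemma L2_gauss_growth:
  assumes [measurable]: "h \<in> borel_measurable borel" and C: "\<And>x. \<bar>h x\<bar> \<le> C * (1 + \<bar>x\<bar>) ^ p"
  shows "h \<in> L2_gauss"
proof -
  have "integrable std_normal_distribution (\<lambda>x. (h x)\<^sup>2)"
  proof (rule integrable_std_normal_bound)
    show "norm ((h x)\<^sup>2) \<le> C\<^sup>2 * (1 + \<bar>x\<bar>) ^ (p * 2)" for x
      using power_mono[OF C, of x 2] by (simp add: power_mult_distrib power_mult)
  qed simp
  then show ?thesis by (simp add: L2_gauss_def)
qed

lemma hermite_L2: "hermite m \<in> L2_gauss"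
  using hermite_growth[of m] by (auto intro: L2_gauss_growth)

lemma L2_gauss_sum_hermite: "finite S \<Longrightarrow> (\<lambda>x. \<Sum>m\<in>S. c m * hermite m x) \<in> L2_gauss"
proof (induction S rule: finite_induct)
  case empty
  then show ?case by (auto intro!: L2_gauss_growth[where C = 0])
next
  case (insert m S)
  then show ?case by (simp add: L2_gauss_add L2_gauss_cmult hermite_L2)
qed

lemma integral_hermite: "(\<integral>x. G x * hermite m x \<partial>std_normal_distribution) = fact m * hermite_coeff G m"
  by (simp add: hermite_coeff_def)

lemma integral_hermite_sum:
  assumes "G \<in> L2_gauss" "finite S"
  shows "(\<integral>x. G x * (\<Sum>m\<in>S. c m * hermite m x) \<partial>std_normal_distribution) =
    (\<Sum>m\<in>S. c m * (fact m * hermite_coeff G m))"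
proof -
  have "(\<integral>x. G x * (\<Sum>m\<in>S. c m * hermite m x) \<partial>std_normal_distribution) =
      (\<integral>x. (\<Sum>m\<in>S. c m * (G x * hermite m x)) \<partial>std_normal_distribution)"
    by (simp add: sum_distrib_left ac_simps)
  also have "\<dots> = (\<Sum>m\<in>S. c m * (\<integral>x. G x * hermite m x \<partial>std_normal_distribution))"
    using L2_gauss_mult(1)[OF assms(1) hermite_L2] by simp
  finally show ?thesis by (simp only: integral_hermite)
qed

lemma hermite_coeff_sum_hermite:
  assumes "finite S"
  shows "hermite_coeff (\<lambda>x. \<Sum>m\<in>S. c m * hermite m x) l = (if l \<in> S then c l else 0)"
proof -
  have "fact m * hermite_coeff (hermite l) m = (if l = m then fact l else 0)" for m
    by (simp flip: integral_hermite add: hermite_orthogonal)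
  then have "(\<Sum>m\<in>S. c m * (fact m * hermite_coeff (hermite l) m)) =
      (\<Sum>m\<in>S. if l = m then c m * fact l else 0)"
    by (intro sum.cong refl) simp
  then have "(\<Sum>m\<in>S. c m * (fact m * hermite_coeff (hermite l) m)) = (if l \<in> S then c l * fact l else 0)"
    using assms by simp
  with integral_hermite_sum[OF hermite_L2[of l] assms, of c]
  have "(\<integral>x. (\<Sum>m\<in>S. c m * hermite m x) * hermite l x \<partial>std_normal_distribution) =
      (if l \<in> S then c l * fact l else 0)" by (simp add: mult.commute)
  then show ?thesis by (simp add: hermite_coeff_def)
qed

lemma integral_sum_hermite_sq:
  assumes "finite S"
  shows "(\<integral>x. (\<Sum>m\<in>S. c m * hermite m x)\<^sup>2 \<partial>std_normal_distribution) = (\<Sum>m\<in>S. (c m)\<^sup>2 * fact m)"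
  using integral_hermite_sum[OF L2_gauss_sum_hermite[OF assms] assms, of c c]
  by (simp add: power2_eq_square hermite_coeff_sum_hermite[OF assms] ac_simps)

text \<open>The three-term recursion turns \<open>x * hermite m x\<close> into a combination of the
  two neighbours, so orthogonality to Hermite polynomials passes to all powers of
  \<open>x\<close>.\<close>

lemma L2_gauss_moments_vanish:
  assumes R: "R \<in> L2_gauss" and 0: "\<And>m. (\<integral>x. R x * hermite m x \<partial>std_normal_distribution) = 0"
  shows "integrable std_normal_distribution (\<lambda>x. R x * (x ^ j * hermite m x))"
    "(\<integral>x. R x * (x ^ j * hermite m x) \<partial>std_normal_distribution) = 0"
proof -
  show int: "integrable std_normal_distribution (\<lambda>x. R x * (x ^ j * hermite m x))" for j m
  proof (rule L2_gauss_mult(1)[OF R])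
    obtain C where C: "0 \<le> C" "\<And>x. \<bar>hermite m x\<bar> \<le> C * (1 + \<bar>x\<bar>) ^ m" using hermite_growth[of m] by auto
    have "\<bar>x ^ j * hermite m x\<bar> \<le> C * (1 + \<bar>x\<bar>) ^ (j + m)" for x
    proof -
      have "\<bar>x\<bar> ^ j * \<bar>hermite m x\<bar> \<le> (1 + \<bar>x\<bar>) ^ j * (C * (1 + \<bar>x\<bar>) ^ m)"
        by (intro mult_mono power_mono C) auto
      then show ?thesis by (simp add: abs_mult power_abs power_add ac_simps)
    qed
    then show "(\<lambda>x. x ^ j * hermite m x) \<in> L2_gauss" by (intro L2_gauss_growth) auto
  qed
  show "(\<integral>x. R x * (x ^ j * hermite m x) \<partial>std_normal_distribution) = 0"
  proof (induction j arbitrary: m)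
    case 0
    then show ?case using assms(2) by simp
  next
    case (Suc j)
    have "x ^ Suc j * hermite m x = x ^ j * hermite (Suc m) x + real m * (x ^ j * hermite (m - 1) x)" for x
      by (simp add: hermite_Suc algebra_simps)
    then have "(\<integral>x. R x * (x ^ Suc j * hermite m x) \<partial>std_normal_distribution) =
        (\<integral>x. R x * (x ^ j * hermite (Suc m) x) + real m * (R x * (x ^ j * hermite (m - 1) x)) \<partial>std_normal_distribution)"
      by (simp add: algebra_simps)
    also have "\<dots> = 0" using int Suc.IH by simp
    finally show ?case .
  qed
qed

text \<open>The Taylor polynomials of the exponential integrate to 0 against \<open>R\<close>.
  Cauchy-Schwarz bounds the remainder by an even Gaussian moment, and the resulting bound tends to 0
  for every \<open>t\<close>, not only for small ones.\<close>

lemma L2_gauss_fourier_vanish: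
  assumes R: "R \<in> L2_gauss" and 0: "\<And>m. (\<integral>x. R x * hermite m x \<partial>std_normal_distribution) = 0"
  shows "(\<integral>x. R x *\<^sub>R iexp (t * x) \<partial>std_normal_distribution) = 0"
proof -
  let ?N = std_normal_distribution
  have [measurable]: "R \<in> borel_measurable borel" using L2_gaussD(1)[OF R] .
  have intR: "integrable ?N R" using L2_gauss_mult(1)[OF R hermite_L2[of 0]] by simp
  have mom: "integrable ?N (\<lambda>x. R x * x ^ j)" "(\<integral>x. R x * x ^ j \<partial>?N) = 0" for j
    using L2_gauss_moments_vanish[OF R 0, of j 0] by simp_all
  define K where "K = sqrt (\<integral>x. (R x)\<^sup>2 \<partial>?N)"
  have bound: "norm (\<integral>x. R x *\<^sub>R iexp (t * x) \<partial>?N) \<le> K * sqrt ((2 * t\<^sup>2) ^ Suc n / fact (Suc n))" for n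
  proof -
    define T where "T x = (\<Sum>k\<le>n. (\<i> * of_real (t * x)) ^ k / fact k)" for x :: real
    have T: "R x *\<^sub>R T x = (\<Sum>k\<le>n. ((\<i> * t) ^ k / fact k) * of_real (R x * x ^ k))" for x
      unfolding T_def scaleR_conv_of_real sum_distrib_left
      by (intro sum.cong) (auto simp: power_mult_distrib)
    have intT: "integrable ?N (\<lambda>x. R x *\<^sub>R T x)" and "(\<integral>x. R x *\<^sub>R T x \<partial>?N) = 0"
      unfolding T using mom by (auto simp: integral_complex_of_real simp del: of_real_mult)
    moreover have inte: "integrable ?N (\<lambda>x. R x *\<^sub>R iexp (t * x))"
      by (rule Bochner_Integration.integrable_bound[OF intR]) auto
    ultimately have "(\<integral>x. R x *\<^sub>R iexp (t * x) \<partial>?N) = (\<integral>x. R x *\<^sub>R (iexp (t * x) - T x) \<partial>?N)"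
      by (simp add: scaleR_diff_right)
    also have "norm \<dots> \<le> (\<integral>x. \<bar>R x\<bar> * (\<bar>t * x\<bar> ^ Suc n / fact (Suc n)) \<partial>?N)"
    proof (rule order_trans[OF integral_norm_bound integral_mono])
      show "integrable ?N (\<lambda>x. norm (R x *\<^sub>R (iexp (t * x) - T x)))"
        using inte intT by (intro integrable_norm) (simp add: scaleR_diff_right)
      have "integrable ?N (\<lambda>x. \<bar>R x * x ^ Suc n\<bar> * (\<bar>t\<bar> ^ Suc n / fact (Suc n)))"
        using mom(1)[of "Suc n"] by (intro integrable_mult_left integrable_abs)
      moreover have "(\<lambda>x. \<bar>R x * x ^ Suc n\<bar> * (\<bar>t\<bar> ^ Suc n / fact (Suc n))) =
          (\<lambda>x. \<bar>R x\<bar> * (\<bar>t * x\<bar> ^ Suc n / fact (Suc n)))"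
        by (simp add: abs_mult power_abs power_mult_distrib fun_eq_iff)
      ultimately show "integrable ?N (\<lambda>x. \<bar>R x\<bar> * (\<bar>t * x\<bar> ^ Suc n / fact (Suc n)))" by simp
      show "norm (R x *\<^sub>R (iexp (t * x) - T x)) \<le> \<bar>R x\<bar> * (\<bar>t * x\<bar> ^ Suc n / fact (Suc n))" for x
        unfolding norm_scaleR T_def by (intro mult_left_mono iexp_approx1) auto
    qed
    also have "\<dots> \<le> \<bar>\<integral>x. \<bar>R x\<bar> * (\<bar>t * x\<bar> ^ Suc n / fact (Suc n)) \<partial>?N\<bar>" by simp
    also have "\<dots> \<le> sqrt (\<integral>x. \<bar>R x\<bar>\<^sup>2 \<partial>?N) * sqrt (\<integral>x. (\<bar>t * x\<bar> ^ Suc n / fact (Suc n))\<^sup>2 \<partial>?N)"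
    proof (rule L2_gauss_mult(2))
      show "(\<lambda>x. \<bar>R x\<bar>) \<in> L2_gauss" using R by (simp add: L2_gauss_def)
      show "(\<lambda>x. \<bar>t * x\<bar> ^ Suc n / fact (Suc n)) \<in> L2_gauss"
      proof (rule L2_gauss_growth)
        fix x
        have "\<bar>t\<bar> ^ Suc n / fact (Suc n) * \<bar>x\<bar> ^ Suc n \<le> \<bar>t\<bar> ^ Suc n / fact (Suc n) * (1 + \<bar>x\<bar>) ^ Suc n"
          by (intro mult_left_mono power_mono) auto
        then show "\<bar>\<bar>t * x\<bar> ^ Suc n / fact (Suc n)\<bar> \<le> \<bar>t\<bar> ^ Suc n / fact (Suc n) * (1 + \<bar>x\<bar>) ^ Suc n"
          by (simp add: abs_mult power_mult_distrib del: power_Suc)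
      qed simp
    qed
    also have "\<dots> \<le> K * sqrt ((2 * t\<^sup>2) ^ Suc n / fact (Suc n))"
      unfolding K_def power2_abs
    proof (intro mult_left_mono real_sqrt_le_mono)
      define k where "k = Suc n"
      have "(\<integral>x. (\<bar>t * x\<bar> ^ k / fact k)\<^sup>2 \<partial>?N) = (\<integral>x. (t\<^sup>2) ^ k / (fact k)\<^sup>2 * x ^ (2 * k) \<partial>?N)"
      proof (intro Bochner_Integration.integral_cong refl)
        fix x
        have "(\<bar>t * x\<bar> ^ k)\<^sup>2 = (\<bar>t * x\<bar>\<^sup>2) ^ k" by (metis power_mult mult.commute)
        also have "\<dots> = (t\<^sup>2) ^ k * x ^ (2 * k)" by (simp add: power_mult power_mult_distrib)
        finally show "(\<bar>t * x\<bar> ^ k / fact k)\<^sup>2 = (t\<^sup>2) ^ k / (fact k)\<^sup>2 * x ^ (2 * k)"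
          by (simp add: power_divide)
      qed
      also have "\<dots> = (t\<^sup>2) ^ k / (fact k)\<^sup>2 * (fact (2 * k) / (2 ^ k * fact k))"
        by (simp add: std_normal_distribution_even_moments)
      also have "\<dots> = (t\<^sup>2) ^ k / (2 ^ k * fact k) * (fact (2 * k) / (fact k * fact k))"
        by (simp add: power2_eq_square)
      \<comment> \<open>The central binomial coefficient is at most \<open>4 ^ k\<close>; the
        \<open>2 ^ k\<close> in the denominator of the moment reduces this to
        \<open>2 ^ k\<close>.\<close>
      also have "fact (2 * k) / (fact k * fact k) = real ((2 * k) choose k)"
        by (subst binomial_fact) (auto simp: mult_2)
      also have "(t\<^sup>2) ^ k / (2 ^ k * fact k) * real ((2 * k) choose k) \<le> (t\<^sup>2) ^ k / (2 ^ k * fact k) * 2 ^ (2 * k)"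
      proof (rule mult_left_mono)
        have "real ((2 * k) choose k) \<le> real (2 ^ (2 * k))" using binomial_le_pow2 of_nat_le_iff by blast
        then show "real ((2 * k) choose k) \<le> 2 ^ (2 * k)" by simp
      qed auto
      also have "\<dots> = (2 * t\<^sup>2) ^ k / fact k"
      proof -
        have "(2::real) ^ (2 * k) = 2 ^ k * 2 ^ k" by (metis mult_2 power_add)
        then show ?thesis by (simp only: power_mult_distrib) simp
      qed
      finally show "(\<integral>x. (\<bar>t * x\<bar> ^ Suc n / fact (Suc n))\<^sup>2 \<partial>?N) \<le> (2 * t\<^sup>2) ^ Suc n / fact (Suc n)"
        unfolding k_def .
    qed (auto intro: integral_nonneg_AE)
    finally show ?thesis .
  qed
  have "(\<lambda>n. (2 * t\<^sup>2) ^ n / fact n) \<longlonglongrightarrow> 0"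
    using summable_LIMSEQ_zero[OF summable_exp[of "2 * t\<^sup>2"]] by (simp only: divide_inverse mult.commute)
  then have "(\<lambda>n. (2 * t\<^sup>2) ^ Suc n / fact (Suc n)) \<longlonglongrightarrow> 0" by (rule LIMSEQ_Suc)
  then have "(\<lambda>n. K * sqrt ((2 * t\<^sup>2) ^ Suc n / fact (Suc n))) \<longlonglongrightarrow> K * sqrt 0"
    by (intro tendsto_intros)
  from LIMSEQ_le_const[OF this, of "norm (\<integral>x. R x *\<^sub>R iexp (t * x) \<partial>?N)"] bound
  show ?thesis by auto
qed

text \<open>The densities proportional to \<open>1 + \<bar>R\<bar> + R\<close> and \<open>1 + \<bar>R\<bar>\<close> have the same characteristic function.\<close>

lemma hermite_total:
  assumes R: "R \<in> L2_gauss" and 0: "\<And>m. (\<integral>x. R x * hermite m x \<partial>std_normal_distribution) = 0"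
  shows "AE x in std_normal_distribution. R x = 0"
proof -
  let ?N = std_normal_distribution
  interpret N: prob_space ?N by (rule prob_space_normal_density) simp
  have [measurable]: "R \<in> borel_measurable borel" using L2_gaussD(1)[OF R] .
  have intR: "integrable ?N R" using L2_gauss_mult(1)[OF R hermite_L2[of 0]] by simp
  have R0: "(\<integral>x. R x \<partial>?N) = 0" using 0[of 0] by simp
  define Z where "Z = (\<integral>x. 1 + \<bar>R x\<bar> \<partial>?N)"
  have Z: "1 \<le> Z"
    using intR N.prob_space by (simp add: Z_def)
  \<comment> \<open>The summand \<open>1 + \<bar>R\<bar>\<close> makes both functions nonnegative.
    They have the same mass because \<open>R\<close> integrates to 0, and their difference is
    \<open>R / Z\<close>.\<close>
  define p where "p b x = (1 + \<bar>R x\<bar> + (if b then R x else 0)) / Z" for b x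
  have [measurable]: "p b \<in> borel_measurable borel" for b unfolding p_def by (cases b) simp_all
  have p_nonneg: "0 \<le> p b x" for b x using Z by (auto simp: p_def)
  have int_p: "integrable ?N (p b)" for b unfolding p_def using intR by (cases b) auto
  have p1: "(\<integral>x. p b x \<partial>?N) = 1" for b
  proof -
    have "(\<integral>x. p b x \<partial>?N) = (Z + (if b then (\<integral>x. R x \<partial>?N) else 0)) / Z"
      unfolding p_def Z_def using intR by (cases b) auto
    then show ?thesis using R0 Z by auto
  qed
  define \<mu> where "\<mu> b = density ?N (\<lambda>x. ennreal (p b x))" for b
  have real_dist: "real_distribution (\<mu> b)" for b
  proof -
    have "emeasure (\<mu> b) UNIV = 1"
      unfolding \<mu>_def using nn_integral_eq_integral[OF int_p[of b]] p_nonneg p1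
      by (subst emeasure_density) auto
    then have "prob_space (\<mu> b)" by (intro prob_spaceI) (simp add: \<mu>_def)
    then show ?thesis by (simp add: real_distribution_def real_distribution_axioms_def \<mu>_def)
  qed
  have "char (\<mu> b) t = (\<integral>x. ((1 + \<bar>R x\<bar>) / Z) *\<^sub>R iexp (t * x) \<partial>?N)" for b t
  proof -
    have int1: "integrable ?N (\<lambda>x. ((1 + \<bar>R x\<bar>) / Z) *\<^sub>R iexp (t * x))"
      by (rule Bochner_Integration.integrable_bound[of _ "\<lambda>x. (1 + \<bar>R x\<bar>) / Z"]) (use intR in auto)
    have int2: "integrable ?N (\<lambda>x. R x *\<^sub>R iexp (t * x))"
      by (rule Bochner_Integration.integrable_bound[OF intR]) auto
    have "char (\<mu> b) t = (\<integral>x. p b x *\<^sub>R iexp (t * x) \<partial>?N)"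
      unfolding char_def \<mu>_def using p_nonneg by (subst integral_density) auto
    also have "\<dots> = (\<integral>x. ((1 + \<bar>R x\<bar>) / Z) *\<^sub>R iexp (t * x) + (if b then 1 / Z else 0) *\<^sub>R (R x *\<^sub>R iexp (t * x)) \<partial>?N)"
      by (intro Bochner_Integration.integral_cong) (auto simp: p_def add_divide_distrib scaleR_left.add)
    also have "\<dots> = (\<integral>x. ((1 + \<bar>R x\<bar>) / Z) *\<^sub>R iexp (t * x) \<partial>?N)"
    proof -
      have "integrable ?N (\<lambda>x. c *\<^sub>R (R x *\<^sub>R iexp (t * x)))" for c using int2 by (rule integrable_scaleR_right)
      then show ?thesis
        by (subst Bochner_Integration.integral_add[OF int1])
          (simp_all only: integral_scaleR_right int2 L2_gauss_fourier_vanish[OF R 0] scaleR_zero_right add_0_right)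
    qed
    finally show ?thesis .
  qed
  then have "char (\<mu> True) = char (\<mu> False)" by (intro ext) simp
  from Levy_uniqueness[OF real_dist real_dist this]
  have "AE x in ?N. ennreal (p True x) = ennreal (p False x)"
    unfolding \<mu>_def using nn_integral_eq_integral[OF int_p[of True]] p_nonneg
    by (subst (asm) finite_density_unique) auto
  then show ?thesis
  proof eventually_elim
    case (elim x)
    then have "p True x = p False x" using p_nonneg by simp
    then show ?case using Z by (simp add: p_def)
  qed
qed

definition hermite_partial :: "(real \<Rightarrow> real) \<Rightarrow> nat \<Rightarrow> real \<Rightarrow> real" where
  "hermite_partial G Q x = (\<Sum>m\<le>Q. hermite_coeff G m * hermite m x)"

lemma hermite_partial_L2: "hermite_partial G Q \<in> L2_gauss"
  unfolding hermite_partial_def[abs_def] by (rule L2_gauss_sum_hermite) simp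

lemma hermite_coeff_diff_partial:
  assumes "G \<in> L2_gauss"
  shows "hermite_coeff (\<lambda>x. G x - hermite_partial G Q x) m = (if m \<le> Q then 0 else hermite_coeff G m)"
proof -
  have "hermite_coeff (\<lambda>x. G x - hermite_partial G Q x) m = hermite_coeff G m - hermite_coeff (hermite_partial G Q) m"
    unfolding hermite_coeff_def
    using L2_gauss_mult(1)[OF assms hermite_L2[of m]] L2_gauss_mult(1)[OF hermite_partial_L2 hermite_L2[of m]]
    by (simp add: left_diff_distrib right_diff_distrib)
  also have "hermite_coeff (hermite_partial G Q) m = (if m \<le> Q then hermite_coeff G m else 0)"
    unfolding hermite_partial_def[abs_def] by (subst hermite_coeff_sum_hermite) auto
  finally show ?thesis by simp
qed

lemma integral_diff_partial_sq:
  assumes G: "G \<in> L2_gauss"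
  shows "(\<integral>x. (G x - hermite_partial G Q x)\<^sup>2 \<partial>std_normal_distribution) =
    (\<integral>x. (G x)\<^sup>2 \<partial>std_normal_distribution) - (\<Sum>m\<le>Q. (hermite_coeff G m)\<^sup>2 * fact m)"
proof -
  let ?N = std_normal_distribution
  have 1: "(\<integral>x. G x * hermite_partial G Q x \<partial>?N) = (\<Sum>m\<le>Q. (hermite_coeff G m)\<^sup>2 * fact m)"
    unfolding hermite_partial_def using integral_hermite_sum[OF G, of "{..Q}" "hermite_coeff G"]
    by (simp add: power2_eq_square ac_simps)
  have 2: "(\<integral>x. (hermite_partial G Q x)\<^sup>2 \<partial>?N) = (\<Sum>m\<le>Q. (hermite_coeff G m)\<^sup>2 * fact m)"
    unfolding hermite_partial_def by (rule integral_sum_hermite_sq) simp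
  have "(\<integral>x. (G x - hermite_partial G Q x)\<^sup>2 \<partial>?N) =
      (\<integral>x. (G x)\<^sup>2 - 2 * (G x * hermite_partial G Q x) + (hermite_partial G Q x)\<^sup>2 \<partial>?N)"
    by (intro Bochner_Integration.integral_cong) (auto simp: power2_diff)
  also have "\<dots> = (\<integral>x. (G x)\<^sup>2 \<partial>?N) - 2 * (\<integral>x. G x * hermite_partial G Q x \<partial>?N) + (\<integral>x. (hermite_partial G Q x)\<^sup>2 \<partial>?N)"
    using L2_gaussD(2)[OF G] L2_gaussD(2)[OF hermite_partial_L2[of G Q]] L2_gauss_mult(1)[OF G hermite_partial_L2[of G Q]]
    by simp
  finally show ?thesis using 1 2 by simp
qed

lemma hermite_coeff_sq_summable:
  assumes G: "G \<in> L2_gauss"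
  shows "summable (\<lambda>m. (hermite_coeff G m)\<^sup>2 * fact m)"
proof (rule summableI_nonneg_bounded)
  fix n
  have "0 \<le> (\<integral>x. (G x - hermite_partial G n x)\<^sup>2 \<partial>std_normal_distribution)" by (auto intro: integral_nonneg_AE)
  moreover have "(\<Sum>m<n. (hermite_coeff G m)\<^sup>2 * fact m) \<le> (\<Sum>m\<le>n. (hermite_coeff G m)\<^sup>2 * fact m)"
    by (intro sum_mono2) auto
  ultimately show "(\<Sum>m<n. (hermite_coeff G m)\<^sup>2 * fact m) \<le> (\<integral>x. (G x)\<^sup>2 \<partial>std_normal_distribution)"
    unfolding integral_diff_partial_sq[OF G] by simp
qed auto

text \<open>The remainders \<open>r Q\<close> form a Cauchy sequence in mean square. Their limit
  \<open>R\<close> is orthogonal to every Hermite polynomial, hence vanishes almost everywhere by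
  \<open>hermite_total\<close>. The limit is constructed from a subsequence that converges almost
  everywhere, which Cauchy convergence in mean provides.\<close>

lemma hermite_complete:
  assumes G: "G \<in> L2_gauss"
  shows "(\<lambda>Q. \<integral>x. (G x - hermite_partial G Q x)\<^sup>2 \<partial>std_normal_distribution) \<longlonglongrightarrow> 0"
proof -
  let ?N = std_normal_distribution
  interpret N: prob_space ?N by (rule prob_space_normal_density) simp
  define a where "a m = (hermite_coeff G m)\<^sup>2 * fact m" for m
  have a: "summable a" "\<And>m. 0 \<le> a m" unfolding a_def[abs_def] using hermite_coeff_sq_summable[OF G] by auto
  define tail where "tail Q = suminf a - (\<Sum>m\<le>Q. a m)" for Q
  have tail_lim: "tail \<longlonglongrightarrow> 0"
    unfolding tail_def using tendsto_diff[OF tendsto_const summable_LIMSEQ'[OF a(1)], of "suminf a"] by simp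
  define r where "r Q x = G x - hermite_partial G Q x" for Q x
  have r: "r Q \<in> L2_gauss" for Q unfolding r_def[abs_def] by (rule L2_gauss_diff[OF G hermite_partial_L2])
  have [measurable]: "r Q \<in> borel_measurable borel" for Q by (rule L2_gaussD(1)[OF r])
  have diff_L2: "(\<lambda>x. r Q x - r Q' x) \<in> L2_gauss" for Q Q' by (intro L2_gauss_diff r)
  have diff: "(\<integral>x. (r Q x - r Q' x)\<^sup>2 \<partial>?N) \<le> tail Q" if "Q \<le> Q'" for Q Q'
  proof -
    have "{..Q'} = {..Q} \<union> {Q<..Q'}" using that by auto
    then have split: "(\<Sum>m\<le>Q'. f m) = (\<Sum>m\<le>Q. f m) + (\<Sum>m\<in>{Q<..Q'}. f m)" for f :: "nat \<Rightarrow> real"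
      by (simp add: sum.union_disjoint Int_def)
    have "r Q x - r Q' x = (\<Sum>m\<in>{Q<..Q'}. hermite_coeff G m * hermite m x)" for x
      unfolding r_def hermite_partial_def split by simp
    then have "(\<integral>x. (r Q x - r Q' x)\<^sup>2 \<partial>?N) = (\<Sum>m\<in>{Q<..Q'}. a m)"
      by (simp add: integral_sum_hermite_sq a_def)
    moreover have "(\<Sum>m\<le>Q'. a m) \<le> suminf a" by (rule sum_le_suminf[OF a(1)]) (use a in auto)
    ultimately show ?thesis using split[of a] by (simp add: tail_def)
  qed
  have L1: "(\<integral>x. norm (r i x - r j x) \<partial>?N) \<le> sqrt (tail (min i j))" for i j
  proof (induction i j rule: linorder_wlog)
    case (le i j)
    have "(\<integral>x. \<bar>r i x - r j x\<bar> \<partial>?N) \<le> sqrt (\<integral>x. (r i x - r j x)\<^sup>2 \<partial>?N)"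
      by (rule N.expectation_abs_le_sqrt(2)) (use L2_gaussD(2)[OF diff_L2[of i j]] in simp_all)
    also have "\<dots> \<le> sqrt (tail i)" using diff[OF le] by simp
    finally show ?case using le by (simp add: min_def)
  next
    case (sym i j)
    then show ?case by (simp add: abs_minus_commute min.commute)
  qed
  have "\<exists>M. \<forall>i\<ge>M. \<forall>j\<ge>M. (\<integral>x. norm (r i x - r j x) \<partial>?N) < e" if "0 < e" for e
  proof -
    have "0 < e\<^sup>2" using that by simp
    from order_tendstoD(2)[OF tail_lim this] obtain M where M: "\<And>Q. Q \<ge> M \<Longrightarrow> tail Q < e\<^sup>2"
      by (auto simp: eventually_sequentially)
    have "(\<integral>x. norm (r i x - r j x) \<partial>?N) < e" if "i \<ge> M" "j \<ge> M" for i j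
    proof -
      have "tail (min i j) < e\<^sup>2" using M[of "min i j"] that by simp
      then have "sqrt (tail (min i j)) < sqrt (e\<^sup>2)" by (rule real_sqrt_less_mono)
      then show ?thesis using L1[of i j] \<open>0 < e\<close> by simp
    qed
    then show ?thesis by blast
  qed
  moreover have "integrable ?N (r Q)" for Q
    using L2_gauss_mult(1)[OF r[of Q] hermite_L2[of 0]] by simp
  ultimately obtain s where s: "strict_mono s" "AE x in ?N. Cauchy (\<lambda>i. r (s i) x)"
    using cauchy_L1_AE_cauchy_subseq[of ?N r] by blast
  define R where "R x = lim (\<lambda>i. r (s i) x)" for x
  have R_meas [measurable]: "R \<in> borel_measurable borel"
    unfolding R_def by (rule borel_measurable_lim_metric) simp
  have R_lim: "AE x in ?N. (\<lambda>i. r (s i) x) \<longlonglongrightarrow> R x"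
    using s(2) by eventually_elim (simp add: R_def Cauchy_convergent_iff convergent_LIMSEQ_iff)
  \<comment> \<open>Fatou's lemma transfers the bound to the limit. Nonnegative integrals are used
    since square integrability of \<open>R\<close> is still to be shown.\<close>
  have nn: "(\<integral>\<^sup>+x. ennreal ((r Q x - R x)\<^sup>2) \<partial>?N) \<le> ennreal (tail Q)" for Q
  proof -
    have "(\<integral>\<^sup>+x. ennreal ((r Q x - R x)\<^sup>2) \<partial>?N) = (\<integral>\<^sup>+x. liminf (\<lambda>i. ennreal ((r Q x - r (s i) x)\<^sup>2)) \<partial>?N)"
    proof (rule nn_integral_cong_AE)
      show "AE x in ?N. ennreal ((r Q x - R x)\<^sup>2) = liminf (\<lambda>i. ennreal ((r Q x - r (s i) x)\<^sup>2))"
        using R_lim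
      proof eventually_elim
        case (elim x)
        then have "(\<lambda>i. ennreal ((r Q x - r (s i) x)\<^sup>2)) \<longlonglongrightarrow> ennreal ((r Q x - R x)\<^sup>2)"
          by (intro tendsto_intros tendsto_ennrealI)
        then show ?case by (intro lim_imp_Liminf[symmetric] trivial_limit_sequentially)
      qed
    qed
    also have "\<dots> \<le> liminf (\<lambda>i. \<integral>\<^sup>+x. ennreal ((r Q x - r (s i) x)\<^sup>2) \<partial>?N)"
      by (rule nn_integral_liminf) simp
    also have "\<dots> \<le> limsup (\<lambda>i. \<integral>\<^sup>+x. ennreal ((r Q x - r (s i) x)\<^sup>2) \<partial>?N)"
      by (rule Liminf_le_Limsup) simp
    also have "\<dots> \<le> ennreal (tail Q)"
    proof (rule Limsup_bounded)
      have "(\<integral>\<^sup>+x. ennreal ((r Q x - r (s i) x)\<^sup>2) \<partial>?N) \<le> ennreal (tail Q)" if "i \<ge> Q" for i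
      proof -
        have "Q \<le> s i" using seq_suble[OF s(1), of i] that by simp
        then show ?thesis
          using L2_gaussD(2)[OF diff_L2[of Q "s i"]] diff[of Q "s i"]
          by (subst nn_integral_eq_integral) (auto intro: ennreal_leI)
      qed
      then show "\<forall>\<^sub>F i in sequentially. (\<integral>\<^sup>+x. ennreal ((r Q x - r (s i) x)\<^sup>2) \<partial>?N) \<le> ennreal (tail Q)"
        by (auto simp: eventually_sequentially)
    qed
    finally show ?thesis .
  qed
  have tail_nonneg: "0 \<le> tail Q" for Q
    unfolding tail_def using sum_le_suminf[OF a(1), of "{..Q}"] a(2) by auto
  have rR_int: "integrable ?N (\<lambda>x. (r Q x - R x)\<^sup>2)" for Q
    by (rule integrableI_bounded) (use nn[of Q] in \<open>auto intro: le_less_trans\<close>)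
  have rR_L2: "(\<lambda>x. r Q x - R x) \<in> L2_gauss" for Q using rR_int by (simp add: L2_gauss_def)
  have rR: "(\<integral>x. (r Q x - R x)\<^sup>2 \<partial>?N) \<le> tail Q" for Q
    using nn[of Q] tail_nonneg nn_integral_eq_integral[OF rR_int[of Q]] by simp
  have R_L2: "R \<in> L2_gauss" using L2_gauss_diff[OF r[of 0] rR_L2[of 0]] by simp
  have "(\<integral>x. R x * hermite m x \<partial>?N) = 0" for m
  proof -
    have "\<bar>\<integral>x. R x * hermite m x \<partial>?N\<bar> \<le> sqrt (tail Q) * sqrt (fact m)" if "Q \<ge> m" for Q
    proof -
      have "(\<integral>x. r Q x * hermite m x \<partial>?N) = 0"
        unfolding integral_hermite r_def hermite_coeff_diff_partial[OF G] using that by simp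
      moreover have "(\<integral>x. (r Q x - R x) * hermite m x \<partial>?N) = (\<integral>x. r Q x * hermite m x \<partial>?N) - (\<integral>x. R x * hermite m x \<partial>?N)"
        using L2_gauss_mult(1)[OF r[of Q] hermite_L2[of m]] L2_gauss_mult(1)[OF R_L2 hermite_L2[of m]]
        by (simp add: left_diff_distrib)
      ultimately have "\<bar>\<integral>x. R x * hermite m x \<partial>?N\<bar> = \<bar>\<integral>x. (r Q x - R x) * hermite m x \<partial>?N\<bar>" by simp
      also have "\<dots> \<le> sqrt (\<integral>x. (r Q x - R x)\<^sup>2 \<partial>?N) * sqrt (\<integral>x. (hermite m x)\<^sup>2 \<partial>?N)"
        by (rule L2_gauss_mult(2)[OF rR_L2 hermite_L2])
      also have "\<dots> \<le> sqrt (tail Q) * sqrt (fact m)"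
        using rR hermite_orthogonal(2)[of m m] tail_nonneg by (intro mult_mono) (auto simp: power2_eq_square)
      finally show ?thesis .
    qed
    then have "\<forall>\<^sub>F Q in sequentially. \<bar>\<integral>x. R x * hermite m x \<partial>?N\<bar> \<le> sqrt (tail Q) * sqrt (fact m)"
      by (auto simp: eventually_sequentially)
    moreover have "(\<lambda>Q. sqrt (tail Q) * sqrt (fact m)) \<longlonglongrightarrow> sqrt 0 * sqrt (fact m)"
      by (intro tendsto_intros tail_lim)
    ultimately have "\<bar>\<integral>x. R x * hermite m x \<partial>?N\<bar> \<le> sqrt 0 * sqrt (fact m)"
      by (intro tendsto_lowerbound) auto
    then show ?thesis by simp
  qed
  from hermite_total[OF R_L2 this] have R0: "AE x in ?N. R x = 0" .
  have "(\<integral>x. (r Q x)\<^sup>2 \<partial>?N) \<le> tail Q" for Q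
  proof -
    have "(\<integral>x. (r Q x)\<^sup>2 \<partial>?N) = (\<integral>x. (r Q x - R x)\<^sup>2 \<partial>?N)"
      by (rule integral_cong_AE) (use R0 in auto)
    then show ?thesis using rR by simp
  qed
  then show ?thesis
    unfolding r_def[symmetric]
    by (intro tendsto_sandwich[OF _ _ tendsto_const tail_lim] always_eventually allI integral_nonneg_AE AE_I2
        zero_le_power2)
qed

section \<open>Integration by parts for Gaussian families\<close>

lemma measurable_continuous_on_PiE_complex:
  fixes u :: "('i \<Rightarrow> real) \<Rightarrow> complex"
  assumes I: "finite I" and u: "continuous_on (I \<rightarrow>\<^sub>E UNIV) u"
    and Y: "\<And>i. i \<in> I \<Longrightarrow> Y i \<in> borel_measurable M"
  shows "(\<lambda>\<omega>. u (\<lambda>i\<in>I. Y i \<omega>)) \<in> borel_measurable M"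
proof -
  have real: "(\<lambda>\<omega>. f (\<lambda>i\<in>I. Y i \<omega>)) \<in> borel_measurable M"
    if f: "continuous_on (I \<rightarrow>\<^sub>E UNIV) f" for f :: "('i \<Rightarrow> real) \<Rightarrow> real"
  proof (rule borel_measurable_LIMSEQ_metric)
    show "(\<lambda>\<omega>. max (- real n) (min (real n) (f (\<lambda>i\<in>I. Y i \<omega>)))) \<in> borel_measurable M" for n
      using f by (intro measurable_continuous_on_PiE[where C = "real n"
            and f = "\<lambda>x. max (- real n) (min (real n) (f x))", OF I _ _ Y] continuous_intros) auto
    fix \<omega>
    obtain n0 :: nat where n0: "\<bar>f (\<lambda>i\<in>I. Y i \<omega>)\<bar> \<le> real n0" using real_arch_simple by blast
    have "max (- real n) (min (real n) (f (\<lambda>i\<in>I. Y i \<omega>))) = f (\<lambda>i\<in>I. Y i \<omega>)" if "n \<ge> n0" for n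
      using n0 that by (auto simp: abs_le_iff)
    then show "(\<lambda>n. max (- real n) (min (real n) (f (\<lambda>i\<in>I. Y i \<omega>)))) \<longlonglongrightarrow> f (\<lambda>i\<in>I. Y i \<omega>)"
      by (intro tendsto_eventually) (auto simp: eventually_sequentially)
  qed
  have "(\<lambda>\<omega>. Re (u (\<lambda>i\<in>I. Y i \<omega>))) \<in> borel_measurable M"
    by (rule real) (intro continuous_intros u)
  moreover have "(\<lambda>\<omega>. Im (u (\<lambda>i\<in>I. Y i \<omega>))) \<in> borel_measurable M"
    by (rule real) (intro continuous_intros u)
  ultimately show ?thesis by (subst borel_measurable_complex_iff) simp
qed

lemma vec_char_eq_imp_integral_eq_complex:
  fixes u :: "('i \<Rightarrow> real) \<Rightarrow> complex"
  assumes M: "prob_space M" and P: "prob_space P" and I: "finite I"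
    and Y: "\<And>i. i \<in> I \<Longrightarrow> Y i \<in> borel_measurable M"
    and Z: "\<And>i. i \<in> I \<Longrightarrow> Z i \<in> borel_measurable P"
    and char: "\<And>c. (\<integral>\<omega>. cis (\<Sum>i\<in>I. c i * Y i \<omega>) \<partial>M) = (\<integral>\<omega>. cis (\<Sum>i\<in>I. c i * Z i \<omega>) \<partial>P)"
    and u: "continuous_on (I \<rightarrow>\<^sub>E UNIV) u"
    and int: "integrable M (\<lambda>\<omega>. u (\<lambda>i\<in>I. Y i \<omega>))" "integrable P (\<lambda>\<omega>. u (\<lambda>i\<in>I. Z i \<omega>))"
  shows "(\<integral>\<omega>. u (\<lambda>i\<in>I. Y i \<omega>) \<partial>M) = (\<integral>\<omega>. u (\<lambda>i\<in>I. Z i \<omega>) \<partial>P)"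
proof (rule complex_eqI)
  have "(\<integral>\<omega>. Re (u (\<lambda>i\<in>I. Y i \<omega>)) \<partial>M) = (\<integral>\<omega>. Re (u (\<lambda>i\<in>I. Z i \<omega>)) \<partial>P)"
    by (rule vec_char_eq_imp_integral_eq[OF M P I Y Z char, where f = "\<lambda>x. Re (u x)"])
      (use int u in \<open>auto intro!: continuous_intros integrable_Re\<close>)
  then show "Re (\<integral>\<omega>. u (\<lambda>i\<in>I. Y i \<omega>) \<partial>M) = Re (\<integral>\<omega>. u (\<lambda>i\<in>I. Z i \<omega>) \<partial>P)"
    using integral_Re[OF int(1)] integral_Re[OF int(2)] by simp
  have "(\<integral>\<omega>. Im (u (\<lambda>i\<in>I. Y i \<omega>)) \<partial>M) = (\<integral>\<omega>. Im (u (\<lambda>i\<in>I. Z i \<omega>)) \<partial>P)"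
    by (rule vec_char_eq_imp_integral_eq[OF M P I Y Z char, where f = "\<lambda>x. Im (u x)"])
      (use int u in \<open>auto intro!: continuous_intros integrable_Im\<close>)
  then show "Im (\<integral>\<omega>. u (\<lambda>i\<in>I. Y i \<omega>) \<partial>M) = Im (\<integral>\<omega>. u (\<lambda>i\<in>I. Z i \<omega>) \<partial>P)"
    using integral_Im[OF int(1)] integral_Im[OF int(2)] by simp
qed

text \<open>A class closed under sums and products that contains the Hermite polynomials and all
  bounded functions; its continuous members are integrable for every Gaussian family.\<close>

definition poly_growth :: "'i set \<Rightarrow> (('i \<Rightarrow> real) \<Rightarrow> complex) \<Rightarrow> bool" where
  "poly_growth F u \<longleftrightarrow> (\<exists>C p. 0 \<le> C \<and> (\<forall>x. norm (u x) \<le> C * (1 + (\<Sum>i\<in>F. \<bar>x i\<bar>)) ^ p))"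

lemma poly_growthI: "0 \<le> C \<Longrightarrow> (\<And>x. norm (u x) \<le> C * (1 + (\<Sum>i\<in>F. \<bar>x i\<bar>)) ^ p) \<Longrightarrow> poly_growth F u"
  unfolding poly_growth_def by blast

lemma growth_base: "1 \<le> 1 + (\<Sum>i\<in>F. \<bar>x i :: real\<bar>)"
  by (simp add: sum_nonneg)

lemma poly_growth_common:
  assumes "poly_growth F u" "poly_growth F v"
  obtains C p where "0 \<le> C" "\<And>x. norm (u x) \<le> C * (1 + (\<Sum>i\<in>F. \<bar>x i\<bar>)) ^ p"
    "\<And>x. norm (v x) \<le> C * (1 + (\<Sum>i\<in>F. \<bar>x i\<bar>)) ^ p"
proof -
  obtain C p where C: "0 \<le> C" "\<And>x. norm (u x) \<le> C * (1 + (\<Sum>i\<in>F. \<bar>x i\<bar>)) ^ p"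
    using assms(1) by (auto simp: poly_growth_def)
  obtain D q where D: "0 \<le> D" "\<And>x. norm (v x) \<le> D * (1 + (\<Sum>i\<in>F. \<bar>x i\<bar>)) ^ q"
    using assms(2) by (auto simp: poly_growth_def)
  have le: "c * (1 + (\<Sum>i\<in>F. \<bar>x i\<bar>)) ^ k \<le> (C + D) * (1 + (\<Sum>i\<in>F. \<bar>x i\<bar>)) ^ (p + q)"
    if "c \<le> C + D" "k \<le> p + q" for c k and x :: "'a \<Rightarrow> real"
    using that C(1) D(1) growth_base[of x F] by (intro mult_mono power_increasing) auto
  show ?thesis
  proof (rule that[of "C + D" "p + q"])
    show "norm (u x) \<le> (C + D) * (1 + (\<Sum>i\<in>F. \<bar>x i\<bar>)) ^ (p + q)" for x
      using le[of C p x] C(2)[of x] D(1) by simp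
    show "norm (v x) \<le> (C + D) * (1 + (\<Sum>i\<in>F. \<bar>x i\<bar>)) ^ (p + q)" for x
      using le[of D q x] D(2)[of x] C(1) by simp
  qed (use C D in auto)
qed

lemma poly_growth_add:
  assumes "poly_growth F u" "poly_growth F v"
  shows "poly_growth F (\<lambda>x. u x + v x)"
proof -
  obtain C p where C: "0 \<le> C" "\<And>x. norm (u x) \<le> C * (1 + (\<Sum>i\<in>F. \<bar>x i\<bar>)) ^ p"
    "\<And>x. norm (v x) \<le> C * (1 + (\<Sum>i\<in>F. \<bar>x i\<bar>)) ^ p"
    using poly_growth_common[OF assms] by blast
  show ?thesis
  proof (rule poly_growthI)
    show "norm (u x + v x) \<le> (2 * C) * (1 + (\<Sum>i\<in>F. \<bar>x i\<bar>)) ^ p" for x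
      using norm_triangle_le[OF add_mono[OF C(2)[of x] C(3)[of x]]] by simp
  qed (use C in simp)
qed

lemma poly_growth_mult:
  assumes "poly_growth F u" "poly_growth F v"
  shows "poly_growth F (\<lambda>x. u x * v x)"
proof -
  obtain C p where C: "0 \<le> C" "\<And>x. norm (u x) \<le> C * (1 + (\<Sum>i\<in>F. \<bar>x i\<bar>)) ^ p"
    "\<And>x. norm (v x) \<le> C * (1 + (\<Sum>i\<in>F. \<bar>x i\<bar>)) ^ p"
    using poly_growth_common[OF assms] by blast
  show ?thesis
  proof (rule poly_growthI)
    fix x
    have "norm (u x * v x) \<le> (C * (1 + (\<Sum>i\<in>F. \<bar>x i\<bar>)) ^ p) * (C * (1 + (\<Sum>i\<in>F. \<bar>x i\<bar>)) ^ p)"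
      unfolding norm_mult using C growth_base[of x F] by (intro mult_mono) auto
    then show "norm (u x * v x) \<le> (C * C) * (1 + (\<Sum>i\<in>F. \<bar>x i\<bar>)) ^ (p + p)"
      by (simp add: power_add ac_simps)
  qed (use C in simp)
qed

lemma poly_growth_bounded:
  assumes "\<And>x. norm (u x) \<le> C"
  shows "poly_growth F u"
proof (rule poly_growthI[where p = 0])
  show "0 \<le> C" using assms[of undefined] norm_ge_zero order_trans by blast
qed (use assms in simp)

lemma poly_growth_hermite:
  assumes "finite F" "i \<in> F"
  shows "poly_growth F (\<lambda>x. of_real (hermite m (x i)))"
proof -
  obtain C where C: "0 \<le> C" "\<And>x. \<bar>hermite m x\<bar> \<le> C * (1 + \<bar>x\<bar>) ^ m" using hermite_growth[of m] by auto
  show ?thesis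
  proof (rule poly_growthI[OF C(1)])
    fix x :: "'a \<Rightarrow> real"
    have "\<bar>x i\<bar> \<le> (\<Sum>i\<in>F. \<bar>x i\<bar>)" using assms by (intro member_le_sum) auto
    then have "C * (1 + \<bar>x i\<bar>) ^ m \<le> C * (1 + (\<Sum>i\<in>F. \<bar>x i\<bar>)) ^ m"
      using C(1) by (intro mult_left_mono power_mono) auto
    with C(2)[of "x i"] show "norm (complex_of_real (hermite m (x i))) \<le> C * (1 + (\<Sum>i\<in>F. \<bar>x i\<bar>)) ^ m"
      by simp
  qed
qed

text \<open>Directional derivative of \<open>u\<close> along \<open>v\<close>, bundled with the
  regularity that integration by parts asks for. For \<open>v = r n\<close> it is the direction in
  which the coordinates move when \<open>X n\<close> changes and the residuals of the regression on
  \<open>X n\<close> stay fixed.\<close>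

definition tame_deriv :: "'i set \<Rightarrow> ('i \<Rightarrow> real) \<Rightarrow> (('i \<Rightarrow> real) \<Rightarrow> complex) \<Rightarrow> (('i \<Rightarrow> real) \<Rightarrow> complex) \<Rightarrow> bool" where
  "tame_deriv F v u u' \<longleftrightarrow>
     continuous_on (F \<rightarrow>\<^sub>E UNIV) u \<and> continuous_on (F \<rightarrow>\<^sub>E UNIV) u' \<and> poly_growth F u \<and> poly_growth F u' \<and>
     (\<forall>x \<xi>. ((\<lambda>\<xi>. u (\<lambda>i\<in>F. x i + \<xi> * v i)) has_vector_derivative u' (\<lambda>i\<in>F. x i + \<xi> * v i)) (at \<xi>))"

lemma tame_deriv_add:
  "tame_deriv F v u u' \<Longrightarrow> tame_deriv F v w w' \<Longrightarrow> tame_deriv F v (\<lambda>x. u x + w x) (\<lambda>x. u' x + w' x)"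
  unfolding tame_deriv_def by (auto intro!: continuous_intros poly_growth_add has_vector_derivative_add)

lemma tame_deriv_mult:
  "tame_deriv F v u u' \<Longrightarrow> tame_deriv F v w w' \<Longrightarrow>
    tame_deriv F v (\<lambda>x. u x * w x) (\<lambda>x. u x * w' x + u' x * w x)"
  unfolding tame_deriv_def
  by (auto intro!: continuous_intros poly_growth_add poly_growth_mult has_vector_derivative_mult)

lemma tame_deriv_const: "tame_deriv F v (\<lambda>x. c) (\<lambda>x. 0)"
  unfolding tame_deriv_def by (auto intro!: poly_growth_bounded)

lemma tame_deriv_cmult:
  assumes "tame_deriv F v u u'"
  shows "tame_deriv F v (\<lambda>x. c * u x) (\<lambda>x. c * u' x)"
  using tame_deriv_mult[OF tame_deriv_const assms, of c] by simp

lemma tame_deriv_sum: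
  assumes "\<And>k. k \<in> S \<Longrightarrow> tame_deriv F v (u k) (u' k)"
  shows "tame_deriv F v (\<lambda>x. \<Sum>k\<in>S. u k x) (\<lambda>x. \<Sum>k\<in>S. u' k x)"
  using assms
proof (induction S rule: infinite_finite_induct)
  case (insert k S)
  then show ?case by (simp add: tame_deriv_add)
qed (auto intro: tame_deriv_const)

lemma tame_deriv_hermite:
  assumes "finite F" "i \<in> F"
  shows "tame_deriv F v (\<lambda>x. of_real (hermite m (x i))) (\<lambda>x. of_real (v i * (real m * hermite (m - 1) (x i))))"
proof -
  have cx: "continuous_on (F \<rightarrow>\<^sub>E UNIV) (\<lambda>x::'a \<Rightarrow> real. x i)"
    using continuous_on_product_coordinates[of i] continuous_on_subset by blast
  then have "continuous_on (F \<rightarrow>\<^sub>E UNIV) (\<lambda>x. complex_of_real (hermite m (x i)))" for m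
    by (intro continuous_intros)
  moreover have "poly_growth F (\<lambda>x. complex_of_real (v i * real m) * complex_of_real (hermite (m - 1) (x i)))"
    by (rule poly_growth_mult[OF poly_growth_bounded[OF order_refl] poly_growth_hermite[OF assms]])
  moreover have "((\<lambda>\<xi>. complex_of_real (hermite m (x i + \<xi> * v i))) has_vector_derivative
      complex_of_real (v i * (real m * hermite (m - 1) (x i + \<xi> * v i)))) (at \<xi>)" for x \<xi>
  proof -
    have "((\<lambda>\<xi>. hermite m (x i + \<xi> * v i)) has_real_derivative
        (real m * hermite (m - 1) (x i + \<xi> * v i)) * v i) (at \<xi>)"
      by (rule DERIV_chain2[OF DERIV_hermite]) (auto intro!: derivative_eq_intros)
    then show ?thesis
      by (intro has_vector_derivative_of_real)
        (simp add: has_real_derivative_iff_has_vector_derivative mult.commute)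
  qed
  ultimately show ?thesis
    unfolding tame_deriv_def using assms
    by (auto intro!: poly_growth_hermite continuous_intros cx simp: mult.assoc)
qed

lemma tame_deriv_cis:
  assumes "tame_deriv F v (\<lambda>x. of_real (s x)) (\<lambda>x. of_real (s' x))"
  shows "tame_deriv F v (\<lambda>x. cis (s x)) (\<lambda>x. \<i> * of_real (s' x) * cis (s x))"
proof -
  have cont: "continuous_on (F \<rightarrow>\<^sub>E UNIV) s"
  proof -
    have "continuous_on (F \<rightarrow>\<^sub>E UNIV) (\<lambda>x. Re (complex_of_real (s x)))"
      using assms unfolding tame_deriv_def by (intro continuous_on_Re) simp
    then show ?thesis by simp
  qed
  have deriv: "((\<lambda>\<xi>. cis (s (\<lambda>i\<in>F. x i + \<xi> * v i))) has_vector_derivative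
      (\<i> * of_real (s' (\<lambda>i\<in>F. x i + \<xi> * v i)) * cis (s (\<lambda>i\<in>F. x i + \<xi> * v i)))) (at \<xi>)" for x \<xi>
  proof -
    have "((\<lambda>\<xi>. complex_of_real (s (\<lambda>i\<in>F. x i + \<xi> * v i))) has_vector_derivative
        complex_of_real (s' (\<lambda>i\<in>F. x i + \<xi> * v i))) (at \<xi>)"
      using assms unfolding tame_deriv_def by blast
    then have "((\<lambda>\<xi>. \<i> * complex_of_real (s (\<lambda>i\<in>F. x i + \<xi> * v i))) has_vector_derivative
        \<i> * complex_of_real (s' (\<lambda>i\<in>F. x i + \<xi> * v i))) (at \<xi>)"
      by (rule has_vector_derivative_mult_right)
    from field_vector_diff_chain_at[OF this DERIV_exp]
    show ?thesis by (simp add: cis_conv_exp comp_def)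
  qed
  have "poly_growth F (\<lambda>x. \<i> * of_real (s' x) * cis (s x))"
    using assms unfolding tame_deriv_def
    by (intro poly_growth_mult poly_growth_bounded[where u = "\<lambda>_. \<i>" and C = 1]
        poly_growth_bounded[where u = "\<lambda>x. cis (s x)" and C = 1]) auto
  moreover have "poly_growth F (\<lambda>x. cis (s x))" by (rule poly_growth_bounded[where C = 1]) simp
  ultimately show ?thesis
    using assms cont deriv unfolding tame_deriv_def by (auto intro!: continuous_intros)
qed

text \<open>The law is prescribed by characteristic functions: this covers degenerate families
  without a density and allows families on different spaces to be compared by
  \<open>vec_char_eq_imp_integral_eq_complex\<close>.\<close>

locale std_gauss = prob_space M for M :: "'a measure" +
  fixes X :: "'i \<Rightarrow> 'a \<Rightarrow> real" and r :: "'i \<Rightarrow> 'i \<Rightarrow> real"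
  assumes X_meas [measurable]: "\<And>i. X i \<in> borel_measurable M"
    and r_diag: "\<And>i. r i i = 1" and r_sym: "\<And>i j. r i j = r j i"
    and char_X: "\<And>F c. finite F \<Longrightarrow> expectation (\<lambda>\<omega>. cis (\<Sum>i\<in>F. c i * X i \<omega>)) =
      of_real (exp (- (\<Sum>i\<in>F. \<Sum>j\<in>F. c i * c j * r i j) / 2))"
begin

lemma distr_X: "distr M borel (X i) = std_normal_distribution"
proof (rule Levy_uniqueness)
  show "real_distribution (distr M borel (X i))" by simp
  show "real_distribution std_normal_distribution" by (rule real_dist_normal_dist)
  show "char (distr M borel (X i)) = char std_normal_distribution"
  proof
    fix t
    have "char (distr M borel (X i)) t = expectation (\<lambda>\<omega>. cis (t * X i \<omega>))"
      unfolding char_def by (subst integral_distr) (auto simp: cis_conv_exp)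
    also have "\<dots> = char std_normal_distribution t"
      using char_X[of "{i}" "\<lambda>_. t"] by (simp add: r_diag char_std_normal_distribution power2_eq_square)
    finally show "char (distr M borel (X i)) t = char std_normal_distribution t" .
  qed
qed

lemma integrable_X_iff:
  fixes f :: "real \<Rightarrow> 'b::{banach, second_countable_topology}"
  assumes "f \<in> borel_measurable borel"
  shows "integrable M (\<lambda>\<omega>. f (X i \<omega>)) \<longleftrightarrow> integrable std_normal_distribution f"
  using assms by (subst distr_X[of i, symmetric]) (simp add: integrable_distr_eq)

lemma integral_X:
  fixes f :: "real \<Rightarrow> 'b::{banach, second_countable_topology}"
  assumes "f \<in> borel_measurable borel"
  shows "expectation (\<lambda>\<omega>. f (X i \<omega>)) = (\<integral>x. f x \<partial>std_normal_distribution)"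
  using assms by (subst distr_X[of i, symmetric]) (simp add: integral_distr)

lemma integrable_growth:
  assumes "finite F"
  shows "integrable M (\<lambda>\<omega>. (1 + (\<Sum>i\<in>F. \<bar>X i \<omega>\<bar>)) ^ p)"
  using assms
proof (induction F rule: finite_induct)
  case (insert i F)
  have "integrable M (\<lambda>\<omega>. \<bar>X i \<omega>\<bar> ^ p)"
    using integrable_X_iff[of "\<lambda>x. \<bar>x\<bar> ^ p" i] integrable_std_normal_moment_abs[of p]
    by (simp add: integrable_density)
  with insert have int: "integrable M (\<lambda>\<omega>. 2 ^ p * ((1 + (\<Sum>i\<in>F. \<bar>X i \<omega>\<bar>)) ^ p + \<bar>X i \<omega>\<bar> ^ p))" by simp
  have conv: "(a + b) ^ p \<le> 2 ^ p * (a ^ p + b ^ p)" if "0 \<le> a" "0 \<le> b" for a b :: real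
  proof -
    have "(a + b) ^ p \<le> (2 * max a b) ^ p" using that by (intro power_mono) auto
    also have "\<dots> = 2 ^ p * max a b ^ p" by (simp add: power_mult_distrib)
    also have "max a b ^ p \<le> a ^ p + b ^ p" using that by (auto simp: max_def)
    finally show ?thesis by simp
  qed
  have bound: "\<bar>(1 + (\<Sum>i\<in>insert i F. \<bar>X i \<omega>\<bar>)) ^ p\<bar> \<le> 2 ^ p * ((1 + (\<Sum>i\<in>F. \<bar>X i \<omega>\<bar>)) ^ p + \<bar>X i \<omega>\<bar> ^ p)" for \<omega>
  proof -
    have "0 \<le> 1 + (\<Sum>i\<in>F. \<bar>X i \<omega>\<bar>)" using growth_base[of "\<lambda>i. X i \<omega>" F] by simp
    moreover have "1 + (\<Sum>i\<in>insert i F. \<bar>X i \<omega>\<bar>) = (1 + (\<Sum>i\<in>F. \<bar>X i \<omega>\<bar>)) + \<bar>X i \<omega>\<bar>" using insert by simp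
    ultimately show ?thesis
      using conv[of "1 + (\<Sum>i\<in>F. \<bar>X i \<omega>\<bar>)" "\<bar>X i \<omega>\<bar>"]
      by (simp add: add.assoc)
  qed
  show ?case
  proof (rule Bochner_Integration.integrable_bound[OF int])
    show "AE \<omega> in M. norm ((1 + (\<Sum>i\<in>insert i F. \<bar>X i \<omega>\<bar>)) ^ p) \<le>
        norm (2 ^ p * ((1 + (\<Sum>i\<in>F. \<bar>X i \<omega>\<bar>)) ^ p + \<bar>X i \<omega>\<bar> ^ p))"
      using bound unfolding real_norm_def by (intro AE_I2 order_trans[OF _ abs_ge_self])
  qed simp
qed simp

lemma integrable_poly_growth:
  assumes F: "finite F" and u: "continuous_on (F \<rightarrow>\<^sub>E UNIV) u" "poly_growth F u"
  shows "integrable M (\<lambda>\<omega>. u (\<lambda>i\<in>F. X i \<omega>))"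
proof -
  obtain C p where C: "\<And>x. norm (u x) \<le> C * (1 + (\<Sum>i\<in>F. \<bar>x i\<bar>)) ^ p"
    using u(2) by (auto simp: poly_growth_def)
  show ?thesis
  proof (rule Bochner_Integration.integrable_bound)
    show "integrable M (\<lambda>\<omega>. C * (1 + (\<Sum>i\<in>F. \<bar>X i \<omega>\<bar>)) ^ p)"
      by (intro integrable_mult_right integrable_growth F)
    show "(\<lambda>\<omega>. u (\<lambda>i\<in>F. X i \<omega>)) \<in> borel_measurable M"
      by (rule measurable_continuous_on_PiE_complex[OF F u(1) X_meas])
    have "norm (u (\<lambda>i\<in>F. X i \<omega>)) \<le> C * (1 + (\<Sum>i\<in>F. \<bar>X i \<omega>\<bar>)) ^ p" for \<omega>
      using C[of "\<lambda>i\<in>F. X i \<omega>"] by simp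
    then show "AE \<omega> in M. norm (u (\<lambda>i\<in>F. X i \<omega>)) \<le> norm (C * (1 + (\<Sum>i\<in>F. \<bar>X i \<omega>\<bar>)) ^ p)"
      by (intro AE_I2) (auto intro: order_trans[OF _ abs_ge_self])
  qed
qed

text \<open>\<open>X i = r n i * X n + (X i - r n i * X n)\<close>, and replacing \<open>X n\<close> by an independent copy
  \<open>\<xi>\<close> does not change the law since both parts are uncorrelated.\<close>

lemma std_gauss_resample:
  "std_gauss (std_normal_distribution \<Otimes>\<^sub>M M) (\<lambda>i (\<xi>, \<omega>). r n i * \<xi> + (X i \<omega> - r n i * X n \<omega>)) r"
proof -
  interpret N: prob_space std_normal_distribution by (rule prob_space_normal_density) simp
  interpret pair: pair_prob_space std_normal_distribution M ..
  let ?Z = "\<lambda>i (\<xi>, \<omega>). r n i * \<xi> + (X i \<omega> - r n i * X n \<omega>)"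
  have Nchar: "(\<integral>\<xi>. cis (s * \<xi>) \<partial>std_normal_distribution) = of_real (exp (- s\<^sup>2 / 2))" for s
    using fun_cong[OF char_std_normal_distribution, of s] by (simp add: char_def cis_conv_exp)
  show ?thesis
  proof (unfold_locales)
    show [measurable]: "?Z i \<in> borel_measurable (std_normal_distribution \<Otimes>\<^sub>M M)" for i
      by measurable
    show "r i i = 1" for i by (rule r_diag)
    show "r i j = r j i" for i j by (rule r_sym)
    fix F :: "'i set" and c :: "'i \<Rightarrow> real" assume F: "finite F"
    \<comment> \<open>The residuals involve \<open>X n\<close> even when \<open>n\<close> lies
      outside \<open>F\<close>; the coefficients are therefore extended by 0 to a set that contains
      \<open>n\<close>.\<close>
    define F' where "F' = insert n F"
    have F': "finite F'" "n \<in> F'" "F \<subseteq> F'" using F by (auto simp: F'_def)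
    define c0 where "c0 i = (if i \<in> F then c i else 0)" for i
    define s where "s = (\<Sum>i\<in>F. c i * r n i)"
    define c' where "c' i = c0 i - (if i = n then s else 0)" for i
    have ext: "(\<Sum>i\<in>F. c i * f i) = (\<Sum>i\<in>F'. c0 i * f i)" for f :: "'i \<Rightarrow> real"
      using F' by (intro sum.mono_neutral_cong_left) (auto simp: c0_def)
    have split: "(\<Sum>i\<in>F'. c' i * f i) = (\<Sum>i\<in>F. c i * f i) - s * f n" for f :: "'i \<Rightarrow> real"
      using F' by (simp add: c'_def ext left_diff_distrib sum_subtractf if_distrib[of "\<lambda>c. c * _"] cong: if_cong)
    \<comment> \<open>Removing the component along \<open>X n\<close> lowers the variance by
      \<open>s\<^sup>2\<close>, exactly what the independent copy puts back.\<close>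
    have Q: "(\<Sum>i\<in>F'. \<Sum>j\<in>F'. c' i * c' j * r i j) = (\<Sum>i\<in>F. \<Sum>j\<in>F. c i * c j * r i j) - s\<^sup>2"
    proof -
      have "(\<Sum>i\<in>F'. \<Sum>j\<in>F'. c' i * c' j * r i j) = (\<Sum>i\<in>F'. c' i * (\<Sum>j\<in>F'. c' j * r i j))"
        by (simp add: sum_distrib_left mult.assoc)
      also have "\<dots> = (\<Sum>i\<in>F. c i * ((\<Sum>j\<in>F. c j * r i j) - s * r i n)) - s * ((\<Sum>j\<in>F. c j * r n j) - s * r n n)"
        by (simp only: split)
      also have "\<dots> = (\<Sum>i\<in>F. c i * (\<Sum>j\<in>F. c j * r i j)) - s * (\<Sum>i\<in>F. c i * r i n) - s * (s - s)"
        by (simp add: right_diff_distrib sum_subtractf sum_distrib_left[of s] r_diag s_def[symmetric] ac_simps)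
      also have "(\<Sum>i\<in>F. c i * r i n) = s" unfolding s_def by (intro sum.cong refl) (simp add: r_sym)
      finally show ?thesis by (simp add: sum_distrib_left mult.assoc power2_eq_square)
    qed
    have "(\<Sum>i\<in>F. c i * ?Z i (\<xi>, \<omega>)) = s * \<xi> + (\<Sum>i\<in>F'. c' i * X i \<omega>)" for \<xi> \<omega>
      unfolding split by (simp add: s_def sum.distrib sum_subtractf distrib_left right_diff_distrib sum_distrib_left ac_simps)
    then have eq: "cis (\<Sum>i\<in>F. c i * ?Z i (\<xi>, \<omega>)) = cis (s * \<xi>) * cis (\<Sum>i\<in>F'. c' i * X i \<omega>)" for \<xi> \<omega>
      by (simp add: cis_mult)
    have [measurable]: "cis \<in> borel_measurable borel"
      by (intro borel_measurable_continuous_onI continuous_intros)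
    have "(\<integral>z. cis (\<Sum>i\<in>F. c i * ?Z i z) \<partial>(std_normal_distribution \<Otimes>\<^sub>M M)) =
        (\<integral>(\<xi>, \<omega>). cis (s * \<xi>) * cis (\<Sum>i\<in>F'. c' i * X i \<omega>) \<partial>(std_normal_distribution \<Otimes>\<^sub>M M))"
      using eq by (intro Bochner_Integration.integral_cong) auto
    also have "\<dots> = (\<integral>\<omega>. (\<integral>\<xi>. cis (s * \<xi>) * cis (\<Sum>i\<in>F'. c' i * X i \<omega>) \<partial>std_normal_distribution) \<partial>M)"
      by (rule pair.integral_snd[symmetric])
        (rule pair.P.integrable_const_bound[where B = 1]; auto simp: norm_mult)
    also have "\<dots> = of_real (exp (- s\<^sup>2 / 2)) * of_real (exp (- ((\<Sum>i\<in>F. \<Sum>j\<in>F. c i * c j * r i j) - s\<^sup>2) / 2))"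
      by (simp add: Nchar char_X[OF F'(1)] Q)
    also have "\<dots> = of_real (exp (- (\<Sum>i\<in>F. \<Sum>j\<in>F. c i * c j * r i j) / 2))"
      by (simp flip: of_real_mult exp_add add: field_simps)
    finally show "(\<integral>z. cis (\<Sum>i\<in>F. c i * ?Z i z) \<partial>(std_normal_distribution \<Otimes>\<^sub>M M)) =
        of_real (exp (- (\<Sum>i\<in>F. \<Sum>j\<in>F. c i * c j * r i j) / 2))" .
  qed
qed

text \<open>Once \<open>X n\<close> is replaced by an independent copy \<xi>, the vector runs along
  a line in the direction \<open>r n\<close> as \<xi> varies. One-dimensional integration by parts
  in \<xi> for each fixed \<omega>, followed by Fubini, gives the identity.\<close>

lemma gauss_integration_by_parts:
  assumes F: "finite F" "n \<in> F" and u: "tame_deriv F (r n) u u'"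
  shows "expectation (\<lambda>\<omega>. of_real (X n \<omega>) * u (\<lambda>i\<in>F. X i \<omega>)) = expectation (\<lambda>\<omega>. u' (\<lambda>i\<in>F. X i \<omega>))"
proof -
  let ?N = std_normal_distribution
  let ?P = "?N \<Otimes>\<^sub>M M"
  define Z where "Z = (\<lambda>i (\<xi>, \<omega>). r n i * \<xi> + (X i \<omega> - r n i * X n \<omega>))"
  interpret Z: std_gauss ?P Z r unfolding Z_def by (rule std_gauss_resample)
  interpret N: prob_space ?N by (rule prob_space_normal_density) simp
  interpret pair: pair_prob_space ?N M ..
  have u_cont: "continuous_on (F \<rightarrow>\<^sub>E UNIV) u" "continuous_on (F \<rightarrow>\<^sub>E UNIV) u'"
    and u_growth: "poly_growth F u" "poly_growth F u'"
    and u_deriv: "\<And>x \<xi>. ((\<lambda>\<xi>. u (\<lambda>i\<in>F. x i + \<xi> * r n i)) has_vector_derivative u' (\<lambda>i\<in>F. x i + \<xi> * r n i)) (at \<xi>)"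
    using u by (auto simp: tame_deriv_def)
  have char: "expectation (\<lambda>\<omega>. cis (\<Sum>i\<in>F. c i * X i \<omega>)) = Z.expectation (\<lambda>z. cis (\<Sum>i\<in>F. c i * Z i z))" for c
    using char_X[OF F(1)] Z.char_X[OF F(1)] by simp
  define w where "w x = complex_of_real (x n) * u x" for x
  have "hermite 1 y = y" for y using hermite_Suc[of 0 y] by simp
  then have w_growth: "poly_growth F w"
    unfolding w_def[abs_def] using poly_growth_mult[OF poly_growth_hermite[OF F, of 1] u_growth(1)] by simp
  have "continuous_on (F \<rightarrow>\<^sub>E UNIV) (\<lambda>x::'i \<Rightarrow> real. x n)"
    using continuous_on_product_coordinates[of n] continuous_on_subset by blast
  then have w_cont: "continuous_on (F \<rightarrow>\<^sub>E UNIV) w" unfolding w_def[abs_def] by (intro continuous_intros u_cont)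
  have transfer: "expectation (\<lambda>\<omega>. f (\<lambda>i\<in>F. X i \<omega>)) = Z.expectation (\<lambda>z. f (\<lambda>i\<in>F. Z i z))"
    if "continuous_on (F \<rightarrow>\<^sub>E UNIV) f" "poly_growth F f" for f
    by (rule vec_char_eq_imp_integral_eq_complex[OF prob_space_axioms Z.prob_space_axioms F(1) X_meas Z.X_meas char that(1)
        integrable_poly_growth[OF F(1) that] Z.integrable_poly_growth[OF F(1) that]])
  have fubini: "Z.expectation (\<lambda>z. f (\<lambda>i\<in>F. Z i z)) = (\<integral>\<omega>. (\<integral>\<xi>. f (\<lambda>i\<in>F. Z i (\<xi>, \<omega>)) \<partial>?N) \<partial>M)"
    if "continuous_on (F \<rightarrow>\<^sub>E UNIV) f" "poly_growth F f" for f
  proof -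
    have eq: "(\<lambda>(\<xi>, \<omega>). f (\<lambda>i\<in>F. Z i (\<xi>, \<omega>))) = (\<lambda>z. f (\<lambda>i\<in>F. Z i z))" by auto
    show ?thesis
      using pair.integral_snd[of "\<lambda>\<xi> \<omega>. f (\<lambda>i\<in>F. Z i (\<xi>, \<omega>))"]
        Z.integrable_poly_growth[OF F(1) that] unfolding eq by simp
  qed
  have "(\<integral>\<xi>. w (\<lambda>i\<in>F. Z i (\<xi>, \<omega>)) \<partial>?N) = (\<integral>\<xi>. u' (\<lambda>i\<in>F. Z i (\<xi>, \<omega>)) \<partial>?N)" for \<omega>
  proof -
    define R where "R i = X i \<omega> - r n i * X n \<omega>" for i
    obtain C p where C: "0 \<le> C" "\<And>x. norm (u x) \<le> C * (1 + (\<Sum>i\<in>F. \<bar>x i\<bar>)) ^ p"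
      "\<And>x. norm (u' x) \<le> C * (1 + (\<Sum>i\<in>F. \<bar>x i\<bar>)) ^ p"
      using poly_growth_common[OF u_growth] by blast
    define K where "K = 1 + (\<Sum>i\<in>F. \<bar>R i\<bar>) + (\<Sum>i\<in>F. \<bar>r n i\<bar>)"
    have line: "C * (1 + (\<Sum>i\<in>F. \<bar>(\<lambda>i\<in>F. R i + \<xi> * r n i) i\<bar>)) ^ p \<le> (C * K ^ p) * (1 + \<bar>\<xi>\<bar>) ^ p" for \<xi>
    proof -
      have "(\<Sum>i\<in>F. \<bar>(\<lambda>i\<in>F. R i + \<xi> * r n i) i\<bar>) \<le> (\<Sum>i\<in>F. \<bar>R i\<bar> + \<bar>\<xi>\<bar> * \<bar>r n i\<bar>)"
        by (intro sum_mono) (auto simp: abs_mult intro: order_trans[OF abs_triangle_ineq])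
      also have "\<dots> = (\<Sum>i\<in>F. \<bar>R i\<bar>) + \<bar>\<xi>\<bar> * (\<Sum>i\<in>F. \<bar>r n i\<bar>)"
        by (simp add: sum.distrib sum_distrib_left)
      finally have "1 + (\<Sum>i\<in>F. \<bar>(\<lambda>i\<in>F. R i + \<xi> * r n i) i\<bar>) \<le> K * (1 + \<bar>\<xi>\<bar>)"
      proof -
        assume "(\<Sum>i\<in>F. \<bar>(\<lambda>i\<in>F. R i + \<xi> * r n i) i\<bar>) \<le> (\<Sum>i\<in>F. \<bar>R i\<bar>) + \<bar>\<xi>\<bar> * (\<Sum>i\<in>F. \<bar>r n i\<bar>)"
        moreover have "0 \<le> (\<Sum>i\<in>F. \<bar>r n i\<bar>)" by (simp add: sum_nonneg)
        moreover have "0 \<le> \<bar>\<xi>\<bar> * (\<Sum>i\<in>F. \<bar>R i\<bar>)" by (simp add: sum_nonneg)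
        moreover have "0 \<le> \<bar>\<xi>\<bar>" by simp
        ultimately show ?thesis unfolding K_def by (simp only: distrib_left distrib_right mult_1_left mult_1_right
              mult.commute[of _ "\<bar>\<xi>\<bar>"])
      qed
      then have "(1 + (\<Sum>i\<in>F. \<bar>(\<lambda>i\<in>F. R i + \<xi> * r n i) i\<bar>)) ^ p \<le> (K * (1 + \<bar>\<xi>\<bar>)) ^ p"
        by (intro power_mono) (auto simp: sum_nonneg add_nonneg_nonneg)
      then show ?thesis using C(1) by (simp add: power_mult_distrib mult_left_mono mult.assoc)
    qed
    have Zeq: "(\<lambda>i\<in>F. Z i (\<xi>, \<omega>)) = (\<lambda>i\<in>F. R i + \<xi> * r n i)" for \<xi>
      by (auto simp: Z_def R_def fun_eq_iff)
    \<comment> \<open>The residual of \<open>X n\<close> itself is 0, so on each line the coordinate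
      \<open>n\<close> equals \<xi>, the factor required by the one-dimensional formula.\<close>
    have Rn: "R n = 0" by (simp add: R_def r_diag)
    have "(\<integral>\<xi>. \<xi> *\<^sub>R u (\<lambda>i\<in>F. R i + \<xi> * r n i) \<partial>?N) = (\<integral>\<xi>. u' (\<lambda>i\<in>F. R i + \<xi> * r n i) \<partial>?N)"
    proof (rule std_normal_integration_by_parts(3)[OF u_deriv])
      show "continuous_on UNIV (\<lambda>\<xi>. u' (\<lambda>i\<in>F. R i + \<xi> * r n i))"
      proof (rule continuous_on_compose2[OF u_cont(2)])
        show "continuous_on UNIV (\<lambda>\<xi>. \<lambda>i\<in>F. R i + \<xi> * r n i)"
        proof (rule continuous_on_coordinatewise_then_product)
          show "continuous_on UNIV (\<lambda>\<xi>. (\<lambda>i\<in>F. R i + \<xi> * r n i) i)" for i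
            by (cases "i \<in> F") (auto intro!: continuous_intros)
        qed
      qed auto
      show "norm (u (\<lambda>i\<in>F. R i + \<xi> * r n i)) \<le> (C * K ^ p) * (1 + \<bar>\<xi>\<bar>) ^ p" for \<xi>
        by (rule order_trans[OF C(2) line])
      show "norm (u' (\<lambda>i\<in>F. R i + \<xi> * r n i)) \<le> (C * K ^ p) * (1 + \<bar>\<xi>\<bar>) ^ p" for \<xi>
        by (rule order_trans[OF C(3) line])
    qed
    then show ?thesis
      unfolding Zeq w_def using F(2) by (simp add: Rn r_diag scaleR_conv_of_real)
  qed
  then have "Z.expectation (\<lambda>z. w (\<lambda>i\<in>F. Z i z)) = Z.expectation (\<lambda>z. u' (\<lambda>i\<in>F. Z i z))"
    unfolding fubini[OF w_cont w_growth] fubini[OF u_cont(2) u_growth(2)] by simp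
  then have "expectation (\<lambda>\<omega>. w (\<lambda>i\<in>F. X i \<omega>)) = expectation (\<lambda>\<omega>. u' (\<lambda>i\<in>F. X i \<omega>))"
    using transfer[OF w_cont w_growth] transfer[OF u_cont(2) u_growth(2)] by simp
  then show ?thesis unfolding w_def using F(2) by simp
qed

text \<open>Integration by parts is applied to \<open>hermite m (X n)\<close> times
  \<open>u\<close>. The derivative of the Hermite factor is the lower term of the three-term
  recursion and cancels against it.\<close>

lemma hermite_integration_by_parts:
  assumes F: "finite F" "n \<in> F" and u: "tame_deriv F (r n) u u'"
  shows "expectation (\<lambda>\<omega>. of_real (hermite (Suc m) (X n \<omega>)) * u (\<lambda>i\<in>F. X i \<omega>)) =
    expectation (\<lambda>\<omega>. of_real (hermite m (X n \<omega>)) * u' (\<lambda>i\<in>F. X i \<omega>))"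
proof -
  let ?H = "\<lambda>m x. complex_of_real (hermite m (x n))"
  let ?V = "\<lambda>\<omega>. \<lambda>i\<in>F. X i \<omega>"
  have H: "tame_deriv F (r n) (?H m) (\<lambda>x. of_real (real m) * ?H (m - 1) x)"
    using tame_deriv_hermite[OF F, of "r n" m] by (simp add: r_diag)
  have Hu: "tame_deriv F (r n) (\<lambda>x. ?H m x * u x) (\<lambda>x. ?H m x * u' x + of_real (real m) * ?H (m - 1) x * u x)"
    using tame_deriv_mult[OF H u] by simp
  have int: "integrable M (\<lambda>\<omega>. f (?V \<omega>))" if "tame_deriv F (r n) f f'" for f f'
    using that by (intro integrable_poly_growth F) (auto simp: tame_deriv_def)
  have H0: "tame_deriv F (r n) (?H l) (\<lambda>x. of_real (r n n * (real l * hermite (l - 1) (x n))))" for l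
    by (rule tame_deriv_hermite[OF F])
  have int1: "integrable M (\<lambda>\<omega>. ?H l (?V \<omega>) * u (?V \<omega>))" for l
    by (rule int[OF tame_deriv_mult[OF H0 u]])
  have int2: "integrable M (\<lambda>\<omega>. ?H m (?V \<omega>) * u' (?V \<omega>))"
  proof (rule integrable_poly_growth[OF F(1)])
    show "continuous_on (F \<rightarrow>\<^sub>E UNIV) (\<lambda>x. ?H m x * u' x)"
      using H u unfolding tame_deriv_def by (intro continuous_on_mult) auto
    show "poly_growth F (\<lambda>x. ?H m x * u' x)"
      using H u unfolding tame_deriv_def by (intro poly_growth_mult) auto
  qed
  have "expectation (\<lambda>\<omega>. of_real (X n \<omega>) * (?H m (?V \<omega>) * u (?V \<omega>))) =
      expectation (\<lambda>\<omega>. ?H m (?V \<omega>) * u' (?V \<omega>) + of_real (real m) * ?H (m - 1) (?V \<omega>) * u (?V \<omega>))"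
    by (rule gauss_integration_by_parts[OF F Hu])
  also have "\<dots> = expectation (\<lambda>\<omega>. ?H m (?V \<omega>) * u' (?V \<omega>)) +
      of_real (real m) * expectation (\<lambda>\<omega>. ?H (m - 1) (?V \<omega>) * u (?V \<omega>))"
    using int2 int1[of "m - 1"] by (subst Bochner_Integration.integral_add) (simp_all add: mult.assoc)
  finally have eq: "expectation (\<lambda>\<omega>. of_real (X n \<omega>) * (?H m (?V \<omega>) * u (?V \<omega>))) =
      expectation (\<lambda>\<omega>. ?H m (?V \<omega>) * u' (?V \<omega>)) +
      of_real (real m) * expectation (\<lambda>\<omega>. ?H (m - 1) (?V \<omega>) * u (?V \<omega>))" .
  have "expectation (\<lambda>\<omega>. of_real (X n \<omega>) * (?H m (?V \<omega>) * u (?V \<omega>))) =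
      expectation (\<lambda>\<omega>. ?H (Suc m) (?V \<omega>) * u (?V \<omega>) + of_real (real m) * (?H (m - 1) (?V \<omega>) * u (?V \<omega>)))"
    using F(2) by (intro Bochner_Integration.integral_cong) (auto simp: hermite_Suc algebra_simps)
  also have "\<dots> = expectation (\<lambda>\<omega>. ?H (Suc m) (?V \<omega>) * u (?V \<omega>)) +
      of_real (real m) * expectation (\<lambda>\<omega>. ?H (m - 1) (?V \<omega>) * u (?V \<omega>))"
    using int1[of "Suc m"] int1[of "m - 1"] by (subst Bochner_Integration.integral_add) simp_all
  finally have "expectation (\<lambda>\<omega>. ?H (Suc m) (?V \<omega>) * u (?V \<omega>)) = expectation (\<lambda>\<omega>. ?H m (?V \<omega>) * u' (?V \<omega>))"
    using eq by simp
  then show ?thesis using F(2) by simp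
qed

text \<open>Degree 0 in a slot contributes the factor 1, so two-point moments are the case
  \<open>c = d = 0\<close>, with any index in the remaining slots.\<close>

definition hmom :: "nat \<Rightarrow> 'i \<Rightarrow> nat \<Rightarrow> 'i \<Rightarrow> nat \<Rightarrow> 'i \<Rightarrow> nat \<Rightarrow> 'i \<Rightarrow> real" where
  "hmom a i b j c k d l = expectation (\<lambda>\<omega>. hermite a (X i \<omega>) * (hermite b (X j \<omega>) * (hermite c (X k \<omega>) * hermite d (X l \<omega>))))"

lemma integrable_hermite4:
  "integrable M (\<lambda>\<omega>. hermite a (X i \<omega>) * (hermite b (X j \<omega>) * (hermite c (X k \<omega>) * hermite d (X l \<omega>))))"
proof -
  let ?F = "{i, j, k, l}"
  let ?H = "\<lambda>m i x. complex_of_real (hermite m (x i))"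
  have H: "tame_deriv ?F (r i) (?H m p) (\<lambda>x. of_real (r i p * (real m * hermite (m - 1) (x p))))"
    if "p \<in> ?F" for m p
    using that by (intro tame_deriv_hermite) auto
  have "tame_deriv ?F (r i) (\<lambda>x. ?H a i x * (?H b j x * (?H c k x * ?H d l x)))
    (\<lambda>x. ?H a i x * (?H b j x * (?H c k x * of_real (r i l * (real d * hermite (d - 1) (x l))) +
        of_real (r i k * (real c * hermite (c - 1) (x k))) * ?H d l x) +
        of_real (r i j * (real b * hermite (b - 1) (x j))) * (?H c k x * ?H d l x)) +
        of_real (r i i * (real a * hermite (a - 1) (x i))) * (?H b j x * (?H c k x * ?H d l x)))"
    by (intro tame_deriv_mult H) auto
  then have "integrable M (\<lambda>\<omega>. (\<lambda>x. ?H a i x * (?H b j x * (?H c k x * ?H d l x))) (\<lambda>p\<in>?F. X p \<omega>))"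
    by (intro integrable_poly_growth) (auto simp: tame_deriv_def)
  then have "integrable M (\<lambda>\<omega>. complex_of_real (hermite a (X i \<omega>) * (hermite b (X j \<omega>) * (hermite c (X k \<omega>) * hermite d (X l \<omega>)))))"
    by simp
  from integrable_Re[OF this] show ?thesis by simp
qed

text \<open>One integration by parts removes an edge that leaves \<open>i\<close> and ends at one of
  the other three vertices; iterating it generates the expansion over multigraphs. A slot of degree
  0 drops out through its own factor, so truncated subtraction does no harm.\<close>

lemma hmom_Suc:
  "hmom (Suc a) i b j c k d l = real b * r i j * hmom a i (b - 1) j c k d l +
    real c * r i k * hmom a i b j (c - 1) k d l + real d * r i l * hmom a i b j c k (d - 1) l"
proof -
  let ?F = "{i, j, k, l}"
  let ?H = "\<lambda>m i x. complex_of_real (hermite m (x i))"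
  have H: "tame_deriv ?F (r i) (?H m p) (\<lambda>x. of_real (r i p * (real m * hermite (m - 1) (x p))))"
    if "p \<in> ?F" for m p
    using that by (intro tame_deriv_hermite) auto
  have t: "tame_deriv ?F (r i) (\<lambda>x. ?H b j x * (?H c k x * ?H d l x))
    (\<lambda>x. ?H b j x * (?H c k x * of_real (r i l * (real d * hermite (d - 1) (x l))) +
        of_real (r i k * (real c * hermite (c - 1) (x k))) * ?H d l x) +
        of_real (r i j * (real b * hermite (b - 1) (x j))) * (?H c k x * ?H d l x))"
    by (intro tame_deriv_mult H) auto
  have "complex_of_real (hmom (Suc a) i b j c k d l) =
      expectation (\<lambda>\<omega>. complex_of_real (hermite (Suc a) (X i \<omega>)) * (\<lambda>x. ?H b j x * (?H c k x * ?H d l x)) (\<lambda>p\<in>?F. X p \<omega>))"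
    unfolding hmom_def by (subst integral_complex_of_real[symmetric]) simp
  also have "\<dots> = expectation (\<lambda>\<omega>. complex_of_real (
      real b * r i j * (hermite a (X i \<omega>) * (hermite (b - 1) (X j \<omega>) * (hermite c (X k \<omega>) * hermite d (X l \<omega>)))) +
      real c * r i k * (hermite a (X i \<omega>) * (hermite b (X j \<omega>) * (hermite (c - 1) (X k \<omega>) * hermite d (X l \<omega>)))) +
      real d * r i l * (hermite a (X i \<omega>) * (hermite b (X j \<omega>) * (hermite c (X k \<omega>) * hermite (d - 1) (X l \<omega>))))))"
    by (subst hermite_integration_by_parts[OF _ _ t]) (auto simp: algebra_simps)
  also have "\<dots> = complex_of_real (real b * r i j * hmom a i (b - 1) j c k d l +
    real c * r i k * hmom a i b j (c - 1) k d l + real d * r i l * hmom a i b j c k (d - 1) l)"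
    unfolding integral_complex_of_real hmom_def using integrable_hermite4 by simp
  finally show ?thesis by (simp only: of_real_eq_iff)
qed

lemma hmom_rotate: "hmom a i b j c k d l = hmom b j c k d l a i"
  unfolding hmom_def by (simp add: ac_simps)

lemma hmom_swap: "hmom a i b j c k d l = hmom c k d l a i b j"
  by (metis hmom_rotate)

lemma hmom_0 [simp]: "hmom 0 i 0 j 0 k 0 l = 1"
  by (simp add: hmom_def prob_space)

lemma hmom2: "hmom a i b j 0 k 0 l = (if a = b then fact a * r i j ^ a else 0)"
proof (induction a arbitrary: b)
  case 0
  then show ?case
    by (cases b) (simp_all add: hmom_rotate[of 0 i] hmom_Suc)
next
  case (Suc a)
  show ?case by (cases b) (simp_all add: hmom_Suc Suc.IH)
qed

lemma expectation_hermite2: "expectation (\<lambda>\<omega>. hermite a (X i \<omega>) * hermite b (X j \<omega>)) = (if a = b then fact a * r i j ^ a else 0)"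
  using hmom2[of a i b j undefined undefined] by (simp add: hmom_def)

section \<open>Square-integrable functions of the Gaussian variables\<close>

lemma L2_X:
  assumes "G \<in> L2_gauss"
  shows "(\<lambda>\<omega>. G (X i \<omega>)) \<in> borel_measurable M" "integrable M (\<lambda>\<omega>. (G (X i \<omega>))\<^sup>2)"
    "expectation (\<lambda>\<omega>. (G (X i \<omega>))\<^sup>2) = (\<integral>x. (G x)\<^sup>2 \<partial>std_normal_distribution)"
proof -
  have [measurable]: "G \<in> borel_measurable borel" by (rule L2_gaussD(1)[OF assms])
  show "(\<lambda>\<omega>. G (X i \<omega>)) \<in> borel_measurable M" by simp
  show "integrable M (\<lambda>\<omega>. (G (X i \<omega>))\<^sup>2)"
    using integrable_X_iff[of "\<lambda>x. (G x)\<^sup>2" i] L2_gaussD(2)[OF assms] by simp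
  show "expectation (\<lambda>\<omega>. (G (X i \<omega>))\<^sup>2) = (\<integral>x. (G x)\<^sup>2 \<partial>std_normal_distribution)"
    using integral_X[of "\<lambda>x. (G x)\<^sup>2" i] by simp
qed

lemma L2_X_mult:
  assumes "G \<in> L2_gauss" "H \<in> L2_gauss"
  shows "integrable M (\<lambda>\<omega>. G (X i \<omega>) * H (X j \<omega>))"
    "\<bar>expectation (\<lambda>\<omega>. G (X i \<omega>) * H (X j \<omega>))\<bar> \<le>
      sqrt (\<integral>x. (G x)\<^sup>2 \<partial>std_normal_distribution) * sqrt (\<integral>x. (H x)\<^sup>2 \<partial>std_normal_distribution)"
  using integral_Cauchy_Schwarz[OF L2_X(1)[OF assms(1), of i] L2_X(1)[OF assms(2), of j]
      L2_X(2)[OF assms(1), of i] L2_X(2)[OF assms(2), of j]] L2_X(3)[OF assms(1), of i] L2_X(3)[OF assms(2), of j]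
  by simp_all

text \<open>For truncated expansions only equal degrees survive, each with a power of the
  correlation. Truncating both factors produces three error terms, and Cauchy-Schwarz bounds each of
  them by a remainder in mean square.\<close>

lemma expectation_L2_sums:
  assumes G: "G \<in> L2_gauss" and H: "H \<in> L2_gauss"
  shows "(\<lambda>m. hermite_coeff G m * hermite_coeff H m * fact m * r i j ^ m) sums
    expectation (\<lambda>\<omega>. G (X i \<omega>) * H (X j \<omega>))"
proof -
  let ?n = "\<lambda>G. sqrt (\<integral>x. (G x)\<^sup>2 \<partial>std_normal_distribution)"
  let ?E = "\<lambda>G H. expectation (\<lambda>\<omega>. G (X i \<omega>) * H (X j \<omega>))"
  have PG: "hermite_partial G Q \<in> L2_gauss" "hermite_partial H Q \<in> L2_gauss" for Q
    by (rule hermite_partial_L2)+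
  have DG: "(\<lambda>x. G x - hermite_partial G Q x) \<in> L2_gauss" "(\<lambda>x. H x - hermite_partial H Q x) \<in> L2_gauss" for Q
    by (intro L2_gauss_diff G H PG)+
  have partial: "?E (hermite_partial G Q) (hermite_partial H Q) =
      (\<Sum>m\<le>Q. hermite_coeff G m * hermite_coeff H m * fact m * r i j ^ m)" for Q
  proof -
    have "?E (hermite_partial G Q) (hermite_partial H Q) =
        expectation (\<lambda>\<omega>. \<Sum>m\<le>Q. \<Sum>l\<le>Q. hermite_coeff G m * hermite_coeff H l * (hermite m (X i \<omega>) * hermite l (X j \<omega>)))"
      unfolding hermite_partial_def sum_product by (simp add: ac_simps)
    also have "\<dots> = (\<Sum>m\<le>Q. \<Sum>l\<le>Q. hermite_coeff G m * hermite_coeff H l * ?E (hermite m) (hermite l))"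
      using L2_X_mult(1)[OF hermite_L2 hermite_L2] by simp
    also have "\<dots> = (\<Sum>m\<le>Q. \<Sum>l\<le>Q. if m = l then hermite_coeff G m * hermite_coeff H l * (fact m * r i j ^ m) else 0)"
      by (intro sum.cong refl) (simp add: expectation_hermite2)
    also have "\<dots> = (\<Sum>m\<le>Q. hermite_coeff G m * hermite_coeff H m * fact m * r i j ^ m)"
      by (intro sum.cong refl) (simp add: ac_simps)
    finally show ?thesis .
  qed
  have nG: "(\<lambda>Q. ?n (\<lambda>x. G x - hermite_partial G Q x)) \<longlonglongrightarrow> 0"
    using tendsto_real_sqrt[OF hermite_complete[OF G]] by simp
  have nH: "(\<lambda>Q. ?n (\<lambda>x. H x - hermite_partial H Q x)) \<longlonglongrightarrow> 0"
    using tendsto_real_sqrt[OF hermite_complete[OF H]] by simp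
  have "(\<lambda>Q. ?E (hermite_partial G Q) (hermite_partial H Q) - ?E G H) \<longlonglongrightarrow> 0"
  proof (rule Lim_null_comparison)
    show "(\<lambda>Q. ?n (\<lambda>x. G x - hermite_partial G Q x) * ?n H + ?n G * ?n (\<lambda>x. H x - hermite_partial H Q x) +
        ?n (\<lambda>x. G x - hermite_partial G Q x) * ?n (\<lambda>x. H x - hermite_partial H Q x)) \<longlonglongrightarrow> 0"
      by (rule tendsto_eq_intros nG nH refl)+ simp
    show "\<forall>\<^sub>F Q in sequentially. norm (?E (hermite_partial G Q) (hermite_partial H Q) - ?E G H) \<le>
        ?n (\<lambda>x. G x - hermite_partial G Q x) * ?n H + ?n G * ?n (\<lambda>x. H x - hermite_partial H Q x) +
        ?n (\<lambda>x. G x - hermite_partial G Q x) * ?n (\<lambda>x. H x - hermite_partial H Q x)"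
    proof (intro always_eventually allI)
      fix Q
      let ?dG = "\<lambda>x. G x - hermite_partial G Q x" and ?dH = "\<lambda>x. H x - hermite_partial H Q x"
      have "?E (hermite_partial G Q) (hermite_partial H Q) =
          expectation (\<lambda>\<omega>. G (X i \<omega>) * H (X j \<omega>) - ?dG (X i \<omega>) * H (X j \<omega>) - G (X i \<omega>) * ?dH (X j \<omega>)
            + ?dG (X i \<omega>) * ?dH (X j \<omega>))"
        by (intro Bochner_Integration.integral_cong) (auto simp: algebra_simps)
      also have "\<dots> = ?E G H - ?E ?dG H - ?E G ?dH + ?E ?dG ?dH"
        using L2_X_mult(1)[OF G H] L2_X_mult(1)[OF DG(1) H] L2_X_mult(1)[OF G DG(2)] L2_X_mult(1)[OF DG(1) DG(2)]
        by (simp del: integrable_diff)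
      finally have "norm (?E (hermite_partial G Q) (hermite_partial H Q) - ?E G H) \<le> \<bar>?E ?dG H\<bar> + \<bar>?E G ?dH\<bar> + \<bar>?E ?dG ?dH\<bar>"
        unfolding real_norm_def by linarith
      also have "\<dots> \<le> ?n ?dG * ?n H + ?n G * ?n ?dH + ?n ?dG * ?n ?dH"
        by (intro add_mono L2_X_mult(2) G H DG)
      finally show "norm (?E (hermite_partial G Q) (hermite_partial H Q) - ?E G H) \<le>
          ?n ?dG * ?n H + ?n G * ?n ?dH + ?n ?dG * ?n ?dH" .
    qed
  qed
  then show ?thesis
    unfolding sums_def_le partial[symmetric] by (rule LIM_zero_cancel)
qed

end

section \<open>Covariances of products of two Hermite polynomials\<close>

text \<open>Multigraphs on four vertices with vertex degrees \<open>a, b, c, d\<close>, given by the edge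
  multiplicities \<open>(e12, e13, e14, e23, e24, e34)\<close>; the flag asks for an edge between
  \<open>{1, 2}\<close> and \<open>{3, 4}\<close>.\<close>

definition graphs4 :: "bool \<Rightarrow> nat \<Rightarrow> nat \<Rightarrow> nat \<Rightarrow> nat \<Rightarrow> (nat \<times> nat \<times> nat \<times> nat \<times> nat \<times> nat) set" where
  "graphs4 cross a b c d = {(e12, e13, e14, e23, e24, e34).
     e12 + e13 + e14 = a \<and> e12 + e23 + e24 = b \<and> e13 + e23 + e34 = c \<and> e14 + e24 + e34 = d \<and>
     (cross \<longrightarrow> 0 < e13 + e14 + e23 + e24)}"

lemma graphs4_iff [simp]:
  "(e12, e13, e14, e23, e24, e34) \<in> graphs4 cross a b c d \<longleftrightarrow>
     e12 + e13 + e14 = a \<and> e12 + e23 + e24 = b \<and> e13 + e23 + e34 = c \<and> e14 + e24 + e34 = d \<and>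
     (cross \<longrightarrow> 0 < e13 + e14 + e23 + e24)"
  by (simp add: graphs4_def)

lemma finite_graphs4 [simp]: "finite (graphs4 cross a b c d)"
proof (rule finite_subset)
  show "graphs4 cross a b c d \<subseteq> {..a} \<times> {..a} \<times> {..a} \<times> {..b} \<times> {..b} \<times> {..c}"
    by (rule subrelI | clarsimp)+
qed simp

context std_gauss
begin

definition gweight :: "'i \<Rightarrow> 'i \<Rightarrow> 'i \<Rightarrow> 'i \<Rightarrow> nat \<times> nat \<times> nat \<times> nat \<times> nat \<times> nat \<Rightarrow> real" where
  "gweight i j k l = (\<lambda>(e12, e13, e14, e23, e24, e34).
     \<bar>r i j\<bar> ^ e12 * \<bar>r i k\<bar> ^ e13 * \<bar>r i l\<bar> ^ e14 * \<bar>r j k\<bar> ^ e23 * \<bar>r j l\<bar> ^ e24 * \<bar>r k l\<bar> ^ e34)"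

definition gsum :: "bool \<Rightarrow> nat \<Rightarrow> 'i \<Rightarrow> nat \<Rightarrow> 'i \<Rightarrow> nat \<Rightarrow> 'i \<Rightarrow> nat \<Rightarrow> 'i \<Rightarrow> real" where
  "gsum cross a i b j c k d l = (\<Sum>e\<in>graphs4 cross a b c d. gweight i j k l e)"

lemma gweight_nonneg: "0 \<le> gweight i j k l e"
  by (cases e) (simp add: gweight_def)

lemma gsum_nonneg: "0 \<le> gsum cross a i b j c k d l"
  unfolding gsum_def by (intro sum_nonneg gweight_nonneg)

text \<open>Adding an edge is an injection between sets of graphs that multiplies each weight by the
  correlation of that edge. The weights on the left thus reappear on the right, and the additional
  ones are nonnegative.\<close>

lemma gsum_step:
  assumes "inj f" "\<And>e. e \<in> graphs4 x a b c d \<Longrightarrow> f e \<in> graphs4 x' a' b' c' d'"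
    "\<And>e. gweight i j k l (f e) = \<rho> * gweight i j k l e"
  shows "\<rho> * gsum x a i b j c k d l \<le> gsum x' a' i b' j c' k d' l"
proof -
  have "\<rho> * gsum x a i b j c k d l = (\<Sum>e\<in>graphs4 x a b c d. gweight i j k l (f e))"
    by (simp add: gsum_def sum_distrib_left assms(3))
  also have "\<dots> = (\<Sum>e\<in>f ` graphs4 x a b c d. gweight i j k l e)"
    using assms(1) by (subst sum.reindex) (auto intro: inj_on_subset)
  also have "\<dots> \<le> gsum x' a' i b' j c' k d' l"
    unfolding gsum_def using assms(2) by (intro sum_mono2) (auto intro: gweight_nonneg)
  finally show ?thesis .
qed

lemma gsum_edge12: "\<bar>r i j\<bar> * gsum x a i b j c k d l \<le> gsum x (Suc a) i (Suc b) j c k d l"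
  by (rule gsum_step[where f = "\<lambda>(e12, e13, e14, e23, e24, e34). (Suc e12, e13, e14, e23, e24, e34)"])
    (auto simp: gweight_def split_paired_all intro!: injI)

text \<open>An edge between the two pairs satisfies the flag by itself, so the smaller graph is
  unrestricted here and in the next three lemmas; an edge inside a pair, as in
  \<open>gsum_edge12\<close>, can only preserve the flag.\<close>

lemma gsum_edge13: "\<bar>r i k\<bar> * gsum False a i b j c k d l \<le> gsum x (Suc a) i b j (Suc c) k d l"
  by (rule gsum_step[where f = "\<lambda>(e12, e13, e14, e23, e24, e34). (e12, Suc e13, e14, e23, e24, e34)"])
    (auto simp: gweight_def split_paired_all intro!: injI)

lemma gsum_edge14: "\<bar>r i l\<bar> * gsum False a i b j c k d l \<le> gsum x (Suc a) i b j c k (Suc d) l"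
  by (rule gsum_step[where f = "\<lambda>(e12, e13, e14, e23, e24, e34). (e12, e13, Suc e14, e23, e24, e34)"])
    (auto simp: gweight_def split_paired_all intro!: injI)

lemma gsum_edge23: "\<bar>r j k\<bar> * gsum False a i b j c k d l \<le> gsum x a i (Suc b) j (Suc c) k d l"
  by (rule gsum_step[where f = "\<lambda>(e12, e13, e14, e23, e24, e34). (e12, e13, e14, Suc e23, e24, e34)"])
    (auto simp: gweight_def split_paired_all intro!: injI)

lemma gsum_edge24: "\<bar>r j l\<bar> * gsum False a i b j c k d l \<le> gsum x a i (Suc b) j c k (Suc d) l"
  by (rule gsum_step[where f = "\<lambda>(e12, e13, e14, e23, e24, e34). (e12, e13, e14, e23, Suc e24, e34)"])
    (auto simp: gweight_def split_paired_all intro!: injI)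

lemma hmom_Suc2:
  "hmom 0 i (Suc b) j c k d l = real c * r j k * hmom 0 i b j (c - 1) k d l + real d * r j l * hmom 0 i b j c k (d - 1) l"
  unfolding hmom_rotate[of 0 i] hmom_Suc by simp

lemma edge_term_bound:
  fixes h S :: real
  assumes "0 < n \<Longrightarrow> \<bar>h\<bar> \<le> C * S" "0 < n \<Longrightarrow> \<bar>\<rho>\<bar> * S \<le> S'" "0 \<le> C" "0 \<le> S'"
  shows "\<bar>real n * \<rho> * h\<bar> \<le> real n * C * S'"
proof (cases "n = 0")
  case False
  have "\<bar>\<rho>\<bar> * \<bar>h\<bar> \<le> \<bar>\<rho>\<bar> * (C * S)" using False assms(1) by (intro mult_left_mono) auto
  also have "\<dots> = C * (\<bar>\<rho>\<bar> * S)" by simp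
  also have "\<dots> \<le> C * S'" using False assms by (intro mult_left_mono) auto
  finally have "real n * (\<bar>\<rho>\<bar> * \<bar>h\<bar>) \<le> real n * (C * S')" by (intro mult_left_mono) auto
  then show ?thesis by (simp add: abs_mult mult.assoc)
qed simp

text \<open>Induction on the total degree, removing an edge at vertex 1, or at vertex 2 once vertex
  1 is bare. When both are bare only copies of the edge 34 remain. The constant depends on the
  degrees alone, not on the indices.\<close>

lemma hmom_bound: "\<exists>C\<ge>0. \<forall>i j k l. \<bar>hmom a i b j c k d l\<bar> \<le> C * gsum False a i b j c k d l"
proof (induction "a + b + c + d" arbitrary: a b c d rule: less_induct)
  case less
  consider a' where "a = Suc a'" | b' where "a = 0" "b = Suc b'" | "a = 0" "b = 0" by (cases a; cases b) auto
  then show ?case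
  proof cases
    case 1
    obtain C1 where C1: "0 \<le> C1" "\<And>i j k l. \<bar>hmom a' i (b - 1) j c k d l\<bar> \<le> C1 * gsum False a' i (b - 1) j c k d l"
    proof -
      have "a' + (b - 1) + c + d < a + b + c + d" using 1 by simp
      from less[OF this] show ?thesis using that by blast
    qed
    obtain C2 where C2: "0 \<le> C2" "\<And>i j k l. \<bar>hmom a' i b j (c - 1) k d l\<bar> \<le> C2 * gsum False a' i b j (c - 1) k d l"
    proof -
      have "a' + b + (c - 1) + d < a + b + c + d" using 1 by simp
      from less[OF this] show ?thesis using that by blast
    qed
    obtain C3 where C3: "0 \<le> C3" "\<And>i j k l. \<bar>hmom a' i b j c k (d - 1) l\<bar> \<le> C3 * gsum False a' i b j c k (d - 1) l"
    proof -
      have "a' + b + c + (d - 1) < a + b + c + d" using 1 by simp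
      from less[OF this] show ?thesis using that by blast
    qed
    show ?thesis
    proof (intro exI[of _ "real b * C1 + real c * C2 + real d * C3"] conjI allI)
      fix i j k l
      let ?S = "gsum False a i b j c k d l"
      have "\<bar>real b * r i j * hmom a' i (b - 1) j c k d l\<bar> \<le> real b * C1 * ?S"
        by (rule edge_term_bound[OF C1(2) _ C1(1) gsum_nonneg])
          (use gsum_edge12[of i j False a' "b - 1" c k d l] 1 in simp)
      moreover have "\<bar>real c * r i k * hmom a' i b j (c - 1) k d l\<bar> \<le> real c * C2 * ?S"
        by (rule edge_term_bound[OF C2(2) _ C2(1) gsum_nonneg])
          (use gsum_edge13[of i k a' b j "c - 1" d l False] 1 in simp)
      moreover have "\<bar>real d * r i l * hmom a' i b j c k (d - 1) l\<bar> \<le> real d * C3 * ?S"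
        by (rule edge_term_bound[OF C3(2) _ C3(1) gsum_nonneg])
          (use gsum_edge14[of i l a' b j c k "d - 1" False] 1 in simp)
      ultimately show "\<bar>hmom a i b j c k d l\<bar> \<le> (real b * C1 + real c * C2 + real d * C3) * ?S"
        unfolding 1 hmom_Suc distrib_right by linarith
    qed (use C1 C2 C3 in auto)
  next
    case 2
    obtain C2 where C2: "0 \<le> C2" "\<And>i j k l. \<bar>hmom a i b' j (c - 1) k d l\<bar> \<le> C2 * gsum False a i b' j (c - 1) k d l"
    proof -
      have "a + b' + (c - 1) + d < a + b + c + d" using 2 by simp
      from less[OF this] show ?thesis using that by blast
    qed
    obtain C3 where C3: "0 \<le> C3" "\<And>i j k l. \<bar>hmom a i b' j c k (d - 1) l\<bar> \<le> C3 * gsum False a i b' j c k (d - 1) l"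
    proof -
      have "a + b' + c + (d - 1) < a + b + c + d" using 2 by simp
      from less[OF this] show ?thesis using that by blast
    qed
    show ?thesis
    proof (intro exI[of _ "real c * C2 + real d * C3"] conjI allI)
      fix i j k l
      let ?S = "gsum False a i b j c k d l"
      have "\<bar>real c * r j k * hmom a i b' j (c - 1) k d l\<bar> \<le> real c * C2 * ?S"
        by (rule edge_term_bound[OF C2(2) _ C2(1) gsum_nonneg])
          (use gsum_edge23[of j k a i b' "c - 1" d l False] 2 in simp)
      moreover have "\<bar>real d * r j l * hmom a i b' j c k (d - 1) l\<bar> \<le> real d * C3 * ?S"
        by (rule edge_term_bound[OF C3(2) _ C3(1) gsum_nonneg])
          (use gsum_edge24[of j l a i b' c k "d - 1" False] 2 in simp)
      ultimately show "\<bar>hmom a i b j c k d l\<bar> \<le> (real c * C2 + real d * C3) * ?S"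
        unfolding 2 hmom_Suc2 distrib_right by (simp add: 2)
    qed (use C2 C3 in auto)
  next
    case 3
    show ?thesis
    proof (intro exI[of _ "fact c"] conjI allI)
      fix i j k l
      have "hmom 0 i 0 j c k d l = (if c = d then fact c * r k l ^ c else 0)"
        unfolding hmom_swap[of 0] by (rule hmom2)
      moreover have "\<bar>r k l\<bar> ^ c \<le> gsum False 0 i 0 j c k c l"
      proof -
        have "(\<Sum>e\<in>{(0, 0, 0, 0, 0, c)}. gweight i j k l e) \<le> gsum False 0 i 0 j c k c l"
          unfolding gsum_def
          by (intro sum_mono2[OF finite_graphs4] gweight_nonneg) simp
        then show ?thesis by (simp add: gweight_def)
      qed
      ultimately have "\<bar>hmom 0 i 0 j c k d l\<bar> \<le> fact c * gsum False 0 i 0 j c k d l"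
        by (cases "c = d") (simp_all add: abs_mult power_abs gsum_nonneg)
      then show "\<bar>hmom a i b j c k d l\<bar> \<le> fact c * gsum False a i b j c k d l"
        unfolding 3 .
    qed simp
  qed
qed

text \<open>In the recursion the terms with an edge 12 combine into a covariance of smaller degree,
  to which induction applies. Every other term already carries an edge between the two pairs, so the
  bound for plain moments suffices there.\<close>

lemma hmom_cov_bound:
  "\<exists>C\<ge>0. \<forall>i j k l. \<bar>hmom a i b j c k d l - hmom a i b j 0 i 0 i * hmom c k d l 0 i 0 i\<bar> \<le> C * gsum True a i b j c k d l"
proof (induction a arbitrary: b)
  case 0
  show ?case
  proof (cases b)
    case 0
    have "hmom 0 i 0 j c k d l - hmom 0 i 0 j 0 i 0 i * hmom c k d l 0 i 0 i = 0" for i j k l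
      unfolding hmom_swap[of 0 _ 0 _ c] hmom2 by simp
    then show ?thesis using 0 by (intro exI[of _ 0]) simp
  next
    case (Suc b')
    obtain C2 where C2: "0 \<le> C2" "\<And>i j k l. \<bar>hmom 0 i b' j (c - 1) k d l\<bar> \<le> C2 * gsum False 0 i b' j (c - 1) k d l"
      using hmom_bound by blast
    obtain C3 where C3: "0 \<le> C3" "\<And>i j k l. \<bar>hmom 0 i b' j c k (d - 1) l\<bar> \<le> C3 * gsum False 0 i b' j c k (d - 1) l"
      using hmom_bound by blast
    show ?thesis
    proof (intro exI[of _ "real c * C2 + real d * C3"] conjI allI)
      fix i j k l
      let ?S = "gsum True 0 i b j c k d l"
      have "\<bar>real c * r j k * hmom 0 i b' j (c - 1) k d l\<bar> \<le> real c * C2 * ?S"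
        by (rule edge_term_bound[OF C2(2) _ C2(1) gsum_nonneg])
          (use gsum_edge23[of j k 0 i b' "c - 1" d l True] Suc in simp)
      moreover have "\<bar>real d * r j l * hmom 0 i b' j c k (d - 1) l\<bar> \<le> real d * C3 * ?S"
        by (rule edge_term_bound[OF C3(2) _ C3(1) gsum_nonneg])
          (use gsum_edge24[of j l 0 i b' c k "d - 1" True] Suc in simp)
      ultimately show "\<bar>hmom 0 i b j c k d l - hmom 0 i b j 0 i 0 i * hmom c k d l 0 i 0 i\<bar> \<le> (real c * C2 + real d * C3) * ?S"
        unfolding Suc hmom2 hmom_Suc2 distrib_right by simp
    qed (use C2 C3 in auto)
  qed
next
  case (Suc a)
  obtain C1 where C1: "0 \<le> C1"
    "\<And>i j k l. \<bar>hmom a i (b - 1) j c k d l - hmom a i (b - 1) j 0 i 0 i * hmom c k d l 0 i 0 i\<bar> \<le> C1 * gsum True a i (b - 1) j c k d l"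
    using Suc[of "b - 1"] by auto
  obtain C2 where C2: "0 \<le> C2" "\<And>i j k l. \<bar>hmom a i b j (c - 1) k d l\<bar> \<le> C2 * gsum False a i b j (c - 1) k d l"
    using hmom_bound by blast
  obtain C3 where C3: "0 \<le> C3" "\<And>i j k l. \<bar>hmom a i b j c k (d - 1) l\<bar> \<le> C3 * gsum False a i b j c k (d - 1) l"
    using hmom_bound by blast
  show ?case
  proof (intro exI[of _ "real b * C1 + real c * C2 + real d * C3"] conjI allI)
    fix i j k l
    let ?S = "gsum True (Suc a) i b j c k d l"
    let ?D = "hmom a i (b - 1) j c k d l - hmom a i (b - 1) j 0 i 0 i * hmom c k d l 0 i 0 i"
    have 1: "\<bar>real b * r i j * ?D\<bar> \<le> real b * C1 * ?S"
      by (rule edge_term_bound[OF C1(2) _ C1(1) gsum_nonneg])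
        (use gsum_edge12[of i j True a "b - 1" c k d l] in simp)
    have 2: "\<bar>real c * r i k * hmom a i b j (c - 1) k d l\<bar> \<le> real c * C2 * ?S"
      by (rule edge_term_bound[OF C2(2) _ C2(1) gsum_nonneg])
        (use gsum_edge13[of i k a b j "c - 1" d l True] in simp)
    have 3: "\<bar>real d * r i l * hmom a i b j c k (d - 1) l\<bar> \<le> real d * C3 * ?S"
      by (rule edge_term_bound[OF C3(2) _ C3(1) gsum_nonneg])
        (use gsum_edge14[of i l a b j c k "d - 1" True] in simp)
    have "hmom (Suc a) i b j 0 i 0 i = real b * r i j * hmom a i (b - 1) j 0 i 0 i"
      by (simp add: hmom_Suc)
    then have "hmom (Suc a) i b j c k d l - hmom (Suc a) i b j 0 i 0 i * hmom c k d l 0 i 0 i =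
        real b * r i j * ?D + real c * r i k * hmom a i b j (c - 1) k d l + real d * r i l * hmom a i b j c k (d - 1) l"
      by (simp only: hmom_Suc[of a i b j c k d l] right_diff_distrib mult.assoc)
    with 1 2 3 show "\<bar>hmom (Suc a) i b j c k d l - hmom (Suc a) i b j 0 i 0 i * hmom c k d l 0 i 0 i\<bar> \<le>
        (real b * C1 + real c * C2 + real d * C3) * ?S"
      unfolding distrib_right by linarith
  qed (use C1 C2 C3 in auto)
qed

text \<open>Cauchy-Schwarz for the Hermite polynomial of degree 1, whose mixed moment is the
  correlation itself.\<close>

lemma r_le_1: "\<bar>r i j\<bar> \<le> 1"
proof -
  have "expectation (\<lambda>\<omega>. hermite 1 (X i \<omega>) * hermite 1 (X j \<omega>)) = r i j"
    by (simp add: expectation_hermite2)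
  moreover have "(\<integral>x. (hermite 1 x)\<^sup>2 \<partial>std_normal_distribution) = 1"
    using hermite_orthogonal(2)[of 1 1] by (simp add: power2_eq_square)
  ultimately show ?thesis
    using L2_X_mult(2)[OF hermite_L2[of 1] hermite_L2[of 1], of i j] by simp
qed

text \<open>After one more edge \<open>12\<close> and one more edge \<open>34\<close>, a graph with degrees \<open>p, q, p, q\<close> contains
  either an alternating 4-cycle or a path \<open>1-2-4-3\<close> or \<open>2-1-3-4\<close>.\<close>

lemma gweight_bound:
  assumes e: "e \<in> graphs4 True p q p q" and m: "m = Suc (min p q)"
  shows "\<bar>r i j\<bar> * \<bar>r k l\<bar> * gweight i j k l e \<le>
    (\<Sum>\<alpha>\<in>{1..<m}. (\<bar>r i j\<bar> * \<bar>r k l\<bar>) ^ \<alpha> * (\<bar>r i l\<bar> * \<bar>r j k\<bar>) ^ (m - \<alpha>)) +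
    (\<Sum>\<alpha>\<in>{1..<m}. (\<bar>r i j\<bar> * \<bar>r k l\<bar>) ^ \<alpha> * (\<bar>r i k\<bar> * \<bar>r j l\<bar>) ^ (m - \<alpha>)) +
    (\<bar>r i j\<bar> * \<bar>r k l\<bar>) ^ m * (\<bar>r i k\<bar> + \<bar>r j l\<bar>)" (is "_ \<le> ?A + ?B + ?C")
proof -
  obtain \<alpha> e13 e14 \<beta> e24 e34 where e_eq: "e = (\<alpha>, e13, e14, \<beta>, e24, e34)" by (cases e)
  from e have deg: "\<alpha> + e13 + e14 = p" "\<alpha> + \<beta> + e24 = q" "e13 + \<beta> + e34 = p" "e14 + e24 + e34 = q"
    and cross: "0 < e13 + e14 + \<beta> + e24"
    by (auto simp: e_eq)
  \<comment> \<open>Vertices 1 and 3 have the same degree, and so do 2 and 4; this forces the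
    opposite edges 12 and 34, and likewise 14 and 23, to have equal multiplicity.\<close>
  from deg have eq: "e34 = \<alpha>" "e14 = \<beta>" by arith+
  define x y z where "x = \<bar>r i j\<bar> * \<bar>r k l\<bar>" and "y = \<bar>r i l\<bar> * \<bar>r j k\<bar>" and "z = \<bar>r i k\<bar> * \<bar>r j l\<bar>"
  have xyz: "0 \<le> x" "0 \<le> y" "0 \<le> z" "x \<le> 1" "y \<le> 1" "z \<le> 1"
    unfolding x_def y_def z_def using r_le_1 by (auto intro!: mult_le_one)
  have weight: "\<bar>r i j\<bar> * \<bar>r k l\<bar> * gweight i j k l e = x ^ Suc \<alpha> * y ^ \<beta> * (\<bar>r i k\<bar> ^ e13 * \<bar>r j l\<bar> ^ e24)"
    by (simp add: e_eq eq gweight_def x_def y_def power_mult_distrib ac_simps)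
  have nonneg: "0 \<le> ?A" "0 \<le> ?B" "0 \<le> ?C" by (auto intro!: sum_nonneg mult_nonneg_nonneg add_nonneg_nonneg)
  show ?thesis
  proof (cases "\<alpha> = min p q")
    \<comment> \<open>A pair of vertices of smaller degree is saturated by the edges 12 and 34. The
      remaining edges between the pairs then join the two vertices of larger degree, and one of them
      is kept as the factor in the last summand.\<close>
    case True
    then have "Suc \<alpha> = m" "\<beta> = 0" "e13 = 0 \<or> e24 = 0" using m deg eq by auto
    have "\<bar>r i k\<bar> ^ e13 * \<bar>r j l\<bar> ^ e24 \<le> \<bar>r i k\<bar> + \<bar>r j l\<bar>"
    proof (cases "e13 = 0")
      case True
      with cross \<open>\<beta> = 0\<close> eq have "1 \<le> e24" by simp
      then have "\<bar>r j l\<bar> ^ e24 \<le> \<bar>r j l\<bar> ^ 1" using r_le_1 by (intro power_decreasing) auto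
      with True show ?thesis by simp
    next
      case False
      with \<open>e13 = 0 \<or> e24 = 0\<close> have "1 \<le> e13" "e24 = 0" by auto
      then have "\<bar>r i k\<bar> ^ e13 \<le> \<bar>r i k\<bar> ^ 1" using r_le_1 by (intro power_decreasing) auto
      with \<open>e24 = 0\<close> show ?thesis by simp
    qed
    then have "x ^ m * (\<bar>r i k\<bar> ^ e13 * \<bar>r j l\<bar> ^ e24) \<le> ?C"
      using xyz unfolding x_def[symmetric] by (intro mult_left_mono) auto
    then show ?thesis using weight nonneg \<open>Suc \<alpha> = m\<close> \<open>\<beta> = 0\<close> by simp
  next
    case False
    then have lt: "\<alpha> < min p q" using deg eq by auto
    define s where "s = min p q - \<alpha>"
    have s: "0 < s" "m - Suc \<alpha> = s" "Suc \<alpha> \<in> {1..<m}" using lt m by (auto simp: s_def)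
    have \<beta>s: "\<beta> \<le> s" "s - \<beta> \<le> e13" "s - \<beta> \<le> e24" using deg eq by (auto simp: s_def)
    have "\<bar>r i k\<bar> ^ e13 * \<bar>r j l\<bar> ^ e24 \<le> \<bar>r i k\<bar> ^ (s - \<beta>) * \<bar>r j l\<bar> ^ (s - \<beta>)"
      using \<beta>s r_le_1 by (intro mult_mono power_decreasing) auto
    also have "\<dots> = z ^ (s - \<beta>)" by (simp add: z_def power_mult_distrib)
    finally have "x ^ Suc \<alpha> * y ^ \<beta> * (\<bar>r i k\<bar> ^ e13 * \<bar>r j l\<bar> ^ e24) \<le> x ^ Suc \<alpha> * (y ^ \<beta> * z ^ (s - \<beta>))"
      using xyz by (simp add: mult.assoc mult_left_mono)
    \<comment> \<open>A mixed product is at most the \<open>s\<close>-th power of the larger base,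
      which leaves only the two pure alternating cycles.\<close>
    also have "y ^ \<beta> * z ^ (s - \<beta>) \<le> y ^ s + z ^ s"
    proof (cases "y \<le> z")
      case True
      have "y ^ \<beta> * z ^ (s - \<beta>) \<le> z ^ \<beta> * z ^ (s - \<beta>)" using True xyz by (intro mult_right_mono power_mono) auto
      also have "\<dots> = z ^ s" using \<beta>s by (simp flip: power_add)
      finally show ?thesis using zero_le_power[OF xyz(2), of s] by linarith
    next
      case False
      have "y ^ \<beta> * z ^ (s - \<beta>) \<le> y ^ \<beta> * y ^ (s - \<beta>)" using False xyz by (intro mult_left_mono power_mono) auto
      also have "\<dots> = y ^ s" using \<beta>s by (simp flip: power_add)
      finally show ?thesis using zero_le_power[OF xyz(3), of s] by linarith
    qed
    then have "x ^ Suc \<alpha> * (y ^ \<beta> * z ^ (s - \<beta>)) \<le> x ^ Suc \<alpha> * y ^ s + x ^ Suc \<alpha> * z ^ s"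
      using xyz by (simp only: distrib_left[symmetric]) (intro mult_left_mono, auto)
    also have "x ^ Suc \<alpha> * y ^ s \<le> ?A"
      unfolding x_def[symmetric] y_def[symmetric]
      using member_le_sum[of "Suc \<alpha>" "{1..<m}" "\<lambda>\<alpha>. x ^ \<alpha> * y ^ (m - \<alpha>)"] s xyz by simp
    also have "x ^ Suc \<alpha> * z ^ s \<le> ?B"
      unfolding x_def[symmetric] z_def[symmetric]
      using member_le_sum[of "Suc \<alpha>" "{1..<m}" "\<lambda>\<alpha>. x ^ \<alpha> * z ^ (m - \<alpha>)"] s xyz by simp
    finally show ?thesis unfolding weight using nonneg(3) by linarith
  qed
qed

end

section \<open>A quantitative form of Stein's method\<close>

text \<open>Solves the differential equation \<open>\<phi>' = - \<theta> \<tau> \<phi> + error\<close> for the characteristic function \<open>\<phi>\<close> of \<open>S\<close>.\<close>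

lemma (in prob_space) stein_char_bound:
  fixes S T :: "'a \<Rightarrow> real"
  assumes [measurable]: "S \<in> borel_measurable M" "T \<in> borel_measurable M"
    and S: "integrable M (\<lambda>\<omega>. (S \<omega>)\<^sup>2)" and T: "integrable M T"
    and stein: "\<And>\<theta>. expectation (\<lambda>\<omega>. of_real (S \<omega>) * cis (\<theta> * S \<omega>)) =
      \<i> * of_real \<theta> * expectation (\<lambda>\<omega>. of_real (T \<omega>) * cis (\<theta> * S \<omega>))"
  shows "norm (expectation (\<lambda>\<omega>. cis (S \<omega>)) - of_real (exp (- \<tau> / 2))) \<le> exp \<bar>\<tau>\<bar> * expectation (\<lambda>\<omega>. \<bar>T \<omega> - \<tau>\<bar>)"
proof -
  have [measurable]: "cis \<in> borel_measurable borel"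
    by (intro borel_measurable_continuous_onI continuous_intros)
  have int_S: "integrable M S" by (rule expectation_abs_le_sqrt(1)) (use S in simp_all)
  define \<phi> where "\<phi> \<theta> = expectation (\<lambda>\<omega>. cis (\<theta> * S \<omega>))" for \<theta>
  define \<phi>' where "\<phi>' \<theta> = expectation (\<lambda>\<omega>. \<i> * of_real (S \<omega>) * cis (\<theta> * S \<omega>))" for \<theta>
  have int_cis: "integrable M (\<lambda>\<omega>. cis (\<theta> * S \<omega>))" for \<theta>
    by (rule integrable_const_bound[where B = 1]) auto
  have int_mult: "integrable M (\<lambda>\<omega>. of_real (f \<omega>) * cis (\<theta> * S \<omega>))" if "integrable M f" for f and \<theta>
    by (rule Bochner_Integration.integrable_bound[OF that]) (use that in \<open>auto simp: norm_mult\<close>)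
  have int_S': "integrable M (\<lambda>\<omega>. \<i> * of_real (S \<omega>) * cis (\<theta> * S \<omega>))" for \<theta>
    using int_mult[OF int_S, of \<theta>] by (simp add: mult.assoc)
  define E2 where "E2 = expectation (\<lambda>\<omega>. (S \<omega>)\<^sup>2)"
  \<comment> \<open>Differentiation under the expectation: the second-order Taylor bound for the
    exponential has an integrable coefficient because \<open>S\<close> is square-integrable.\<close>
  have deriv: "(\<phi> has_vector_derivative \<phi>' \<theta>) (at \<theta>)" for \<theta>
  proof -
    have bound: "norm (\<phi> (\<theta> + h) - \<phi> \<theta> - h *\<^sub>R \<phi>' \<theta>) \<le> h\<^sup>2 / 2 * E2" for h
    proof -
      have int_h: "integrable M (\<lambda>\<omega>. h *\<^sub>R (\<i> * of_real (S \<omega>) * cis (\<theta> * S \<omega>)))"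
        using int_S' by (rule integrable_scaleR_right)
      have "\<phi> (\<theta> + h) - \<phi> \<theta> - h *\<^sub>R \<phi>' \<theta> =
          expectation (\<lambda>\<omega>. cis ((\<theta> + h) * S \<omega>) - cis (\<theta> * S \<omega>) - h *\<^sub>R (\<i> * of_real (S \<omega>) * cis (\<theta> * S \<omega>)))"
        unfolding \<phi>_def \<phi>'_def using int_cis int_S' int_h
        by (simp add: integral_scaleR_right del: scaleR_left_imp_eq)
      also have "norm \<dots> \<le> expectation (\<lambda>\<omega>. norm (cis ((\<theta> + h) * S \<omega>) - cis (\<theta> * S \<omega>) - h *\<^sub>R (\<i> * of_real (S \<omega>) * cis (\<theta> * S \<omega>))))"
        by (rule integral_norm_bound)
      also have "\<dots> \<le> expectation (\<lambda>\<omega>. h\<^sup>2 / 2 * (S \<omega>)\<^sup>2)"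
      proof (rule integral_mono)
        show "integrable M (\<lambda>\<omega>. norm (cis ((\<theta> + h) * S \<omega>) - cis (\<theta> * S \<omega>) - h *\<^sub>R (\<i> * of_real (S \<omega>) * cis (\<theta> * S \<omega>))))"
          by (intro integrable_norm Bochner_Integration.integrable_diff int_cis int_h)
        show "integrable M (\<lambda>\<omega>. h\<^sup>2 / 2 * (S \<omega>)\<^sup>2)" using S by simp
        fix \<omega>
        have "cis ((\<theta> + h) * S \<omega>) - cis (\<theta> * S \<omega>) - h *\<^sub>R (\<i> * of_real (S \<omega>) * cis (\<theta> * S \<omega>)) =
            cis (\<theta> * S \<omega>) * (cis (h * S \<omega>) - (1 + \<i> * of_real (h * S \<omega>)))"
        proof -
          have "cis ((\<theta> + h) * S \<omega>) = cis (\<theta> * S \<omega>) * cis (h * S \<omega>)"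
            by (simp add: cis_mult distrib_right)
          then show ?thesis
            by (simp add: scaleR_conv_of_real right_diff_distrib distrib_left)
        qed
        also have "norm \<dots> = norm (iexp (h * S \<omega>) - (\<Sum>k\<le>1. (\<i> * of_real (h * S \<omega>)) ^ k / fact k))"
          by (simp add: norm_mult cis_conv_exp)
        also have "\<dots> \<le> \<bar>h * S \<omega>\<bar> ^ Suc 1 / fact (Suc 1)" by (rule iexp_approx1)
        also have "\<dots> = h\<^sup>2 / 2 * (S \<omega>)\<^sup>2" by (simp add: power2_eq_square ac_simps)
        finally show "norm (cis ((\<theta> + h) * S \<omega>) - cis (\<theta> * S \<omega>) - h *\<^sub>R (\<i> * of_real (S \<omega>) * cis (\<theta> * S \<omega>))) \<le> h\<^sup>2 / 2 * (S \<omega>)\<^sup>2" .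
      qed
      also have "\<dots> = h\<^sup>2 / 2 * E2" by (simp add: E2_def)
      finally show ?thesis .
    qed
    have "((\<lambda>h. (\<phi> (\<theta> + h) - \<phi> \<theta> - h *\<^sub>R \<phi>' \<theta>) /\<^sub>R norm h) \<longlongrightarrow> 0) (at 0)"
    proof (rule Lim_null_comparison)
      show "\<forall>\<^sub>F h in at 0. norm ((\<phi> (\<theta> + h) - \<phi> \<theta> - h *\<^sub>R \<phi>' \<theta>) /\<^sub>R norm h) \<le> \<bar>h\<bar> / 2 * E2"
      proof (intro always_eventually allI)
        fix h :: real
        show "norm ((\<phi> (\<theta> + h) - \<phi> \<theta> - h *\<^sub>R \<phi>' \<theta>) /\<^sub>R norm h) \<le> \<bar>h\<bar> / 2 * E2"
        proof (cases "h = 0")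
          case False
          have "norm ((\<phi> (\<theta> + h) - \<phi> \<theta> - h *\<^sub>R \<phi>' \<theta>) /\<^sub>R norm h) = norm (\<phi> (\<theta> + h) - \<phi> \<theta> - h *\<^sub>R \<phi>' \<theta>) / \<bar>h\<bar>"
            by (simp add: divide_inverse mult.commute)
          also have "\<dots> \<le> (h\<^sup>2 / 2 * E2) / \<bar>h\<bar>" by (intro divide_right_mono bound) simp
          also have "\<dots> = \<bar>h\<bar> / 2 * E2" using False by (simp add: power2_eq_square abs_if)
          finally show ?thesis .
        qed simp
      qed
      show "((\<lambda>h. \<bar>h\<bar> / 2 * E2) \<longlongrightarrow> 0) (at 0)"
        by (auto intro!: tendsto_eq_intros)
    qed
    from tendsto_norm_zero[OF this]
    have "((\<lambda>h. norm (\<phi> (\<theta> + h) - \<phi> \<theta> - h *\<^sub>R \<phi>' \<theta>) / norm h) \<longlongrightarrow> 0) (at 0)"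
      by (simp add: divide_inverse mult.commute)
    then show ?thesis
      unfolding has_vector_derivative_def has_derivative_at
      by (intro conjI bounded_linear_scaleR_left)
  qed
  define \<epsilon> where "\<epsilon> = expectation (\<lambda>\<omega>. \<bar>T \<omega> - \<tau>\<bar>)"
  have int_T\<tau>: "integrable M (\<lambda>\<omega>. T \<omega> - \<tau>)" using T by simp
  have \<phi>'_eq: "\<phi>' \<theta> = - of_real (\<theta> * \<tau>) * \<phi> \<theta> - of_real \<theta> * expectation (\<lambda>\<omega>. of_real (T \<omega> - \<tau>) * cis (\<theta> * S \<omega>))" for \<theta>
  proof -
    have "\<phi>' \<theta> = \<i> * expectation (\<lambda>\<omega>. of_real (S \<omega>) * cis (\<theta> * S \<omega>))"
      unfolding \<phi>'_def by (simp add: mult.assoc)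
    also have "\<dots> = - of_real \<theta> * expectation (\<lambda>\<omega>. of_real (T \<omega>) * cis (\<theta> * S \<omega>))"
      unfolding stein by (simp flip: mult.assoc)
    also have "expectation (\<lambda>\<omega>. of_real (T \<omega>) * cis (\<theta> * S \<omega>)) =
        expectation (\<lambda>\<omega>. of_real (T \<omega> - \<tau>) * cis (\<theta> * S \<omega>) + of_real \<tau> * cis (\<theta> * S \<omega>))"
      by (intro Bochner_Integration.integral_cong refl) (simp add: left_diff_distrib)
    also have "\<dots> = expectation (\<lambda>\<omega>. of_real (T \<omega> - \<tau>) * cis (\<theta> * S \<omega>)) + of_real \<tau> * \<phi> \<theta>"
      unfolding \<phi>_def integral_mult_right_zero[symmetric]
      by (intro Bochner_Integration.integral_add int_mult[OF int_T\<tau>] integrable_mult_right int_cis)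
    finally show ?thesis by (simp add: algebra_simps)
  qed
  have err: "norm (expectation (\<lambda>\<omega>. of_real (T \<omega> - \<tau>) * cis (\<theta> * S \<omega>))) \<le> \<epsilon>" for \<theta>
    unfolding \<epsilon>_def by (rule order_trans[OF integral_norm_bound]) (simp add: norm_mult flip: of_real_diff)
  \<comment> \<open>The integrating factor cancels the main term, so that the derivative of \<psi>
    consists of the error alone and can be bounded on the unit interval.\<close>
  define \<psi> where "\<psi> \<theta> = exp (\<tau> * \<theta>\<^sup>2 / 2) *\<^sub>R \<phi> \<theta>" for \<theta>
  define \<psi>' where "\<psi>' \<theta> = exp (\<tau> * \<theta>\<^sup>2 / 2) *\<^sub>R (- of_real \<theta> * expectation (\<lambda>\<omega>. of_real (T \<omega> - \<tau>) * cis (\<theta> * S \<omega>)))" for \<theta>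
  have \<psi>_deriv: "(\<psi> has_vector_derivative \<psi>' \<theta>) (at \<theta>)" for \<theta>
  proof -
    have "((\<lambda>\<theta>. exp (\<tau> * \<theta>\<^sup>2 / 2)) has_real_derivative (\<tau> * \<theta>) * exp (\<tau> * \<theta>\<^sup>2 / 2)) (at \<theta>)"
      by (auto intro!: derivative_eq_intros)
    from has_vector_derivative_scaleR[OF this deriv] show ?thesis
      unfolding \<psi>_def[abs_def] \<psi>'_def \<phi>'_eq by (simp add: scaleR_conv_of_real algebra_simps)
  qed
  have "norm (\<psi> 1 - \<psi> 0) \<le> (exp (max 0 \<tau> / 2) * \<epsilon>) * norm (1 - 0 :: real)"
  proof (rule differentiable_bound[where S = "{0..1}" and f' = "\<lambda>\<theta> h. h *\<^sub>R \<psi>' \<theta>"])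
    fix \<theta> :: real assume "\<theta> \<in> {0..1}"
    then have \<theta>: "0 \<le> \<theta>" "\<theta> \<le> 1" by auto
    show "(\<psi> has_derivative (\<lambda>h. h *\<^sub>R \<psi>' \<theta>)) (at \<theta> within {0..1})"
      using \<psi>_deriv[of \<theta>] by (simp add: has_vector_derivative_def has_derivative_at_withinI)
    have "\<theta>\<^sup>2 \<le> 1" using \<theta> by (simp add: power_le_one)
    then have "\<tau> * \<theta>\<^sup>2 \<le> max 0 \<tau> * 1" using \<theta> by (intro mult_mono) auto
    then have e: "exp (\<tau> * \<theta>\<^sup>2 / 2) \<le> exp (max 0 \<tau> / 2)" by simp
    have "norm (\<psi>' \<theta>) = exp (\<tau> * \<theta>\<^sup>2 / 2) * (\<theta> * norm (expectation (\<lambda>\<omega>. of_real (T \<omega> - \<tau>) * cis (\<theta> * S \<omega>))))"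
      unfolding \<psi>'_def using \<theta> by (simp add: norm_mult del: of_real_diff)
    also have "\<dots> \<le> exp (max 0 \<tau> / 2) * (1 * \<epsilon>)"
      using e \<theta> err by (intro mult_mono) auto
    finally have n: "norm (\<psi>' \<theta>) \<le> exp (max 0 \<tau> / 2) * \<epsilon>" by simp
    show "onorm (\<lambda>h. h *\<^sub>R \<psi>' \<theta>) \<le> exp (max 0 \<tau> / 2) * \<epsilon>"
    proof (rule onorm_le)
      fix h :: real
      show "norm (h *\<^sub>R \<psi>' \<theta>) \<le> (exp (max 0 \<tau> / 2) * \<epsilon>) * norm h"
        using mult_left_mono[OF n, of "\<bar>h\<bar>"] by (simp add: mult.commute)
    qed
  qed auto
  then have "norm (exp (\<tau> / 2) *\<^sub>R \<phi> 1 - 1) \<le> exp (max 0 \<tau> / 2) * \<epsilon>"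
    by (simp add: \<psi>_def \<phi>_def prob_space)
  then have "exp (- \<tau> / 2) * norm (exp (\<tau> / 2) *\<^sub>R \<phi> 1 - 1) \<le> exp (- \<tau> / 2) * (exp (max 0 \<tau> / 2) * \<epsilon>)"
    by (intro mult_left_mono) auto
  also have "exp (- \<tau> / 2) * norm (exp (\<tau> / 2) *\<^sub>R \<phi> 1 - 1) = norm (exp (- \<tau> / 2) *\<^sub>R (exp (\<tau> / 2) *\<^sub>R \<phi> 1 - 1))"
    by simp
  also have "exp (- \<tau> / 2) *\<^sub>R (exp (\<tau> / 2) *\<^sub>R \<phi> 1 - 1) = \<phi> 1 - of_real (exp (- \<tau> / 2))"
    unfolding scaleR_diff_right scaleR_scaleR exp_add[symmetric] by (simp add: scaleR_conv_of_real)
  \<comment> \<open>No sign is imposed on \<tau>. The exponentials multiply to 1 for nonnegative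
    \<tau> and to \<open>exp (- \<tau> / 2)\<close> otherwise; \<open>exp \<bar>\<tau>\<bar>\<close>
    dominates both.\<close>
  also have "exp (- \<tau> / 2) * (exp (max 0 \<tau> / 2) * \<epsilon>) \<le> exp \<bar>\<tau>\<bar> * \<epsilon>"
    unfolding mult.assoc[symmetric] exp_add[symmetric]
    by (intro mult_right_mono) (auto simp: \<epsilon>_def)
  finally show ?thesis by (simp add: \<phi>_def \<epsilon>_def)
qed

section \<open>Sums over finite windows\<close>

lemma sum_diff_le_infsum:
  fixes u :: "int \<Rightarrow> real"
  assumes "u summable_on UNIV" "\<And>h. 0 \<le> u h" "finite L"
  shows "(\<Sum>l\<in>L. u (n - l)) \<le> infsum u UNIV"
proof -
  have "(\<Sum>l\<in>L. u (n - l)) = sum u ((\<lambda>l. n - l) ` L)"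
    by (subst sum.reindex) (auto simp: inj_on_def)
  also have "\<dots> \<le> infsum u UNIV"
    using assms by (intro finite_sum_le_infsum) auto
  finally show ?thesis .
qed

lemma double_sum_le_infsum:
  fixes u :: "int \<Rightarrow> real"
  assumes "u summable_on UNIV" "\<And>h. 0 \<le> u h" "finite I" "finite L"
  shows "(\<Sum>n\<in>I. \<Sum>l\<in>L. u (n - l)) \<le> real (card I) * infsum u UNIV"
  using sum_mono[of I "\<lambda>n. \<Sum>l\<in>L. u (n - l)" "\<lambda>_. infsum u UNIV"] sum_diff_le_infsum[OF assms(1,2,4)]
  by simp

text \<open>Interchange of limits in the form in which truncation arguments deliver it. Closeness is
  demanded from \<open>N = 1\<close> on because the estimates divide by \<open>N\<close>.\<close>

lemma tendsto_by_norm_approximation: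
  fixes f :: "nat \<Rightarrow> 'b::real_normed_vector"
  assumes "\<And>e. 0 < e \<Longrightarrow> \<exists>g l. g \<longlonglongrightarrow> l \<and> (\<forall>N\<ge>1. norm (f N - g N) \<le> e) \<and> norm (l - L) \<le> e"
  shows "f \<longlonglongrightarrow> L"
proof (rule LIMSEQ_I)
  fix r :: real assume r: "0 < r"
  obtain g l where g: "g \<longlonglongrightarrow> l" "\<And>N. N \<ge> 1 \<Longrightarrow> norm (f N - g N) \<le> r / 4" "norm (l - L) \<le> r / 4"
    using assms[of "r / 4"] r by auto
  obtain N0 where N0: "\<And>N. N \<ge> N0 \<Longrightarrow> norm (g N - l) < r / 4"
    using LIMSEQ_D[OF g(1), of "r / 4"] r by auto
  have "norm (f N - L) < r" if "N \<ge> max 1 N0" for N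
  proof -
    have "norm (f N - g N) \<le> r / 4" "norm (g N - l) < r / 4" using g(2)[of N] N0[of N] that by auto
    moreover have "norm (f N - L) \<le> norm (f N - g N) + norm (g N - l) + norm (l - L)"
      using norm_triangle_ineq[of "f N - g N" "g N - l"] norm_triangle_ineq[of "f N - l" "l - L"] by simp
    ultimately show ?thesis using g(3) r by linarith
  qed
  then show "\<exists>N0. \<forall>N\<ge>N0. norm (f N - L) < r" by blast
qed

lemma tendsto_by_approximation:
  fixes f :: "nat \<Rightarrow> real"
  assumes "\<And>e. 0 < e \<Longrightarrow> \<exists>g l. g \<longlonglongrightarrow> l \<and> (\<forall>N\<ge>1. \<bar>f N - g N\<bar> \<le> e) \<and> \<bar>l - L\<bar> \<le> e"
  shows "f \<longlonglongrightarrow> L"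
  using assms by (intro tendsto_by_norm_approximation) (simp only: real_norm_def)

text \<open>The tail is a function on the whole type that is 0 on \<open>F\<close>, so the bounds
  for sums over index differences apply to it unchanged.\<close>

lemma infsum_outside_small:
  fixes u :: "'b \<Rightarrow> real"
  assumes u: "u summable_on UNIV" "\<And>x. 0 \<le> u x" and e: "0 < e"
  obtains F where "finite F" "(\<lambda>x. if x \<in> F then 0 else u x) summable_on UNIV"
    "infsum (\<lambda>x. if x \<in> F then 0 else u x) UNIV \<le> e"
proof -
  have "(sum u \<longlongrightarrow> infsum u UNIV) (finite_subsets_at_top UNIV)"
    using u(1) by (simp add: has_sum_def[symmetric] has_sum_infsum)
  from tendstoD[OF this e] obtain F where F: "finite F" "dist (sum u F) (infsum u UNIV) < e"
    unfolding eventually_finite_subsets_at_top by blast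
  have 1: "(\<lambda>x. if x \<in> F then 0 else u x) summable_on UNIV"
    by (rule summable_on_comparison_test[OF u(1)]) (use u(2) in auto)
  have 2: "(\<lambda>x. if x \<in> F then u x else 0) summable_on UNIV"
    by (rule summable_on_comparison_test[OF u(1)]) (use u(2) in auto)
  have "infsum (\<lambda>x. if x \<in> F then u x else 0) UNIV = sum u F"
    using F(1) by (subst infsum_cong_neutral[where T = F and g = u]) auto
  moreover have "infsum u UNIV = infsum (\<lambda>x. (if x \<in> F then u x else 0) + (if x \<in> F then 0 else u x)) UNIV"
    by (intro infsum_cong) auto
  ultimately have "infsum (\<lambda>x. if x \<in> F then 0 else u x) UNIV = infsum u UNIV - sum u F"
    using infsum_add[OF 2 1] by simp
  with F 1 show ?thesis using that[of F] by (auto simp: dist_real_def)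
qed

text \<open>The pairs at lag \<open>h\<close> are as many as the shorter window has points, up to a
  boundary effect that does not depend on the lengths.\<close>

lemma card_shifted_window:
  fixes h :: int
  assumes "0 \<le> A" "0 \<le> B"
  shows "\<bar>real (card {l\<in>{1..B}. l + h \<in> {1..A}}) - real_of_int (min A B)\<bar> \<le> 2 * real_of_int \<bar>h\<bar>"
proof -
  have eq: "{l\<in>{1..B}. l + h \<in> {1..A}} = {max 1 (1 - h)..min B (A - h)}" by auto
  have "\<bar>int (card {l\<in>{1..B}. l + h \<in> {1..A}}) - min A B\<bar> \<le> 2 * \<bar>h\<bar>"
    unfolding eq using assms by (simp add: max_def min_def)
  then have "real_of_int \<bar>int (card {l\<in>{1..B}. l + h \<in> {1..A}}) - min A B\<bar> \<le> real_of_int (2 * \<bar>h\<bar>)"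
    by (simp only: of_int_le_iff)
  then show ?thesis by simp
qed

text \<open>The lags are split by a finite set \<open>F\<close>. Each lag in \<open>F\<close> occurs
  about \<open>N * min s t\<close> times, while the rest contributes at most
  \<open>N * s * e'\<close> because rows of the double sum are dominated by the tail of the
  series.\<close>

lemma double_sum_limit:
  fixes u :: "int \<Rightarrow> real"
  assumes u: "(\<lambda>h. \<bar>u h\<bar>) summable_on UNIV" and st: "0 \<le> s" "0 \<le> t"
  shows "(\<lambda>N. (\<Sum>n\<in>{1..\<lfloor>real N * s\<rfloor>}. \<Sum>l\<in>{1..\<lfloor>real N * t\<rfloor>}. u (n - l)) / real N) \<longlonglongrightarrow> min s t * infsum u UNIV"
proof (rule tendsto_by_approximation)
  fix e :: real assume e: "0 < e"
  define I where "I s N = {1..\<lfloor>real N * s\<rfloor>}" for s and N :: nat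
  have card_I: "real (card (I s N)) \<le> real N * s" if "0 \<le> s" for s N
    using that by (simp add: I_def)
  define e' where "e' = e / (s + t + 1)"
  have e': "0 < e'" using e st by (simp add: e'_def)
  obtain F where F: "finite F" "(\<lambda>x. if x \<in> F then 0 else \<bar>u x\<bar>) summable_on UNIV"
    "infsum (\<lambda>x. if x \<in> F then 0 else \<bar>u x\<bar>) UNIV \<le> e'"
    using infsum_outside_small[OF u _ e'] by auto
  define v where "v x = (if x \<in> F then 0 else u x)" for x
  have v_abs: "\<bar>v x\<bar> = (if x \<in> F then 0 else \<bar>u x\<bar>)" for x by (simp add: v_def)
  have v_sum: "(\<lambda>x. norm (v x)) summable_on UNIV" using F(2) by (simp add: v_abs)
  have u_sum: "u summable_on UNIV" by (rule abs_summable_summable) (use u in simp)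
  have small: "\<bar>infsum v UNIV\<bar> \<le> e'"
    using norm_infsum_bound[OF v_sum] F(3) by (simp add: v_abs)
  have split: "infsum u UNIV = sum u F + infsum v UNIV"
  proof -
    have "infsum v UNIV = infsum u (UNIV - F)"
      by (rule infsum_cong_neutral) (auto simp: v_def)
    moreover have "infsum u (UNIV - F) = infsum u UNIV - infsum u F"
      using u_sum F(1) by (intro infsum_Diff) auto
    ultimately show ?thesis using F(1) by simp
  qed
  define g where "g N = (\<Sum>h\<in>F. u h * (real (card {l\<in>I t N. l + h \<in> I s N}) / real N))" for N
  have g_eq: "(\<Sum>n\<in>I s N. \<Sum>l\<in>I t N. u (n - l)) / real N - g N = (\<Sum>n\<in>I s N. \<Sum>l\<in>I t N. v (n - l)) / real N" for N
  proof -
    have "(\<Sum>n\<in>I s N. \<Sum>l\<in>I t N. if n - l \<in> F then u (n - l) else 0) = (\<Sum>h\<in>F. u h * real (card {l\<in>I t N. l + h \<in> I s N}))"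
    proof -
      have "(\<Sum>n\<in>I s N. \<Sum>l\<in>I t N. if n - l \<in> F then u (n - l) else 0) =
          (\<Sum>n\<in>I s N. \<Sum>l\<in>I t N. \<Sum>h\<in>F. if n = l + h then u h else 0)"
      proof (intro sum.cong refl)
        fix n l
        have "(\<Sum>h\<in>F. if n = l + h then u h else 0) = (\<Sum>h\<in>F. if n - l = h then u h else 0)"
          by (intro sum.cong refl) auto
        then show "(if n - l \<in> F then u (n - l) else 0) = (\<Sum>h\<in>F. if n = l + h then u h else 0)"
          using F(1) by simp
      qed
      also have "\<dots> = (\<Sum>l\<in>I t N. \<Sum>n\<in>I s N. \<Sum>h\<in>F. if n = l + h then u h else 0)"
        by (rule sum.swap)
      also have "\<dots> = (\<Sum>l\<in>I t N. \<Sum>h\<in>F. \<Sum>n\<in>I s N. if n = l + h then u h else 0)"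
        by (intro sum.cong refl sum.swap)
      also have "\<dots> = (\<Sum>h\<in>F. \<Sum>l\<in>I t N. \<Sum>n\<in>I s N. if n = l + h then u h else 0)"
        by (rule sum.swap)
      also have "\<dots> = (\<Sum>h\<in>F. \<Sum>l\<in>I t N. if l + h \<in> I s N then u h else 0)"
        by (intro sum.cong refl) (simp add: I_def)
      also have "\<dots> = (\<Sum>h\<in>F. u h * real (card {l\<in>I t N. l + h \<in> I s N}))"
        by (intro sum.cong refl) (simp add: sum.If_cases I_def Int_def mult.commute)
      finally show ?thesis .
    qed
    moreover have "(\<Sum>n\<in>I s N. \<Sum>l\<in>I t N. u (n - l)) = (\<Sum>n\<in>I s N. \<Sum>l\<in>I t N. if n - l \<in> F then u (n - l) else 0) + (\<Sum>n\<in>I s N. \<Sum>l\<in>I t N. v (n - l))"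
      unfolding sum.distrib[symmetric] by (intro sum.cong refl) (auto simp: v_def)
    ultimately show ?thesis by (simp add: g_def add_divide_distrib sum_divide_distrib)
  qed
  have "\<bar>(\<Sum>n\<in>I s N. \<Sum>l\<in>I t N. u (n - l)) / real N - g N\<bar> \<le> e" if N: "N \<ge> 1" for N
  proof -
    have "\<bar>\<Sum>n\<in>I s N. \<Sum>l\<in>I t N. v (n - l)\<bar> \<le> (\<Sum>n\<in>I s N. \<Sum>l\<in>I t N. \<bar>v (n - l)\<bar>)"
      by (intro order_trans[OF sum_abs] sum_mono) simp
    also have "\<dots> \<le> real (card (I s N)) * infsum (\<lambda>x. \<bar>v x\<bar>) UNIV"
      using F(2) by (intro double_sum_le_infsum) (auto simp: v_abs I_def)
    also have "\<dots> \<le> (real N * s) * e'"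
      using F(3) card_I[OF st(1)] e' st by (intro mult_mono) (auto simp: v_abs intro!: infsum_nonneg)
    finally have "\<bar>\<Sum>n\<in>I s N. \<Sum>l\<in>I t N. v (n - l)\<bar> / real N \<le> s * e'"
      using N by (simp add: divide_le_eq ac_simps)
    also have "s * e' \<le> e"
      using e st by (simp add: e'_def field_simps)
    finally show ?thesis unfolding g_eq by simp
  qed
  moreover have "g \<longlonglongrightarrow> (\<Sum>h\<in>F. u h * min s t)"
    unfolding g_def[abs_def]
  proof (intro tendsto_intros)
    fix h
    have bound: "\<bar>real (card {l\<in>I t N. l + h \<in> I s N}) / real N - min s t\<bar> \<le> (2 * real_of_int \<bar>h\<bar> + 1) / real N" if "N \<ge> 1" for N
    proof -
      have "0 \<le> \<lfloor>real N * s\<rfloor>" "0 \<le> \<lfloor>real N * t\<rfloor>" using st by auto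
      from card_shifted_window[OF this, of h]
      have "\<bar>real (card {l\<in>I t N. l + h \<in> I s N}) - real_of_int (min \<lfloor>real N * s\<rfloor> \<lfloor>real N * t\<rfloor>)\<bar> \<le> 2 * real_of_int \<bar>h\<bar>"
        by (simp add: I_def)
      moreover have "\<bar>real_of_int (min \<lfloor>real N * s\<rfloor> \<lfloor>real N * t\<rfloor>) - min (real N * s) (real N * t)\<bar> \<le> 1"
      proof -
        have floor: "\<bar>real_of_int \<lfloor>x\<rfloor> - x\<bar> \<le> 1" for x :: real by linarith
        have "\<bar>min x1 y1 - min x2 y2\<bar> \<le> 1" if "\<bar>x1 - x2\<bar> \<le> 1" "\<bar>y1 - y2\<bar> \<le> 1" for x1 x2 y1 y2 :: real
          using that unfolding abs_le_iff min_def by auto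
        then show ?thesis unfolding of_int_min using floor by blast
      qed
      moreover have "min (real N * s) (real N * t) = real N * min s t" by (simp add: min_mult_distrib_left)
      moreover have "\<bar>x - z\<bar> \<le> p + 1" if "\<bar>x - y\<bar> \<le> p" "\<bar>y - z\<bar> \<le> 1" for x y z p :: real
        using that by linarith
      ultimately have "\<bar>real (card {l\<in>I t N. l + h \<in> I s N}) - real N * min s t\<bar> \<le> 2 * real_of_int \<bar>h\<bar> + 1"
        by metis
      then have "\<bar>real (card {l\<in>I t N. l + h \<in> I s N}) - real N * min s t\<bar> / real N \<le> (2 * real_of_int \<bar>h\<bar> + 1) / real N"
        by (rule divide_right_mono) simp
      moreover have "real (card {l\<in>I t N. l + h \<in> I s N}) / real N - min s t = (real (card {l\<in>I t N. l + h \<in> I s N}) - real N * min s t) / real N"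
        using that by (simp add: field_simps)
      ultimately show ?thesis by simp
    qed
    show "(\<lambda>N. real (card {l\<in>I t N. l + h \<in> I s N}) / real N) \<longlonglongrightarrow> min s t"
    proof (rule LIM_zero_cancel, rule Lim_null_comparison)
      show "\<forall>\<^sub>F N in sequentially. norm (real (card {l\<in>I t N. l + h \<in> I s N}) / real N - min s t) \<le> (2 * real_of_int \<bar>h\<bar> + 1) / real N"
        using bound unfolding real_norm_def by (auto simp: eventually_sequentially)
      show "(\<lambda>N. (2 * real_of_int \<bar>h\<bar> + 1) / real N) \<longlonglongrightarrow> 0" by (rule lim_const_over_n)
    qed
  qed
  moreover have "\<bar>(\<Sum>h\<in>F. u h * min s t) - min s t * infsum u UNIV\<bar> \<le> e"
  proof -
    have "(\<Sum>h\<in>F. u h * min s t) - min s t * infsum u UNIV = - (min s t * infsum v UNIV)"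
      unfolding split by (simp add: sum_distrib_left algebra_simps sum_distrib_right)
    then have "\<bar>(\<Sum>h\<in>F. u h * min s t) - min s t * infsum u UNIV\<bar> = min s t * \<bar>infsum v UNIV\<bar>"
      using st by (simp add: abs_mult)
    also have "\<dots> \<le> s * e'" using small st e' by (intro mult_mono) auto
    also have "\<dots> \<le> e" using e st by (simp add: e'_def field_simps)
    finally show ?thesis .
  qed
  ultimately show "\<exists>g l. g \<longlonglongrightarrow> l \<and>
      (\<forall>N\<ge>1. \<bar>(\<Sum>n\<in>{1..\<lfloor>real N * s\<rfloor>}. \<Sum>l\<in>{1..\<lfloor>real N * t\<rfloor>}. u (n - l)) / real N - g N\<bar> \<le> e) \<and>
      \<bar>l - min s t * infsum u UNIV\<bar> \<le> e"
    unfolding I_def by blast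
qed

text \<open>The fourfold sum is of smaller order than the square of the window size, uniformly over
  all finite windows. The second moment of the centred Stein kernel is such a sum divided by
  \<open>N\<^sup>2\<close>. The linear term absorbs the finitely many near lags and may have any
  coefficient depending on \<open>e\<close>.\<close>

definition small4 :: "(int \<Rightarrow> int \<Rightarrow> int \<Rightarrow> int \<Rightarrow> real) \<Rightarrow> bool" where
  "small4 f \<longleftrightarrow> (\<forall>e>0. \<exists>D\<ge>0. \<forall>I. finite I \<longrightarrow>
     (\<Sum>i\<in>I. \<Sum>j\<in>I. \<Sum>k\<in>I. \<Sum>l\<in>I. f i j k l) \<le> e * (real (card I))\<^sup>2 + D * real (card I))"

lemma small4_mono:
  assumes "small4 f" "\<And>i j k l. g i j k l \<le> f i j k l"
  shows "small4 g"
  unfolding small4_def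
proof (intro allI impI)
  fix e :: real assume "0 < e"
  then obtain D where D: "0 \<le> D" "\<And>I. finite I \<Longrightarrow>
     (\<Sum>i\<in>I. \<Sum>j\<in>I. \<Sum>k\<in>I. \<Sum>l\<in>I. f i j k l) \<le> e * (real (card I))\<^sup>2 + D * real (card I)"
    using assms(1) unfolding small4_def by meson
  have "(\<Sum>i\<in>I. \<Sum>j\<in>I. \<Sum>k\<in>I. \<Sum>l\<in>I. g i j k l) \<le> (\<Sum>i\<in>I. \<Sum>j\<in>I. \<Sum>k\<in>I. \<Sum>l\<in>I. f i j k l)" for I
    by (intro sum_mono assms(2))
  with D show "\<exists>D\<ge>0. \<forall>I. finite I \<longrightarrow>
     (\<Sum>i\<in>I. \<Sum>j\<in>I. \<Sum>k\<in>I. \<Sum>l\<in>I. g i j k l) \<le> e * (real (card I))\<^sup>2 + D * real (card I)"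
    by (meson order_trans)
qed

lemma small4_add:
  assumes "small4 f" "small4 g"
  shows "small4 (\<lambda>i j k l. f i j k l + g i j k l)"
  unfolding small4_def
proof (intro allI impI)
  fix e :: real assume "0 < e"
  then have "0 < e / 2" by simp
  with assms(1) obtain D where D: "0 \<le> D" "\<And>I. finite I \<Longrightarrow>
     (\<Sum>i\<in>I. \<Sum>j\<in>I. \<Sum>k\<in>I. \<Sum>l\<in>I. f i j k l) \<le> e / 2 * (real (card I))\<^sup>2 + D * real (card I)"
    unfolding small4_def by meson
  from \<open>0 < e / 2\<close> assms(2) obtain D' where D': "0 \<le> D'" "\<And>I. finite I \<Longrightarrow>
     (\<Sum>i\<in>I. \<Sum>j\<in>I. \<Sum>k\<in>I. \<Sum>l\<in>I. g i j k l) \<le> e / 2 * (real (card I))\<^sup>2 + D' * real (card I)"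
    unfolding small4_def by meson
  have "(\<Sum>i\<in>I. \<Sum>j\<in>I. \<Sum>k\<in>I. \<Sum>l\<in>I. f i j k l + g i j k l) \<le> e * (real (card I))\<^sup>2 + (D + D') * real (card I)"
    if "finite I" for I
    using add_mono[OF D(2)[OF that] D'(2)[OF that]] by (simp add: sum.distrib algebra_simps)
  with D D' show "\<exists>D\<ge>0. \<forall>I. finite I \<longrightarrow>
     (\<Sum>i\<in>I. \<Sum>j\<in>I. \<Sum>k\<in>I. \<Sum>l\<in>I. f i j k l + g i j k l) \<le> e * (real (card I))\<^sup>2 + D * real (card I)"
    by (intro exI[of _ "D + D'"]) auto
qed

lemma small4_zero: "small4 (\<lambda>i j k l. 0)"
  unfolding small4_def by (auto intro!: exI[of _ 0])

lemma small4_sum: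
  assumes "\<And>a. a \<in> S \<Longrightarrow> small4 (f a)"
  shows "small4 (\<lambda>i j k l. \<Sum>a\<in>S. f a i j k l)"
  using assms by (induction S rule: infinite_finite_induct) (simp_all add: small4_zero small4_add)

lemma small4_cmult:
  assumes "small4 f" "0 \<le> c"
  shows "small4 (\<lambda>i j k l. c * f i j k l)"
  unfolding small4_def
proof (intro allI impI)
  fix e :: real assume "0 < e"
  then have "0 < e / (c + 1)" using assms(2) by simp
  with assms(1) obtain D where D: "0 \<le> D" "\<And>I. finite I \<Longrightarrow>
     (\<Sum>i\<in>I. \<Sum>j\<in>I. \<Sum>k\<in>I. \<Sum>l\<in>I. f i j k l) \<le> e / (c + 1) * (real (card I))\<^sup>2 + D * real (card I)"
    unfolding small4_def by meson
  have "(\<Sum>i\<in>I. \<Sum>j\<in>I. \<Sum>k\<in>I. \<Sum>l\<in>I. c * f i j k l) \<le> e * (real (card I))\<^sup>2 + (c * D) * real (card I)"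
    if "finite I" for I
  proof -
    have "(\<Sum>i\<in>I. \<Sum>j\<in>I. \<Sum>k\<in>I. \<Sum>l\<in>I. c * f i j k l) = c * (\<Sum>i\<in>I. \<Sum>j\<in>I. \<Sum>k\<in>I. \<Sum>l\<in>I. f i j k l)"
      by (simp add: sum_distrib_left)
    also have "\<dots> \<le> c * (e / (c + 1) * (real (card I))\<^sup>2 + D * real (card I))"
      by (intro mult_left_mono D that assms(2))
    also have "\<dots> = (c * (e / (c + 1))) * (real (card I))\<^sup>2 + (c * D) * real (card I)"
      by (simp add: algebra_simps)
    also have "c * (e / (c + 1)) \<le> e" using assms(2) \<open>0 < e\<close> by (simp add: divide_le_eq field_simps)
    finally show ?thesis by (simp add: mult_right_mono)
  qed
  with D assms(2) show "\<exists>D\<ge>0. \<forall>I. finite I \<longrightarrow>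
     (\<Sum>i\<in>I. \<Sum>j\<in>I. \<Sum>k\<in>I. \<Sum>l\<in>I. c * f i j k l) \<le> e * (real (card I))\<^sup>2 + D * real (card I)"
    by (intro exI[of _ "c * D"]) auto
qed

text \<open>All four indices run over the same window, so renaming them only changes the order of
  summation. This symmetry and the next one yield the second cycle and the second path from the
  first.\<close>

lemma small4_swap34:
  assumes "small4 f"
  shows "small4 (\<lambda>i j k l. f i j l k)"
proof -
  have "(\<Sum>i\<in>I. \<Sum>j\<in>I. \<Sum>k\<in>I. \<Sum>l\<in>I. f i j l k) = (\<Sum>i\<in>I. \<Sum>j\<in>I. \<Sum>k\<in>I. \<Sum>l\<in>I. f i j k l)" for I
    by (rule sum.cong[OF refl], rule sum.cong[OF refl], rule sum.swap)
  then show ?thesis using assms unfolding small4_def by simp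
qed

lemma small4_swap_pairs:
  assumes "small4 f"
  shows "small4 (\<lambda>i j k l. f j i l k)"
proof -
  have "(\<Sum>i\<in>I. \<Sum>j\<in>I. \<Sum>k\<in>I. \<Sum>l\<in>I. f j i l k) = (\<Sum>i\<in>I. \<Sum>j\<in>I. \<Sum>k\<in>I. \<Sum>l\<in>I. f i j k l)" for I
  proof -
    have "(\<Sum>i\<in>I. \<Sum>j\<in>I. \<Sum>k\<in>I. \<Sum>l\<in>I. f j i l k) = (\<Sum>j\<in>I. \<Sum>i\<in>I. \<Sum>k\<in>I. \<Sum>l\<in>I. f j i l k)"
      by (rule sum.swap)
    also have "\<dots> = (\<Sum>j\<in>I. \<Sum>i\<in>I. \<Sum>l\<in>I. \<Sum>k\<in>I. f j i l k)"
      by (rule sum.cong[OF refl], rule sum.cong[OF refl], rule sum.swap)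
    finally show ?thesis .
  qed
  then show ?thesis using assms unfolding small4_def by simp
qed

text \<open>Young's inequality with a small constant. If \<open>x \<le> e * y\<close>, one factor
  \<open>x\<close> already supplies the \<open>e\<close>; otherwise \<open>y\<close> is at most
  \<open>x / e\<close> and can be replaced throughout, at the price of a large constant before
  \<open>x ^ m\<close>.\<close>

lemma young_eps:
  fixes x y e :: real
  assumes "0 \<le> x" "0 \<le> y" "0 < e" "e \<le> 1" "1 \<le> \<alpha>" "\<alpha> < m"
  shows "x ^ \<alpha> * y ^ (m - \<alpha>) \<le> e * y ^ m + (1 / e) ^ m * x ^ m"
proof (cases "x \<le> e * y")
  case True
  have "x ^ \<alpha> * y ^ (m - \<alpha>) \<le> (e * y) ^ \<alpha> * y ^ (m - \<alpha>)"
    using True assms by (intro mult_right_mono power_mono) auto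
  also have "\<dots> = e ^ \<alpha> * y ^ m" using assms by (simp add: power_mult_distrib flip: power_add)
  also have "\<dots> \<le> e ^ 1 * y ^ m" using assms by (intro mult_right_mono power_decreasing) auto
  finally show ?thesis using assms by (simp add: add_increasing2)
next
  case False
  then have "y \<le> 1 / e * x" using assms by (simp add: field_simps)
  then have "x ^ \<alpha> * y ^ (m - \<alpha>) \<le> x ^ \<alpha> * (1 / e * x) ^ (m - \<alpha>)"
    using assms by (intro mult_left_mono power_mono) auto
  also have "\<dots> = (1 / e) ^ (m - \<alpha>) * (x ^ \<alpha> * x ^ (m - \<alpha>))"
    unfolding power_mult_distrib by (simp only: ac_simps)
  also have "x ^ \<alpha> * x ^ (m - \<alpha>) = x ^ m" using assms by (simp flip: power_add)
  also have "(1 / e) ^ (m - \<alpha>) * x ^ m \<le> (1 / e) ^ m * x ^ m"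
    using assms by (intro mult_right_mono power_increasing) auto
  finally show ?thesis using assms by (simp add: add_increasing)
qed

lemma sum4_product:
  fixes p q :: "int \<Rightarrow> real"
  shows "(\<Sum>i\<in>I. \<Sum>j\<in>I. \<Sum>k\<in>I. \<Sum>l\<in>I. p (i - j) * q (k - l)) =
    (\<Sum>i\<in>I. \<Sum>j\<in>I. p (i - j)) * (\<Sum>k\<in>I. \<Sum>l\<in>I. q (k - l))"
proof -
  have 1: "(\<Sum>i\<in>I. \<Sum>j\<in>I. p (i - j)) * Q = (\<Sum>i\<in>I. \<Sum>j\<in>I. p (i - j) * Q)" for Q
    by (simp add: sum_distrib_right)
  have 2: "P * (\<Sum>k\<in>I. \<Sum>l\<in>I. q (k - l)) = (\<Sum>k\<in>I. \<Sum>l\<in>I. P * q (k - l))" for P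
    by (simp add: sum_distrib_left)
  show ?thesis
    unfolding 1 by (rule sum.cong[OF refl], rule sum.cong[OF refl], rule 2[symmetric])
qed

text \<open>The estimates produce \<open>e\<close> times a constant \<open>A\<close> made of sums of
  the series; rescaling the tolerance absorbs it. Tolerances up to 1 suffice and fit
  \<open>young_eps\<close>.\<close>

lemma small4_leI:
  assumes "\<And>e. 0 < e \<Longrightarrow> e \<le> 1 \<Longrightarrow> \<exists>D. \<forall>I. finite I \<longrightarrow>
     (\<Sum>i\<in>I. \<Sum>j\<in>I. \<Sum>k\<in>I. \<Sum>l\<in>I. f i j k l) \<le> e * A * (real (card I))\<^sup>2 + D * real (card I)"
  shows "small4 f"
  unfolding small4_def
proof (intro allI impI)
  fix e :: real assume e: "0 < e"
  define e' where "e' = min 1 (e / (\<bar>A\<bar> + 1))"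
  have e': "0 < e'" "e' \<le> 1" using e by (auto simp: e'_def)
  have "e' * A \<le> e' * (\<bar>A\<bar> + 1)" using e' by (intro mult_left_mono) auto
  also have "\<dots> \<le> e / (\<bar>A\<bar> + 1) * (\<bar>A\<bar> + 1)" by (intro mult_right_mono) (auto simp: e'_def)
  also have "\<dots> = e" by (simp add: add_nonneg_eq_0_iff)
  finally have eA: "e' * A \<le> e" .
  obtain D where D: "\<And>I. finite I \<Longrightarrow>
     (\<Sum>i\<in>I. \<Sum>j\<in>I. \<Sum>k\<in>I. \<Sum>l\<in>I. f i j k l) \<le> e' * A * (real (card I))\<^sup>2 + D * real (card I)"
    using assms[OF e'] by blast
  have "(\<Sum>i\<in>I. \<Sum>j\<in>I. \<Sum>k\<in>I. \<Sum>l\<in>I. f i j k l) \<le> e * (real (card I))\<^sup>2 + \<bar>D\<bar> * real (card I)" if "finite I" for I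
    by (rule order_trans[OF D[OF that]]) (intro add_mono mult_right_mono eA, auto)
  then show "\<exists>D\<ge>0. \<forall>I. finite I \<longrightarrow>
     (\<Sum>i\<in>I. \<Sum>j\<in>I. \<Sum>k\<in>I. \<Sum>l\<in>I. f i j k l) \<le> e * (real (card I))\<^sup>2 + D * real (card I)"
    by (intro exI[of _ "\<bar>D\<bar>"]) auto
qed

text \<open>Summing first over the end points \<open>j\<close> and \<open>l\<close> costs a factor
  \<open>A\<close> each. What is left is \<open>g (i - k)\<close> summed over pairs, and
  \<open>g\<close> is at most \<open>e\<close> at all but finitely many lags.\<close>

lemma small4_path:
  fixes g :: "int \<Rightarrow> real"
  assumes m: "m \<noteq> 0" and g: "\<And>h. 0 \<le> g h" "\<And>h. g h \<le> 1" and sm: "(\<lambda>h. g h ^ m) summable_on UNIV"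
  shows "small4 (\<lambda>i j k l. (g (i - j) * g (k - l)) ^ m * g (i - k))"
proof (rule small4_leI)
  fix e :: real assume e: "0 < e" "e \<le> 1"
  define A where "A = infsum (\<lambda>h. g h ^ m) UNIV"
  have A: "0 \<le> A" unfolding A_def by (intro infsum_nonneg) (simp add: g)
  \<comment> \<open>The threshold \<open>e ^ m\<close> for the tail of \<open>g ^ m\<close> makes
    \<open>g\<close> itself at most \<open>e\<close> outside \<open>F\<close>.\<close>
  obtain F where F: "finite F" "(\<lambda>x. if x \<in> F then 0 else g x ^ m) summable_on UNIV"
    "infsum (\<lambda>x. if x \<in> F then 0 else g x ^ m) UNIV \<le> e ^ m"
    using infsum_outside_small[OF sm, of "e ^ m"] g(1) e by auto
  have out: "g h ^ m \<le> e ^ m" if "h \<notin> F" for h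
  proof -
    have "(\<Sum>x\<in>{h}. if x \<in> F then 0 else g x ^ m) \<le> infsum (\<lambda>x. if x \<in> F then 0 else g x ^ m) UNIV"
      by (rule finite_sum_le_infsum[OF F(2)]) (auto simp: g)
    with F(3) that show ?thesis by simp
  qed
  have g_le: "g h ^ m' * w \<le> w" if "0 \<le> w" for h m' w
    using g that by (simp add: mult_left_le_one_le power_le_one)
  show "\<exists>D. \<forall>I. finite I \<longrightarrow> (\<Sum>i\<in>I. \<Sum>j\<in>I. \<Sum>k\<in>I. \<Sum>l\<in>I. (g (i - j) * g (k - l)) ^ m * g (i - k)) \<le>
     e * (A * A) * (real (card I))\<^sup>2 + D * real (card I)"
  proof -
    from m have g_small: "g h \<le> e" if "h \<notin> F" for h
      using out[OF that] g(1)[of h] e by (metis less_imp_le not_gr0 power_mono_iff)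
    show ?thesis
    proof (intro exI allI impI)
      fix I :: "int set" assume I: "finite I"
      have rows: "(\<Sum>l\<in>I. g (i - l) ^ m) \<le> A" for i
        unfolding A_def by (rule sum_diff_le_infsum[OF sm _ I]) (simp add: g)
      have "(\<Sum>i\<in>I. \<Sum>j\<in>I. \<Sum>k\<in>I. \<Sum>l\<in>I. (g (i - j) * g (k - l)) ^ m * g (i - k)) =
          (\<Sum>i\<in>I. \<Sum>k\<in>I. (\<Sum>j\<in>I. g (i - j) ^ m) * (\<Sum>l\<in>I. g (k - l) ^ m) * g (i - k))"
      proof (rule sum.cong[OF refl])
        fix i
        have "(\<Sum>j\<in>I. \<Sum>k\<in>I. \<Sum>l\<in>I. (g (i - j) * g (k - l)) ^ m * g (i - k)) =
            (\<Sum>k\<in>I. \<Sum>j\<in>I. \<Sum>l\<in>I. (g (i - j) * g (k - l)) ^ m * g (i - k))" by (rule sum.swap)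
        also have "\<dots> = (\<Sum>k\<in>I. (\<Sum>j\<in>I. g (i - j) ^ m) * (\<Sum>l\<in>I. g (k - l) ^ m) * g (i - k))"
          unfolding sum_product by (simp only: sum_distrib_right power_mult_distrib)
        finally show "(\<Sum>j\<in>I. \<Sum>k\<in>I. \<Sum>l\<in>I. (g (i - j) * g (k - l)) ^ m * g (i - k)) =
            (\<Sum>k\<in>I. (\<Sum>j\<in>I. g (i - j) ^ m) * (\<Sum>l\<in>I. g (k - l) ^ m) * g (i - k))" .
      qed
      also have "\<dots> \<le> (\<Sum>i\<in>I. \<Sum>k\<in>I. (A * A) * (e + indicator F (i - k)))"
      proof (intro sum_mono mult_mono)
        fix i k
        show "g (i - k) \<le> e + indicator F (i - k)"
          using g_small[of "i - k"] g(2)[of "i - k"] e by (cases "i - k \<in> F") auto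
      qed (use A rows g in \<open>auto intro!: sum_nonneg mult_nonneg_nonneg\<close>)
      also have "\<dots> = (A * A) * ((\<Sum>i\<in>I. \<Sum>k\<in>I. e) + (\<Sum>i\<in>I. \<Sum>k\<in>I. indicator F (i - k)))"
        by (simp only: sum.distrib[symmetric] sum_distrib_left)
      also have "\<dots> \<le> (A * A) * (e * (real (card I))\<^sup>2 + real (card I) * real (card F))"
      proof (intro mult_left_mono add_mono)
        show "(\<Sum>i\<in>I. \<Sum>k\<in>I. e) \<le> e * (real (card I))\<^sup>2" by (simp add: power2_eq_square ac_simps)
        have "(\<lambda>h. indicator F h :: real) summable_on UNIV"
          by (rule finite_nonzero_values_imp_summable_on)
            (rule finite_subset[OF _ F(1)], auto simp: indicator_def split: if_splits)
        moreover have "infsum (\<lambda>h. indicator F h :: real) UNIV = real (card F)"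
          using F(1) by (subst infsum_cong_neutral[where T = F and g = "\<lambda>_. 1"]) auto
        ultimately show "(\<Sum>i\<in>I. \<Sum>k\<in>I. indicator F (i - k)) \<le> real (card I) * real (card F)"
          using double_sum_le_infsum[of "indicator F" I I] I by simp
      qed (use A in auto)
      finally show "(\<Sum>i\<in>I. \<Sum>j\<in>I. \<Sum>k\<in>I. \<Sum>l\<in>I. (g (i - j) * g (k - l)) ^ m * g (i - k)) \<le>
          e * (A * A) * (real (card I))\<^sup>2 + (A * A * real (card F)) * real (card I)"
        by (simp add: algebra_simps)
    qed
  qed
qed

text \<open>For \<open>x = g (i - j) * g (k - l)\<close> and \<open>y = g (i - l) * g (j - k)\<close>, the \<open>m\<close>-th power of \<open>x\<close> is
  concentrated near \<open>i = j\<close>, where \<open>y ^ m\<close> contributes only linearly.\<close>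

lemma small4_cycle:
  fixes g :: "int \<Rightarrow> real"
  assumes g: "\<And>h. 0 \<le> g h" and sm: "(\<lambda>h. g h ^ m) summable_on UNIV" and \<alpha>: "1 \<le> \<alpha>" "\<alpha> < m"
  shows "small4 (\<lambda>i j k l. (g (i - j) * g (k - l)) ^ \<alpha> * (g (i - l) * g (j - k)) ^ (m - \<alpha>))"
proof (rule small4_leI)
  fix e :: real assume e: "0 < e" "e \<le> 1"
  define A where "A = infsum (\<lambda>h. g h ^ m) UNIV"
  have A: "0 \<le> A" unfolding A_def by (intro infsum_nonneg) (simp add: g)
  define K where "K = (1 / e) ^ m"
  have K: "0 < K" using e by (simp add: K_def)
  \<comment> \<open>The tail is multiplied by the large constant \<open>K\<close> below, so it is
    made as small as \<open>e / K\<close>.\<close>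
  obtain F where F: "finite F" "(\<lambda>x. if x \<in> F then 0 else g x ^ m) summable_on UNIV"
    "infsum (\<lambda>x. if x \<in> F then 0 else g x ^ m) UNIV \<le> e / K"
    using infsum_outside_small[OF sm, of "e / K"] g e K by auto
  define w where "w x = (if x \<in> F then 0 else g x ^ m)" for x
  have pw: "(g (i - j) * g (k - l)) ^ \<alpha> * (g (i - l) * g (j - k)) ^ (m - \<alpha>) \<le>
      e * (g (i - j) ^ m * g (k - l) ^ m) + e * (g (i - l) ^ m * g (j - k) ^ m) +
      K * (w (i - j) * g (k - l) ^ m) + K * (indicator F (i - j) * (g (i - l) ^ m * g (j - k) ^ m))" for i j k l
  proof -
    define x y where "x = g (i - j) * g (k - l)" and "y = g (i - l) * g (j - k)"
    have xy: "0 \<le> x" "0 \<le> y" using g by (auto simp: x_def y_def)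
    \<comment> \<open>Young's inequality is used in both directions: far lags of
      \<open>i - j\<close> put the large constant on \<open>x ^ m\<close>, where the tail is small,
      and near lags put it on \<open>y ^ m\<close>, where few pairs occur.\<close>
    have 1: "x ^ \<alpha> * y ^ (m - \<alpha>) \<le> e * y ^ m + K * x ^ m"
      unfolding K_def by (rule young_eps[OF xy e \<alpha>])
    have 2: "x ^ \<alpha> * y ^ (m - \<alpha>) \<le> e * x ^ m + K * y ^ m"
      unfolding K_def using young_eps[OF xy(2,1) e, of "m - \<alpha>" m] \<alpha> by (simp add: mult.commute)
    have "0 \<le> e * x ^ m" "0 \<le> e * y ^ m" using xy e by auto
    with 1 2 have "x ^ \<alpha> * y ^ (m - \<alpha>) \<le> e * x ^ m + e * y ^ m + K * (if i - j \<in> F then 0 else x ^ m) + K * (indicator F (i - j) * y ^ m)"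
      by (cases "i - j \<in> F") auto
    then show ?thesis by (cases "i - j \<in> F") (auto simp: x_def y_def w_def power_mult_distrib)
  qed
  show "\<exists>D. \<forall>I. finite I \<longrightarrow>
     (\<Sum>i\<in>I. \<Sum>j\<in>I. \<Sum>k\<in>I. \<Sum>l\<in>I. (g (i - j) * g (k - l)) ^ \<alpha> * (g (i - l) * g (j - k)) ^ (m - \<alpha>)) \<le>
     e * (2 * A * A + A) * (real (card I))\<^sup>2 + D * real (card I)"
  proof (intro exI allI impI)
    fix I :: "int set" assume I: "finite I"
    let ?n = "real (card I)"
    define G where "G = (\<Sum>i\<in>I. \<Sum>j\<in>I. g (i - j) ^ m)"
    have G: "0 \<le> G" "G \<le> ?n * A"
      unfolding G_def A_def using double_sum_le_infsum[OF sm _ I I] by (auto intro!: sum_nonneg simp: g)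
    have rows: "(\<Sum>l\<in>I. g (i - l) ^ m) \<le> A" for i
      unfolding A_def by (rule sum_diff_le_infsum[OF sm _ I]) (simp add: g)
    have 1: "(\<Sum>i\<in>I. \<Sum>j\<in>I. \<Sum>k\<in>I. \<Sum>l\<in>I. g (i - j) ^ m * g (k - l) ^ m) = G * G"
      unfolding G_def by (rule sum4_product)
    have 2: "(\<Sum>i\<in>I. \<Sum>j\<in>I. \<Sum>k\<in>I. \<Sum>l\<in>I. g (i - l) ^ m * g (j - k) ^ m) = G * G"
    proof -
      have "(\<Sum>i\<in>I. \<Sum>j\<in>I. \<Sum>k\<in>I. \<Sum>l\<in>I. g (i - l) ^ m * g (j - k) ^ m) =
          (\<Sum>i\<in>I. (\<Sum>l\<in>I. g (i - l) ^ m) * (\<Sum>j\<in>I. \<Sum>k\<in>I. g (j - k) ^ m))"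
        by (intro sum.cong refl) (simp add: sum_distrib_left sum_distrib_right)
      then show ?thesis by (simp add: G_def sum_distrib_right)
    qed
    have 3: "(\<Sum>i\<in>I. \<Sum>j\<in>I. \<Sum>k\<in>I. \<Sum>l\<in>I. w (i - j) * g (k - l) ^ m) \<le> (?n * (e / K)) * (?n * A)"
    proof -
      have "(\<Sum>i\<in>I. \<Sum>j\<in>I. \<Sum>k\<in>I. \<Sum>l\<in>I. w (i - j) * g (k - l) ^ m) = (\<Sum>i\<in>I. \<Sum>j\<in>I. w (i - j)) * G"
        unfolding G_def by (rule sum4_product)
      also have "\<dots> \<le> (?n * (e / K)) * (?n * A)"
      proof (intro mult_mono G)
        have "(\<Sum>i\<in>I. \<Sum>j\<in>I. w (i - j)) \<le> ?n * infsum w UNIV"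
          using F(2) g by (intro double_sum_le_infsum I) (auto simp: w_def[abs_def])
        also have "\<dots> \<le> ?n * (e / K)" using F(3) by (intro mult_left_mono) (auto simp: w_def[abs_def])
        finally show "(\<Sum>i\<in>I. \<Sum>j\<in>I. w (i - j)) \<le> ?n * (e / K)" .
      qed (use e K in auto)
      finally show ?thesis .
    qed
    have 4: "(\<Sum>i\<in>I. \<Sum>j\<in>I. \<Sum>k\<in>I. \<Sum>l\<in>I. indicator F (i - j) * (g (i - l) ^ m * g (j - k) ^ m)) \<le> ?n * real (card F) * (A * A)"
    proof -
      have "(\<Sum>i\<in>I. \<Sum>j\<in>I. \<Sum>k\<in>I. \<Sum>l\<in>I. indicator F (i - j) * (g (i - l) ^ m * g (j - k) ^ m)) =
          (\<Sum>i\<in>I. \<Sum>j\<in>I. indicator F (i - j) * ((\<Sum>l\<in>I. g (i - l) ^ m) * (\<Sum>k\<in>I. g (j - k) ^ m)))"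
        by (intro sum.cong refl) (simp add: sum_distrib_left sum_distrib_right)
      also have "\<dots> \<le> (\<Sum>i\<in>I. \<Sum>j\<in>I. indicator F (i - j) * (A * A))"
        by (intro sum_mono mult_left_mono mult_mono rows) (auto intro!: sum_nonneg simp: g A)
      also have "\<dots> = (\<Sum>i\<in>I. \<Sum>j\<in>I. indicator F (i - j)) * (A * A)"
        by (simp only: sum_distrib_right)
      also have "\<dots> \<le> ?n * real (card F) * (A * A)"
      proof (intro mult_right_mono)
        have "(\<lambda>h. indicator F h :: real) summable_on UNIV"
          by (rule finite_nonzero_values_imp_summable_on)
            (rule finite_subset[OF _ F(1)], auto simp: indicator_def split: if_splits)
        moreover have "infsum (\<lambda>h. indicator F h :: real) UNIV = real (card F)"
          using F(1) by (subst infsum_cong_neutral[where T = F and g = "\<lambda>_. 1"]) auto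
        ultimately show "(\<Sum>i\<in>I. \<Sum>k\<in>I. indicator F (i - k)) \<le> ?n * real (card F)"
          using double_sum_le_infsum[of "indicator F" I I] I by simp
      qed (use A in auto)
      finally show ?thesis .
    qed
    have "(\<Sum>i\<in>I. \<Sum>j\<in>I. \<Sum>k\<in>I. \<Sum>l\<in>I. (g (i - j) * g (k - l)) ^ \<alpha> * (g (i - l) * g (j - k)) ^ (m - \<alpha>)) \<le>
        (\<Sum>i\<in>I. \<Sum>j\<in>I. \<Sum>k\<in>I. \<Sum>l\<in>I. e * (g (i - j) ^ m * g (k - l) ^ m) + e * (g (i - l) ^ m * g (j - k) ^ m) +
          K * (w (i - j) * g (k - l) ^ m) + K * (indicator F (i - j) * (g (i - l) ^ m * g (j - k) ^ m)))"
      by (intro sum_mono pw)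
    also have "\<dots> = e * (\<Sum>i\<in>I. \<Sum>j\<in>I. \<Sum>k\<in>I. \<Sum>l\<in>I. g (i - j) ^ m * g (k - l) ^ m) +
        e * (\<Sum>i\<in>I. \<Sum>j\<in>I. \<Sum>k\<in>I. \<Sum>l\<in>I. g (i - l) ^ m * g (j - k) ^ m) + K * (\<Sum>i\<in>I. \<Sum>j\<in>I. \<Sum>k\<in>I. \<Sum>l\<in>I. w (i - j) * g (k - l) ^ m) +
        K * (\<Sum>i\<in>I. \<Sum>j\<in>I. \<Sum>k\<in>I. \<Sum>l\<in>I. indicator F (i - j) * (g (i - l) ^ m * g (j - k) ^ m))"
      by (simp only: sum.distrib sum_distrib_left)
    also have "\<dots> \<le> e * ((?n * A) * (?n * A)) + e * ((?n * A) * (?n * A)) + K * ((?n * (e / K)) * (?n * A)) +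
        K * (?n * real (card F) * (A * A))"
      unfolding 1 2 using G e K A by (intro add_mono mult_left_mono mult_mono 3 4) auto
    also have "\<dots> = e * (2 * A * A + A) * ?n\<^sup>2 + (K * real (card F) * (A * A)) * ?n"
      using K by (simp add: power2_eq_square algebra_simps)
    finally show "(\<Sum>i\<in>I. \<Sum>j\<in>I. \<Sum>k\<in>I. \<Sum>l\<in>I. (g (i - j) * g (k - l)) ^ \<alpha> * (g (i - l) * g (j - k)) ^ (m - \<alpha>)) \<le>
        e * (2 * A * A + A) * ?n\<^sup>2 + (K * real (card F) * (A * A)) * ?n" .
  qed
qed

section \<open>The central limit theorem for finite Hermite expansions\<close>

context std_gauss
begin

definition chaos_sum :: "'i set \<Rightarrow> nat set \<Rightarrow> ('i \<Rightarrow> nat \<Rightarrow> real) \<Rightarrow> 'a \<Rightarrow> real" where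
  "chaos_sum I K \<beta> \<omega> = (\<Sum>n\<in>I. \<Sum>m\<in>K. \<beta> n m * hermite m (X n \<omega>))"

text \<open>In Malliavin calculus this is the inner product of the derivative of \<open>S\<close>
  with the derivative of the inverse number operator applied to \<open>S\<close>; that operator
  explains why the factor \<open>q\<close> occurs without a factor \<open>m\<close>.\<close>

definition stein_kernel :: "'i set \<Rightarrow> nat set \<Rightarrow> ('i \<Rightarrow> nat \<Rightarrow> real) \<Rightarrow> 'a \<Rightarrow> real" where
  "stein_kernel I K \<beta> \<omega> = (\<Sum>n\<in>I. \<Sum>m\<in>K. \<Sum>l\<in>I. \<Sum>q\<in>K.
     \<beta> n m * \<beta> l q * real q * (r n l * (hermite (m - 1) (X n \<omega>) * hermite (q - 1) (X l \<omega>))))"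

lemma chaos_sum_measurable [measurable]: "chaos_sum I K \<beta> \<in> borel_measurable M"
  unfolding chaos_sum_def[abs_def] by measurable

lemma stein_kernel_measurable [measurable]: "stein_kernel I K \<beta> \<in> borel_measurable M"
  unfolding stein_kernel_def[abs_def] by measurable

lemma integrable_hermite2: "integrable M (\<lambda>\<omega>. hermite a (X i \<omega>) * hermite b (X j \<omega>))"
  by (rule L2_X_mult(1)[OF hermite_L2 hermite_L2])

lemma integrable_stein_kernel: "integrable M (stein_kernel I K \<beta>)"
  unfolding stein_kernel_def[abs_def]
  by (intro Bochner_Integration.integrable_sum integrable_mult_right integrable_hermite2)

lemma integrable_chaos_sum_sq: "integrable M (\<lambda>\<omega>. (chaos_sum I K \<beta> \<omega>)\<^sup>2)"
proof -
  have "(chaos_sum I K \<beta> \<omega>)\<^sup>2 = (\<Sum>n\<in>I. \<Sum>l\<in>I. \<Sum>m\<in>K. \<Sum>q\<in>K. (\<beta> n m * \<beta> l q) * (hermite m (X n \<omega>) * hermite q (X l \<omega>)))" for \<omega>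
    unfolding chaos_sum_def power2_eq_square sum_product by (simp add: ac_simps)
  then show ?thesis
    by (simp only:) (intro Bochner_Integration.integrable_sum integrable_mult_right integrable_hermite2)
qed

text \<open>Orthogonality leaves equal degrees, and \<open>q * fact (q - 1)\<close> is
  \<open>fact q\<close>. The right-hand side is the variance of the chaos sum, which ties the kernel
  to the limit variance.\<close>

lemma expectation_stein_kernel:
  assumes "finite K" "0 \<notin> K"
  shows "expectation (stein_kernel I K \<beta>) = (\<Sum>n\<in>I. \<Sum>l\<in>I. \<Sum>m\<in>K. \<beta> n m * \<beta> l m * fact m * r n l ^ m)"
proof -
  have "expectation (stein_kernel I K \<beta>) = (\<Sum>n\<in>I. \<Sum>m\<in>K. \<Sum>l\<in>I. \<Sum>q\<in>K.
      \<beta> n m * \<beta> l q * real q * (r n l * expectation (\<lambda>\<omega>. hermite (m - 1) (X n \<omega>) * hermite (q - 1) (X l \<omega>))))"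
    unfolding stein_kernel_def[abs_def] using integrable_hermite2 by simp
  also have "\<dots> = (\<Sum>n\<in>I. \<Sum>m\<in>K. \<Sum>l\<in>I. \<Sum>q\<in>K. if m = q then \<beta> n m * \<beta> l m * fact m * r n l ^ m else 0)"
  proof (intro sum.cong refl)
    fix n m l q assume "m \<in> K" "q \<in> K"
    with assms have "m \<noteq> 0" "q \<noteq> 0" by (metis)+
    then obtain m' q' where "m = Suc m'" "q = Suc q'" by (metis not0_implies_Suc)
    then show "\<beta> n m * \<beta> l q * real q * (r n l * expectation (\<lambda>\<omega>. hermite (m - 1) (X n \<omega>) * hermite (q - 1) (X l \<omega>))) =
        (if m = q then \<beta> n m * \<beta> l m * fact m * r n l ^ m else 0)"
      by (simp add: expectation_hermite2)
  qed
  also have "\<dots> = (\<Sum>n\<in>I. \<Sum>m\<in>K. \<Sum>l\<in>I. \<beta> n m * \<beta> l m * fact m * r n l ^ m)"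
    using assms(1) by (intro sum.cong refl) simp
  also have "\<dots> = (\<Sum>n\<in>I. \<Sum>l\<in>I. \<Sum>m\<in>K. \<beta> n m * \<beta> l m * fact m * r n l ^ m)"
    by (rule sum.cong[OF refl], rule sum.swap)
  finally show ?thesis .
qed

text \<open>Integration by parts takes one degree off each Hermite factor and differentiates the
  exponential instead, which brings down \<open>\<i> * \<theta>\<close> and the derivative of the
  sum along \<open>r n\<close>. Collecting the terms gives the kernel.\<close>

lemma stein_identity:
  assumes I: "finite I" and K: "finite K" "0 \<notin> K"
  shows "expectation (\<lambda>\<omega>. of_real (chaos_sum I K \<beta> \<omega>) * cis (\<theta> * chaos_sum I K \<beta> \<omega>)) =
    \<i> * of_real \<theta> * expectation (\<lambda>\<omega>. of_real (stein_kernel I K \<beta> \<omega>) * cis (\<theta> * chaos_sum I K \<beta> \<omega>))"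
proof -
  define s where "s x = \<theta> * (\<Sum>n\<in>I. \<Sum>m\<in>K. \<beta> n m * hermite m (x n))" for x :: "'i \<Rightarrow> real"
  define s' where "s' n x = \<theta> * (\<Sum>l\<in>I. \<Sum>q\<in>K. \<beta> l q * (r n l * (real q * hermite (q - 1) (x l))))" for n and x :: "'i \<Rightarrow> real"
  let ?c = "\<lambda>\<omega>. cis (\<theta> * chaos_sum I K \<beta> \<omega>)"
  have tame: "tame_deriv I (r n) (\<lambda>x. of_real (s x)) (\<lambda>x. of_real (s' n x))" for n
  proof -
    have "tame_deriv I (r n) (\<lambda>x. of_real \<theta> * (\<Sum>n\<in>I. \<Sum>m\<in>K. of_real (\<beta> n m) * of_real (hermite m (x n))))
        (\<lambda>x. of_real \<theta> * (\<Sum>l\<in>I. \<Sum>q\<in>K. of_real (\<beta> l q) * of_real (r n l * (real q * hermite (q - 1) (x l)))))"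
      by (intro tame_deriv_cmult tame_deriv_sum tame_deriv_hermite I)
    then show ?thesis by (simp add: s_def s'_def)
  qed
  have X_s: "s (\<lambda>i\<in>I. X i \<omega>) = \<theta> * chaos_sum I K \<beta> \<omega>" for \<omega>
    by (simp add: s_def chaos_sum_def)
  have int_c: "integrable M (\<lambda>\<omega>. of_real (f \<omega>) * ?c \<omega>)" if "integrable M f" for f
  proof -
    have [measurable]: "cis \<in> borel_measurable borel"
      by (intro borel_measurable_continuous_onI continuous_intros)
    have [measurable]: "f \<in> borel_measurable M" using that by simp
    show ?thesis by (rule Bochner_Integration.integrable_bound[OF that]) (auto simp: norm_mult)
  qed
  have int_H: "integrable M (\<lambda>\<omega>. hermite m (X n \<omega>))" for m n
    using integrable_hermite2[of m n 0 n] by simp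
  have trm: "expectation (\<lambda>\<omega>. of_real (hermite m (X n \<omega>)) * ?c \<omega>) =
      (\<Sum>l\<in>I. \<Sum>q\<in>K. \<i> * of_real \<theta> * of_real (\<beta> l q * real q * r n l) *
        expectation (\<lambda>\<omega>. of_real (hermite (m - 1) (X n \<omega>) * hermite (q - 1) (X l \<omega>)) * ?c \<omega>))"
    if n: "n \<in> I" and m: "m \<in> K" for n m
  proof -
    from m K obtain m' where m': "m = Suc m'" by (metis not0_implies_Suc)
    have "expectation (\<lambda>\<omega>. of_real (hermite (Suc m') (X n \<omega>)) * cis (s (\<lambda>i\<in>I. X i \<omega>))) =
        expectation (\<lambda>\<omega>. of_real (hermite m' (X n \<omega>)) * (\<i> * of_real (s' n (\<lambda>i\<in>I. X i \<omega>)) * cis (s (\<lambda>i\<in>I. X i \<omega>))))"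
      by (rule hermite_integration_by_parts[OF I n tame_deriv_cis[OF tame]])
    then have "expectation (\<lambda>\<omega>. of_real (hermite m (X n \<omega>)) * ?c \<omega>) =
        expectation (\<lambda>\<omega>. of_real (hermite m' (X n \<omega>)) * (\<i> * of_real (s' n (\<lambda>i\<in>I. X i \<omega>)) * ?c \<omega>))"
      unfolding X_s m' .
    also have "\<dots> = expectation (\<lambda>\<omega>. \<Sum>l\<in>I. \<Sum>q\<in>K. \<i> * of_real \<theta> * of_real (\<beta> l q * real q * r n l) *
        (of_real (hermite (m - 1) (X n \<omega>) * hermite (q - 1) (X l \<omega>)) * ?c \<omega>))"
      unfolding s'_def m' by (intro Bochner_Integration.integral_cong refl)
        (simp add: sum_distrib_left sum_distrib_right ac_simps)
    also have "\<dots> = (\<Sum>l\<in>I. \<Sum>q\<in>K. \<i> * of_real \<theta> * of_real (\<beta> l q * real q * r n l) *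
        expectation (\<lambda>\<omega>. of_real (hermite (m - 1) (X n \<omega>) * hermite (q - 1) (X l \<omega>)) * ?c \<omega>))"
    proof -
      have "integrable M (\<lambda>\<omega>. c * (of_real (hermite (m - 1) (X n \<omega>) * hermite (q - 1) (X l \<omega>)) * ?c \<omega>))" for c l q
        by (intro integrable_mult_right int_c integrable_hermite2)
      then show ?thesis
        by (simp only: Bochner_Integration.integral_sum Bochner_Integration.integrable_sum integral_mult_right_zero)
    qed
    finally show ?thesis .
  qed
  have "expectation (\<lambda>\<omega>. of_real (chaos_sum I K \<beta> \<omega>) * ?c \<omega>) =
      expectation (\<lambda>\<omega>. \<Sum>n\<in>I. \<Sum>m\<in>K. of_real (\<beta> n m) * (of_real (hermite m (X n \<omega>)) * ?c \<omega>))"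
    by (intro Bochner_Integration.integral_cong refl)
      (simp add: chaos_sum_def[of I K \<beta>] sum_distrib_right mult.assoc)
  also have "\<dots> = (\<Sum>n\<in>I. \<Sum>m\<in>K. of_real (\<beta> n m) * expectation (\<lambda>\<omega>. of_real (hermite m (X n \<omega>)) * ?c \<omega>))"
  proof -
    have "integrable M (\<lambda>\<omega>. c * (of_real (hermite m (X n \<omega>)) * ?c \<omega>))" for c m n
      by (intro integrable_mult_right int_c int_H)
    then show ?thesis
      by (simp only: Bochner_Integration.integral_sum Bochner_Integration.integrable_sum integral_mult_right_zero)
  qed
  also have "\<dots> = (\<Sum>n\<in>I. \<Sum>m\<in>K. of_real (\<beta> n m) * (\<Sum>l\<in>I. \<Sum>q\<in>K. \<i> * of_real \<theta> * of_real (\<beta> l q * real q * r n l) *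
        expectation (\<lambda>\<omega>. of_real (hermite (m - 1) (X n \<omega>) * hermite (q - 1) (X l \<omega>)) * ?c \<omega>)))"
    by (rule sum.cong[OF refl], rule sum.cong[OF refl]) (simp only: trm)
  also have "\<dots> = (\<Sum>n\<in>I. \<Sum>m\<in>K. \<Sum>l\<in>I. \<Sum>q\<in>K. \<i> * of_real \<theta> * (of_real (\<beta> n m * \<beta> l q * real q * r n l) *
        expectation (\<lambda>\<omega>. of_real (hermite (m - 1) (X n \<omega>) * hermite (q - 1) (X l \<omega>)) * ?c \<omega>)))"
    unfolding sum_distrib_left by (intro sum.cong refl) (simp add: ac_simps)
  also have "\<dots> = \<i> * of_real \<theta> * (\<Sum>n\<in>I. \<Sum>m\<in>K. \<Sum>l\<in>I. \<Sum>q\<in>K. of_real (\<beta> n m * \<beta> l q * real q * r n l) *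
        expectation (\<lambda>\<omega>. of_real (hermite (m - 1) (X n \<omega>) * hermite (q - 1) (X l \<omega>)) * ?c \<omega>))"
    by (simp only: sum_distrib_left)
  also have "(\<Sum>n\<in>I. \<Sum>m\<in>K. \<Sum>l\<in>I. \<Sum>q\<in>K. of_real (\<beta> n m * \<beta> l q * real q * r n l) *
        expectation (\<lambda>\<omega>. of_real (hermite (m - 1) (X n \<omega>) * hermite (q - 1) (X l \<omega>)) * ?c \<omega>)) =
      expectation (\<lambda>\<omega>. \<Sum>n\<in>I. \<Sum>m\<in>K. \<Sum>l\<in>I. \<Sum>q\<in>K. of_real (\<beta> n m * \<beta> l q * real q * r n l) *
        (of_real (hermite (m - 1) (X n \<omega>) * hermite (q - 1) (X l \<omega>)) * ?c \<omega>))"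
  proof -
    have "integrable M (\<lambda>\<omega>. c * (of_real (hermite (m - 1) (X n \<omega>) * hermite (q - 1) (X l \<omega>)) * ?c \<omega>))" for c m n l q
      by (intro integrable_mult_right int_c integrable_hermite2)
    then show ?thesis
      by (simp only: Bochner_Integration.integral_sum Bochner_Integration.integrable_sum integral_mult_right_zero)
  qed
  also have "\<dots> = expectation (\<lambda>\<omega>. of_real (stein_kernel I K \<beta> \<omega>) * ?c \<omega>)"
    by (intro Bochner_Integration.integral_cong refl)
      (simp add: stein_kernel_def sum_distrib_left sum_distrib_right ac_simps)
  finally show ?thesis .
qed

end

text \<open>Summability of the \<open>k\<close>-th power is all that the limit theorems draw from
  the long memory formula; \<open>k\<close> is to be the smallest of the ranks.\<close>

locale stat_gauss = std_gauss M X "\<lambda>i j. \<gamma> (i - j)" for M :: "'a measure" and X and \<gamma> :: "int \<Rightarrow> real" +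
  fixes k :: nat
  assumes k_pos: "1 \<le> k" and \<gamma>_summable: "(\<lambda>n. \<bar>\<gamma> n\<bar> ^ k) summable_on UNIV"
begin

lemma \<gamma>_le_1: "\<bar>\<gamma> n\<bar> \<le> 1"
  using r_le_1[of n 0] by simp

lemma \<gamma>_power_summable: "k \<le> m \<Longrightarrow> (\<lambda>n. \<bar>\<gamma> n\<bar> ^ m) summable_on UNIV"
  by (rule summable_on_comparison_test[OF \<gamma>_summable]) (auto intro!: power_decreasing \<gamma>_le_1)

text \<open>The two prefactors are the additional edges 12 and 34 of \<open>gweight_bound\<close>.
  That bound leaves cycles and paths with exponent \<open>m \<ge> k\<close>, for which the
  \<open>m\<close>-th power is summable; evenness of \<gamma> identifies the remaining two shapes
  with those already treated.\<close>

lemma small4_gsum: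
  assumes "k \<le> Suc (min p q)"
  shows "small4 (\<lambda>i j n l. \<bar>\<gamma> (i - j)\<bar> * \<bar>\<gamma> (n - l)\<bar> * gsum True p i q j p n q l)"
proof -
  define m where "m = Suc (min p q)"
  define g where "g h = \<bar>\<gamma> h\<bar>" for h
  have g: "\<And>h. 0 \<le> g h" "\<And>h. g h \<le> 1" by (auto simp: g_def \<gamma>_le_1)
  have g_even: "g (i - j) = g (j - i)" for i j using r_sym[of i j] by (simp add: g_def)
  have sm: "(\<lambda>h. g h ^ m) summable_on UNIV" unfolding g_def by (rule \<gamma>_power_summable) (use assms m_def in simp)
  have cyc: "small4 (\<lambda>i j n l. (g (i - j) * g (n - l)) ^ \<alpha> * (g (i - l) * g (j - n)) ^ (m - \<alpha>))" if "\<alpha> \<in> {1..<m}" for \<alpha>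
    using that by (intro small4_cycle g sm) auto
  have cyc': "small4 (\<lambda>i j n l. (g (i - j) * g (n - l)) ^ \<alpha> * (g (i - n) * g (j - l)) ^ (m - \<alpha>))" if "\<alpha> \<in> {1..<m}" for \<alpha>
    using small4_swap34[OF cyc[OF that]] by (simp add: g_even)
  have m0: "m \<noteq> 0" by (simp add: m_def)
  have path: "small4 (\<lambda>i j n l. (g (i - j) * g (n - l)) ^ m * g (i - n))"
    by (rule small4_path[OF m0 g sm])
  have path': "small4 (\<lambda>i j n l. (g (i - j) * g (n - l)) ^ m * g (j - l))"
    using small4_swap_pairs[OF path] by (simp add: g_even)
  define B where "B i j n l = (\<Sum>\<alpha>\<in>{1..<m}. (g (i - j) * g (n - l)) ^ \<alpha> * (g (i - l) * g (j - n)) ^ (m - \<alpha>)) +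
      (\<Sum>\<alpha>\<in>{1..<m}. (g (i - j) * g (n - l)) ^ \<alpha> * (g (i - n) * g (j - l)) ^ (m - \<alpha>)) +
      ((g (i - j) * g (n - l)) ^ m * g (i - n) + (g (i - j) * g (n - l)) ^ m * g (j - l))" for i j n l
  have B: "small4 B"
    unfolding B_def[abs_def] by (intro small4_add small4_sum cyc cyc' path path')
  show ?thesis
  proof (rule small4_mono[OF small4_cmult[OF B, of "real (card (graphs4 True p q p q))"]])
    fix i j n l
    have "g (i - j) * g (n - l) * gsum True p i q j p n q l = (\<Sum>e\<in>graphs4 True p q p q. g (i - j) * g (n - l) * gweight i j n l e)"
      by (simp add: gsum_def sum_distrib_left)
    also have "\<dots> \<le> (\<Sum>e\<in>graphs4 True p q p q. B i j n l)"
      using gweight_bound[OF _ m_def, where i = i and j = j and k = n and l = l]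
      unfolding B_def g_def by (intro sum_mono) (simp add: distrib_left)
    finally show "\<bar>\<gamma> (i - j)\<bar> * \<bar>\<gamma> (n - l)\<bar> * gsum True p i q j p n q l \<le> real (card (graphs4 True p q p q)) * B i j n l"
      by (simp add: g_def)
  qed simp
qed

text \<open>Expanding the square gives covariances of products of two Hermite polynomials, hence
  graph sums. The constant \<open>D\<close> is chosen before the window and the weights, so that one
  constant serves all sample sizes.\<close>

lemma variance_product_sum:
  assumes "k \<le> Suc (min p q)" "0 \<le> W" "0 < e"
  shows "\<exists>D\<ge>0. \<forall>I w. finite I \<longrightarrow> (\<forall>n\<in>I. \<forall>l\<in>I. \<bar>w n l\<bar> \<le> W) \<longrightarrow>
    expectation (\<lambda>\<omega>. (\<Sum>n\<in>I. \<Sum>l\<in>I. w n l * \<gamma> (n - l) * (hermite p (X n \<omega>) * hermite q (X l \<omega>) -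
      expectation (\<lambda>\<omega>. hermite p (X n \<omega>) * hermite q (X l \<omega>))))\<^sup>2) \<le> e * (real (card I))\<^sup>2 + D * real (card I)"
proof -
  obtain C where C: "0 \<le> C" "\<And>i j n l. \<bar>hmom p i q j p n q l - hmom p i q j 0 i 0 i * hmom p n q l 0 i 0 i\<bar> \<le> C * gsum True p i q j p n q l"
    using hmom_cov_bound[of p q p q] by blast
  have "small4 (\<lambda>i j n l. (W * W * C) * (\<bar>\<gamma> (i - j)\<bar> * \<bar>\<gamma> (n - l)\<bar> * gsum True p i q j p n q l))"
    using assms C by (intro small4_cmult small4_gsum) auto
  then obtain D where D: "0 \<le> D" "\<And>I. finite I \<Longrightarrow> (\<Sum>i\<in>I. \<Sum>j\<in>I. \<Sum>n\<in>I. \<Sum>l\<in>I. (W * W * C) * (\<bar>\<gamma> (i - j)\<bar> * \<bar>\<gamma> (n - l)\<bar> * gsum True p i q j p n q l)) \<le>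
      e * (real (card I))\<^sup>2 + D * real (card I)"
    using assms(3) unfolding small4_def by meson
  have "expectation (\<lambda>\<omega>. (\<Sum>n\<in>I. \<Sum>l\<in>I. w n l * \<gamma> (n - l) * (hermite p (X n \<omega>) * hermite q (X l \<omega>) -
      expectation (\<lambda>\<omega>. hermite p (X n \<omega>) * hermite q (X l \<omega>))))\<^sup>2) \<le> e * (real (card I))\<^sup>2 + D * real (card I)"
    if I: "finite I" and w: "\<forall>n\<in>I. \<forall>l\<in>I. \<bar>w n l\<bar> \<le> W" for I w
  proof -
    define Y where "Y n l \<omega> = hermite p (X n \<omega>) * hermite q (X l \<omega>)" for n l \<omega>
    define E where "E n l = expectation (Y n l)" for n l
    have E: "E n l = (if p = q then fact p * \<gamma> (n - l) ^ p else 0)" for n l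
      unfolding E_def Y_def[abs_def] by (rule expectation_hermite2)
    have int_Y: "integrable M (Y n l)" for n l unfolding Y_def[abs_def] by (rule integrable_hermite2)
    have int_YY: "integrable M (\<lambda>\<omega>. Y i j \<omega> * Y n l \<omega>)" for i j n l
      using integrable_hermite4[of p i q j p n q l] by (simp add: Y_def ac_simps)
    have YY: "expectation (\<lambda>\<omega>. Y i j \<omega> * Y n l \<omega>) = hmom p i q j p n q l" for i j n l
      unfolding Y_def hmom_def by (simp add: ac_simps)
    have cov: "expectation (\<lambda>\<omega>. (Y i j \<omega> - E i j) * (Y n l \<omega> - E n l)) = hmom p i q j p n q l - E i j * E n l"
      "integrable M (\<lambda>\<omega>. (Y i j \<omega> - E i j) * (Y n l \<omega> - E n l))" for i j n l
    proof -
      have "(\<lambda>\<omega>. (Y i j \<omega> - E i j) * (Y n l \<omega> - E n l)) = (\<lambda>\<omega>. Y i j \<omega> * Y n l \<omega> - E n l * Y i j \<omega> - E i j * Y n l \<omega> + E i j * E n l)"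
        by (auto simp: algebra_simps)
      then show "expectation (\<lambda>\<omega>. (Y i j \<omega> - E i j) * (Y n l \<omega> - E n l)) = hmom p i q j p n q l - E i j * E n l"
        "integrable M (\<lambda>\<omega>. (Y i j \<omega> - E i j) * (Y n l \<omega> - E n l))"
        using int_Y int_YY by (simp_all add: YY E_def[symmetric] prob_space)
    qed
    have "(\<Sum>n\<in>I. \<Sum>l\<in>I. w n l * \<gamma> (n - l) * (Y n l \<omega> - E n l))\<^sup>2 =
        (\<Sum>i\<in>I. \<Sum>j\<in>I. \<Sum>n\<in>I. \<Sum>l\<in>I. (w i j * \<gamma> (i - j) * (w n l * \<gamma> (n - l))) * ((Y i j \<omega> - E i j) * (Y n l \<omega> - E n l)))" for \<omega>
    proof -
      have prod: "(\<Sum>i\<in>I. \<Sum>j\<in>I. f i j) * (\<Sum>n\<in>I. \<Sum>l\<in>I. f n l) = (\<Sum>i\<in>I. \<Sum>j\<in>I. \<Sum>n\<in>I. \<Sum>l\<in>I. f i j * f n l)" for f :: "int \<Rightarrow> int \<Rightarrow> real"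
        unfolding sum_distrib_right by (simp only: sum_distrib_left)
      show ?thesis unfolding power2_eq_square prod by (simp add: ac_simps)
    qed
    then have "expectation (\<lambda>\<omega>. (\<Sum>n\<in>I. \<Sum>l\<in>I. w n l * \<gamma> (n - l) * (Y n l \<omega> - E n l))\<^sup>2) =
        (\<Sum>i\<in>I. \<Sum>j\<in>I. \<Sum>n\<in>I. \<Sum>l\<in>I. (w i j * \<gamma> (i - j) * (w n l * \<gamma> (n - l))) * (hmom p i q j p n q l - E i j * E n l))"
      using cov by (simp add: Bochner_Integration.integral_sum)
    also have "\<dots> \<le> (\<Sum>i\<in>I. \<Sum>j\<in>I. \<Sum>n\<in>I. \<Sum>l\<in>I. (W * W * C) * (\<bar>\<gamma> (i - j)\<bar> * \<bar>\<gamma> (n - l)\<bar> * gsum True p i q j p n q l))"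
    proof (intro sum_mono)
      fix i j n l assume ijnl: "i \<in> I" "j \<in> I" "n \<in> I" "l \<in> I"
      have "(w i j * \<gamma> (i - j) * (w n l * \<gamma> (n - l))) * (hmom p i q j p n q l - E i j * E n l) \<le>
          (\<bar>w i j\<bar> * \<bar>w n l\<bar>) * (\<bar>\<gamma> (i - j)\<bar> * \<bar>\<gamma> (n - l)\<bar>) * \<bar>hmom p i q j p n q l - E i j * E n l\<bar>"
        by (rule order_trans[OF abs_ge_self]) (simp add: abs_mult ac_simps)
      also have "\<dots> \<le> (W * W) * (\<bar>\<gamma> (i - j)\<bar> * \<bar>\<gamma> (n - l)\<bar>) * (C * gsum True p i q j p n q l)"
        using w ijnl C(2)[of i j n l, unfolded hmom2] assms(2)
        by (intro mult_mono) (auto simp: E intro!: mult_nonneg_nonneg)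
      finally show "(w i j * \<gamma> (i - j) * (w n l * \<gamma> (n - l))) * (hmom p i q j p n q l - E i j * E n l) \<le>
          (W * W * C) * (\<bar>\<gamma> (i - j)\<bar> * \<bar>\<gamma> (n - l)\<bar> * gsum True p i q j p n q l)"
        by (simp add: ac_simps)
    qed
    also have "\<dots> \<le> e * (real (card I))\<^sup>2 + D * real (card I)" by (rule D(2)[OF I])
    finally show ?thesis unfolding Y_def E_def .
  qed
  then show ?thesis using D(1) by blast
qed

text \<open>Coefficients of size \<open>1 / sqrt N\<close> make the centred kernel a window sum
  divided by \<open>N\<close>, whose second moment vanishes by \<open>variance_product_sum\<close>.
  Coefficients that vary with the index allow several functions and time points to share one
  sum.\<close>

lemma chaos_clt:
  fixes \<beta> :: "nat \<Rightarrow> int \<Rightarrow> nat \<Rightarrow> real"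
  assumes I: "\<And>N. finite (I N)" "\<And>N. real (card (I N)) \<le> c * real N"
    and K: "finite K" "\<And>m. m \<in> K \<Longrightarrow> k \<le> m"
    and \<beta>: "\<And>N n m. n \<in> I N \<Longrightarrow> m \<in> K \<Longrightarrow> \<bar>\<beta> N n m\<bar> \<le> W / sqrt (real N)"
    and \<tau>: "(\<lambda>N. \<Sum>n\<in>I N. \<Sum>l\<in>I N. \<Sum>m\<in>K. \<beta> N n m * \<beta> N l m * fact m * \<gamma> (n - l) ^ m) \<longlonglongrightarrow> \<tau>"
  shows "(\<lambda>N. expectation (\<lambda>\<omega>. cis (chaos_sum (I N) K (\<beta> N) \<omega>))) \<longlonglongrightarrow> of_real (exp (- \<tau> / 2))"
proof -
  have K0: "0 \<notin> K" using K(2)[of 0] k_pos by auto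
  define \<tau>' where "\<tau>' N = (\<Sum>n\<in>I N. \<Sum>l\<in>I N. \<Sum>m\<in>K. \<beta> N n m * \<beta> N l m * fact m * \<gamma> (n - l) ^ m)" for N
  define T where "T N = stein_kernel (I N) K (\<beta> N)" for N
  have ET: "expectation (T N) = \<tau>' N" for N
    unfolding T_def \<tau>'_def by (rule expectation_stein_kernel[OF K(1) K0])
  \<comment> \<open>The centred kernel is split by the pair of degrees, so that each piece involves
    one product of two Hermite polynomials.\<close>
  define V where "V N m q \<omega> = (\<Sum>n\<in>I N. \<Sum>l\<in>I N. (\<beta> N n m * \<beta> N l q * real q) * \<gamma> (n - l) *
      (hermite (m - 1) (X n \<omega>) * hermite (q - 1) (X l \<omega>) - expectation (\<lambda>\<omega>. hermite (m - 1) (X n \<omega>) * hermite (q - 1) (X l \<omega>))))" for N m q \<omega>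
  have T_split: "T N \<omega> - \<tau>' N = (\<Sum>m\<in>K. \<Sum>q\<in>K. V N m q \<omega>)" for N \<omega>
  proof -
    have swap: "(\<Sum>n\<in>I N. \<Sum>m\<in>K. \<Sum>l\<in>I N. \<Sum>q\<in>K. f n m l q) = (\<Sum>m\<in>K. \<Sum>q\<in>K. \<Sum>n\<in>I N. \<Sum>l\<in>I N. f n m l q)" for f :: "int \<Rightarrow> nat \<Rightarrow> int \<Rightarrow> nat \<Rightarrow> real"
    proof -
      have "(\<Sum>n\<in>I N. \<Sum>m\<in>K. \<Sum>l\<in>I N. \<Sum>q\<in>K. f n m l q) = (\<Sum>m\<in>K. \<Sum>n\<in>I N. \<Sum>l\<in>I N. \<Sum>q\<in>K. f n m l q)"
        by (rule sum.swap)
      also have "\<dots> = (\<Sum>m\<in>K. \<Sum>n\<in>I N. \<Sum>q\<in>K. \<Sum>l\<in>I N. f n m l q)"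
        by (rule sum.cong[OF refl], rule sum.cong[OF refl], rule sum.swap)
      also have "\<dots> = (\<Sum>m\<in>K. \<Sum>q\<in>K. \<Sum>n\<in>I N. \<Sum>l\<in>I N. f n m l q)"
        by (rule sum.cong[OF refl], rule sum.swap)
      finally show ?thesis .
    qed
    have 1: "T N \<omega> = (\<Sum>m\<in>K. \<Sum>q\<in>K. \<Sum>n\<in>I N. \<Sum>l\<in>I N. (\<beta> N n m * \<beta> N l q * real q) * \<gamma> (n - l) * (hermite (m - 1) (X n \<omega>) * hermite (q - 1) (X l \<omega>)))" for \<omega>
      unfolding T_def stein_kernel_def swap by (simp add: ac_simps)
    have 2: "\<tau>' N = (\<Sum>m\<in>K. \<Sum>q\<in>K. \<Sum>n\<in>I N. \<Sum>l\<in>I N. (\<beta> N n m * \<beta> N l q * real q) * \<gamma> (n - l) * expectation (\<lambda>\<omega>. hermite (m - 1) (X n \<omega>) * hermite (q - 1) (X l \<omega>)))"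
    proof -
      have "\<tau>' N = expectation (T N)" by (simp add: ET)
      also have "\<dots> = expectation (\<lambda>\<omega>. \<Sum>m\<in>K. \<Sum>q\<in>K. \<Sum>n\<in>I N. \<Sum>l\<in>I N. (\<beta> N n m * \<beta> N l q * real q) * \<gamma> (n - l) * (hermite (m - 1) (X n \<omega>) * hermite (q - 1) (X l \<omega>)))"
        by (intro Bochner_Integration.integral_cong refl) (rule 1)
      finally show ?thesis using integrable_hermite2 by simp
    qed
    show ?thesis unfolding 1 2 V_def by (simp add: sum_subtractf right_diff_distrib)
  qed
  have V_int: "integrable M (\<lambda>\<omega>. (V N m q \<omega>)\<^sup>2)" "V N m q \<in> borel_measurable M" for N m q
  proof -
    show "V N m q \<in> borel_measurable M" unfolding V_def[abs_def] by measurable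
    define a where "a n l = (\<beta> N n m * \<beta> N l q * real q) * \<gamma> (n - l)" for n l
    define E where "E n l = expectation (\<lambda>\<omega>. hermite (m - 1) (X n \<omega>) * hermite (q - 1) (X l \<omega>))" for n l
    define Y where "Y n l \<omega> = hermite (m - 1) (X n \<omega>) * hermite (q - 1) (X l \<omega>)" for n l \<omega>
    have int: "integrable M (\<lambda>\<omega>. (Y i j \<omega> - E i j) * (Y n l \<omega> - E n l))" for i j n l
    proof -
      have "(\<lambda>\<omega>. (Y i j \<omega> - E i j) * (Y n l \<omega> - E n l)) = (\<lambda>\<omega>. Y i j \<omega> * Y n l \<omega> - E n l * Y i j \<omega> - E i j * Y n l \<omega> + E i j * E n l)"
        by (auto simp: algebra_simps)
      moreover have "integrable M (\<lambda>\<omega>. Y i j \<omega> * Y n l \<omega>)"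
        using integrable_hermite4[of "m - 1" i "q - 1" j "m - 1" n "q - 1" l] by (simp add: Y_def ac_simps)
      moreover have "integrable M (Y n l)" for n l unfolding Y_def[abs_def] by (rule integrable_hermite2)
      ultimately show ?thesis by simp
    qed
    have "(V N m q \<omega>)\<^sup>2 = (\<Sum>i\<in>I N. \<Sum>j\<in>I N. \<Sum>n\<in>I N. \<Sum>l\<in>I N. (a i j * a n l) * ((Y i j \<omega> - E i j) * (Y n l \<omega> - E n l)))" for \<omega>
    proof -
      have prod: "(\<Sum>i\<in>I N. \<Sum>j\<in>I N. f i j) * (\<Sum>n\<in>I N. \<Sum>l\<in>I N. f n l) = (\<Sum>i\<in>I N. \<Sum>j\<in>I N. \<Sum>n\<in>I N. \<Sum>l\<in>I N. f i j * f n l)" for f :: "int \<Rightarrow> int \<Rightarrow> real"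
        unfolding sum_distrib_right by (simp only: sum_distrib_left)
      have "V N m q \<omega> = (\<Sum>n\<in>I N. \<Sum>l\<in>I N. a n l * (Y n l \<omega> - E n l))"
        by (simp add: V_def a_def Y_def E_def)
      then show ?thesis unfolding power2_eq_square prod by (simp only: prod) (simp add: ac_simps)
    qed
    then show "integrable M (\<lambda>\<omega>. (V N m q \<omega>)\<^sup>2)" using int by simp
  qed
  have V_lim: "(\<lambda>N. expectation (\<lambda>\<omega>. \<bar>V N m q \<omega>\<bar>)) \<longlonglongrightarrow> 0" if mq: "m \<in> K" "q \<in> K" for m q
  proof -
    define W' where "W' = W * W * real q"
    have W': "0 \<le> W'" by (simp add: W'_def)
    have "k \<le> m" "k \<le> q" using K(2) mq by auto
    \<comment> \<open>The kernel has lowered degrees \<open>m - 1\<close> and \<open>q - 1\<close>;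
      the edge supplied by \<open>\<gamma> (n - l)\<close> restores the exponent to at least
      \<open>k\<close>.\<close>
    then have kmq: "k \<le> Suc (min (m - 1) (q - 1))" using k_pos by simp
    have "(\<lambda>N. expectation (\<lambda>\<omega>. (V N m q \<omega>)\<^sup>2)) \<longlonglongrightarrow> 0"
    proof (rule tendsto_by_approximation)
      fix e :: real assume e: "0 < e"
      define e' where "e' = e / (\<bar>c\<bar> + 1)\<^sup>2"
      have e': "0 < e'" using e by (simp add: e'_def)
      obtain D where D: "0 \<le> D" "\<And>I w. finite I \<Longrightarrow> (\<forall>n\<in>I. \<forall>l\<in>I. \<bar>w n l\<bar> \<le> W') \<Longrightarrow>
        expectation (\<lambda>\<omega>. (\<Sum>n\<in>I. \<Sum>l\<in>I. w n l * \<gamma> (n - l) * (hermite (m - 1) (X n \<omega>) * hermite (q - 1) (X l \<omega>) -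
          expectation (\<lambda>\<omega>. hermite (m - 1) (X n \<omega>) * hermite (q - 1) (X l \<omega>))))\<^sup>2) \<le> e' * (real (card I))\<^sup>2 + D * real (card I)"
        using variance_product_sum[OF kmq W' e'] by blast
      have bound: "\<bar>expectation (\<lambda>\<omega>. (V N m q \<omega>)\<^sup>2) - D * \<bar>c\<bar> / real N\<bar> \<le> e + D * \<bar>c\<bar> / real N" if N: "N \<ge> 1" for N
      proof -
        define w where "w n l = real N * (\<beta> N n m * \<beta> N l q * real q)" for n l
        have w: "\<bar>w n l\<bar> \<le> W'" if "n \<in> I N" "l \<in> I N" for n l
        proof -
          have "\<bar>\<beta> N n m\<bar> * \<bar>\<beta> N l q\<bar> \<le> (W / sqrt (real N)) * (W / sqrt (real N))"
            using \<beta>[OF that(1) mq(1)] \<beta>[OF that(2) mq(2)] by (intro mult_mono) auto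
          also have "\<dots> = W * W / real N" by simp
          finally have "(\<bar>\<beta> N n m\<bar> * \<bar>\<beta> N l q\<bar>) * (real N * real q) \<le> (W * W / real N) * (real N * real q)"
            by (intro mult_right_mono) auto
          then show ?thesis using N by (simp add: w_def W'_def abs_mult ac_simps)
        qed
        have V_w: "V N m q \<omega> = (\<Sum>n\<in>I N. \<Sum>l\<in>I N. w n l * \<gamma> (n - l) * (hermite (m - 1) (X n \<omega>) * hermite (q - 1) (X l \<omega>) -
          expectation (\<lambda>\<omega>. hermite (m - 1) (X n \<omega>) * hermite (q - 1) (X l \<omega>)))) / real N" for \<omega>
          unfolding V_def w_def sum_divide_distrib using N by (intro sum.cong refl) simp
        have cN: "real (card (I N)) \<le> \<bar>c\<bar> * real N"
          by (rule order_trans[OF I(2)]) (intro mult_right_mono, auto)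
        have "expectation (\<lambda>\<omega>. (V N m q \<omega>)\<^sup>2) = expectation (\<lambda>\<omega>. (\<Sum>n\<in>I N. \<Sum>l\<in>I N. w n l * \<gamma> (n - l) * (hermite (m - 1) (X n \<omega>) * hermite (q - 1) (X l \<omega>) -
          expectation (\<lambda>\<omega>. hermite (m - 1) (X n \<omega>) * hermite (q - 1) (X l \<omega>))))\<^sup>2) / (real N)\<^sup>2"
          unfolding V_w power_divide by simp
        also have "\<dots> \<le> (e' * (real (card (I N)))\<^sup>2 + D * real (card (I N))) / (real N)\<^sup>2"
          using w by (intro divide_right_mono D(2) I) auto
        also have "\<dots> \<le> (e' * (\<bar>c\<bar> * real N)\<^sup>2 + D * (\<bar>c\<bar> * real N)) / (real N)\<^sup>2"
          using cN e' D(1) by (intro divide_right_mono add_mono mult_left_mono power_mono) auto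
        also have "\<dots> = e' * \<bar>c\<bar>\<^sup>2 + D * \<bar>c\<bar> / real N"
          using N by (simp add: field_simps power2_eq_square)
        also have "e' * \<bar>c\<bar>\<^sup>2 \<le> e' * (\<bar>c\<bar> + 1)\<^sup>2" using e' by (intro mult_left_mono power_mono) auto
        also have "\<dots> = e" by (simp add: e'_def add_nonneg_eq_0_iff)
        finally have up: "expectation (\<lambda>\<omega>. (V N m q \<omega>)\<^sup>2) \<le> e + D * \<bar>c\<bar> / real N" by simp
        have "0 \<le> expectation (\<lambda>\<omega>. (V N m q \<omega>)\<^sup>2)" by (auto intro: integral_nonneg_AE)
        moreover have "0 \<le> D * \<bar>c\<bar> / real N" using D(1) by simp
        ultimately show ?thesis using up e by linarith
      qed
      show "\<exists>g l. g \<longlonglongrightarrow> l \<and> (\<forall>N\<ge>1. \<bar>expectation (\<lambda>\<omega>. (V N m q \<omega>)\<^sup>2) - g N\<bar> \<le> e) \<and> \<bar>l - 0\<bar> \<le> e"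
      proof (intro exI conjI allI impI)
        \<comment> \<open>The comparison sequence is the excess of the second moment over
          \<open>e\<close>: it stays within \<open>e\<close> of the moment and is at most
          \<open>2 * D * \<bar>c\<bar> / N\<close>.\<close>
        show "(\<lambda>N. max 0 (expectation (\<lambda>\<omega>. (V N m q \<omega>)\<^sup>2) - e)) \<longlonglongrightarrow> 0"
        proof (rule tendsto_sandwich[OF _ _ tendsto_const])
          show "\<forall>\<^sub>F N in sequentially. max 0 (expectation (\<lambda>\<omega>. (V N m q \<omega>)\<^sup>2) - e) \<le> 2 * D * \<bar>c\<bar> / real N"
            using eventually_ge_at_top[of 1]
          proof eventually_elim
            case (elim N)
            have "0 \<le> D * \<bar>c\<bar> / real N" using D(1) by simp
            then show ?case using bound[OF elim] by (simp add: max_def) linarith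
          qed
          show "(\<lambda>N. 2 * D * \<bar>c\<bar> / real N) \<longlonglongrightarrow> 0" by (rule lim_const_over_n)
        qed auto
        fix N :: nat
        have "0 \<le> expectation (\<lambda>\<omega>. (V N m q \<omega>)\<^sup>2)" by (auto intro: integral_nonneg_AE)
        then show "\<bar>expectation (\<lambda>\<omega>. (V N m q \<omega>)\<^sup>2) - max 0 (expectation (\<lambda>\<omega>. (V N m q \<omega>)\<^sup>2) - e)\<bar> \<le> e"
          using e by (auto simp: max_def)
      qed (use e in simp)
    qed
    from tendsto_real_sqrt[OF this]
    have "(\<lambda>N. sqrt (expectation (\<lambda>\<omega>. (V N m q \<omega>)\<^sup>2))) \<longlonglongrightarrow> 0" by simp
    then show ?thesis
    proof (rule tendsto_sandwich[OF _ _ tendsto_const, rotated 2])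
      show "\<forall>\<^sub>F N in sequentially. expectation (\<lambda>\<omega>. \<bar>V N m q \<omega>\<bar>) \<le> sqrt (expectation (\<lambda>\<omega>. (V N m q \<omega>)\<^sup>2))"
        by (intro always_eventually allI expectation_abs_le_sqrt(2) V_int)
    qed (auto intro!: always_eventually)
  qed
  have T_lim: "(\<lambda>N. expectation (\<lambda>\<omega>. \<bar>T N \<omega> - \<tau>' N\<bar>)) \<longlonglongrightarrow> 0"
  proof (rule tendsto_sandwich[OF _ _ tendsto_const])
    have int_V: "integrable M (\<lambda>\<omega>. \<bar>V N m q \<omega>\<bar>)" for N m q
      by (rule integrable_abs[OF expectation_abs_le_sqrt(1)[OF V_int(2) V_int(1)]])
    have "expectation (\<lambda>\<omega>. \<bar>T N \<omega> - \<tau>' N\<bar>) \<le> (\<Sum>m\<in>K. \<Sum>q\<in>K. expectation (\<lambda>\<omega>. \<bar>V N m q \<omega>\<bar>))" for N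
    proof -
      have "expectation (\<lambda>\<omega>. \<bar>T N \<omega> - \<tau>' N\<bar>) \<le> expectation (\<lambda>\<omega>. \<Sum>m\<in>K. \<Sum>q\<in>K. \<bar>V N m q \<omega>\<bar>)"
      proof (rule integral_mono)
        show "integrable M (\<lambda>\<omega>. \<bar>T N \<omega> - \<tau>' N\<bar>)" unfolding T_def
          by (intro integrable_abs Bochner_Integration.integrable_diff integrable_stein_kernel) simp
        show "\<bar>T N \<omega> - \<tau>' N\<bar> \<le> (\<Sum>m\<in>K. \<Sum>q\<in>K. \<bar>V N m q \<omega>\<bar>)" for \<omega>
          unfolding T_split by (rule order_trans[OF sum_abs]) (intro sum_mono sum_abs)
      qed (intro Bochner_Integration.integrable_sum int_V)
      then show ?thesis using int_V by simp
    qed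
    then show "\<forall>\<^sub>F N in sequentially. expectation (\<lambda>\<omega>. \<bar>T N \<omega> - \<tau>' N\<bar>) \<le> (\<Sum>m\<in>K. \<Sum>q\<in>K. expectation (\<lambda>\<omega>. \<bar>V N m q \<omega>\<bar>))"
      by simp
    show "(\<lambda>N. \<Sum>m\<in>K. \<Sum>q\<in>K. expectation (\<lambda>\<omega>. \<bar>V N m q \<omega>\<bar>)) \<longlonglongrightarrow> 0"
      by (intro tendsto_null_sum V_lim)
  qed (auto intro!: always_eventually)
  have \<tau>_lim: "\<tau>' \<longlonglongrightarrow> \<tau>" using \<tau> by (simp add: \<tau>'_def[abs_def])
  have stein: "norm (expectation (\<lambda>\<omega>. cis (chaos_sum (I N) K (\<beta> N) \<omega>)) - of_real (exp (- \<tau>' N / 2))) \<le>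
      exp \<bar>\<tau>' N\<bar> * expectation (\<lambda>\<omega>. \<bar>T N \<omega> - \<tau>' N\<bar>)" for N
    unfolding T_def
    by (intro stein_char_bound integrable_stein_kernel integrable_chaos_sum_sq stein_identity I K(1) K0) simp_all
  have "(\<lambda>N. expectation (\<lambda>\<omega>. cis (chaos_sum (I N) K (\<beta> N) \<omega>)) - of_real (exp (- \<tau>' N / 2))) \<longlonglongrightarrow> 0"
  proof (rule Lim_null_comparison[OF always_eventually])
    show "\<forall>N. norm (expectation (\<lambda>\<omega>. cis (chaos_sum (I N) K (\<beta> N) \<omega>)) - of_real (exp (- \<tau>' N / 2))) \<le>
      exp \<bar>\<tau>' N\<bar> * expectation (\<lambda>\<omega>. \<bar>T N \<omega> - \<tau>' N\<bar>)" using stein by blast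
    show "(\<lambda>N. exp \<bar>\<tau>' N\<bar> * expectation (\<lambda>\<omega>. \<bar>T N \<omega> - \<tau>' N\<bar>)) \<longlonglongrightarrow> 0"
      using tendsto_mult[OF tendsto_exp[OF tendsto_rabs[OF \<tau>_lim]] T_lim] by simp
  qed
  moreover have "(\<lambda>N. complex_of_real (exp (- \<tau>' N / 2))) \<longlonglongrightarrow> of_real (exp (- \<tau> / 2))"
    by (intro tendsto_intros \<tau>_lim) simp
  ultimately show ?thesis using tendsto_add by fastforce
qed

end

section \<open>Growth of slowly varying functions\<close>

text \<open>At each fixed shift \<open>u\<close> the indicator of the exceptional set is eventually
  0; dominated convergence on a bounded interval turns this into small measure along the sequence
  \<open>y\<close>.\<close>

lemma additive_exceptional_measure:
  fixes h :: "real \<Rightarrow> real"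
  assumes [measurable]: "h \<in> borel_measurable borel" and h: "\<And>u. ((\<lambda>y. h (y + u) - h y) \<longlongrightarrow> 0) at_top"
    and y: "filterlim y at_top sequentially" and e: "0 < e"
  shows "(\<lambda>n. measure lborel {u\<in>{0..2}. e \<le> \<bar>h (y n + u) - h (y n)\<bar>}) \<longlonglongrightarrow> 0"
proof -
  define S where "S n = {u\<in>{0..2::real}. e \<le> \<bar>h (y n + u) - h (y n)\<bar>}" for n :: nat
  have [measurable]: "S n \<in> sets borel" for n unfolding S_def by measurable
  have "(\<lambda>n. integral\<^sup>L lborel (indicator (S n) :: real \<Rightarrow> real)) \<longlonglongrightarrow> integral\<^sup>L lborel (\<lambda>_::real. 0)"
  proof (rule integral_dominated_convergence[where s = "\<lambda>n. indicator (S n)" and f = "\<lambda>_. 0" and w = "indicator {0..2::real}"])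
    show "AE u in lborel. (\<lambda>n. indicator (S n) u :: real) \<longlonglongrightarrow> 0"
    proof (intro AE_I2 tendsto_eventually)
      fix u
      have "((\<lambda>n. h (y n + u) - h (y n)) \<longlongrightarrow> 0) sequentially"
        by (rule filterlim_compose[OF h y])
      from tendstoD[OF this e] show "\<forall>\<^sub>F n in sequentially. indicator (S n) u = (0::real)"
        by eventually_elim (auto simp: S_def dist_real_def)
    qed
  qed (auto simp: S_def indicator_def)
  then show ?thesis by (simp add: S_def)
qed

text \<open>The uniform convergence theorem of Karamata theory, in additive form: two sets of almost
  full measure in an interval of length 3 must meet.\<close>

lemma additive_uniform_convergence:
  fixes h :: "real \<Rightarrow> real"
  assumes hm: "h \<in> borel_measurable borel" and h: "\<And>u. ((\<lambda>y. h (y + u) - h y) \<longlongrightarrow> 0) at_top" and e: "0 < e"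
  shows "\<exists>y1. \<forall>y\<ge>y1. \<forall>u\<in>{0..1}. \<bar>h (y + u) - h y\<bar> < e"
proof (rule ccontr)
  note [measurable] = hm
  assume "\<not> ?thesis"
  then have "\<forall>y1. \<exists>y u. y1 \<le> y \<and> u \<in> {0..1} \<and> e \<le> \<bar>h (y + u) - h y\<bar>"
    by (metis not_less)
  then have "\<forall>n::nat. \<exists>y u. real n \<le> y \<and> u \<in> {0..1} \<and> e \<le> \<bar>h (y + u) - h y\<bar>"
    by blast
  then obtain y u where yu: "\<And>n::nat. real n \<le> y n" "\<And>n. u n \<in> {0..1}" "\<And>n. e \<le> \<bar>h (y n + u n) - h (y n)\<bar>"
    by metis
  define z where "z n = y n + u n" for n
  have y_lim: "filterlim y at_top sequentially"
    by (rule filterlim_at_top_mono[OF filterlim_real_sequentially]) (use yu(1) in auto)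
  have z_lim: "filterlim z at_top sequentially"
  proof (rule filterlim_at_top_mono[OF filterlim_real_sequentially])
    have "real n \<le> z n" for n using yu(1,2)[of n] by (simp add: z_def)
    then show "\<forall>\<^sub>F n in sequentially. real n \<le> z n" by simp
  qed
  define A where "A n = {v\<in>{0..2}. e / 2 \<le> \<bar>h (y n + v) - h (y n)\<bar>}" for n
  define B where "B n = {v\<in>{0..2}. e / 2 \<le> \<bar>h (z n + v) - h (z n)\<bar>}" for n
  have [measurable]: "A n \<in> sets borel" "B n \<in> sets borel" for n unfolding A_def B_def by measurable
  have "(\<lambda>n. measure lborel (A n)) \<longlonglongrightarrow> 0" "(\<lambda>n. measure lborel (B n)) \<longlonglongrightarrow> 0"
    unfolding A_def B_def using e by (intro additive_exceptional_measure[OF hm h] y_lim z_lim; simp)+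
  then have "\<forall>\<^sub>F n in sequentially. measure lborel (A n) < 1 / 4" "\<forall>\<^sub>F n in sequentially. measure lborel (B n) < 1 / 4"
    by (auto dest: order_tendstoD(2)[of _ 0 _ "1 / 4"])
  then have "\<forall>\<^sub>F n in sequentially. measure lborel (A n) < 1 / 4 \<and> measure lborel (B n) < 1 / 4"
    by (rule eventually_conj)
  then obtain n where n: "measure lborel (A n) < 1 / 4" "measure lborel (B n) < 1 / 4"
    by (auto simp: eventually_sequentially)
  have fm: "S \<in> fmeasurable lborel" if "S \<in> sets borel" "S \<subseteq> {0..3::real}" for S
  proof (rule fmeasurableI2[OF _ that(2)])
    show "{0..3::real} \<in> fmeasurable lborel" by (simp add: fmeasurable_def)
  qed (use that in simp)
  \<comment> \<open>The exceptional shifts of \<open>z n\<close>, translated by \<open>u n\<close>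
    so as to be measured from \<open>y n\<close>.\<close>
  define B' where "B' = (\<lambda>v. u n + v) ` B n"
  have B'_eq: "B' = (\<lambda>v. v - u n) -` B n" 
  proof safe
    fix x assume "x - u n \<in> B n"
    then have "u n + (x - u n) \<in> B'" unfolding B'_def by (rule imageI)
    then show "x \<in> B'" by simp
  qed (auto simp: B'_def)
  have B'_sets: "B' \<in> sets borel"
    unfolding B'_eq using measurable_sets[of "\<lambda>v. v - u n" borel borel "B n"] by simp
  have "measure lborel B' = measure lborel (B n)"
  proof -
    have "measure lborel (B n) = measure (distr lborel borel ((+) (- u n))) (B n)"
      by (simp add: lborel_distr_plus)
    also have "\<dots> = measure lborel ((+) (- u n) -` B n)"
      by (subst measure_distr) auto
    also have "(+) (- u n) -` B n = B'" unfolding B'_eq by (auto simp: vimage_def)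
    finally show ?thesis ..
  qed
  \<comment> \<open>This interval has length at least 1. Since the values at \<open>y n\<close> and
    \<open>z n\<close> differ by at least \<open>e\<close>, the value at \<open>y n + w\<close> is
    far from one of them for every \<open>w\<close> in it.\<close>
  define C where "C = {u n..2::real}"
  have "C \<subseteq> A n \<union> B'"
  proof
    fix w assume w: "w \<in> C"
    then have v: "w \<in> {0..2}" "w - u n \<in> {0..2}" using yu(2)[of n] by (auto simp: C_def)
    have zw: "z n + (w - u n) = y n + w" by (simp add: z_def)
    have "e \<le> \<bar>h (z n) - h (y n)\<bar>" using yu(3)[of n] by (simp add: z_def)
    then have "e / 2 \<le> \<bar>h (y n + w) - h (y n)\<bar> \<or> e / 2 \<le> \<bar>h (y n + w) - h (z n)\<bar>" by linarith
    then have "w \<in> A n \<or> w - u n \<in> B n" using v unfolding A_def B_def by (auto simp: zw)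
    then show "w \<in> A n \<union> B'" unfolding B'_eq by auto
  qed
  have sub: "A n \<subseteq> {0..3}" "B' \<subseteq> {0..3}" using yu(2)[of n] unfolding A_def B'_def B_def by auto
  have "measure lborel C \<le> measure lborel (A n \<union> B')"
  proof (rule measure_mono_fmeasurable[OF \<open>C \<subseteq> A n \<union> B'\<close>])
    show "A n \<union> B' \<in> fmeasurable lborel" using sub B'_sets by (intro fm) auto
  qed (simp add: C_def)
  also have "\<dots> \<le> measure lborel (A n) + measure lborel B'"
    by (rule measure_Un_le) (use B'_sets in auto)
  also have "\<dots> < 1 / 4 + 1 / 4" using n \<open>measure lborel B' = measure lborel (B n)\<close> by simp
  finally have "measure lborel C < 1 / 2" by simp
  moreover have "1 \<le> measure lborel C" using yu(2)[of n] by (simp add: C_def)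
  ultimately show False by simp
qed

text \<open>In the variable \<open>ln x\<close>, slow variation says that the increments of the
  logarithm of \<open>L\<close> over fixed steps vanish at infinity. By the uniform version each
  step of length at most 1 costs less than \<open>e\<close>, so the logarithm grows at most linearly
  with slope \<open>e\<close>.\<close>

lemma slowly_varying_growth:
  assumes L: "slowly_varying L" and e: "0 < e"
  shows "\<exists>x1\<ge>1. \<exists>C>0. \<forall>x\<ge>x1. 0 < L x \<and> L x \<le> C * x powr e"
proof -
  obtain x0 where x0: "\<And>x. x \<ge> x0 \<Longrightarrow> 0 < L x" "L \<in> borel_measurable (restrict_space borel {x0..})"
    using L by (auto simp: slowly_varying_def)
  have L_lim: "((\<lambda>x. L (c * x) / L x) \<longlongrightarrow> 1) at_top" if "c > 0" for c
    using L that by (auto simp: slowly_varying_def)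
  \<comment> \<open>Setting the value 1 before \<open>x0\<close> makes the function positive and
    measurable everywhere, without affecting its behaviour at infinity.\<close>
  define L' where "L' x = (if x \<in> {x0..} then L x else 1)" for x
  have L'_pos: "0 < L' x" for x using x0(1) by (simp add: L'_def)
  have L'_meas [measurable]: "L' \<in> borel_measurable borel"
    unfolding L'_def[abs_def] using x0(2) by (subst measurable_If_restrict_space_iff) (auto simp: atLeast_def)
  define h where "h y = ln (L' (exp y))" for y
  have hm: "h \<in> borel_measurable borel" unfolding h_def[abs_def] by measurable
  have "((\<lambda>y. h (y + u) - h y) \<longlongrightarrow> 0) at_top" for u
  proof -
    have "((\<lambda>x. L' (exp u * x) / L' x) \<longlongrightarrow> 1) at_top"
    proof (rule Lim_transform_eventually[OF L_lim[of "exp u"]])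
      have "filterlim (\<lambda>x. exp u * x) at_top at_top"
        by (rule filterlim_tendsto_pos_mult_at_top[OF tendsto_const _ filterlim_ident]) simp
      from this[unfolded filterlim_at_top, rule_format, of x0] eventually_ge_at_top[of x0]
      show "\<forall>\<^sub>F x in at_top. L (exp u * x) / L x = L' (exp u * x) / L' x"
        by eventually_elim (simp add: L'_def)
    qed simp
    from filterlim_compose[OF this exp_at_top]
    have "((\<lambda>y. L' (exp (y + u)) / L' (exp y)) \<longlongrightarrow> 1) at_top"
      by (simp add: exp_add mult.commute)
    from tendsto_ln[OF this]
    have "((\<lambda>y. ln (L' (exp (y + u)) / L' (exp y))) \<longlongrightarrow> 0) at_top" by simp
    then show ?thesis unfolding h_def using L'_pos by (simp add: ln_div less_imp_neq[symmetric])
  qed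
  from additive_uniform_convergence[OF hm this e] obtain y1 where
    y1: "\<And>y u. y \<ge> y1 \<Longrightarrow> u \<in> {0..1} \<Longrightarrow> \<bar>h (y + u) - h y\<bar> < e" by blast
  have step: "h (y1 + real n) \<le> h y1 + e * real n" for n
  proof (induction n)
    case (Suc n)
    have "\<bar>h ((y1 + real n) + 1) - h (y1 + real n)\<bar> < e" by (rule y1) auto
    with Suc show ?case by (simp add: algebra_simps)
  qed simp
  have growth: "h y \<le> h y1 + e * (y - y1) + e" if "y \<ge> y1" for y
  proof -
    define n where "n = nat \<lfloor>y - y1\<rfloor>"
    have n: "real n \<le> y - y1" "y - y1 < real n + 1" using that unfolding n_def by linarith+
    have "\<bar>h ((y1 + real n) + (y - y1 - real n)) - h (y1 + real n)\<bar> < e" by (rule y1) (use n in auto)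
    then have "h y < h (y1 + real n) + e" by simp
    also have "\<dots> \<le> h y1 + e * real n + e" using step[of n] by simp
    also have "e * real n \<le> e * (y - y1)" using n e by simp
    finally show ?thesis by simp
  qed
  define x1 where "x1 = max (max 1 x0) (exp y1)"
  define C where "C = exp (h y1 - e * y1 + e)"
  have "L x \<le> C * x powr e" "0 < L x" if x: "x \<ge> x1" for x
  proof -
    have xpos: "0 < x" "x0 \<le> x" "exp y1 \<le> x" using x by (auto simp: x1_def)
    then have "y1 \<le> ln x" by (simp add: ln_ge_iff)
    from growth[OF this] have "h (ln x) \<le> (h y1 - e * y1 + e) + e * ln x" by (simp add: algebra_simps)
    then have "exp (h (ln x)) \<le> exp ((h y1 - e * y1 + e) + e * ln x)" by simp
    also have "exp (h (ln x)) = L x" using xpos L'_pos x0 by (simp add: h_def L'_def)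
    also have "exp ((h y1 - e * y1 + e) + e * ln x) = C * x powr e"
      using xpos unfolding C_def exp_add powr_def by simp
    finally show "L x \<le> C * x powr e" .
    show "0 < L x" using xpos x0 by simp
  qed
  moreover have "1 \<le> x1" by (simp add: x1_def)
  moreover have "0 < C" by (simp add: C_def)
  ultimately show ?thesis by blast
qed

section \<open>Summability of powers of the covariance\<close>

lemma summable_on_int_even:
  fixes f :: "int \<Rightarrow> real"
  assumes "summable (\<lambda>n. f (int n))" "\<And>n. 0 \<le> f n" "\<And>n. f (- n) = f n"
  shows "f summable_on UNIV"
proof -
  have nat: "(\<lambda>n. f (int n)) summable_on UNIV"
    using assms by (intro norm_summable_imp_summable_on) simp
  have 1: "f summable_on (range int)"
    using nat by (subst summable_on_reindex) (auto simp: comp_def)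
  have 2: "f summable_on (range (\<lambda>n. - int n))"
    using nat assms(3) by (subst summable_on_reindex) (auto simp: comp_def inj_def)
  have "UNIV = range int \<union> range (\<lambda>n. - int n)"
  proof -
    have "x \<in> range int \<union> range (\<lambda>n. - int n)" for x
      by (cases x rule: int_cases2) auto
    then show ?thesis by auto
  qed
  then show ?thesis
    using summable_on_union[OF 1 2] by simp
qed

text \<open>The hypothesis on \<open>d\<close> says that the surplus \<open>s\<close> is positive.
  Half of \<open>s\<close> is spent on the slowly varying factor, whence the choice of
  \<open>e\<close>, and the exponent \<open>- 1 - s / 2\<close> remains.\<close>

lemma long_memory_power_summable:
  fixes \<gamma> :: "int \<Rightarrow> real"
  assumes L: "slowly_varying L" and \<gamma>: "\<And>n::nat. 1 \<le> n \<Longrightarrow> \<gamma> (int n) = L (real n) * real n powr (2 * d - 1)"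
    and even: "\<And>n. \<gamma> (- n) = \<gamma> n" and k: "1 \<le> k" "d < 1 / 2 * (1 - 1 / real k)"
  shows "(\<lambda>n. \<bar>\<gamma> n\<bar> ^ k) summable_on UNIV"
proof (rule summable_on_int_even)
  define s where "s = (1 - 2 * d) * real k - 1"
  have s: "0 < s" using k by (simp add: s_def field_simps)
  define e where "e = s / (2 * real k)"
  have e: "0 < e" using s k by (simp add: e_def)
  obtain x1 C where x1: "1 \<le> x1" "0 < C" "\<And>x. x \<ge> x1 \<Longrightarrow> 0 < L x \<and> L x \<le> C * x powr e"
    using slowly_varying_growth[OF L e] by blast
  have bound: "norm (\<bar>\<gamma> (int n)\<bar> ^ k) \<le> C ^ k * real n powr (- 1 - s / 2)" if n: "n \<ge> nat \<lceil>x1\<rceil>" for n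
  proof -
    have nx: "x1 \<le> real n" using n by linarith
    then have n1: "1 \<le> n" using x1(1) by linarith
    have "\<bar>\<gamma> (int n)\<bar> = L (real n) * real n powr (2 * d - 1)"
      using \<gamma>[OF n1] x1(3)[OF nx] by (simp add: abs_mult)
    also have "\<dots> \<le> (C * real n powr e) * real n powr (2 * d - 1)"
      using x1(3)[OF nx] by (intro mult_right_mono) auto
    also have "\<dots> = C * real n powr (e + (2 * d - 1))" by (simp add: powr_add)
    finally have "\<bar>\<gamma> (int n)\<bar> ^ k \<le> (C * real n powr (e + (2 * d - 1))) ^ k"
      by (intro power_mono) auto
    also have "\<dots> = C ^ k * real n powr (real k * (e + (2 * d - 1)))"
      using n1 by (simp add: power_mult_distrib powr_power mult.commute)
    also have "real k * (e + (2 * d - 1)) = - 1 - s / 2"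
      using k by (simp add: e_def s_def field_simps)
    finally show ?thesis by simp
  qed
  have "summable (\<lambda>n. C ^ k * real n powr (- 1 - s / 2))"
    using s by (intro summable_mult) (simp add: summable_real_powr_iff)
  then show "summable (\<lambda>n. \<bar>\<gamma> (int n)\<bar> ^ k)"
    by (rule summable_comparison_test'[where N = "nat \<lceil>x1\<rceil>"]) (rule bound)
qed (auto simp: even)

section \<open>Normal laws and independence via characteristic functions\<close>

text \<open>As an affine image of the standard normal law, the point mass for \<sigma> = 0 is
  covered uniformly and the later computations avoid a case distinction.\<close>

lemma normal_law_eq_distr:
  assumes "0 \<le> \<sigma>"
  shows "normal_law \<mu> \<sigma> = distr std_normal_distribution borel (\<lambda>x. \<mu> + \<sigma> * x)"
proof (cases "\<sigma> = 0")
  case True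
  interpret N: prob_space std_normal_distribution by (rule prob_space_normal_density) simp
  show ?thesis using True by (simp add: normal_law_def N.distr_const)
next
  case False
  with assms have "0 < \<sigma>" by simp
  interpret N: prob_space std_normal_distribution by (rule prob_space_normal_density) simp
  have "distr std_normal_distribution lborel (\<lambda>x. x) = distr std_normal_distribution std_normal_distribution (\<lambda>x. x)"
    by (rule distr_cong) simp_all
  then have "distributed std_normal_distribution lborel (\<lambda>x. x) std_normal_density"
    unfolding distributed_def by (simp add: distr_id)
  from N.normal_density_affine[OF this, of \<sigma> \<mu>] \<open>0 < \<sigma>\<close>
  have "distributed std_normal_distribution lborel (\<lambda>x. \<mu> + \<sigma> * x) (normal_density \<mu> \<sigma>)" by simp
  then have "distr std_normal_distribution lborel (\<lambda>x. \<mu> + \<sigma> * x) = density lborel (normal_density \<mu> \<sigma>)"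
    by (simp add: distributed_def)
  moreover have "distr std_normal_distribution lborel (\<lambda>x. \<mu> + \<sigma> * x) = distr std_normal_distribution borel (\<lambda>x. \<mu> + \<sigma> * x)"
    by (rule distr_cong) simp_all
  ultimately show ?thesis using False by (simp add: normal_law_def)
qed

lemma borel_measurable_cis [measurable]: "cis \<in> borel_measurable borel"
  by (intro borel_measurable_continuous_onI continuous_intros)

lemma integral_cis_std_normal: "(\<integral>x. cis (\<theta> * x) \<partial>std_normal_distribution) = of_real (exp (- \<theta>\<^sup>2 / 2))"
  using fun_cong[OF char_std_normal_distribution, of \<theta>] by (simp add: char_def cis_conv_exp)

lemma integral_cis_normal_law:
  assumes "0 \<le> \<sigma>"
  shows "(\<integral>x. cis (\<theta> * x) \<partial>normal_law \<mu> \<sigma>) = cis (\<theta> * \<mu>) * of_real (exp (- (\<theta> * \<sigma>)\<^sup>2 / 2))"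
proof -
  have "(\<integral>x. cis (\<theta> * x) \<partial>normal_law \<mu> \<sigma>) = (\<integral>x. cis (\<theta> * (\<mu> + \<sigma> * x)) \<partial>std_normal_distribution)"
    unfolding normal_law_eq_distr[OF assms] by (subst integral_distr) auto
  also have "\<dots> = (\<integral>x. cis (\<theta> * \<mu>) * cis ((\<theta> * \<sigma>) * x) \<partial>std_normal_distribution)"
    by (simp add: cis_mult algebra_simps)
  finally show ?thesis by (simp only: integral_mult_right_zero integral_cis_std_normal)
qed

lemma real_distribution_normal_law:
  assumes "0 \<le> \<sigma>"
  shows "real_distribution (normal_law \<mu> \<sigma>)"
proof -
  interpret N: prob_space std_normal_distribution by (rule prob_space_normal_density) simp
  show ?thesis unfolding normal_law_eq_distr[OF assms] by simp
qed

lemma (in prob_space) distr_eq_normal_law: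
  assumes [measurable]: "Y \<in> borel_measurable M" and v: "0 \<le> v"
    and char: "\<And>\<theta>. expectation (\<lambda>\<omega>. cis (\<theta> * Y \<omega>)) = of_real (exp (- \<theta>\<^sup>2 * v / 2))"
  shows "distr M borel Y = normal_law 0 (sqrt v)"
proof (rule Levy_uniqueness)
  show "real_distribution (distr M borel Y)" by simp
  show "real_distribution (normal_law 0 (sqrt v))" by (rule real_distribution_normal_law) (simp add: v)
  show "char (distr M borel Y) = char (normal_law 0 (sqrt v))"
  proof
    fix \<theta>
    have "char (distr M borel Y) \<theta> = expectation (\<lambda>\<omega>. cis (\<theta> * Y \<omega>))"
      unfolding char_def by (subst integral_distr) (auto simp: cis_conv_exp)
    also have "\<dots> = (\<integral>x. cis (\<theta> * x) \<partial>normal_law 0 (sqrt v))"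
      unfolding char by (subst integral_cis_normal_law) (auto simp: v power_mult_distrib)
    finally show "char (distr M borel Y) \<theta> = char (normal_law 0 (sqrt v)) \<theta>"
      by (simp add: char_def cis_conv_exp)
  qed
qed

text \<open>The vector is compared with the product of its marginal laws: by hypothesis both have
  the same characteristic function, and under a product measure the integral factorizes.\<close>

lemma (in prob_space) integral_prod_of_char_prod:
  fixes Y :: "'i \<Rightarrow> 'a \<Rightarrow> real" and f :: "'i \<Rightarrow> real \<Rightarrow> real"
  assumes I: "finite I" and Y[measurable]: "\<And>i. i \<in> I \<Longrightarrow> Y i \<in> borel_measurable M"
    and char: "\<And>c. expectation (\<lambda>\<omega>. cis (\<Sum>i\<in>I. c i * Y i \<omega>)) = (\<Prod>i\<in>I. expectation (\<lambda>\<omega>. cis (c i * Y i \<omega>)))"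
    and f: "\<And>i. i \<in> I \<Longrightarrow> continuous_on UNIV (f i)" "\<And>i x. i \<in> I \<Longrightarrow> 0 \<le> f i x \<and> f i x \<le> 1"
  shows "expectation (\<lambda>\<omega>. \<Prod>i\<in>I. f i (Y i \<omega>)) = (\<Prod>i\<in>I. expectation (\<lambda>\<omega>. f i (Y i \<omega>)))"
proof -
  \<comment> \<open>The zero variable outside \<open>I\<close> keeps every factor a probability
    measure, as \<open>product_prob_space\<close> asks for all indices.\<close>
  define D where "D i = distr M borel (if i \<in> I then Y i else (\<lambda>_. 0))" for i
  have YD: "(if i \<in> I then Y i else (\<lambda>_. 0)) \<in> borel_measurable M" for i using Y by auto
  have D: "prob_space (D i)" "sets (D i) = sets borel" for i
    unfolding D_def by (rule prob_space_distr[OF YD]) simp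
  interpret D: product_prob_space D I
    using D(1) by (intro product_prob_spaceI)
  let ?P = "\<Pi>\<^sub>M i\<in>I. D i"
  have comp[measurable]: "(\<lambda>x. x i) \<in> borel_measurable ?P" if "i \<in> I" for i
    using measurable_component_singleton[OF that, of D] D(2) measurable_cong_sets by blast
  have int_D: "(\<integral>x. g x \<partial>D i) = expectation (\<lambda>\<omega>. g (Y i \<omega>))" if "i \<in> I" "g \<in> borel_measurable borel" for i and g :: "real \<Rightarrow> 'c::{banach, second_countable_topology}"
    unfolding D_def using that Y[OF that(1)] by (simp add: integral_distr)
  have fm[measurable]: "f i \<in> borel_measurable borel" if "i \<in> I" for i
    using f(1)[OF that] by (rule borel_measurable_continuous_onI)
  have char_P: "(\<integral>x. cis (\<Sum>i\<in>I. c i * x i) \<partial>?P) = (\<Prod>i\<in>I. expectation (\<lambda>\<omega>. cis (c i * Y i \<omega>)))" for c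
  proof -
    have "cis (\<Sum>i\<in>I. c i * x i) = (\<Prod>i\<in>I. cis (c i * x i))" for x
      using I by (induction I rule: finite_induct) (simp_all add: cis_mult[symmetric])
    then have "(\<integral>x. cis (\<Sum>i\<in>I. c i * x i) \<partial>?P) = (\<integral>x. (\<Prod>i\<in>I. cis (c i * x i)) \<partial>?P)" by simp
    also have "\<dots> = (\<Prod>i\<in>I. \<integral>x. cis (c i * x) \<partial>D i)"
    proof (rule D.product_integral_prod[OF I])
      fix i assume "i \<in> I"
      have "(\<lambda>x. cis (c i * x)) \<in> borel_measurable (D i)"
        using D(2)[of i] by (subst measurable_cong_sets[OF D(2) refl]) measurable
      then show "integrable (D i) (\<lambda>x. cis (c i * x))"
        by (intro finite_measure.integrable_const_bound[OF prob_space.finite_measure[OF D(1)], where B = 1]) auto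
    qed
    also have "\<dots> = (\<Prod>i\<in>I. expectation (\<lambda>\<omega>. cis (c i * Y i \<omega>)))"
      by (intro prod.cong refl int_D) auto
    finally show ?thesis .
  qed
  have "expectation (\<lambda>\<omega>. (\<lambda>x. \<Prod>i\<in>I. f i (x i)) (\<lambda>i\<in>I. Y i \<omega>)) = (\<integral>x. (\<lambda>x. \<Prod>i\<in>I. f i (x i)) (\<lambda>i\<in>I. x i) \<partial>?P)"
  proof (rule vec_char_eq_imp_integral_eq_bounded[OF prob_space_axioms prob_space_PiM[OF D(1)] I Y comp])
    show "expectation (\<lambda>\<omega>. cis (\<Sum>i\<in>I. c i * Y i \<omega>)) = (\<integral>x. cis (\<Sum>i\<in>I. c i * x i) \<partial>?P)" for c
      unfolding char_P by (rule char)
    show "continuous_on (I \<rightarrow>\<^sub>E UNIV) (\<lambda>x. \<Prod>i\<in>I. f i (x i))"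
    proof (intro continuous_on_prod)
      fix i assume i: "i \<in> I"
      have "continuous_on (I \<rightarrow>\<^sub>E UNIV) (\<lambda>x::'i \<Rightarrow> real. x i)"
        using continuous_on_product_coordinates[of i] continuous_on_subset by blast
      then show "continuous_on (I \<rightarrow>\<^sub>E UNIV) (\<lambda>x. f i (x i))"
        by (intro continuous_on_compose2[OF f(1)[OF i]]) auto
    qed
    have "\<bar>\<Prod>i\<in>I. f i (x i)\<bar> \<le> 1" for x
      using f(2) by (simp add: abs_prod prod_le_1)
    then show "bounded ((\<lambda>x. \<Prod>i\<in>I. f i (x i)) ` (I \<rightarrow>\<^sub>E UNIV))"
      by (auto simp: bounded_iff intro!: exI[of _ 1])
  qed auto
  then have "expectation (\<lambda>\<omega>. \<Prod>i\<in>I. f i (Y i \<omega>)) = (\<integral>x. (\<Prod>i\<in>I. f i (x i)) \<partial>?P)" by simp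
  also have "\<dots> = (\<Prod>i\<in>I. \<integral>x. f i x \<partial>D i)"
  proof (rule D.product_integral_prod[OF I])
    fix i assume i: "i \<in> I"
    have "f i \<in> borel_measurable (D i)"
      using fm[OF i] by (subst measurable_cong_sets[OF D(2) refl])
    then show "integrable (D i) (f i)"
      using f(2)[OF i] by (intro finite_measure.integrable_const_bound[OF prob_space.finite_measure[OF D(1)], where B = 1]) auto
  qed
  also have "\<dots> = (\<Prod>i\<in>I. expectation (\<lambda>\<omega>. f i (Y i \<omega>)))"
    by (intro prod.cong refl int_D fm)
  finally show ?thesis .
qed

lemma closed_indicator_approx:
  fixes A :: "real set"
  assumes "closed A"
  obtains \<phi> :: "nat \<Rightarrow> real \<Rightarrow> real" where "\<And>n. continuous_on UNIV (\<phi> n)" "\<And>n x. 0 \<le> \<phi> n x \<and> \<phi> n x \<le> 1"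
    "\<And>x. (\<lambda>n. \<phi> n x) \<longlonglongrightarrow> indicator A x"
proof (cases "A = {}")
  case True
  show ?thesis by (rule that[of "\<lambda>_ _. 0"]) (use True in auto)
next
  case False
  show ?thesis
  proof (rule that[of "\<lambda>n x. max 0 (1 - real n * infdist x A)"])
    show "continuous_on UNIV (\<lambda>x. max 0 (1 - real n * infdist x A))" for n
      by (intro continuous_intros)
    show "0 \<le> max 0 (1 - real n * infdist x A) \<and> max 0 (1 - real n * infdist x A) \<le> 1" for n x
      by (simp add: infdist_nonneg)
    fix x
    show "(\<lambda>n. max 0 (1 - real n * infdist x A)) \<longlonglongrightarrow> indicator A x"
    proof (cases "x \<in> A")
      case True
      then show ?thesis by simp
    next
      case notin: False
      then have d: "0 < infdist x A"
        using in_closed_iff_infdist_zero[OF assms False, of x] infdist_nonneg[of x A] by auto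
      obtain n0 :: nat where n0: "1 / infdist x A \<le> real n0" using real_arch_simple by blast
      have "max 0 (1 - real n * infdist x A) = 0" if "n \<ge> n0" for n
      proof -
        have "1 / infdist x A \<le> real n" using n0 that by linarith
        then show ?thesis using d by (simp add: divide_le_eq)
      qed
      then show ?thesis using notin
        by (intro tendsto_eventually) (auto simp: eventually_sequentially)
    qed
  qed
qed

text \<open>Closed sets form an intersection-stable generator of the Borel sets, and their
  indicators are limits of continuous functions with values in [0, 1]; factorization therefore
  passes from expectations to probabilities.\<close>

lemma (in prob_space) indep_vars_of_char_prod:
  fixes Y :: "'i \<Rightarrow> 'a \<Rightarrow> real"
  assumes I: "finite I" and Y[measurable]: "\<And>i. i \<in> I \<Longrightarrow> Y i \<in> borel_measurable M"
    and char: "\<And>c. expectation (\<lambda>\<omega>. cis (\<Sum>i\<in>I. c i * Y i \<omega>)) = (\<Prod>i\<in>I. expectation (\<lambda>\<omega>. cis (c i * Y i \<omega>)))"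
  shows "indep_vars (\<lambda>_. borel) Y I"
proof (cases "I = {}")
  case True
  then show ?thesis by (simp add: indep_vars_def indep_sets_def)
next
  case False
  have "prob (\<Inter>j\<in>I. Y j -` A j \<inter> space M) = (\<Prod>j\<in>I. prob (Y j -` A j \<inter> space M))"
    if A: "\<And>i. i \<in> I \<Longrightarrow> closed (A i)" for A
  proof -
    have "\<forall>i\<in>I. \<exists>\<phi> :: nat \<Rightarrow> real \<Rightarrow> real. (\<forall>n. continuous_on UNIV (\<phi> n)) \<and> (\<forall>n x. 0 \<le> \<phi> n x \<and> \<phi> n x \<le> 1) \<and>
        (\<forall>x. (\<lambda>n::nat. \<phi> n x) \<longlonglongrightarrow> indicator (A i) (x::real))"
    proof
      fix i assume i: "i \<in> I"
      obtain \<phi> :: "nat \<Rightarrow> real \<Rightarrow> real" where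
        "\<And>n. continuous_on UNIV (\<phi> n)" "\<And>n x. 0 \<le> \<phi> n x \<and> \<phi> n x \<le> 1"
        "\<And>x. (\<lambda>n. \<phi> n x) \<longlonglongrightarrow> indicator (A i) x"
        by (rule closed_indicator_approx[OF A[OF i]]) blast
      then show "\<exists>\<phi> :: nat \<Rightarrow> real \<Rightarrow> real. (\<forall>n. continuous_on UNIV (\<phi> n)) \<and> (\<forall>n x. 0 \<le> \<phi> n x \<and> \<phi> n x \<le> 1) \<and>
        (\<forall>x. (\<lambda>n::nat. \<phi> n x) \<longlonglongrightarrow> indicator (A i) (x::real))" by blast
    qed
    from bchoice[OF this] obtain \<phi> :: "'i \<Rightarrow> nat \<Rightarrow> real \<Rightarrow> real" where "\<forall>i\<in>I. (\<forall>n. continuous_on UNIV (\<phi> i n)) \<and>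
        (\<forall>n x. 0 \<le> \<phi> i n x \<and> \<phi> i n x \<le> 1) \<and> (\<forall>x. (\<lambda>n::nat. \<phi> i n x) \<longlonglongrightarrow> indicator (A i) (x::real))" ..
    then have \<phi>: "\<And>i n. i \<in> I \<Longrightarrow> continuous_on UNIV (\<phi> i n)" "\<And>i n x. i \<in> I \<Longrightarrow> 0 \<le> \<phi> i n x \<and> \<phi> i n x \<le> (1::real)"
      "\<And>i x. i \<in> I \<Longrightarrow> (\<lambda>n::nat. \<phi> i n x) \<longlonglongrightarrow> indicator (A i) (x::real)"
      by blast+
    have [measurable]: "\<phi> i n \<in> borel_measurable borel" "A i \<in> sets borel" if "i \<in> I" for i n
      using \<phi>(1)[OF that] A[OF that] by (auto intro: borel_measurable_continuous_onI)
    have "(\<lambda>n. expectation (\<lambda>\<omega>. \<Prod>i\<in>I. \<phi> i n (Y i \<omega>))) \<longlonglongrightarrow> expectation (\<lambda>\<omega>. \<Prod>i\<in>I. indicat_real (A i) (Y i \<omega>))"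
    proof (rule integral_dominated_convergence[where w = "\<lambda>_. 1"])
      show "AE \<omega> in M. (\<lambda>n. \<Prod>i\<in>I. \<phi> i n (Y i \<omega>)) \<longlonglongrightarrow> (\<Prod>i\<in>I. indicat_real (A i) (Y i \<omega>))"
        by (intro AE_I2 tendsto_prod \<phi>(3))
      show "AE \<omega> in M. norm (\<Prod>i\<in>I. \<phi> i n (Y i \<omega>)) \<le> 1" for n
        using \<phi>(2) by (intro AE_I2) (simp add: abs_prod prod_le_1)
    qed auto
    moreover have "(\<lambda>n. \<Prod>i\<in>I. expectation (\<lambda>\<omega>. \<phi> i n (Y i \<omega>))) \<longlonglongrightarrow> (\<Prod>i\<in>I. expectation (\<lambda>\<omega>. indicat_real (A i) (Y i \<omega>)))"
    proof (rule tendsto_prod)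
      fix i assume i: "i \<in> I"
      show "(\<lambda>n. expectation (\<lambda>\<omega>. \<phi> i n (Y i \<omega>))) \<longlonglongrightarrow> expectation (\<lambda>\<omega>. indicat_real (A i) (Y i \<omega>))"
        by (rule integral_dominated_convergence[where w = "\<lambda>_. 1"]) (use \<phi>(2,3)[OF i] i in auto)
    qed
    moreover have "expectation (\<lambda>\<omega>. \<Prod>i\<in>I. \<phi> i n (Y i \<omega>)) = (\<Prod>i\<in>I. expectation (\<lambda>\<omega>. \<phi> i n (Y i \<omega>)))" for n
      by (rule integral_prod_of_char_prod[OF I Y char]) (use \<phi> in auto)
    ultimately have eq: "expectation (\<lambda>\<omega>. \<Prod>i\<in>I. indicat_real (A i) (Y i \<omega>)) = (\<Prod>i\<in>I. expectation (\<lambda>\<omega>. indicat_real (A i) (Y i \<omega>)) :: real)"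
      using LIMSEQ_unique by simp
    have "(\<Prod>i\<in>I. indicat_real (A i) (Y i \<omega>)) = (indicat_real (\<Inter>j\<in>I. Y j -` A j \<inter> space M) \<omega> :: real)" if "\<omega> \<in> space M" for \<omega>
      using that I False by (auto simp: indicator_def prod_zero)
    then have "expectation (\<lambda>\<omega>. \<Prod>i\<in>I. indicat_real (A i) (Y i \<omega>)) =
        expectation (indicat_real (\<Inter>j\<in>I. Y j -` A j \<inter> space M))"
      by (intro Bochner_Integration.integral_cong refl)
    also have "\<dots> = prob (\<Inter>j\<in>I. Y j -` A j \<inter> space M)"
      using I False by (subst Bochner_Integration.integral_indicator) (auto intro!: arg_cong[of _ _ prob])
    finally have "expectation (\<lambda>\<omega>. \<Prod>i\<in>I. indicat_real (A i) (Y i \<omega>)) = prob (\<Inter>j\<in>I. Y j -` A j \<inter> space M)" .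
    moreover have "expectation (\<lambda>\<omega>. indicat_real (A i) (Y i \<omega>)) = prob (Y i -` A i \<inter> space M)" if "i \<in> I" for i
    proof -
      have "expectation (\<lambda>\<omega>. indicat_real (A i) (Y i \<omega>) :: real) = expectation (indicat_real (Y i -` A i \<inter> space M))"
        by (intro Bochner_Integration.integral_cong refl) (simp add: indicator_def)
      then show ?thesis by simp
    qed
    ultimately show ?thesis using eq by simp
  qed
  then show ?thesis
  proof (subst indep_vars_finite[OF False I, where E = "\<lambda>_. Collect closed"])
    show "sets borel = sigma_sets (space (borel :: real measure)) (Collect closed)"
      by (subst borel_eq_closed) (simp add: sets_measure_of)
  qed (auto simp: Int_stable_def Pi_def)
qed

section \<open>Brownian motion\<close>

text \<open>The covariance \<open>min\<close> makes distinct increments uncorrelated, so their joint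
  characteristic function factorizes; independence and the normal law of each increment follow from
  characteristic functions.\<close>

lemma standard_brownian_motionI:
  assumes P: "prob_space P" and W[measurable]: "\<And>t. 0 \<le> t \<Longrightarrow> W t \<in> borel_measurable P"
    and W0: "AE \<omega> in P. W 0 \<omega> = 0" and cont: "AE \<omega> in P. continuous_on {0..} (\<lambda>t. W t \<omega>)"
    and char: "\<And>(n::nat) t c. (\<And>i. i < n \<Longrightarrow> 0 \<le> t i) \<Longrightarrow>
      (\<integral>\<omega>. cis (\<Sum>i<n. c i * W (t i) \<omega>) \<partial>P) = of_real (exp (- (\<Sum>i<n. \<Sum>j<n. c i * c j * min (t i) (t j)) / 2))"
  shows "standard_brownian_motion P W"
proof -
  interpret P: prob_space P by (rule P)
  have incr: "P.expectation (\<lambda>\<omega>. cis (\<Sum>i<n. c i * (W (t (Suc i)) \<omega> - W (t i) \<omega>))) =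
      of_real (exp (- (\<Sum>i<n. (c i)\<^sup>2 * (t (Suc i) - t i)) / 2))"
    if t0: "0 \<le> t 0" and t: "\<And>i. i < n \<Longrightarrow> t i \<le> t (Suc i)" for n :: nat and t c
  proof -
    \<comment> \<open>Coefficients from summation by parts: for positive \<open>n\<close>, the first
      value receives \<open>- c 0\<close> and the last receives \<open>c (n - 1)\<close>.\<close>
    define d where "d i = (if i = 0 then 0 else c (i - 1)) - (if i = n then 0 else c i)" for i
    have abel: "(\<Sum>i<n. c i * (f (Suc i) - f i)) = (\<Sum>i<Suc n. d i * f i)" for f :: "nat \<Rightarrow> real"
    proof -
      have "(\<Sum>i<Suc n. d i * f i) = (\<Sum>i<Suc n. (if i = 0 then 0 else c (i - 1)) * f i) - (\<Sum>i<Suc n. (if i = n then 0 else c i) * f i)"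
        by (simp only: d_def left_diff_distrib sum_subtractf)
      also have "(\<Sum>i<Suc n. (if i = 0 then 0 else c (i - 1)) * f i) = (\<Sum>i<n. c i * f (Suc i))"
        by (subst sum.lessThan_Suc_shift) simp
      also have "(\<Sum>i<Suc n. (if i = n then 0 else c i) * f i) = (\<Sum>i<n. c i * f i)"
        by simp
      finally show ?thesis by (simp add: right_diff_distrib sum_subtractf)
    qed
    have mono: "t i \<le> t j" if "i \<le> j" "j \<le> n" for i j
      using that
    proof (induction j rule: dec_induct)
      case (step m)
      then show ?case using t[of m] by simp
    qed simp
    have tn: "0 \<le> t i" if "i < Suc n" for i using mono[of 0 i] t0 that by simp
    have "P.expectation (\<lambda>\<omega>. cis (\<Sum>i<n. c i * (W (t (Suc i)) \<omega> - W (t i) \<omega>))) =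
        of_real (exp (- (\<Sum>i<Suc n. \<Sum>j<Suc n. d i * d j * min (t i) (t j)) / 2))"
      unfolding abel[of "\<lambda>i. W (t i) _"] by (rule char) (rule tn)
    also have "(\<Sum>i<Suc n. \<Sum>j<Suc n. d i * d j * min (t i) (t j)) = (\<Sum>i<n. (c i)\<^sup>2 * (t (Suc i) - t i))"
    proof -
      have "(\<Sum>i<Suc n. \<Sum>j<Suc n. d i * d j * min (t i) (t j)) = (\<Sum>i<Suc n. d i * (\<Sum>j<Suc n. d j * min (t i) (t j)))"
        by (simp only: sum_distrib_left mult.assoc)
      also have "\<dots> = (\<Sum>i<n. c i * ((\<Sum>j<n. c j * (min (t (Suc i)) (t (Suc j)) - min (t (Suc i)) (t j))) -
          (\<Sum>j<n. c j * (min (t i) (t (Suc j)) - min (t i) (t j)))))"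
        unfolding abel[symmetric] ..
      also have "\<dots> = (\<Sum>i<n. (c i)\<^sup>2 * (t (Suc i) - t i))"
      proof (rule sum.cong[OF refl])
        fix i assume i: "i \<in> {..<n}"
        \<comment> \<open>Summation by parts in both indices leaves mixed second differences of
          \<open>min\<close>, which vanish off the diagonal and equal the length of the time step on
          it.\<close>
        have "(\<Sum>j<n. c j * (min (t (Suc i)) (t (Suc j)) - min (t (Suc i)) (t j))) -
          (\<Sum>j<n. c j * (min (t i) (t (Suc j)) - min (t i) (t j))) =
          (\<Sum>j<n. if j = i then c i * (t (Suc i) - t i) else 0)"
          unfolding sum_subtractf[symmetric]
        proof (rule sum.cong[OF refl])
          fix j assume j: "j \<in> {..<n}"
          consider "j < i" | "j = i" | "i < j" by linarith
          then show "c j * (min (t (Suc i)) (t (Suc j)) - min (t (Suc i)) (t j)) - c j * (min (t i) (t (Suc j)) - min (t i) (t j)) =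
              (if j = i then c i * (t (Suc i) - t i) else 0)"
          proof cases
            case 1
            then have "t j \<le> t (Suc j)" "t (Suc j) \<le> t i" "t i \<le> t (Suc i)"
              using mono[of j "Suc j"] mono[of "Suc j" i] mono[of i "Suc i"] i j by auto
            then show ?thesis using 1 by (simp add: min_def)
          next
            case 2
            then show ?thesis using t[of i] i by (simp add: min_def)
          next
            case 3
            then have "t i \<le> t (Suc i)" "t (Suc i) \<le> t j" "t j \<le> t (Suc j)"
              using mono[of i "Suc i"] mono[of "Suc i" j] mono[of j "Suc j"] i j by auto
            then show ?thesis using 3 by (simp add: min_def)
          qed
        qed
        then show "c i * ((\<Sum>j<n. c j * (min (t (Suc i)) (t (Suc j)) - min (t (Suc i)) (t j))) -
          (\<Sum>j<n. c j * (min (t i) (t (Suc j)) - min (t i) (t j)))) = (c i)\<^sup>2 * (t (Suc i) - t i)"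
          using i by (simp add: power2_eq_square)
      qed
      finally show ?thesis .
    qed
    finally show ?thesis .
  qed
  have single: "P.expectation (\<lambda>\<omega>. cis (\<theta> * (W t \<omega> - W s \<omega>))) = of_real (exp (- \<theta>\<^sup>2 * (t - s) / 2))"
    if "0 \<le> s" "s \<le> t" for s t \<theta>
    using incr[of "\<lambda>i. if i = 0 then s else t" 1 "\<lambda>_. \<theta>"] that by simp
  show ?thesis
    unfolding standard_brownian_motion_def
  proof (intro conjI allI impI P W W0 cont; (elim conjE)?)
    fix n and t :: "nat \<Rightarrow> real" assume t: "0 \<le> t 0" "\<forall>i<n. t i < t (Suc i)"
    have tn: "0 \<le> t i" if "i \<le> n" for i
      using that
    proof (induction i)
      case (Suc i)
      then have "t i < t (Suc i)" using t(2) by simp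
      moreover have "0 \<le> t i" using Suc by simp
      ultimately show ?case by linarith
    qed (use t in simp)
    show "P.indep_vars (\<lambda>_. borel) (\<lambda>i \<omega>. W (t (Suc i)) \<omega> - W (t i) \<omega>) {..<n}"
    proof (rule P.indep_vars_of_char_prod)
      show "(\<lambda>\<omega>. W (t (Suc i)) \<omega> - W (t i) \<omega>) \<in> borel_measurable P" if "i \<in> {..<n}" for i
        using that by (intro borel_measurable_diff W tn) auto
      fix c
      have "(\<Prod>i<n. P.expectation (\<lambda>\<omega>. cis (c i * (W (t (Suc i)) \<omega> - W (t i) \<omega>)))) =
          (\<Prod>i<n. complex_of_real (exp (- (c i)\<^sup>2 * (t (Suc i) - t i) / 2)))"
        using t tn by (intro prod.cong refl single) (auto intro: less_imp_le)
      also have "\<dots> = of_real (exp (- (\<Sum>i<n. (c i)\<^sup>2 * (t (Suc i) - t i)) / 2))"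
        by (simp add: exp_sum[symmetric] sum_negf sum_divide_distrib flip: of_real_prod)
      finally show "P.expectation (\<lambda>\<omega>. cis (\<Sum>i<n. c i * (W (t (Suc i)) \<omega> - W (t i) \<omega>))) =
          (\<Prod>i<n. P.expectation (\<lambda>\<omega>. cis (c i * (W (t (Suc i)) \<omega> - W (t i) \<omega>))))"
        using incr[of t n c] t by (simp add: less_imp_le)
    qed simp
  next
    fix s t :: real assume st: "0 \<le> s" "s < t"
    have m: "(\<lambda>\<omega>. W t \<omega> - W s \<omega>) \<in> borel_measurable P" using st by (intro borel_measurable_diff W) auto
    have "distr P borel (\<lambda>\<omega>. W t \<omega> - W s \<omega>) = normal_law 0 (sqrt (t - s))"
      using st single by (intro P.distr_eq_normal_law m) auto
    moreover have "distr P lborel (\<lambda>\<omega>. W t \<omega> - W s \<omega>) = distr P borel (\<lambda>\<omega>. W t \<omega> - W s \<omega>)"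
      by (rule distr_cong) simp_all
    ultimately show "distributed P lborel (\<lambda>\<omega>. W t \<omega> - W s \<omega>) (normal_density 0 (sqrt (t - s)))"
      using st m by (simp add: distributed_def normal_law_def)
  qed
qed

lemma psd_factorization:
  fixes \<rho> :: "nat \<Rightarrow> nat \<Rightarrow> real"
  assumes "\<And>i j. i < n \<Longrightarrow> j < n \<Longrightarrow> \<rho> i j = \<rho> j i" "\<And>c. 0 \<le> (\<Sum>i<n. \<Sum>j<n. c i * c j * \<rho> i j)"
  shows "\<exists>S. \<forall>i<n. \<forall>j<n. \<rho> i j = (\<Sum>r<n. S i r * S j r)"
  using assms
proof (induction n arbitrary: \<rho>)
  case (Suc n)
  define a where "a = \<rho> n n"
  have expand: "(\<Sum>i<Suc n. \<Sum>j<Suc n. c i * c j * \<rho> i j) =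
      (\<Sum>i<n. \<Sum>j<n. c i * c j * \<rho> i j) + 2 * c n * (\<Sum>i<n. c i * \<rho> i n) + (c n)\<^sup>2 * a" for c
  proof -
    have "(\<Sum>j<n. c n * c j * \<rho> n j) = c n * (\<Sum>i<n. c i * \<rho> i n)"
      unfolding sum_distrib_left by (intro sum.cong refl) (use Suc.prems(1) in simp)
    moreover have "(\<Sum>i<n. c i * c n * \<rho> i n) = c n * (\<Sum>i<n. c i * \<rho> i n)"
      unfolding sum_distrib_left by (intro sum.cong refl) simp
    ultimately show ?thesis by (simp add: sum.distrib a_def power2_eq_square)
  qed
  have a: "0 \<le> a"
    using Suc.prems(2)[of "\<lambda>i. if i = n then 1 else 0"] unfolding expand by simp
  have zero: "\<rho> i n = 0" if "a = 0" "i < n" for i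
  proof (rule ccontr)
    assume ne: "\<rho> i n \<noteq> 0"
    \<comment> \<open>With a zero diagonal entry the form is affine in \<open>x\<close>, and this
      value makes it -1.\<close>
    define x where "x = - (\<rho> i i + 1) / (2 * \<rho> i n)"
    have "0 \<le> \<rho> i i + 2 * x * \<rho> i n"
      using Suc.prems(2)[of "\<lambda>j. if j = n then x else if j = i then 1 else 0"] that unfolding expand
      by (simp add: if_distrib[of "\<lambda>c. c * _"] if_distrib[of "\<lambda>c. _ * c"] cong: if_cong)
    moreover have "2 * x * \<rho> i n = - (\<rho> i i + 1)" using ne by (simp add: x_def field_simps)
    ultimately show False by linarith
  qed
  define b where "b i = (if a = 0 then 0 else \<rho> i n / sqrt a)" for i
  define \<rho>' where "\<rho>' i j = \<rho> i j - b i * b j" for i j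
  have bn: "b i * sqrt a = \<rho> i n" if "i < n" for i using zero[OF _ that] by (auto simp: b_def)
  have "\<exists>S. \<forall>i<n. \<forall>j<n. \<rho>' i j = (\<Sum>r<n. S i r * S j r)"
  proof (rule Suc.IH)
    show "\<rho>' i j = \<rho>' j i" if "i < n" "j < n" for i j using Suc.prems(1)[of i j] that by (simp add: \<rho>'_def)
    fix c
    define s where "s = (\<Sum>i<n. c i * b i)"
    have "(\<Sum>i<n. \<Sum>j<n. c i * c j * \<rho>' i j) = (\<Sum>i<n. \<Sum>j<n. c i * c j * \<rho> i j) - s\<^sup>2"
      by (simp add: \<rho>'_def right_diff_distrib sum_subtractf s_def power2_eq_square sum_product ac_simps)
    also have "\<dots> \<ge> 0"
    proof (cases "a = 0")
      case True
      then have "s = 0" by (simp add: s_def b_def)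
      then show ?thesis
        using Suc.prems(2)[of "\<lambda>i. if i = n then 0 else c i"] unfolding expand by simp
    next
      case False
      \<comment> \<open>The last coordinate is chosen to minimize the form for the given other
        coordinates; the minimum is the form of the Schur complement.\<close>
      define c' where "c' i = (if i = n then - s / sqrt a else c i)" for i
      have "(\<Sum>i<n. c' i * \<rho> i n) = (\<Sum>i<n. c i * (b i * sqrt a))"
        by (intro sum.cong refl) (simp add: c'_def bn)
      also have "\<dots> = s * sqrt a" by (simp add: s_def sum_distrib_right mult.assoc)
      finally have 1: "(\<Sum>i<n. c' i * \<rho> i n) = s * sqrt a" .
      have "(\<Sum>i<n. \<Sum>j<n. c' i * c' j * \<rho> i j) = (\<Sum>i<n. \<Sum>j<n. c i * c j * \<rho> i j)"
        by (intro sum.cong refl) (simp add: c'_def)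
      then have "(\<Sum>i<Suc n. \<Sum>j<Suc n. c' i * c' j * \<rho> i j) =
          (\<Sum>i<n. \<Sum>j<n. c i * c j * \<rho> i j) + 2 * (- s / sqrt a) * (s * sqrt a) + (- s / sqrt a)\<^sup>2 * a"
        unfolding expand 1 by (simp add: c'_def)
      also have "\<dots> = (\<Sum>i<n. \<Sum>j<n. c i * c j * \<rho> i j) - s\<^sup>2"
        using False a by (simp add: power_divide power2_eq_square)
      finally show ?thesis using Suc.prems(2)[of c'] by simp
    qed
    finally show "0 \<le> (\<Sum>i<n. \<Sum>j<n. c i * c j * \<rho>' i j)" .
  qed
  then obtain S where S: "\<And>i j. i < n \<Longrightarrow> j < n \<Longrightarrow> \<rho>' i j = (\<Sum>r<n. S i r * S j r)" by blast
  define S' where "S' i r = (if i = n then (if r = n then sqrt a else 0) else if r = n then b i else S i r)" for i r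
  have "\<rho> i j = (\<Sum>r<Suc n. S' i r * S' j r)" if ij: "i < Suc n" "j < Suc n" for i j
  proof -
    consider "i < n" "j < n" | "i = n" "j < n" | "i < n" "j = n" | "i = n" "j = n" using ij by linarith
    then show ?thesis
    proof cases
      case 1
      then have "(\<Sum>r<Suc n. S' i r * S' j r) = (\<Sum>r<n. S i r * S j r) + b i * b j" by (simp add: S'_def)
      then show ?thesis using S[OF 1] by (simp add: \<rho>'_def)
    next
      case 2
      then show ?thesis using bn[of j] Suc.prems(1)[of n j] by (simp add: S'_def mult.commute)
    next
      case 3
      then show ?thesis using bn[of i] by (simp add: S'_def)
    next
      case 4
      then show ?thesis using a by (simp add: S'_def a_def)
    qed
  qed
  then show ?case by blast
qed simp

text \<open>Levy's construction: \<open>clamp n k t\<close> is the length of the part of \<open>[0, t]\<close> inside the \<open>k\<close>-th dyadic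
  interval of level \<open>n\<close>, and \<open>schauder (Suc n) k\<close> is the primitive of the Haar function of that interval.\<close>

definition clamp :: "nat \<Rightarrow> nat \<Rightarrow> real \<Rightarrow> real" where
  "clamp n k t = max 0 (min (t - real k / 2 ^ n) (1 / 2 ^ n))"

fun schauder :: "nat \<Rightarrow> nat \<Rightarrow> real \<Rightarrow> real" where
  "schauder 0 k t = clamp 0 k t"
| "schauder (Suc n) k t = sqrt (2 ^ n) * (clamp (Suc n) (2 * k) t - clamp (Suc n) (2 * k + 1) t)"

lemma clamp_bounds: "0 \<le> clamp n k t" "clamp n k t \<le> 1 / 2 ^ n"
  by (auto simp: clamp_def)

lemma clamp_split: "clamp n k t = clamp (Suc n) (2 * k) t + clamp (Suc n) (2 * k + 1) t"
proof -
  define h :: real where "h = 1 / 2 ^ Suc n"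
  have h: "0 < h" "1 / 2 ^ n = 2 * h" "real k / 2 ^ n = 2 * real k * h"
    "real (2 * k) / 2 ^ Suc n = 2 * real k * h" "real (2 * k + 1) / 2 ^ Suc n = 2 * real k * h + h"
    by (auto simp: h_def field_simps)
  show ?thesis unfolding clamp_def h h_def[symmetric] using h(1) by (auto simp: max_def min_def)
qed

lemma clamp_full: "real (Suc k) / 2 ^ n \<le> t \<Longrightarrow> clamp n k t = 1 / 2 ^ n"
proof -
  assume "real (Suc k) / 2 ^ n \<le> t"
  moreover have "(0::real) < 1 / 2 ^ n" by simp
  ultimately have "1 / 2 ^ n \<le> t - real k / 2 ^ n" by (simp add: add_divide_distrib)
  then show ?thesis unfolding clamp_def by (simp add: min_absorb2)
qed

lemma clamp_empty: "t \<le> real k / 2 ^ n \<Longrightarrow> clamp n k t = 0"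
proof -
  assume "t \<le> real k / 2 ^ n"
  then show ?thesis unfolding clamp_def by (intro max_absorb1) (simp add: min_le_iff_disj)
qed

lemma continuous_on_clamp [continuous_intros]: "continuous_on S (clamp n k)"
  unfolding clamp_def[abs_def] by (intro continuous_intros)

lemma continuous_on_schauder [continuous_intros]: "continuous_on S (schauder l k)"
  by (cases l) (auto simp: schauder.simps[abs_def] intro!: continuous_intros)

lemma sum_clamp:
  assumes "0 \<le> t" "t \<le> real T"
  shows "(\<Sum>k<T * 2 ^ n. clamp n k t) = t"
proof -
  have "(\<Sum>k<K. clamp n k t) = min t (real K / 2 ^ n)" for K
  proof (induction K)
    case 0
    then show ?case using assms by simp
  next
    case (Suc K)
    have "min t (real K / 2 ^ n) + clamp n K t = min t (real K / 2 ^ n + 1 / 2 ^ n)"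
    proof -
      have h: "min t x + max 0 (min (t - x) h) = min t (x + h)" if "0 < h" for x h :: real
        using that by (auto simp: min_def max_def)
      show ?thesis unfolding clamp_def by (rule h) simp
    qed
    then show ?case using Suc by (simp add: add_divide_distrib ac_simps)
  qed
  then show ?thesis using assms by simp
qed

text \<open>Inner product of the projections of the indicators of \<open>[0, s]\<close> and
  \<open>[0, t]\<close> onto functions that are constant on dyadic intervals of level
  \<open>n\<close>; the factor is the inverse of the interval length.\<close>

definition dyadic_cov :: "nat \<Rightarrow> nat \<Rightarrow> real \<Rightarrow> real \<Rightarrow> real" where
  "dyadic_cov T n s t = 2 ^ n * (\<Sum>k<T * 2 ^ n. clamp n k s * clamp n k t)"

lemma sum_even_odd: "(\<Sum>k<2 * m. f k) = (\<Sum>k<m. f (2 * k) + f (2 * k + 1 :: nat) :: real)"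
  by (induction m) (auto simp: algebra_simps)

text \<open>Parseval's identity for Haar functions up to level \<open>n\<close>. With
  \<open>a, b\<close> and \<open>a', b'\<close> for the two halves,
  \<open>2 * (a * a' + b * b')\<close> is \<open>(a + b) * (a' + b') + (a - b) * (a' - b')\<close>,
  which splits off the next level. Truncated subtraction in \<open>l - 1\<close> gives levels 0 and
  1 the same number \<open>T\<close> of functions.\<close>

lemma sum_schauder_products:
  "(\<Sum>l\<le>n. \<Sum>k<T * 2 ^ (l - 1). schauder l k s * schauder l k t) = dyadic_cov T n s t"
proof (induction n)
  case 0
  then show ?case by (simp add: dyadic_cov_def)
next
  case (Suc n)
  have sq: "sqrt (2 ^ n) * sqrt (2 ^ n) = (2 ^ n :: real)" by simp
  have "dyadic_cov T (Suc n) s t = 2 ^ Suc n * (\<Sum>k<2 * (T * 2 ^ n). clamp (Suc n) k s * clamp (Suc n) k t)"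
    by (simp add: dyadic_cov_def ac_simps)
  also have "\<dots> = 2 ^ Suc n * (\<Sum>k<T * 2 ^ n. clamp (Suc n) (2 * k) s * clamp (Suc n) (2 * k) t + clamp (Suc n) (2 * k + 1) s * clamp (Suc n) (2 * k + 1) t)"
    by (simp only: sum_even_odd)
  also have "\<dots> = (\<Sum>k<T * 2 ^ n. 2 ^ n * (clamp n k s * clamp n k t) + schauder (Suc n) k s * schauder (Suc n) k t)"
    unfolding sum_distrib_left
  proof (rule sum.cong[OF refl])
    fix k
    define a a' b b' where "a = clamp (Suc n) (2 * k) s" and "a' = clamp (Suc n) (2 * k) t"
      and "b = clamp (Suc n) (2 * k + 1) s" and "b' = clamp (Suc n) (2 * k + 1) t"
    have "schauder (Suc n) k s * schauder (Suc n) k t = (sqrt (2 ^ n) * sqrt (2 ^ n)) * ((a - b) * (a' - b'))"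
      by (simp only: schauder.simps a_def a'_def b_def b'_def ac_simps)
    then have "schauder (Suc n) k s * schauder (Suc n) k t = 2 ^ n * ((a - b) * (a' - b'))" unfolding sq .
    moreover have "clamp n k s * clamp n k t = (a + b) * (a' + b')"
      unfolding clamp_split[of n k s] clamp_split[of n k t] a_def a'_def b_def b'_def ..
    ultimately show "2 ^ Suc n * (clamp (Suc n) (2 * k) s * clamp (Suc n) (2 * k) t + clamp (Suc n) (2 * k + 1) s * clamp (Suc n) (2 * k + 1) t) =
        2 ^ n * (clamp n k s * clamp n k t) + schauder (Suc n) k s * schauder (Suc n) k t"
      unfolding a_def[symmetric] a'_def[symmetric] b_def[symmetric] b'_def[symmetric] by (simp add: algebra_simps)
  qed
  also have "\<dots> = dyadic_cov T n s t + (\<Sum>k<T * 2 ^ n. schauder (Suc n) k s * schauder (Suc n) k t)"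
    by (simp add: sum.distrib dyadic_cov_def sum_distrib_left)
  finally show ?case using Suc by (simp del: schauder.simps)
qed

text \<open>Intervals before the one that contains \<open>t\<close> are full for \<open>t\<close>
  and contribute exactly; later ones are empty for \<open>s\<close>. Only the interval of
  \<open>t\<close> itself causes an error, at most the square of its length times
  \<open>2 ^ n\<close>.\<close>

lemma dyadic_cov_close:
  assumes "0 \<le> s" "s \<le> t" "t \<le> real T"
  shows "\<bar>dyadic_cov T n s t - s\<bar> \<le> 1 / 2 ^ n"
proof -
  define h :: real where "h = 1 / 2 ^ n"
  have h: "0 < h" "2 ^ n * h = 1" by (auto simp: h_def)
  have sT: "(\<Sum>k<T * 2 ^ n. clamp n k s) = s" using sum_clamp[of s T n] assms by simp
  define k0 where "k0 = nat \<lfloor>t * 2 ^ n\<rfloor>"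
  have k0: "real k0 \<le> t * 2 ^ n" "t * 2 ^ n < real k0 + 1" using assms unfolding k0_def by (auto simp: floor_less_cancel)
  have tm: "0 \<le> h * clamp n k s - clamp n k s * clamp n k t" "h * clamp n k s - clamp n k s * clamp n k t \<le> (if k = k0 then h * h else 0)" for k
  proof -
    have c: "0 \<le> clamp n k s" "clamp n k s \<le> h" "0 \<le> clamp n k t" "clamp n k t \<le> h"
      unfolding h_def by (rule clamp_bounds)+
    then show "0 \<le> h * clamp n k s - clamp n k s * clamp n k t"
      using mult_left_mono[of "clamp n k t" h "clamp n k s"] by (simp add: mult.commute)
    consider "k < k0" | "k = k0" | "k0 < k" by linarith
    then show "h * clamp n k s - clamp n k s * clamp n k t \<le> (if k = k0 then h * h else 0)"
    proof cases
      case 1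
      then have "real (Suc k) \<le> t * 2 ^ n" using k0(1) by linarith
      then have "clamp n k t = h" unfolding h_def by (intro clamp_full) (simp add: divide_le_eq)
      then show ?thesis using 1 by simp
    next
      case 2
      have "h * clamp n k s \<le> h * h" using c h by (intro mult_left_mono) auto
      moreover have "0 \<le> clamp n k s * clamp n k t" using c by simp
      ultimately show ?thesis using 2 by simp
    next
      case 3
      then have "t * 2 ^ n \<le> real k" using k0(2) by linarith
      then have "t \<le> real k / 2 ^ n" by (simp add: le_divide_eq)
      then have "s \<le> real k / 2 ^ n" using assms(2) by linarith
      then have "clamp n k s = 0" by (rule clamp_empty)
      then show ?thesis using 3 by simp
    qed
  qed
  have "s - dyadic_cov T n s t = 2 ^ n * (\<Sum>k<T * 2 ^ n. h * clamp n k s - clamp n k s * clamp n k t)"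
  proof -
    have "2 ^ n * (\<Sum>k<T * 2 ^ n. h * clamp n k s) = s"
      by (simp only: sum_distrib_left[symmetric] sT mult.assoc[symmetric] h(2) mult_1_left)
    then show ?thesis by (simp only: dyadic_cov_def sum_subtractf right_diff_distrib)
  qed
  moreover have "0 \<le> (\<Sum>k<T * 2 ^ n. h * clamp n k s - clamp n k s * clamp n k t)"
    by (intro sum_nonneg tm)
  moreover have "(\<Sum>k<T * 2 ^ n. h * clamp n k s - clamp n k s * clamp n k t) \<le> (\<Sum>k<T * 2 ^ n. if k = k0 then h * h else 0)"
    by (intro sum_mono tm)
  moreover have "(\<Sum>k<T * 2 ^ n. if k = k0 then h * h else 0) \<le> h * h" by simp
  ultimately have "0 \<le> s - dyadic_cov T n s t" "s - dyadic_cov T n s t \<le> 2 ^ n * (h * h)"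
    by (auto intro!: mult_left_mono)
  moreover have "2 ^ n * (h * h) = h" using h by simp
  ultimately show ?thesis by (simp add: h_def)
qed

lemma dyadic_cov_tendsto:
  assumes "0 \<le> s" "0 \<le> t" "s \<le> real T" "t \<le> real T"
  shows "(\<lambda>n. dyadic_cov T n s t) \<longlonglongrightarrow> min s t"
proof -
  have sym: "dyadic_cov T n s t = dyadic_cov T n t s" for n by (simp add: dyadic_cov_def mult.commute)
  have bound: "\<bar>dyadic_cov T n s t - min s t\<bar> \<le> 1 / 2 ^ n" for n
    using dyadic_cov_close[of s t T n] dyadic_cov_close[of t s T n] assms sym[of n] by (cases "s \<le> t") (auto simp: min_def)
  show ?thesis
  proof (rule LIM_zero_cancel, rule Lim_null_comparison)
    show "\<forall>\<^sub>F n in sequentially. norm (dyadic_cov T n s t - min s t) \<le> 1 / 2 ^ n"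
      using bound by simp
    show "(\<lambda>n. 1 / 2 ^ n :: real) \<longlonglongrightarrow> 0"
      using LIMSEQ_realpow_zero[of "1 / 2"] by (simp add: power_divide)
  qed
qed

lemma schauder_empty: "t \<le> real k / 2 ^ (l - 1) \<Longrightarrow> schauder l k t = 0"
proof (cases l)
  case (Suc n)
  assume t: "t \<le> real k / 2 ^ (l - 1)"
  have "clamp n k t = 0" using t Suc by (intro clamp_empty) simp
  then have "clamp (Suc n) (2 * k) t = 0" "clamp (Suc n) (2 * k + 1) t = 0"
    unfolding clamp_split[of n k t] using clamp_bounds(1)[of "Suc n" "2 * k" t] clamp_bounds(1)[of "Suc n" "2 * k + 1" t] by linarith+
  then show ?thesis using Suc by simp
qed (simp add: clamp_empty)

text \<open>The functions of one level have disjoint supports, so only the interval that contains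
  \<open>t\<close> contributes, by at most the height of its tent. The bound is thus independent of
  the number of intervals.\<close>

lemma sum_abs_schauder:
  assumes t: "0 \<le> t"
  shows "(\<Sum>k<K. \<bar>schauder (Suc n) k t\<bar>) \<le> sqrt (2 ^ n) / 2 ^ Suc n"
proof -
  define k0 where "k0 = nat \<lfloor>t * 2 ^ n\<rfloor>"
  have k0: "real k0 \<le> t * 2 ^ n" "t * 2 ^ n < real k0 + 1" using t unfolding k0_def by (auto simp: floor_less_cancel)
  have "\<bar>schauder (Suc n) k t\<bar> \<le> (if k = k0 then sqrt (2 ^ n) / 2 ^ Suc n else 0)" for k
  proof -
    consider "k < k0" | "k = k0" | "k0 < k" by linarith
    then show ?thesis
    proof cases
      case 1
      then have "real (Suc k) \<le> t * 2 ^ n" using k0(1) by linarith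
      then have "clamp n k t = 1 / 2 ^ n" by (intro clamp_full) (simp add: divide_le_eq)
      then have "clamp (Suc n) (2 * k) t + clamp (Suc n) (2 * k + 1) t = 2 * (1 / 2 ^ Suc n)"
        unfolding clamp_split[of n k t] by simp
      then have "clamp (Suc n) (2 * k) t = clamp (Suc n) (2 * k + 1) t"
        using clamp_bounds(2)[of "Suc n" "2 * k" t] clamp_bounds(2)[of "Suc n" "2 * k + 1" t] by linarith
      then show ?thesis using 1 by simp
    next
      case 2
      have "\<bar>clamp (Suc n) (2 * k) t - clamp (Suc n) (2 * k + 1) t\<bar> \<le> 1 / 2 ^ Suc n"
        using clamp_bounds[of "Suc n" "2 * k" t] clamp_bounds[of "Suc n" "2 * k + 1" t] by linarith
      then have "sqrt (2 ^ n) * \<bar>clamp (Suc n) (2 * k) t - clamp (Suc n) (2 * k + 1) t\<bar> \<le> sqrt (2 ^ n) * (1 / 2 ^ Suc n)"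
        by (intro mult_left_mono) auto
      then show ?thesis using 2 by (simp add: abs_mult)
    next
      case 3
      then have "t * 2 ^ n \<le> real k" using k0(2) by linarith
      then have "schauder (Suc n) k t = 0" by (intro schauder_empty) (simp add: le_divide_eq)
      then show ?thesis using 3 by simp
    qed
  qed
  then have "(\<Sum>k<K. \<bar>schauder (Suc n) k t\<bar>) \<le> (\<Sum>k<K. if k = k0 then sqrt (2 ^ n) / 2 ^ Suc n else 0)"
    by (intro sum_mono)
  also have "\<dots> \<le> sqrt (2 ^ n) / 2 ^ Suc n" by simp
  finally show ?thesis .
qed

section \<open>Independent Brownian motions on a product of standard normal laws\<close>

definition bm_space :: "(nat \<Rightarrow> real) measure" where
  "bm_space = (\<Pi>\<^sub>M i\<in>UNIV. std_normal_distribution)"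

text \<open>An injective code for motion \<open>r\<close>, level \<open>l\<close> and position
  \<open>k\<close>: all coefficients are different coordinates of one product space, which makes the
  motions independent of each other.\<close>

definition code :: "nat \<Rightarrow> nat \<Rightarrow> nat \<Rightarrow> nat" where
  "code r l k = prod_encode (r, prod_encode (l, k))"

definition bm_level :: "nat \<Rightarrow> nat \<Rightarrow> real \<Rightarrow> (nat \<Rightarrow> real) \<Rightarrow> real" where
  "bm_level l r t \<omega> = (\<Sum>k<nat \<lceil>t\<rceil> * 2 ^ (l - 1). schauder l k t * \<omega> (code r l k))"

definition bm :: "nat \<Rightarrow> real \<Rightarrow> (nat \<Rightarrow> real) \<Rightarrow> real" where
  "bm r t \<omega> = (\<Sum>l. bm_level l r t \<omega>)"

lemma code_inject: "code r l k = code r' l' k' \<longleftrightarrow> r = r' \<and> l = l' \<and> k = k'"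
  by (auto simp: code_def)

text \<open>Schauder functions of intervals that begin at or after \<open>t\<close> vanish, so any
  integer horizon beyond \<open>t\<close> may replace the ceiling. A range that does not depend on
  \<open>t\<close> is needed for continuity and for several times at once.\<close>

lemma bm_level_extend:
  assumes "0 \<le> t" "t \<le> real T"
  shows "bm_level l r t \<omega> = (\<Sum>k<T * 2 ^ (l - 1). schauder l k t * \<omega> (code r l k))"
  unfolding bm_level_def
proof (rule sum.mono_neutral_left)
  have "nat \<lceil>t\<rceil> \<le> T" using assms by (simp add: ceiling_le_iff nat_le_iff)
  then show "{..<nat \<lceil>t\<rceil> * 2 ^ (l - 1)} \<subseteq> {..<T * 2 ^ (l - 1)}" by auto
  show "\<forall>k\<in>{..<T * 2 ^ (l - 1)} - {..<nat \<lceil>t\<rceil> * 2 ^ (l - 1)}. schauder l k t * \<omega> (code r l k) = 0"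
  proof
    fix k assume "k \<in> {..<T * 2 ^ (l - 1)} - {..<nat \<lceil>t\<rceil> * 2 ^ (l - 1)}"
    then have "nat \<lceil>t\<rceil> * 2 ^ (l - 1) \<le> k" by simp
    then have "real (nat \<lceil>t\<rceil> * 2 ^ (l - 1)) \<le> real k" by (simp only: of_nat_le_iff)
    then have k: "real (nat \<lceil>t\<rceil>) * 2 ^ (l - 1) \<le> real k" by simp
    have "t \<le> real (nat \<lceil>t\<rceil>)" using assms by linarith
    then have "t * 2 ^ (l - 1) \<le> real (nat \<lceil>t\<rceil>) * 2 ^ (l - 1)" by (intro mult_right_mono) auto
    with k have "t * 2 ^ (l - 1) \<le> real k" by (rule order_trans[rotated])
    then show "schauder l k t * \<omega> (code r l k) = 0" by (subst schauder_empty) (auto simp: le_divide_eq)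
  qed
qed simp

interpretation bm_space: prob_space bm_space
  unfolding bm_space_def by (intro prob_space_PiM prob_space_normal_density) simp

lemma coord_measurable [measurable]: "(\<lambda>\<omega>. \<omega> i) \<in> borel_measurable bm_space"
proof -
  have "(\<lambda>\<omega>. \<omega> i) \<in> measurable bm_space std_normal_distribution"
    unfolding bm_space_def by measurable
  then show ?thesis by simp
qed

lemma bm_measurable [measurable]: "bm_level l r t \<in> borel_measurable bm_space" "bm r t \<in> borel_measurable bm_space"
  unfolding bm_def[abs_def] bm_level_def[abs_def] by measurable

lemma char_coords:
  assumes F: "finite F"
  shows "bm_space.expectation (\<lambda>\<omega>. cis (\<Sum>i\<in>F. a i * \<omega> i)) = of_real (exp (- (\<Sum>i\<in>F. (a i)\<^sup>2) / 2))"
proof -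
  let ?N = std_normal_distribution
  interpret N: prob_space ?N by (rule prob_space_normal_density) simp
  interpret product_prob_space "\<lambda>_::nat. ?N" UNIV
    by (intro product_prob_spaceI) (rule N.prob_space_axioms)
  have cis: "cis (\<Sum>i\<in>F. a i * x i) = (\<Prod>i\<in>F. cis (a i * x i))" for x
    using F by (induction F rule: finite_induct) (simp_all add: cis_mult[symmetric])
  have "bm_space.expectation (\<lambda>\<omega>. cis (\<Sum>i\<in>F. a i * \<omega> i)) =
      bm_space.expectation (\<lambda>\<omega>. \<Prod>i\<in>F. cis (a i * restrict \<omega> F i))"
    unfolding cis by (intro Bochner_Integration.integral_cong refl prod.cong) auto
  also have "\<dots> = (\<integral>x. (\<Prod>i\<in>F. cis (a i * x i)) \<partial>distr (\<Pi>\<^sub>M i\<in>UNIV. ?N) (\<Pi>\<^sub>M i\<in>F. ?N) (\<lambda>x. restrict x F))"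
    unfolding bm_space_def
  proof (rule integral_distr[symmetric])
    show "(\<lambda>x. restrict x F) \<in> measurable (\<Pi>\<^sub>M i\<in>UNIV. ?N) (\<Pi>\<^sub>M i\<in>F. ?N)"
      by (rule measurable_restrict_subset) simp
    have [measurable]: "(\<lambda>x. x i) \<in> borel_measurable (\<Pi>\<^sub>M i\<in>F. ?N)" if "i \<in> F" for i
      using measurable_component_singleton[OF that, of "\<lambda>_. ?N"] by simp
    show "(\<lambda>x. \<Prod>i\<in>F. cis (a i * x i)) \<in> borel_measurable (\<Pi>\<^sub>M i\<in>F. ?N)" by measurable
  qed
  also have "\<dots> = (\<integral>x. (\<Prod>i\<in>F. cis (a i * x i)) \<partial>(\<Pi>\<^sub>M i\<in>F. ?N))"
    by (subst distr_PiM_restrict_finite[OF F]) auto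
  also have "\<dots> = (\<Prod>i\<in>F. \<integral>x. cis (a i * x) \<partial>?N)"
    by (rule product_integral_prod[OF F]) (rule N.integrable_const_bound[where B = 1]; simp)
  also have "\<dots> = of_real (exp (- (\<Sum>i\<in>F. (a i)\<^sup>2) / 2))"
    unfolding integral_cis_std_normal
    by (simp add: exp_sum[OF F, symmetric] sum_negf sum_divide_distrib flip: of_real_prod)
  finally show ?thesis .
qed

lemma distr_coord: "distr bm_space borel (\<lambda>\<omega>. \<omega> i) = std_normal_distribution"
proof -
  have "distr bm_space borel (\<lambda>\<omega>. \<omega> i) = normal_law 0 (sqrt 1)"
  proof (rule bm_space.distr_eq_normal_law)
    show "bm_space.expectation (\<lambda>\<omega>. cis (\<theta> * \<omega> i)) = of_real (exp (- \<theta>\<^sup>2 * 1 / 2))" for \<theta>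
      using char_coords[of "{i}" "\<lambda>_. \<theta>"] by simp
  qed simp_all
  then show ?thesis by (simp add: normal_law_def)
qed

text \<open>Up to level \<open>n\<close> the combination is a finite linear form in independent
  standard normal coordinates. Its variance is the sum of squared coefficients, which
  \<open>sum_schauder_products\<close> evaluates for each motion separately.\<close>

lemma char_bm_partial:
  assumes A: "finite A" "\<And>a. a \<in> A \<Longrightarrow> 0 \<le> tm a \<and> tm a \<le> real T"
  shows "bm_space.expectation (\<lambda>\<omega>. cis (\<Sum>r<R. \<Sum>a\<in>A. d r a * (\<Sum>l\<le>n. bm_level l r (tm a) \<omega>))) =
    of_real (exp (- (\<Sum>r<R. \<Sum>a\<in>A. \<Sum>b\<in>A. d r a * d r b * dyadic_cov T n (tm a) (tm b)) / 2))"
proof -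
  define S where "S = (SIGMA r:{..<R}. SIGMA l:{..n}. {..<T * 2 ^ (l - 1)})"
  define cd where "cd = (\<lambda>(r, l, k). code r l k)"
  have S: "finite S" by (simp add: S_def)
  have inj: "inj_on cd S" by (auto simp: inj_on_def cd_def code_inject)
  define w where "w = (\<lambda>(r, l, k). \<Sum>a\<in>A. d r a * schauder l k (tm a))"
  define coef where "coef i = w (the_inv_into S cd i)" for i
  have sumS: "(\<Sum>p\<in>S. f p) = (\<Sum>r<R. \<Sum>l\<le>n. \<Sum>k<T * 2 ^ (l - 1). f (r, l, k))" for f :: "nat \<times> nat \<times> nat \<Rightarrow> real"
  proof -
    have Sig: "(\<Sum>p\<in>Sigma A B. g p) = (\<Sum>x\<in>A. \<Sum>y\<in>B x. g (x, y))" if "finite A" "\<And>x. finite (B x)"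
      for A :: "'x set" and B :: "'x \<Rightarrow> 'y set" and g :: "'x \<times> 'y \<Rightarrow> real"
      using that by (subst sum.Sigma) auto
    show ?thesis unfolding S_def by (simp only: Sig finite_lessThan finite_atMost finite_SigmaI)
  qed
  have reindex: "(\<Sum>i\<in>cd ` S. f i) = (\<Sum>p\<in>S. f (cd p))" for f :: "nat \<Rightarrow> real"
    by (simp add: sum.reindex[OF inj])
  have coef: "coef (cd p) = w p" if "p \<in> S" for p
    unfolding coef_def using the_inv_into_f_f[OF inj that] by simp
  have lin: "(\<Sum>r<R. \<Sum>a\<in>A. d r a * (\<Sum>l\<le>n. bm_level l r (tm a) \<omega>)) = (\<Sum>i\<in>cd ` S. coef i * \<omega> i)" for \<omega>
  proof -
    have "(\<Sum>r<R. \<Sum>a\<in>A. d r a * (\<Sum>l\<le>n. bm_level l r (tm a) \<omega>)) =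
        (\<Sum>r<R. \<Sum>a\<in>A. \<Sum>l\<le>n. \<Sum>k<T * 2 ^ (l - 1). d r a * schauder l k (tm a) * \<omega> (code r l k))"
    proof (rule sum.cong[OF refl], rule sum.cong[OF refl])
      fix r a assume "a \<in> A"
      then have ext: "bm_level l r (tm a) \<omega> = (\<Sum>k<T * 2 ^ (l - 1). schauder l k (tm a) * \<omega> (code r l k))" for l
        using A(2) by (intro bm_level_extend) auto
      show "d r a * (\<Sum>l\<le>n. bm_level l r (tm a) \<omega>) =
          (\<Sum>l\<le>n. \<Sum>k<T * 2 ^ (l - 1). d r a * schauder l k (tm a) * \<omega> (code r l k))"
        unfolding ext by (simp add: sum_distrib_left mult.assoc)
    qed
    also have "\<dots> = (\<Sum>r<R. \<Sum>l\<le>n. \<Sum>a\<in>A. \<Sum>k<T * 2 ^ (l - 1). d r a * schauder l k (tm a) * \<omega> (code r l k))"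
      by (rule sum.cong[OF refl], rule sum.swap)
    also have "\<dots> = (\<Sum>r<R. \<Sum>l\<le>n. \<Sum>k<T * 2 ^ (l - 1). \<Sum>a\<in>A. d r a * schauder l k (tm a) * \<omega> (code r l k))"
      by (rule sum.cong[OF refl], rule sum.cong[OF refl], rule sum.swap)
    also have "\<dots> = (\<Sum>p\<in>S. w p * \<omega> (cd p))"
      unfolding sumS by (simp add: w_def cd_def sum_distrib_right)
    also have "\<dots> = (\<Sum>i\<in>cd ` S. coef i * \<omega> i)"
      unfolding reindex by (intro sum.cong refl) (simp add: coef)
    finally show ?thesis .
  qed
  have var: "(\<Sum>i\<in>cd ` S. (coef i)\<^sup>2) = (\<Sum>r<R. \<Sum>a\<in>A. \<Sum>b\<in>A. d r a * d r b * dyadic_cov T n (tm a) (tm b))"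
  proof -
    have "(\<Sum>i\<in>cd ` S. (coef i)\<^sup>2) = (\<Sum>p\<in>S. (w p)\<^sup>2)"
      unfolding reindex by (intro sum.cong refl) (simp add: coef)
    also have "\<dots> = (\<Sum>r<R. \<Sum>l\<le>n. \<Sum>k<T * 2 ^ (l - 1). \<Sum>a\<in>A. \<Sum>b\<in>A. (d r a * d r b) * (schauder l k (tm a) * schauder l k (tm b)))"
      unfolding sumS by (simp add: w_def power2_eq_square sum_product ac_simps)
    also have "\<dots> = (\<Sum>r<R. \<Sum>a\<in>A. \<Sum>b\<in>A. (d r a * d r b) * (\<Sum>l\<le>n. \<Sum>k<T * 2 ^ (l - 1). schauder l k (tm a) * schauder l k (tm b)))"
    proof (rule sum.cong[OF refl])
      fix r
      let ?g = "\<lambda>l k a b. (d r a * d r b) * (schauder l k (tm a) * schauder l k (tm b))"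
      have "(\<Sum>l\<le>n. \<Sum>k<T * 2 ^ (l - 1). \<Sum>a\<in>A. \<Sum>b\<in>A. ?g l k a b) = (\<Sum>l\<le>n. \<Sum>a\<in>A. \<Sum>k<T * 2 ^ (l - 1). \<Sum>b\<in>A. ?g l k a b)"
        by (rule sum.cong[OF refl], rule sum.swap)
      also have "\<dots> = (\<Sum>a\<in>A. \<Sum>l\<le>n. \<Sum>k<T * 2 ^ (l - 1). \<Sum>b\<in>A. ?g l k a b)"
        by (rule sum.swap)
      also have "\<dots> = (\<Sum>a\<in>A. \<Sum>l\<le>n. \<Sum>b\<in>A. \<Sum>k<T * 2 ^ (l - 1). ?g l k a b)"
        by (rule sum.cong[OF refl], rule sum.cong[OF refl], rule sum.swap)
      also have "\<dots> = (\<Sum>a\<in>A. \<Sum>b\<in>A. \<Sum>l\<le>n. \<Sum>k<T * 2 ^ (l - 1). ?g l k a b)"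
        by (rule sum.cong[OF refl], rule sum.swap)
      finally show "(\<Sum>l\<le>n. \<Sum>k<T * 2 ^ (l - 1). \<Sum>a\<in>A. \<Sum>b\<in>A. ?g l k a b) =
          (\<Sum>a\<in>A. \<Sum>b\<in>A. (d r a * d r b) * (\<Sum>l\<le>n. \<Sum>k<T * 2 ^ (l - 1). schauder l k (tm a) * schauder l k (tm b)))"
        by (simp only: sum_distrib_left)
    qed
    finally show ?thesis unfolding sum_schauder_products .
  qed
  show ?thesis unfolding lin using char_coords[of "cd ` S" coef] S var by simp
qed

lemma coord_moment4: "integrable bm_space (\<lambda>\<omega>. \<omega> i ^ 4)" "bm_space.expectation (\<lambda>\<omega>. \<omega> i ^ 4) = 3"
proof -
  have "integrable (distr bm_space borel (\<lambda>\<omega>. \<omega> i)) (\<lambda>x. x ^ 4)"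
    unfolding distr_coord by (rule integrable_std_normal_distribution_moment)
  then show "integrable bm_space (\<lambda>\<omega>. \<omega> i ^ 4)" by (simp add: integrable_distr_eq)
  have "bm_space.expectation (\<lambda>\<omega>. \<omega> i ^ 4) = (\<integral>x. x ^ 4 \<partial>distr bm_space borel (\<lambda>\<omega>. \<omega> i))"
    by (simp add: integral_distr)
  also have "\<dots> = 3"
    unfolding distr_coord using std_normal_distribution_even_moments(1)[of 2] by (simp add: fact_numeral)
  finally show "bm_space.expectation (\<lambda>\<omega>. \<omega> i ^ 4) = 3" .
qed

text \<open>Summability of \<open>E (\<xi> ^ 4) * 2 ^ l / 3 ^ l\<close> bounds all coefficients of level \<open>l\<close> by a constant times
  \<open>3 ^ (l / 4)\<close>, which is beaten by the size \<open>2 ^ (- l / 2)\<close> of the Schauder functions.\<close>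

lemma AE_coefficients_bounded:
  "AE \<omega> in bm_space. \<exists>Z\<ge>0. \<forall>l k. k < T * 2 ^ l \<longrightarrow> \<omega> (code r (Suc l) k) ^ 4 \<le> Z * 3 ^ l"
proof -
  define Y where "Y l \<omega> = (\<Sum>k<T * 2 ^ l. \<omega> (code r (Suc l) k) ^ 4) / 3 ^ l" for l and \<omega> :: "nat \<Rightarrow> real"
  have Y_nonneg: "0 \<le> Y l \<omega>" for l \<omega> unfolding Y_def by (intro divide_nonneg_nonneg sum_nonneg) auto
  have [measurable]: "Y l \<in> borel_measurable bm_space" for l unfolding Y_def[abs_def] by measurable
  have int_Y: "integrable bm_space (Y l)" for l unfolding Y_def[abs_def] using coord_moment4 by simp
  have EY: "bm_space.expectation (Y l) = 3 * real T * (2 / 3) ^ l" for l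
    unfolding Y_def[abs_def] using coord_moment4 by (simp add: power_divide)
  have "(\<integral>\<^sup>+\<omega>. (\<Sum>l. ennreal (Y l \<omega>)) \<partial>bm_space) = (\<Sum>l. \<integral>\<^sup>+\<omega>. ennreal (Y l \<omega>) \<partial>bm_space)"
    by (rule nn_integral_suminf) simp
  also have "\<dots> = (\<Sum>l. ennreal (3 * real T * (2 / 3) ^ l))"
    using int_Y Y_nonneg by (simp add: nn_integral_eq_integral EY)
  also have "\<dots> = ennreal (\<Sum>l. 3 * real T * (2 / 3) ^ l)"
    by (rule suminf_ennreal2) (auto intro!: summable_mult summable_geometric)
  also have "\<dots> < \<infinity>" by simp
  finally have "AE \<omega> in bm_space. (\<Sum>l. ennreal (Y l \<omega>)) \<noteq> \<infinity>"
    by (intro nn_integral_noteq_infinite) (auto simp: less_top[symmetric])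
  then show ?thesis
  proof eventually_elim
    case (elim \<omega>)
    then have sm: "summable (\<lambda>l. Y l \<omega>)" using Y_nonneg by (intro summable_suminf_not_top) auto
    define Z where "Z = (\<Sum>l. Y l \<omega>)"
    have Y_le: "Y l \<omega> \<le> Z" for l
      unfolding Z_def using sum_le_suminf[OF sm, of "{l}"] Y_nonneg by simp
    have "\<omega> (code r (Suc l) k) ^ 4 \<le> Z * 3 ^ l" if "k < T * 2 ^ l" for l k
    proof -
      have "\<omega> (code r (Suc l) k) ^ 4 \<le> (\<Sum>k<T * 2 ^ l. \<omega> (code r (Suc l) k) ^ 4)"
        using that by (intro member_le_sum[where f = "\<lambda>k. \<omega> (code r (Suc l) k) ^ 4"]) auto
      also have "\<dots> = Y l \<omega> * 3 ^ l" by (simp add: Y_def)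
      also have "\<dots> \<le> Z * 3 ^ l" by (intro mult_right_mono Y_le) auto
      finally show ?thesis .
    qed
    moreover have "0 \<le> Z" by (rule order_trans[OF Y_nonneg Y_le])
    ultimately show ?case by blast
  qed
qed

lemma AE_bm_level_bound:
  "AE \<omega> in bm_space. \<forall>T::nat. \<exists>B q. 0 \<le> q \<and> q < 1 \<and> (\<forall>l t. 0 \<le> t \<and> t \<le> real T \<longrightarrow> \<bar>bm_level (Suc l) r t \<omega>\<bar> \<le> B * q ^ l)"
  unfolding AE_all_countable
proof
  fix T :: nat
  show "AE \<omega> in bm_space. \<exists>B q. 0 \<le> q \<and> q < 1 \<and> (\<forall>l t. 0 \<le> t \<and> t \<le> real T \<longrightarrow> \<bar>bm_level (Suc l) r t \<omega>\<bar> \<le> B * q ^ l)"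
    using AE_coefficients_bounded[of T r]
  proof eventually_elim
    case (elim \<omega>)
    then obtain Z where Z: "0 \<le> Z" "\<And>l k. k < T * 2 ^ l \<Longrightarrow> \<omega> (code r (Suc l) k) ^ 4 \<le> Z * 3 ^ l" by blast
    \<comment> \<open>The ratio of \<open>3 ^ (1 / 4)\<close>, the growth of the coefficients, to
      \<open>2 ^ (1 / 2)\<close>, the decay of the Schauder functions; it is below 1 because 3 <
      4.\<close>
    define q where "q = sqrt (sqrt 3) / sqrt 2"
    have "sqrt 3 < sqrt 4" by (rule real_sqrt_less_mono) simp
    then have "sqrt (sqrt 3) < sqrt 2" by (intro real_sqrt_less_mono) simp
    then have q: "0 \<le> q" "q < 1" by (auto simp: q_def)
    define B where "B = sqrt (sqrt Z) / 2"
    have "\<bar>bm_level (Suc l) r t \<omega>\<bar> \<le> B * q ^ l" if t: "0 \<le> t" "t \<le> real T" for l t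
    proof -
      define m where "m = sqrt (sqrt (Z * 3 ^ l))"
      have m: "0 \<le> m" using Z(1) by (simp add: m_def)
      have coef: "\<bar>\<omega> (code r (Suc l) k)\<bar> \<le> m" if "k < T * 2 ^ l" for k
      proof -
        let ?x = "\<omega> (code r (Suc l) k)"
        have "sqrt (sqrt (?x ^ 4)) \<le> m" unfolding m_def by (intro real_sqrt_le_mono Z(2) that)
        moreover have "sqrt (?x ^ 4) = ?x\<^sup>2"
          using real_sqrt_abs[of "?x\<^sup>2"] by (simp flip: power_mult)
        ultimately show ?thesis by simp
      qed
      have "\<bar>bm_level (Suc l) r t \<omega>\<bar> \<le> (\<Sum>k<T * 2 ^ l. \<bar>schauder (Suc l) k t\<bar> * \<bar>\<omega> (code r (Suc l) k)\<bar>)"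
        unfolding bm_level_extend[OF t] by (rule order_trans[OF sum_abs]) (simp add: abs_mult del: schauder.simps)
      also have "\<dots> \<le> (\<Sum>k<T * 2 ^ l. \<bar>schauder (Suc l) k t\<bar> * m)"
        by (intro sum_mono mult_left_mono coef) auto
      also have "\<dots> = (\<Sum>k<T * 2 ^ l. \<bar>schauder (Suc l) k t\<bar>) * m" by (simp only: sum_distrib_right)
      also have "\<dots> \<le> sqrt (2 ^ l) / 2 ^ Suc l * m"
        by (intro mult_right_mono sum_abs_schauder t m)
      also have "\<dots> = B * q ^ l"
      proof -
        have two: "(2::real) ^ l = sqrt 2 ^ l * sqrt 2 ^ l" by (simp flip: power_mult_distrib)
        have "m = sqrt (sqrt Z) * sqrt (sqrt 3) ^ l"
          by (simp add: m_def real_sqrt_mult real_sqrt_power)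
        then show ?thesis unfolding B_def q_def power_divide power_Suc
          by (simp add: real_sqrt_power two)
      qed
      finally show ?thesis .
    qed
    with q show ?case by blast
  qed
qed

text \<open>The geometric bounds hold uniformly on bounded time intervals, so the Weierstrass test
  gives uniform convergence and continuity there. One null set serves all horizons, which extends
  continuity to the half line.\<close>

lemma AE_bm_convergence:
  "AE \<omega> in bm_space. continuous_on {0..} (\<lambda>t. bm r t \<omega>) \<and> (\<forall>t\<ge>0. (\<lambda>n. \<Sum>l\<le>n. bm_level l r t \<omega>) \<longlonglongrightarrow> bm r t \<omega>)"
  using AE_bm_level_bound[of r]
proof eventually_elim
  case (elim \<omega>)
  have on: "continuous_on {0..real T} (\<lambda>t. bm r t \<omega>)" and sm: "\<And>t. 0 \<le> t \<Longrightarrow> t \<le> real T \<Longrightarrow> summable (\<lambda>l. bm_level l r t \<omega>)" for T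
  proof -
    obtain B q where q: "0 \<le> q" "q < 1" and B: "\<And>l t. 0 \<le> t \<Longrightarrow> t \<le> real T \<Longrightarrow> \<bar>bm_level (Suc l) r t \<omega>\<bar> \<le> B * q ^ l"
      using elim by blast
    have sumB: "summable (\<lambda>l. B * q ^ l)" using q by (intro summable_mult summable_geometric) simp
    show sm: "summable (\<lambda>l. bm_level l r t \<omega>)" if "0 \<le> t" "t \<le> real T" for t
    proof (subst summable_Suc_iff[symmetric], rule summable_comparison_test'[OF sumB])
      show "norm (bm_level (Suc l) r t \<omega>) \<le> B * q ^ l" for l using B[OF that] by simp
    qed
    have "uniform_limit {0..real T} (\<lambda>n t. \<Sum>l<n. bm_level (Suc l) r t \<omega>) (\<lambda>t. \<Sum>l. bm_level (Suc l) r t \<omega>) sequentially"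
      by (rule Weierstrass_m_test[OF _ sumB]) (use B in auto)
    then have "continuous_on {0..real T} (\<lambda>t. \<Sum>l. bm_level (Suc l) r t \<omega>)"
    proof (rule uniform_limit_theorem[rotated])
      have "continuous_on {0..real T} (\<lambda>t. bm_level l r t \<omega>)" for l
      proof (subst continuous_on_cong[OF refl])
        show "bm_level l r t \<omega> = (\<Sum>k<T * 2 ^ (l - 1). schauder l k t * \<omega> (code r l k))" if "t \<in> {0..real T}" for t
          using that by (intro bm_level_extend) auto
        show "continuous_on {0..real T} (\<lambda>t. \<Sum>k<T * 2 ^ (l - 1). schauder l k t * \<omega> (code r l k))"
          by (intro continuous_intros)
      qed
      then show "\<forall>\<^sub>F n in sequentially. continuous_on {0..real T} (\<lambda>t. \<Sum>l<n. bm_level (Suc l) r t \<omega>)"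
        by (intro always_eventually allI continuous_on_sum)
    qed simp
    \<comment> \<open>Level 0 is treated apart because the geometric bound starts at level
      1.\<close>
    moreover have "continuous_on {0..real T} (\<lambda>t. bm_level 0 r t \<omega>)"
    proof (subst continuous_on_cong[OF refl])
      show "bm_level 0 r t \<omega> = (\<Sum>k<T * 2 ^ (0 - 1). schauder 0 k t * \<omega> (code r 0 k))" if "t \<in> {0..real T}" for t
        using that by (intro bm_level_extend) auto
      show "continuous_on {0..real T} (\<lambda>t. \<Sum>k<T * 2 ^ (0 - 1). schauder 0 k t * \<omega> (code r 0 k))"
        by (intro continuous_intros)
    qed
    ultimately have "continuous_on {0..real T} (\<lambda>t. (\<Sum>l. bm_level (Suc l) r t \<omega>) + bm_level 0 r t \<omega>)"
      by (rule continuous_on_add)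
    moreover have "bm r t \<omega> = (\<Sum>l. bm_level (Suc l) r t \<omega>) + bm_level 0 r t \<omega>" if "t \<in> {0..real T}" for t
      unfolding bm_def using suminf_split_head[OF sm[of t]] that by simp
    ultimately show "continuous_on {0..real T} (\<lambda>t. bm r t \<omega>)"
      by (subst continuous_on_cong[OF refl]) auto
  qed
  have "continuous_on {0..} (\<lambda>t. bm r t \<omega>)"
    unfolding continuous_on_eq_continuous_within
  proof
    fix t :: real assume t: "t \<in> {0..}"
    obtain T :: nat where T: "t + 1 \<le> real T" using real_arch_simple by blast
    have "continuous (at t within {0..real T}) (\<lambda>t. bm r t \<omega>)"
      using on[of T] t T by (simp add: continuous_on_eq_continuous_within)
    moreover have "at t within {0..real T} = at t within {0..}"
      by (rule at_within_nhd[of t "{..<t + 1}"]) (use T in auto)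
    ultimately show "continuous (at t within {0..}) (\<lambda>t. bm r t \<omega>)" by (simp add: continuous_within)
  qed
  moreover have "(\<lambda>n. \<Sum>l\<le>n. bm_level l r t \<omega>) \<longlonglongrightarrow> bm r t \<omega>" if "0 \<le> t" for t
  proof -
    obtain T :: nat where T: "t \<le> real T" using real_arch_simple by blast
    show ?thesis unfolding bm_def by (rule summable_LIMSEQ'[OF sm[OF that T]])
  qed
  ultimately show ?case by blast
qed

text \<open>The limit of \<open>char_bm_partial\<close> as the level grows: dominated convergence on
  the left, convergence of \<open>dyadic_cov\<close> to \<open>min\<close> on the right. The outer
  sum over \<open>r\<close> expresses independence of the motions.\<close>

lemma char_bm:
  assumes A: "finite A" "\<And>a. a \<in> A \<Longrightarrow> 0 \<le> tm a"
  shows "bm_space.expectation (\<lambda>\<omega>. cis (\<Sum>r<R. \<Sum>a\<in>A. d r a * bm r (tm a) \<omega>)) =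
    of_real (exp (- (\<Sum>r<R. \<Sum>a\<in>A. \<Sum>b\<in>A. d r a * d r b * min (tm a) (tm b)) / 2))"
proof -
  obtain T :: nat where T: "\<And>a. a \<in> A \<Longrightarrow> tm a \<le> real T"
  proof -
    obtain T :: nat where "(\<Sum>a\<in>A. tm a) \<le> real T" using real_arch_simple by blast
    moreover have "tm a \<le> (\<Sum>a\<in>A. tm a)" if "a \<in> A" for a using A that by (intro member_le_sum) auto
    ultimately show ?thesis using that by (meson order_trans)
  qed
  have "(\<lambda>n. bm_space.expectation (\<lambda>\<omega>. cis (\<Sum>r<R. \<Sum>a\<in>A. d r a * (\<Sum>l\<le>n. bm_level l r (tm a) \<omega>)))) \<longlonglongrightarrow>
      bm_space.expectation (\<lambda>\<omega>. cis (\<Sum>r<R. \<Sum>a\<in>A. d r a * bm r (tm a) \<omega>))"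
  proof (rule integral_dominated_convergence[where w = "\<lambda>_. 1"])
    have "AE \<omega> in bm_space. \<forall>r. \<forall>t\<ge>0. (\<lambda>n. \<Sum>l\<le>n. bm_level l r t \<omega>) \<longlonglongrightarrow> bm r t \<omega>"
      unfolding AE_all_countable using AE_bm_convergence by (auto elim: AE_mp)
    then show "AE \<omega> in bm_space. (\<lambda>n. cis (\<Sum>r<R. \<Sum>a\<in>A. d r a * (\<Sum>l\<le>n. bm_level l r (tm a) \<omega>))) \<longlonglongrightarrow>
        cis (\<Sum>r<R. \<Sum>a\<in>A. d r a * bm r (tm a) \<omega>)"
    proof eventually_elim
      case (elim \<omega>)
      have "(\<lambda>n. \<Sum>r<R. \<Sum>a\<in>A. d r a * (\<Sum>l\<le>n. bm_level l r (tm a) \<omega>)) \<longlonglongrightarrow> (\<Sum>r<R. \<Sum>a\<in>A. d r a * bm r (tm a) \<omega>)"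
        using elim A(2) by (intro tendsto_sum tendsto_mult_left) auto
      moreover have "continuous_on UNIV cis" by (intro continuous_intros)
      then have "isCont cis x" for x by (simp add: continuous_on_eq_continuous_at)
      ultimately show ?case by (rule isCont_tendsto_compose[rotated])
    qed
  qed auto
  moreover have "(\<lambda>n. bm_space.expectation (\<lambda>\<omega>. cis (\<Sum>r<R. \<Sum>a\<in>A. d r a * (\<Sum>l\<le>n. bm_level l r (tm a) \<omega>)))) \<longlonglongrightarrow>
      of_real (exp (- (\<Sum>r<R. \<Sum>a\<in>A. \<Sum>b\<in>A. d r a * d r b * min (tm a) (tm b)) / 2))"
  proof -
    have "(\<lambda>n. bm_space.expectation (\<lambda>\<omega>. cis (\<Sum>r<R. \<Sum>a\<in>A. d r a * (\<Sum>l\<le>n. bm_level l r (tm a) \<omega>)))) =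
        (\<lambda>n. of_real (exp (- (\<Sum>r<R. \<Sum>a\<in>A. \<Sum>b\<in>A. d r a * d r b * dyadic_cov T n (tm a) (tm b)) / 2)))"
      using A T by (intro ext char_bm_partial) auto
    moreover have "(\<lambda>n. complex_of_real (exp (- (\<Sum>r<R. \<Sum>a\<in>A. \<Sum>b\<in>A. d r a * d r b * dyadic_cov T n (tm a) (tm b)) / 2))) \<longlonglongrightarrow>
        of_real (exp (- (\<Sum>r<R. \<Sum>a\<in>A. \<Sum>b\<in>A. d r a * d r b * min (tm a) (tm b)) / 2))"
      using A T by (intro tendsto_intros dyadic_cov_tendsto) auto
    ultimately show ?thesis by simp
  qed
  ultimately show ?thesis by (rule LIMSEQ_unique)
qed

lemma bm_0: "bm r 0 \<omega> = 0"
  by (simp add: bm_def bm_level_def)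

section \<open>The central limit theorem for square-integrable functions\<close>

lemma has_sum_finite_sum:
  fixes f :: "'i \<Rightarrow> 'b \<Rightarrow> real"
  assumes "\<And>i. i \<in> A \<Longrightarrow> (f i has_sum s i) B" and "finite A"
  shows "((\<lambda>x. \<Sum>i\<in>A. f i x) has_sum (\<Sum>i\<in>A. s i)) B"
  using assms(2,1) by (induction A rule: finite_induct) (simp_all add: has_sum_add)

text \<open>By completeness this is the squared norm of a square-integrable \<open>G\<close>. The
  series form is the one in which bounds on covariances arise, degree by degree.\<close>

definition hermite_norm_sq :: "(real \<Rightarrow> real) \<Rightarrow> real" where
  "hermite_norm_sq G = (\<Sum>m. (hermite_coeff G m)\<^sup>2 * fact m)"

definition hermite_remainder :: "(real \<Rightarrow> real) \<Rightarrow> nat \<Rightarrow> real \<Rightarrow> real" where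
  "hermite_remainder G Q x = G x - hermite_partial G Q x"

lemma hermite_coeff_partial: "hermite_coeff (hermite_partial G Q) m = (if m \<le> Q then hermite_coeff G m else 0)"
  unfolding hermite_partial_def[abs_def] by (subst hermite_coeff_sum_hermite) auto

lemma hermite_coeff_remainder:
  "G \<in> L2_gauss \<Longrightarrow> hermite_coeff (hermite_remainder G Q) m = (if m \<le> Q then 0 else hermite_coeff G m)"
  unfolding hermite_remainder_def[abs_def] by (rule hermite_coeff_diff_partial)

lemma hermite_norm_sq_nonneg: "G \<in> L2_gauss \<Longrightarrow> 0 \<le> hermite_norm_sq G"
  unfolding hermite_norm_sq_def by (intro suminf_nonneg hermite_coeff_sq_summable) auto

lemma hermite_norm_sq_remainder_small:
  assumes G: "G \<in> L2_gauss" and e: "0 < e"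
  shows "\<forall>\<^sub>F Q in sequentially. hermite_norm_sq (hermite_remainder G Q) \<le> e"
proof -
  let ?f = "\<lambda>m. (hermite_coeff G m)\<^sup>2 * fact m"
  obtain N where N: "\<And>n. n \<ge> N \<Longrightarrow> norm (\<Sum>i. ?f (i + n)) < e"
    using suminf_exist_split[OF e hermite_coeff_sq_summable[OF G]] by auto
  have "hermite_norm_sq (hermite_remainder G Q) \<le> e" if "Q \<ge> N" for Q
  proof -
    let ?g = "\<lambda>m. (hermite_coeff (hermite_remainder G Q) m)\<^sup>2 * fact m"
    have "summable ?g"
      by (rule summable_comparison_test'[OF hermite_coeff_sq_summable[OF G], of 0]) (simp add: hermite_coeff_remainder[OF G])
    from suminf_split_initial_segment[OF this, of "Suc Q"]
    have "hermite_norm_sq (hermite_remainder G Q) = (\<Sum>i. ?f (i + Suc Q))"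
      unfolding hermite_norm_sq_def by (simp add: hermite_coeff_remainder[OF G])
    with N[of "Suc Q"] that show ?thesis by simp
  qed
  then show ?thesis unfolding eventually_sequentially by blast
qed

lemma abs_coeff_product_le:
  "\<bar>hermite_coeff G m * hermite_coeff H m * fact m\<bar> \<le>
    ((hermite_coeff G m)\<^sup>2 * fact m + (hermite_coeff H m)\<^sup>2 * fact m) / 2"
proof -
  have "\<bar>a * b\<bar> \<le> (a\<^sup>2 + b\<^sup>2) / 2" for a b :: real
    using zero_le_power2[of "\<bar>a\<bar> - \<bar>b\<bar>"] by (simp add: power2_diff abs_mult)
  from mult_right_mono[OF this[of "hermite_coeff G m" "hermite_coeff H m"], of "fact m"]
  show ?thesis by (simp add: abs_mult algebra_simps)
qed

section \<open>Covariances at a lag and their sum over all lags\<close>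

context stat_gauss
begin

text \<open>Only a lower bound on the rank, with mean zero included through \<open>m = 0\<close>.
  Unlike the exact rank it is inherited by truncations, remainders and multiples.\<close>

definition rank_ge :: "(real \<Rightarrow> real) set" where
  "rank_ge = {G \<in> L2_gauss. \<forall>m<k. hermite_coeff G m = 0}"

definition lag_cov :: "(real \<Rightarrow> real) \<Rightarrow> (real \<Rightarrow> real) \<Rightarrow> int \<Rightarrow> real" where
  "lag_cov G H h = expectation (\<lambda>\<omega>. G (X h \<omega>) * H (X 0 \<omega>))"

text \<open>The long-run covariance: the limit of the normalized covariances of partial sums. It
  sums over lags; \<open>cov_term_sums\<close> rewrites it as a sum over degrees.\<close>

definition long_cov :: "(real \<Rightarrow> real) \<Rightarrow> (real \<Rightarrow> real) \<Rightarrow> real" where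
  "long_cov G H = infsum (lag_cov G H) UNIV"

definition \<gamma>_total :: real where
  "\<gamma>_total = infsum (\<lambda>n. \<bar>\<gamma> n\<bar> ^ k) UNIV"

lemma \<gamma>_total_nonneg: "0 \<le> \<gamma>_total"
  unfolding \<gamma>_total_def by (intro infsum_nonneg) simp

lemma rank_geD: "G \<in> rank_ge \<Longrightarrow> G \<in> L2_gauss" "G \<in> rank_ge \<Longrightarrow> m < k \<Longrightarrow> hermite_coeff G m = 0"
  by (auto simp: rank_ge_def)

lemma rank_ge_partial: "G \<in> rank_ge \<Longrightarrow> hermite_partial G Q \<in> rank_ge"
  by (auto simp: rank_ge_def hermite_partial_L2 hermite_coeff_partial)

lemma rank_ge_remainder: "G \<in> rank_ge \<Longrightarrow> hermite_remainder G Q \<in> rank_ge"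
  using L2_gauss_diff[OF rank_geD(1) hermite_partial_L2[of G Q], of G]
  by (auto simp: rank_ge_def hermite_coeff_remainder) (simp add: hermite_remainder_def[abs_def])

lemma rank_ge_cmult: "G \<in> rank_ge \<Longrightarrow> (\<lambda>x. c * G x) \<in> rank_ge"
  by (auto simp: rank_ge_def L2_gauss_cmult hermite_coeff_def mult.assoc)

lemma lag_cov_sums:
  assumes "G \<in> L2_gauss" "H \<in> L2_gauss"
  shows "(\<lambda>m. hermite_coeff G m * hermite_coeff H m * fact m * \<gamma> h ^ m) sums lag_cov G H h"
  using expectation_L2_sums[OF assms, of h 0] by (simp add: lag_cov_def)

lemma expectation_lag:
  assumes "G \<in> L2_gauss" "H \<in> L2_gauss"
  shows "expectation (\<lambda>\<omega>. G (X n \<omega>) * H (X l \<omega>)) = lag_cov G H (n - l)"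
  by (rule sums_unique2[OF expectation_L2_sums[OF assms] lag_cov_sums[OF assms]])

text \<open>All contributing degrees are at least \<open>k\<close> and
  \<open>\<bar>\<gamma> h\<bar>\<close> is at most 1, so each power is dominated by the
  \<open>k\<close>-th; the inequality of arithmetic and geometric means splits the products of
  coefficients.\<close>

lemma lag_cov_bound:
  assumes G: "G \<in> rank_ge" and H: "H \<in> rank_ge"
  shows "\<bar>lag_cov G H h\<bar> \<le> (hermite_norm_sq G + hermite_norm_sq H) / 2 * \<bar>\<gamma> h\<bar> ^ k"
proof -
  let ?f = "\<lambda>m. hermite_coeff G m * hermite_coeff H m * fact m * \<gamma> h ^ m"
  let ?g = "\<lambda>m. ((hermite_coeff G m)\<^sup>2 * fact m + (hermite_coeff H m)\<^sup>2 * fact m) / 2 * \<bar>\<gamma> h\<bar> ^ k"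
  note sm = hermite_coeff_sq_summable[OF rank_geD(1)[OF G]] hermite_coeff_sq_summable[OF rank_geD(1)[OF H]]
  have "norm (?f m) \<le> ?g m" for m
  proof (cases "m < k")
    case True
    then show ?thesis using rank_geD(2)[OF G True] by simp
  next
    case False
    then have "\<bar>\<gamma> h\<bar> ^ m \<le> \<bar>\<gamma> h\<bar> ^ k" using \<gamma>_le_1[of h] by (intro power_decreasing) auto
    then show ?thesis using mult_mono[OF abs_coeff_product_le[of G m H], of "\<bar>\<gamma> h\<bar> ^ m" "\<bar>\<gamma> h\<bar> ^ k"]
      by (simp add: abs_mult power_abs)
  qed
  moreover have "?g sums ((hermite_norm_sq G + hermite_norm_sq H) / 2 * \<bar>\<gamma> h\<bar> ^ k)"
    unfolding hermite_norm_sq_def by (intro sums_mult2 sums_divide sums_add summable_sums sm)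
  ultimately have "norm (suminf ?f) \<le> (hermite_norm_sq G + hermite_norm_sq H) / 2 * \<bar>\<gamma> h\<bar> ^ k"
    using norm_suminf_le[of ?f ?g] by (simp add: sums_iff)
  then show ?thesis using sums_unique[OF lag_cov_sums[OF rank_geD(1)[OF G] rank_geD(1)[OF H], of h]] by simp
qed

lemma lag_cov_abs_summable:
  assumes "G \<in> rank_ge" "H \<in> rank_ge"
  shows "(\<lambda>h. \<bar>lag_cov G H h\<bar>) summable_on UNIV"
proof (rule summable_on_comparison_test)
  show "(\<lambda>h. (hermite_norm_sq G + hermite_norm_sq H) / 2 * \<bar>\<gamma> h\<bar> ^ k) summable_on UNIV"
    by (rule summable_on_cmult_right[OF \<gamma>_summable])
qed (use lag_cov_bound[OF assms] in auto)

lemma lag_cov_summable: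
  assumes "G \<in> rank_ge" "H \<in> rank_ge"
  shows "lag_cov G H summable_on UNIV"
  by (rule abs_summable_summable) (use lag_cov_abs_summable[OF assms] in simp)

lemma long_cov_bound:
  assumes "G \<in> rank_ge" "H \<in> rank_ge"
  shows "\<bar>long_cov G H\<bar> \<le> (hermite_norm_sq G + hermite_norm_sq H) / 2 * \<gamma>_total"
proof -
  have "\<bar>long_cov G H\<bar> \<le> infsum (\<lambda>h. \<bar>lag_cov G H h\<bar>) UNIV"
    using norm_infsum_bound[of "lag_cov G H" UNIV] lag_cov_abs_summable[OF assms] by (simp add: long_cov_def)
  also have "\<dots> \<le> infsum (\<lambda>h. (hermite_norm_sq G + hermite_norm_sq H) / 2 * \<bar>\<gamma> h\<bar> ^ k) UNIV"
    by (intro infsum_mono lag_cov_abs_summable assms summable_on_cmult_right \<gamma>_summable lag_cov_bound)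
  finally show ?thesis by (simp only: infsum_cmult_right' \<gamma>_total_def)
qed

text \<open>Different degrees are uncorrelated, so there are no cross terms between low and high
  degrees and the covariance splits additively.\<close>

lemma lag_cov_truncate:
  assumes "G \<in> L2_gauss" "H \<in> L2_gauss" "hermite_remainder G Q \<in> L2_gauss" "hermite_remainder H Q \<in> L2_gauss"
  shows "lag_cov G H h = lag_cov (hermite_partial G Q) (hermite_partial H Q) h +
    lag_cov (hermite_remainder G Q) (hermite_remainder H Q) h"
proof -
  have "(\<lambda>m. hermite_coeff G m * hermite_coeff H m * fact m * \<gamma> h ^ m) sums
      (lag_cov (hermite_partial G Q) (hermite_partial H Q) h + lag_cov (hermite_remainder G Q) (hermite_remainder H Q) h)"
    using sums_add[OF lag_cov_sums[OF hermite_partial_L2 hermite_partial_L2] lag_cov_sums[OF assms(3,4)], of G Q H Q h]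
    by (rule back_subst[of "\<lambda>f. f sums _"])
       (auto simp: fun_eq_iff hermite_coeff_partial hermite_coeff_remainder assms)
  from sums_unique2[OF lag_cov_sums[OF assms(1,2)] this] show ?thesis .
qed

lemma long_cov_truncate:
  assumes "G \<in> rank_ge" "H \<in> rank_ge"
  shows "\<bar>long_cov G H - long_cov (hermite_partial G Q) (hermite_partial H Q)\<bar> \<le>
    (hermite_norm_sq (hermite_remainder G Q) + hermite_norm_sq (hermite_remainder H Q)) / 2 * \<gamma>_total"
proof -
  have "long_cov G H = long_cov (hermite_partial G Q) (hermite_partial H Q) +
      long_cov (hermite_remainder G Q) (hermite_remainder H Q)"
    unfolding long_cov_def
    by (subst infsum_add[symmetric])
       (auto intro!: lag_cov_summable assms rank_ge_partial rank_ge_remainder infsum_cong lag_cov_truncate rank_geD)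
  then show ?thesis using long_cov_bound[OF rank_ge_remainder rank_ge_remainder, OF assms, of Q Q] by simp
qed

lemma lag_cov_partial:
  "lag_cov (hermite_partial G Q) (hermite_partial H Q) h =
    (\<Sum>m\<le>Q. hermite_coeff G m * hermite_coeff H m * fact m * \<gamma> h ^ m)"
proof -
  have "(\<lambda>m. hermite_coeff (hermite_partial G Q) m * hermite_coeff (hermite_partial H Q) m * fact m * \<gamma> h ^ m) sums
      (\<Sum>m\<le>Q. hermite_coeff (hermite_partial G Q) m * hermite_coeff (hermite_partial H Q) m * fact m * \<gamma> h ^ m)"
    by (rule sums_finite) (auto simp: hermite_coeff_partial)
  from sums_unique2[OF lag_cov_sums[OF hermite_partial_L2 hermite_partial_L2] this]
  show ?thesis by (simp add: hermite_coeff_partial)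
qed

lemma long_cov_partial:
  assumes "G \<in> rank_ge"
  shows "long_cov (hermite_partial G Q) (hermite_partial H Q) = (\<Sum>m\<le>Q. cov_term \<gamma> G H m)"
proof -
  have "((\<lambda>h. \<Sum>m\<le>Q. hermite_coeff G m * hermite_coeff H m * fact m * \<gamma> h ^ m) has_sum
      (\<Sum>m\<le>Q. cov_term \<gamma> G H m)) UNIV"
  proof (rule has_sum_finite_sum)
    fix m
    show "((\<lambda>h. hermite_coeff G m * hermite_coeff H m * fact m * \<gamma> h ^ m) has_sum cov_term \<gamma> G H m) UNIV"
    proof (cases "m < k")
      case True
      then show ?thesis using rank_geD(2)[OF assms True] by (simp add: cov_term_def)
    next
      case False
      have "(\<lambda>h. \<gamma> h ^ m) summable_on UNIV"
        by (rule abs_summable_summable) (use \<gamma>_power_summable[of m] False in \<open>simp add: power_abs\<close>)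
      then show ?thesis unfolding cov_term_def by (intro has_sum_cmult_right has_sum_infsum)
    qed
  qed simp
  then show ?thesis unfolding long_cov_def lag_cov_partial by (rule infsumI)
qed

lemma cov_term_abs_summable:
  assumes "G \<in> rank_ge" "H \<in> rank_ge"
  shows "summable (\<lambda>m. norm (cov_term \<gamma> G H m))"
proof (rule summable_comparison_test'[where N = 0])
  let ?g = "\<lambda>m. ((hermite_coeff G m)\<^sup>2 * fact m + (hermite_coeff H m)\<^sup>2 * fact m) / 2 * \<gamma>_total"
  show "summable ?g"
    by (intro summable_mult2 summable_divide summable_add hermite_coeff_sq_summable rank_geD(1) assms)
  show "norm (norm (cov_term \<gamma> G H m)) \<le> ?g m" if "0 \<le> m" for m
  proof (cases "m < k")
    case True
    then show ?thesis using rank_geD(2)[OF assms(1) True] \<gamma>_total_nonneg by (simp add: cov_term_def)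
  next
    case False
    have "\<bar>\<gamma> h\<bar> ^ m \<le> \<bar>\<gamma> h\<bar> ^ k" for h
      using False \<gamma>_le_1[of h] by (intro power_decreasing) auto
    then have "\<bar>infsum (\<lambda>h. \<gamma> h ^ m) UNIV\<bar> \<le> \<gamma>_total"
      using norm_infsum_bound[of "\<lambda>h. \<gamma> h ^ m" UNIV] \<gamma>_power_summable[of m] False \<gamma>_summable
        infsum_mono[of "\<lambda>h. \<bar>\<gamma> h\<bar> ^ m" UNIV "\<lambda>h. \<bar>\<gamma> h\<bar> ^ k"]
      by (simp add: power_abs \<gamma>_total_def)
    then show ?thesis unfolding cov_term_def
      using mult_mono[OF abs_coeff_product_le[of G m H], of "\<bar>infsum (\<lambda>h. \<gamma> h ^ m) UNIV\<bar>" \<gamma>_total]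
      by (simp add: abs_mult)
  qed
qed

lemma remainder_small:
  assumes "G \<in> rank_ge" "0 < e"
  shows "\<forall>\<^sub>F Q in sequentially. hermite_norm_sq (hermite_remainder G Q) * \<gamma>_total \<le> e"
proof -
  define e' where "e' = e / (\<gamma>_total + 1)"
  have e': "0 < e'" "e' * \<gamma>_total \<le> e" using assms(2) \<gamma>_total_nonneg by (simp_all add: e'_def field_simps)
  from hermite_norm_sq_remainder_small[OF rank_geD(1)[OF assms(1)] e'(1)]
  show ?thesis
  proof (rule eventually_mono)
    fix Q assume "hermite_norm_sq (hermite_remainder G Q) \<le> e'"
    from mult_right_mono[OF this \<gamma>_total_nonneg] e'(2)
    show "hermite_norm_sq (hermite_remainder G Q) * \<gamma>_total \<le> e" by linarith
  qed
qed

lemma long_cov_partial_tendsto: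
  assumes "G \<in> rank_ge" "H \<in> rank_ge"
  shows "(\<lambda>Q. long_cov (hermite_partial G Q) (hermite_partial H Q)) \<longlonglongrightarrow> long_cov G H"
proof (rule tendstoI)
  fix e :: real assume e: "0 < e"
  then have e2: "0 < e / 2" by simp
  from eventually_conj[OF remainder_small[OF assms(1) e2] remainder_small[OF assms(2) e2]]
  show "\<forall>\<^sub>F Q in sequentially. dist (long_cov (hermite_partial G Q) (hermite_partial H Q)) (long_cov G H) < e"
  proof (rule eventually_mono)
    fix Q
    assume "hermite_norm_sq (hermite_remainder G Q) * \<gamma>_total \<le> e / 2 \<and>
      hermite_norm_sq (hermite_remainder H Q) * \<gamma>_total \<le> e / 2"
    then have "(hermite_norm_sq (hermite_remainder G Q) + hermite_norm_sq (hermite_remainder H Q)) / 2 * \<gamma>_total \<le> e / 2"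
      by (simp add: algebra_simps)
    with long_cov_truncate[OF assms, of Q] e
    show "dist (long_cov (hermite_partial G Q) (hermite_partial H Q)) (long_cov G H) < e"
      unfolding dist_real_def by linarith
  qed
qed

text \<open>Exchanges the sums over lags and over degrees. For truncated expansions the exchange is
  a finite one, and the truncation error is bounded by the norms of the remainders.\<close>

lemma cov_term_sums:
  assumes "G \<in> rank_ge" "H \<in> rank_ge"
  shows "cov_term \<gamma> G H sums long_cov G H"
  unfolding sums_def_le long_cov_partial[OF assms(1), of _ H, symmetric]
  by (rule long_cov_partial_tendsto[OF assms])

lemma cov_term_has_sum:
  assumes "G \<in> rank_ge" "H \<in> rank_ge"
  shows "(cov_term \<gamma> G H has_sum long_cov G H) UNIV"
  by (rule norm_summable_imp_has_sum[OF cov_term_abs_summable[OF assms] cov_term_sums[OF assms]])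

section \<open>Second moments and the limit theorem for partial sums\<close>

lemma expectation_sum_product:
  assumes G: "G \<in> L2_gauss" and H: "H \<in> L2_gauss" and "finite I" "finite L"
  shows "integrable M (\<lambda>\<omega>. (\<Sum>n\<in>I. G (X n \<omega>)) * (\<Sum>l\<in>L. H (X l \<omega>)))"
    "expectation (\<lambda>\<omega>. (\<Sum>n\<in>I. G (X n \<omega>)) * (\<Sum>l\<in>L. H (X l \<omega>))) = (\<Sum>n\<in>I. \<Sum>l\<in>L. lag_cov G H (n - l))"
  unfolding sum_product using L2_X_mult(1)[OF G H] by (simp_all add: expectation_lag[OF G H])

text \<open>Linear growth in the window size with a constant proportional to the squared norm: this
  makes the error of truncation small uniformly in \<open>N\<close> after division by
  \<open>sqrt N\<close>.\<close>

lemma expectation_sum_sq_le: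
  assumes G: "G \<in> rank_ge" and I: "finite I"
  shows "expectation (\<lambda>\<omega>. (\<Sum>n\<in>I. G (X n \<omega>))\<^sup>2) \<le> real (card I) * (hermite_norm_sq G * \<gamma>_total)"
proof -
  note G2 = rank_geD(1)[OF G]
  let ?u = "\<lambda>h. hermite_norm_sq G * \<bar>\<gamma> h\<bar> ^ k"
  have "lag_cov G G h \<le> ?u h" for h
    using abs_le_D1[OF lag_cov_bound[OF G G, of h]] by simp
  then have "(\<Sum>n\<in>I. \<Sum>l\<in>I. lag_cov G G (n - l)) \<le> (\<Sum>n\<in>I. \<Sum>l\<in>I. ?u (n - l))"
    by (intro sum_mono)
  also have "\<dots> \<le> real (card I) * infsum ?u UNIV"
    by (rule double_sum_le_infsum[OF summable_on_cmult_right[OF \<gamma>_summable] _ I I])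
       (simp add: hermite_norm_sq_nonneg[OF G2])
  finally show ?thesis
    unfolding power2_eq_square expectation_sum_product(2)[OF G2 G2 I I] \<gamma>_total_def by (simp only: infsum_cmult_right')
qed

lemma partial_sum_cov_limit:
  assumes "G \<in> rank_ge" "H \<in> rank_ge" "0 \<le> s" "0 \<le> t"
  shows "(\<lambda>N. expectation (\<lambda>\<omega>. (\<Sum>n\<in>{1..\<lfloor>real N * s\<rfloor>}. G (X n \<omega>)) * (\<Sum>n\<in>{1..\<lfloor>real N * t\<rfloor>}. H (X n \<omega>))) / real N)
    \<longlonglongrightarrow> min s t * long_cov G H"
  unfolding expectation_sum_product(2)[OF rank_geD(1)[OF assms(1)] rank_geD(1)[OF assms(2)] finite_atLeastAtMost_int finite_atLeastAtMost_int]
    long_cov_def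
  by (rule double_sum_limit[OF lag_cov_abs_summable[OF assms(1,2)] assms(3,4)])

text \<open>All pairs of a function and a time are merged into one chaos sum over a common window.
  Its coefficient at \<open>n\<close> adds up those functions whose own window contains
  \<open>n\<close>.\<close>

lemma hermite_partial_clt:
  assumes P: "finite P" and H: "\<And>p. p \<in> P \<Longrightarrow> H p \<in> rank_ge" and tm: "\<And>p. p \<in> P \<Longrightarrow> 0 \<le> tm p"
  shows "(\<lambda>N. expectation (\<lambda>\<omega>. cis ((\<Sum>p\<in>P. \<Sum>n\<in>{1..\<lfloor>real N * tm p\<rfloor>}. hermite_partial (H p) Q (X n \<omega>)) / sqrt (real N))))
    \<longlonglongrightarrow> of_real (exp (- (\<Sum>p\<in>P. \<Sum>q\<in>P. min (tm p) (tm q) *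
      long_cov (hermite_partial (H p) Q) (hermite_partial (H q) Q)) / 2))"
proof -
  \<comment> \<open>The sum of the times serves as a common upper bound for them.\<close>
  define T where "T = (\<Sum>p\<in>P. tm p)"
  have T: "0 \<le> T" "\<And>p. p \<in> P \<Longrightarrow> tm p \<le> T"
    unfolding T_def using P tm by (auto intro: sum_nonneg member_le_sum)
  define I where "I t N = {1..\<lfloor>real N * t\<rfloor>}" for t and N :: nat
  have I_sub: "I (tm p) N \<subseteq> I T N" if "p \<in> P" for p N
    unfolding I_def using floor_mono[OF mult_left_mono[OF T(2)[OF that], of "real N"]] by auto
  have fin: "finite (I t N)" for t N by (simp add: I_def)
  define c where "c p m = hermite_coeff (H p) m" for p m
  define b where "b N n m = (\<Sum>p\<in>P. of_bool (n \<in> I (tm p) N) * c p m) / sqrt (real N)" for N n m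
  have restr: "(\<Sum>n\<in>I T N. of_bool (n \<in> I (tm p) N) * f n) = (\<Sum>n\<in>I (tm p) N. f n)"
    if "p \<in> P" for f :: "int \<Rightarrow> real" and p N
    by (rule sum.mono_neutral_cong_right[OF fin I_sub[OF that]]) auto
  have low: "(\<Sum>m\<in>{k..Q}. c p m * f m) = (\<Sum>m\<le>Q. c p m * f m)" if "p \<in> P" for f :: "nat \<Rightarrow> real" and p
    by (rule sum.mono_neutral_left) (auto simp: c_def rank_geD(2)[OF H[OF that]])
  have chaos: "chaos_sum (I T N) {k..Q} (b N) \<omega> =
      (\<Sum>p\<in>P. \<Sum>n\<in>I (tm p) N. hermite_partial (H p) Q (X n \<omega>)) / sqrt (real N)" for N \<omega>
  proof -
    have "chaos_sum (I T N) {k..Q} (b N) \<omega> =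
        (\<Sum>n\<in>I T N. \<Sum>m\<in>{k..Q}. \<Sum>p\<in>P. of_bool (n \<in> I (tm p) N) * (c p m * hermite m (X n \<omega>))) / sqrt (real N)"
      by (simp add: chaos_sum_def b_def sum_divide_distrib sum_distrib_right mult.assoc)
    also have "(\<Sum>n\<in>I T N. \<Sum>m\<in>{k..Q}. \<Sum>p\<in>P. of_bool (n \<in> I (tm p) N) * (c p m * hermite m (X n \<omega>))) =
        (\<Sum>n\<in>I T N. \<Sum>p\<in>P. of_bool (n \<in> I (tm p) N) * (\<Sum>m\<in>{k..Q}. c p m * hermite m (X n \<omega>)))"
      unfolding sum_distrib_left by (rule sum.cong[OF refl], rule sum.swap)
    also have "\<dots> = (\<Sum>p\<in>P. \<Sum>n\<in>I T N. of_bool (n \<in> I (tm p) N) * (\<Sum>m\<in>{k..Q}. c p m * hermite m (X n \<omega>)))"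
      by (rule sum.swap)
    also have "\<dots> = (\<Sum>p\<in>P. \<Sum>n\<in>I (tm p) N. hermite_partial (H p) Q (X n \<omega>))"
      by (rule sum.cong[OF refl]) (simp only: restr low, simp add: hermite_partial_def c_def)
    finally show ?thesis .
  qed
  have lag: "(\<Sum>m\<in>{k..Q}. c p m * (c q m * fact m * \<gamma> h ^ m)) = lag_cov (hermite_partial (H p) Q) (hermite_partial (H q) Q) h"
    if "p \<in> P" for p q h
    unfolding low[OF that] lag_cov_partial by (simp add: c_def mult.assoc)
  have tau: "(\<Sum>n\<in>I T N. \<Sum>l\<in>I T N. \<Sum>m\<in>{k..Q}. b N n m * b N l m * fact m * \<gamma> (n - l) ^ m) =
      (\<Sum>p\<in>P. \<Sum>q\<in>P. (\<Sum>n\<in>I (tm p) N. \<Sum>l\<in>I (tm q) N.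
        lag_cov (hermite_partial (H p) Q) (hermite_partial (H q) Q) (n - l)) / real N)" for N
  proof -
    let ?L = "\<lambda>p q h. lag_cov (hermite_partial (H p) Q) (hermite_partial (H q) Q) h"
    let ?i = "\<lambda>p n. of_bool (n \<in> I (tm p) N) :: real"
    have "(\<Sum>m\<in>{k..Q}. b N n m * b N l m * fact m * \<gamma> (n - l) ^ m) =
        (\<Sum>p\<in>P. \<Sum>q\<in>P. ?i p n * (?i q l * ?L p q (n - l))) / real N" for n l
    proof -
      have bb: "b N n m * b N l m = (\<Sum>p\<in>P. \<Sum>q\<in>P. (?i p n * c p m) * (?i q l * c q m)) / real N" for m
        unfolding b_def times_divide_times_eq real_sqrt_mult_self sum_product by simp
      have "(\<Sum>m\<in>{k..Q}. b N n m * b N l m * fact m * \<gamma> (n - l) ^ m) =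
          (\<Sum>m\<in>{k..Q}. \<Sum>p\<in>P. \<Sum>q\<in>P. ?i p n * (?i q l * (c p m * (c q m * fact m * \<gamma> (n - l) ^ m)))) / real N"
        unfolding bb by (simp only: sum_divide_distrib sum_distrib_right) (simp add: ac_simps)
      also have "(\<Sum>m\<in>{k..Q}. \<Sum>p\<in>P. \<Sum>q\<in>P. ?i p n * (?i q l * (c p m * (c q m * fact m * \<gamma> (n - l) ^ m)))) =
          (\<Sum>p\<in>P. \<Sum>m\<in>{k..Q}. \<Sum>q\<in>P. ?i p n * (?i q l * (c p m * (c q m * fact m * \<gamma> (n - l) ^ m))))"
        by (rule sum.swap)
      also have "\<dots> = (\<Sum>p\<in>P. \<Sum>q\<in>P. \<Sum>m\<in>{k..Q}. ?i p n * (?i q l * (c p m * (c q m * fact m * \<gamma> (n - l) ^ m))))"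
        by (rule sum.cong[OF refl], rule sum.swap)
      also have "\<dots> = (\<Sum>p\<in>P. \<Sum>q\<in>P. ?i p n * (?i q l * ?L p q (n - l)))"
        by (rule sum.cong[OF refl], rule sum.cong[OF refl]) (simp only: sum_distrib_left[symmetric] lag)
      finally show ?thesis .
    qed
    then have "(\<Sum>n\<in>I T N. \<Sum>l\<in>I T N. \<Sum>m\<in>{k..Q}. b N n m * b N l m * fact m * \<gamma> (n - l) ^ m) =
        (\<Sum>n\<in>I T N. \<Sum>l\<in>I T N. \<Sum>p\<in>P. \<Sum>q\<in>P. ?i p n * (?i q l * ?L p q (n - l))) / real N"
      by (simp add: sum_divide_distrib)
    also have "(\<Sum>n\<in>I T N. \<Sum>l\<in>I T N. \<Sum>p\<in>P. \<Sum>q\<in>P. ?i p n * (?i q l * ?L p q (n - l))) =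
        (\<Sum>n\<in>I T N. \<Sum>p\<in>P. \<Sum>l\<in>I T N. \<Sum>q\<in>P. ?i p n * (?i q l * ?L p q (n - l)))"
      by (rule sum.cong[OF refl], rule sum.swap)
    also have "\<dots> = (\<Sum>p\<in>P. \<Sum>n\<in>I T N. \<Sum>l\<in>I T N. \<Sum>q\<in>P. ?i p n * (?i q l * ?L p q (n - l)))"
      by (rule sum.swap)
    also have "\<dots> = (\<Sum>p\<in>P. \<Sum>n\<in>I T N. \<Sum>q\<in>P. \<Sum>l\<in>I T N. ?i p n * (?i q l * ?L p q (n - l)))"
      by (rule sum.cong[OF refl], rule sum.cong[OF refl], rule sum.swap)
    also have "\<dots> = (\<Sum>p\<in>P. \<Sum>q\<in>P. \<Sum>n\<in>I T N. \<Sum>l\<in>I T N. ?i p n * (?i q l * ?L p q (n - l)))"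
      by (rule sum.cong[OF refl], rule sum.swap)
    also have "\<dots> = (\<Sum>p\<in>P. \<Sum>q\<in>P. \<Sum>n\<in>I (tm p) N. \<Sum>l\<in>I (tm q) N. ?L p q (n - l))"
      by (rule sum.cong[OF refl], rule sum.cong[OF refl]) (simp only: sum_distrib_left[symmetric] restr)
    finally show ?thesis by (simp add: sum_divide_distrib)
  qed
  define W where "W = (\<Sum>m\<le>Q. \<Sum>p\<in>P. \<bar>c p m\<bar>)"
  have lim: "(\<lambda>N. expectation (\<lambda>\<omega>. cis (chaos_sum (I T N) {k..Q} (b N) \<omega>)))
    \<longlonglongrightarrow> of_real (exp (- (\<Sum>p\<in>P. \<Sum>q\<in>P. min (tm p) (tm q) *
      long_cov (hermite_partial (H p) Q) (hermite_partial (H q) Q)) / 2))"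
  proof (rule chaos_clt)
    show "finite (I T N)" for N by (rule fin)
    show "real (card (I T N)) \<le> T * real N" for N
      using T(1) by (simp add: I_def mult.commute)
    show "\<bar>b N n m\<bar> \<le> W / sqrt (real N)" if "m \<in> {k..Q}" for N n m
    proof -
      have "\<bar>\<Sum>p\<in>P. of_bool (n \<in> I (tm p) N) * c p m\<bar> \<le> (\<Sum>p\<in>P. \<bar>c p m\<bar>)"
        by (rule order_trans[OF sum_abs], rule sum_mono) simp
      also have "\<dots> \<le> W" unfolding W_def using that by (intro member_le_sum sum_nonneg) auto
      finally show ?thesis unfolding b_def abs_divide using divide_right_mono[of _ W "sqrt (real N)"] by simp
    qed
    show "(\<lambda>N. \<Sum>n\<in>I T N. \<Sum>l\<in>I T N. \<Sum>m\<in>{k..Q}. b N n m * b N l m * fact m * \<gamma> (n - l) ^ m) \<longlonglongrightarrow>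
      (\<Sum>p\<in>P. \<Sum>q\<in>P. min (tm p) (tm q) * long_cov (hermite_partial (H p) Q) (hermite_partial (H q) Q))"
      unfolding tau unfolding I_def long_cov_def
      by (intro tendsto_sum double_sum_limit lag_cov_abs_summable rank_ge_partial H tm)
  qed auto
  then show ?thesis unfolding chaos unfolding I_def .
qed

lemma norm_cis_diff_le: "norm (cis x - cis y) \<le> \<bar>x - y\<bar>"
proof -
  have "cis x - cis y = cis y * (cis (x - y) - 1)" by (simp add: algebra_simps cis_mult)
  then have "norm (cis x - cis y) = norm (cis (x - y) - 1)" by (simp add: norm_mult)
  also have "\<dots> \<le> \<bar>x - y\<bar>" using iexp_approx1[of "x - y" 0] by (simp add: cis_conv_exp)
  finally show ?thesis .
qed

text \<open>\<open>cis\<close> is Lipschitz with constant 1, so truncating the expansions moves the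
  characteristic function by at most the mean absolute value of the normalized remainder sums,
  uniformly in \<open>N\<close>; the limits of the truncated sums converge as well.\<close>

lemma rank_clt:
  assumes P: "finite P" and H: "\<And>p. p \<in> P \<Longrightarrow> H p \<in> rank_ge" and tm: "\<And>p. p \<in> P \<Longrightarrow> 0 \<le> tm p"
  shows "(\<lambda>N. expectation (\<lambda>\<omega>. cis ((\<Sum>p\<in>P. \<Sum>n\<in>{1..\<lfloor>real N * tm p\<rfloor>}. H p (X n \<omega>)) / sqrt (real N))))
    \<longlonglongrightarrow> of_real (exp (- (\<Sum>p\<in>P. \<Sum>q\<in>P. min (tm p) (tm q) * long_cov (H p) (H q)) / 2))"
proof (rule tendsto_by_norm_approximation)
  fix e :: real assume e: "0 < e"
  let ?lim = "\<lambda>Q. of_real (exp (- (\<Sum>p\<in>P. \<Sum>q\<in>P. min (tm p) (tm q) *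
      long_cov (hermite_partial (H p) Q) (hermite_partial (H q) Q)) / 2)) :: complex"
  let ?L = "of_real (exp (- (\<Sum>p\<in>P. \<Sum>q\<in>P. min (tm p) (tm q) * long_cov (H p) (H q)) / 2)) :: complex"
  let ?I = "\<lambda>p N. {1..\<lfloor>real N * tm p\<rfloor>}"
  have "?lim \<longlonglongrightarrow> ?L"
    by (intro tendsto_intros long_cov_partial_tendsto H) auto
  from tendstoD[OF this e] have ev1: "\<forall>\<^sub>F Q in sequentially. dist (?lim Q) ?L < e" .
  define B where "B = (\<Sum>p\<in>P. sqrt (tm p)) + 1"
  have B: "0 < B" unfolding B_def using sum_nonneg[of P "\<lambda>p. sqrt (tm p)"] tm by (auto simp: add_nonneg_pos)
  \<comment> \<open>Each remainder sum contributes \<open>sqrt (tm p) * sqrt e'\<close>; since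
    \<open>B\<close> exceeds the sum of the roots of the times, the total stays below
    \<open>e\<close>.\<close>
  define e' where "e' = (e / B)\<^sup>2"
  have e': "0 < e'" "sqrt e' = e / B" using e B by (simp_all add: e'_def)
  have ev2: "\<forall>\<^sub>F Q in sequentially. \<forall>p\<in>P. hermite_norm_sq (hermite_remainder (H p) Q) * \<gamma>_total \<le> e'"
    using P by (intro eventually_ball_finite ballI remainder_small H e') auto
  obtain Q where Q: "dist (?lim Q) ?L < e" "\<And>p. p \<in> P \<Longrightarrow> hermite_norm_sq (hermite_remainder (H p) Q) * \<gamma>_total \<le> e'"
    using eventually_happens'[OF sequentially_bot eventually_conj[OF ev1 ev2]] by blast
  define U where "U K N \<omega> = (\<Sum>p\<in>P. \<Sum>n\<in>?I p N. K p (X n \<omega>)) / sqrt (real N)"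
    for K :: "'b \<Rightarrow> real \<Rightarrow> real" and N :: nat and \<omega>
  define S where "S p N \<omega> = (\<Sum>n\<in>?I p N. hermite_remainder (H p) Q (X n \<omega>))" for p and N :: nat and \<omega>
  have meas: "(\<lambda>\<omega>. K p (X n \<omega>)) \<in> borel_measurable M" if "K p \<in> rank_ge" for K :: "'b \<Rightarrow> real \<Rightarrow> real" and p n
    by (rule L2_X(1)[OF rank_geD(1)[OF that]])
  have U_meas: "U K N \<in> borel_measurable M" if "\<And>p. p \<in> P \<Longrightarrow> K p \<in> rank_ge" for K N
    unfolding U_def[abs_def] using meas[OF that] by measurable
  have S: "integrable M (S p N)" "expectation (\<lambda>\<omega>. \<bar>S p N \<omega>\<bar>) \<le> sqrt (real N) * sqrt (tm p) * (e / B)" if p: "p \<in> P" for p N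
  proof -
    note R = rank_ge_remainder[OF H[OF p], of Q]
    have "S p N \<in> borel_measurable M" unfolding S_def[abs_def] using L2_X(1)[OF rank_geD(1)[OF R]] by measurable
    moreover have "integrable M (\<lambda>\<omega>. (S p N \<omega>)\<^sup>2)"
      unfolding S_def power2_eq_square by (rule expectation_sum_product(1)[OF rank_geD(1)[OF R] rank_geD(1)[OF R]]) auto
    ultimately have "integrable M (S p N)" and 1: "expectation (\<lambda>\<omega>. \<bar>S p N \<omega>\<bar>) \<le> sqrt (expectation (\<lambda>\<omega>. (S p N \<omega>)\<^sup>2))"
      by (rule expectation_abs_le_sqrt)+
    then show "integrable M (S p N)" by simp
    have "expectation (\<lambda>\<omega>. (S p N \<omega>)\<^sup>2) \<le> real (card (?I p N)) * (hermite_norm_sq (hermite_remainder (H p) Q) * \<gamma>_total)"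
      unfolding S_def by (rule expectation_sum_sq_le[OF R]) simp
    also have "\<dots> \<le> (real N * tm p) * e'"
      using Q(2)[OF p] tm[OF p] hermite_norm_sq_nonneg[OF rank_geD(1)[OF R]] \<gamma>_total_nonneg by (intro mult_mono) auto
    finally have "sqrt (expectation (\<lambda>\<omega>. (S p N \<omega>)\<^sup>2)) \<le> sqrt (real N) * sqrt (tm p) * (e / B)"
      using real_sqrt_le_mono by (fastforce simp: real_sqrt_mult e'(2)[symmetric])
    with 1 show "expectation (\<lambda>\<omega>. \<bar>S p N \<omega>\<bar>) \<le> sqrt (real N) * sqrt (tm p) * (e / B)" by linarith
  qed
  show "\<exists>g l. g \<longlonglongrightarrow> l \<and> (\<forall>N\<ge>1. norm (expectation (\<lambda>\<omega>. cis ((\<Sum>p\<in>P. \<Sum>n\<in>?I p N. H p (X n \<omega>)) / sqrt (real N))) - g N) \<le> e) \<and>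
      norm (l - ?L) \<le> e"
  proof (intro exI conjI allI impI)
    let ?H' = "\<lambda>p. hermite_partial (H p) Q"
    show "(\<lambda>N. expectation (\<lambda>\<omega>. cis (U ?H' N \<omega>))) \<longlonglongrightarrow> ?lim Q"
      unfolding U_def by (rule hermite_partial_clt[OF P H tm])
    show "norm (?lim Q - ?L) \<le> e" using Q(1) by (simp add: dist_norm)
    fix N :: nat assume N: "1 \<le> N"
    have H': "?H' p \<in> rank_ge" if "p \<in> P" for p by (rule rank_ge_partial[OF H[OF that]])
    have cis_int: "integrable M (\<lambda>\<omega>. cis (U K N \<omega>))" if "\<And>p. p \<in> P \<Longrightarrow> K p \<in> rank_ge" for K
      using U_meas[OF that] by (intro integrable_const_bound[where B = 1]) auto
    have diff: "U H N \<omega> - U ?H' N \<omega> = (\<Sum>p\<in>P. S p N \<omega>) / sqrt (real N)" for \<omega>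
      by (simp add: U_def S_def hermite_remainder_def sum_subtractf diff_divide_distrib)
    have "norm (expectation (\<lambda>\<omega>. cis (U H N \<omega>)) - expectation (\<lambda>\<omega>. cis (U ?H' N \<omega>))) =
        norm (expectation (\<lambda>\<omega>. cis (U H N \<omega>) - cis (U ?H' N \<omega>)))"
      using cis_int[OF H] cis_int[OF H'] by simp
    also have "\<dots> \<le> expectation (\<lambda>\<omega>. (\<Sum>p\<in>P. \<bar>S p N \<omega>\<bar>) / sqrt (real N))"
    proof (rule order_trans[OF integral_norm_bound integral_mono])
      show "integrable M (\<lambda>\<omega>. norm (cis (U H N \<omega>) - cis (U ?H' N \<omega>)))"
        using cis_int[OF H] cis_int[OF H'] by simp
      show "integrable M (\<lambda>\<omega>. (\<Sum>p\<in>P. \<bar>S p N \<omega>\<bar>) / sqrt (real N))"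
        using S(1) by simp
      show "norm (cis (U H N \<omega>) - cis (U ?H' N \<omega>)) \<le> (\<Sum>p\<in>P. \<bar>S p N \<omega>\<bar>) / sqrt (real N)" for \<omega>
        using norm_cis_diff_le[of "U H N \<omega>" "U ?H' N \<omega>"] sum_abs[of "\<lambda>p. S p N \<omega>" P]
        unfolding diff abs_divide by (auto elim!: order_trans intro: divide_right_mono)
    qed
    also have "\<dots> = (\<Sum>p\<in>P. expectation (\<lambda>\<omega>. \<bar>S p N \<omega>\<bar>)) / sqrt (real N)"
      using S(1) by simp
    also have "\<dots> \<le> (\<Sum>p\<in>P. sqrt (real N) * sqrt (tm p) * (e / B)) / sqrt (real N)"
      by (intro divide_right_mono sum_mono S(2)) auto
    also have "\<dots> = (\<Sum>p\<in>P. sqrt (tm p)) * (e / B)"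
      using N by (simp add: sum_distrib_left[symmetric] sum_distrib_right[symmetric] mult.assoc sum_divide_distrib[symmetric])
    also have "\<dots> \<le> B * (e / B)" using e B by (intro mult_right_mono) (auto simp: B_def)
    also have "\<dots> = e" using B by simp
    finally show "norm (expectation (\<lambda>\<omega>. cis ((\<Sum>p\<in>P. \<Sum>n\<in>?I p N. H p (X n \<omega>)) / sqrt (real N))) -
        expectation (\<lambda>\<omega>. cis (U ?H' N \<omega>))) \<le> e"
      unfolding U_def[of H] .
  qed
qed

lemma lag_cov_commute: "G \<in> L2_gauss \<Longrightarrow> H \<in> L2_gauss \<Longrightarrow> lag_cov G H h = lag_cov H G h"
  using sums_unique2[OF lag_cov_sums[of G H h]] lag_cov_sums[of H G h] by (simp add: ac_simps)

lemma long_cov_commute: "G \<in> L2_gauss \<Longrightarrow> H \<in> L2_gauss \<Longrightarrow> long_cov G H = long_cov H G"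
  unfolding long_cov_def by (intro infsum_cong lag_cov_commute)

lemma long_cov_cmult: "long_cov (\<lambda>x. a * G x) (\<lambda>x. b * H x) = a * b * long_cov G H"
proof -
  have "lag_cov (\<lambda>x. a * G x) (\<lambda>x. b * H x) = (\<lambda>h. (a * b) * lag_cov G H h)"
    unfolding lag_cov_def[abs_def] by (simp add: mult.assoc mult.left_commute flip: integral_mult_right_zero)
  then show ?thesis unfolding long_cov_def by (simp only: infsum_cmult_right')
qed

text \<open>The double sum is a limit of normalized second moments of one partial sum, hence
  nonnegative.\<close>

lemma long_cov_psd:
  assumes P: "finite P" and H: "\<And>p. p \<in> P \<Longrightarrow> H p \<in> rank_ge"
  shows "0 \<le> (\<Sum>p\<in>P. \<Sum>q\<in>P. long_cov (H p) (H q))"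
proof (rule LIMSEQ_le_const)
  let ?S = "\<lambda>p (N::nat) \<omega>. \<Sum>n\<in>{1..\<lfloor>real N * 1\<rfloor>}. H p (X n \<omega>)"
  show "(\<lambda>N. \<Sum>p\<in>P. \<Sum>q\<in>P. expectation (\<lambda>\<omega>. ?S p N \<omega> * ?S q N \<omega>) / real N) \<longlonglongrightarrow>
      (\<Sum>p\<in>P. \<Sum>q\<in>P. long_cov (H p) (H q))"
    using partial_sum_cov_limit[OF H H, of _ _ 1 1] by (intro tendsto_sum) simp
  have int: "integrable M (\<lambda>\<omega>. ?S p N \<omega> * ?S q N \<omega>)" if "p \<in> P" "q \<in> P" for p q N
    using that by (intro expectation_sum_product(1) rank_geD(1) H) auto
  have "0 \<le> (\<Sum>p\<in>P. \<Sum>q\<in>P. expectation (\<lambda>\<omega>. ?S p N \<omega> * ?S q N \<omega>) / real N)" for N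
  proof -
    have "(\<Sum>p\<in>P. \<Sum>q\<in>P. expectation (\<lambda>\<omega>. ?S p N \<omega> * ?S q N \<omega>) / real N) =
        (\<Sum>p\<in>P. \<Sum>q\<in>P. expectation (\<lambda>\<omega>. ?S p N \<omega> * ?S q N \<omega>)) / real N"
      by (simp only: sum_divide_distrib)
    also have "(\<Sum>p\<in>P. \<Sum>q\<in>P. expectation (\<lambda>\<omega>. ?S p N \<omega> * ?S q N \<omega>)) = (\<Sum>p\<in>P. expectation (\<lambda>\<omega>. \<Sum>q\<in>P. ?S p N \<omega> * ?S q N \<omega>))"
      by (rule sum.cong[OF refl], rule Bochner_Integration.integral_sum[symmetric], rule int)
    also have "\<dots> = expectation (\<lambda>\<omega>. \<Sum>p\<in>P. \<Sum>q\<in>P. ?S p N \<omega> * ?S q N \<omega>)"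
      by (rule Bochner_Integration.integral_sum[symmetric], rule Bochner_Integration.integrable_sum, rule int)
    also have "\<dots> = expectation (\<lambda>\<omega>. (\<Sum>p\<in>P. ?S p N \<omega>) * (\<Sum>p\<in>P. ?S p N \<omega>))"
      by (simp only: sum_product)
    also have "\<dots> / real N \<ge> 0" by (intro divide_nonneg_nonneg Bochner_Integration.integral_nonneg) auto
    finally show ?thesis .
  qed
  then show "\<exists>N0. \<forall>N\<ge>N0. 0 \<le> (\<Sum>p\<in>P. \<Sum>q\<in>P. expectation (\<lambda>\<omega>. ?S p N \<omega> * ?S q N \<omega>) / real N)" by blast
qed

end

section \<open>Gaussian processes\<close>

lemma (in prob_space) normal_law_moments:
  assumes [measurable]: "Y \<in> borel_measurable M" and d: "distr M borel Y = normal_law \<mu> \<sigma>" and \<sigma>: "0 \<le> \<sigma>"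
  shows "integrable M Y" "integrable M (\<lambda>\<omega>. (Y \<omega>)\<^sup>2)" "expectation Y = \<mu>" "expectation (\<lambda>\<omega>. (Y \<omega> - \<mu>)\<^sup>2) = \<sigma>\<^sup>2"
proof -
  interpret N: prob_space std_normal_distribution by (rule prob_space_normal_density) simp
  note dY = d[unfolded normal_law_eq_distr[OF \<sigma>]]
  have int: "integrable M (\<lambda>\<omega>. f (Y \<omega>)) \<longleftrightarrow> integrable std_normal_distribution (\<lambda>x. f (\<mu> + \<sigma> * x))"
    "expectation (\<lambda>\<omega>. f (Y \<omega>)) = (\<integral>x. f (\<mu> + \<sigma> * x) \<partial>std_normal_distribution)"
    if [measurable]: "f \<in> borel_measurable borel" for f :: "real \<Rightarrow> real"
  proof -
    have "integrable M (\<lambda>\<omega>. f (Y \<omega>)) \<longleftrightarrow> integrable (distr M borel Y) f" by (rule integrable_distr_eq[of Y M borel f, symmetric]) (use that in auto)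
    also have "\<dots> \<longleftrightarrow> integrable std_normal_distribution (\<lambda>x. f (\<mu> + \<sigma> * x))"
      unfolding dY by (rule integrable_distr_eq[of "\<lambda>x. \<mu> + \<sigma> * x" _ borel f]) (use that in auto)
    finally show "integrable M (\<lambda>\<omega>. f (Y \<omega>)) \<longleftrightarrow> integrable std_normal_distribution (\<lambda>x. f (\<mu> + \<sigma> * x))" .
    have "expectation (\<lambda>\<omega>. f (Y \<omega>)) = integral\<^sup>L (distr M borel Y) f" by (rule integral_distr[of Y M borel f, symmetric]) (use that in auto)
    also have "\<dots> = (\<integral>x. f (\<mu> + \<sigma> * x) \<partial>std_normal_distribution)"
      unfolding dY by (rule integral_distr[of "\<lambda>x. \<mu> + \<sigma> * x" _ borel f]) (use that in auto)
    finally show "expectation (\<lambda>\<omega>. f (Y \<omega>)) = (\<integral>x. f (\<mu> + \<sigma> * x) \<partial>std_normal_distribution)" .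
  qed
  have m1: "integrable std_normal_distribution (\<lambda>x. x)" "(\<integral>x. x \<partial>std_normal_distribution) = 0"
    using integrable_std_normal_distribution_moment[of 1] integral_std_normal_distribution_moment_odd[of 1] by simp_all
  have m2: "integrable std_normal_distribution (\<lambda>x. x\<^sup>2)" "(\<integral>x. x\<^sup>2 \<partial>std_normal_distribution) = 1"
    using integrable_std_normal_distribution_moment[of 2] std_normal_distribution_even_moments[of 1] by (simp_all add: fact_numeral)
  have lin: "integrable std_normal_distribution (\<lambda>x. \<mu> + \<sigma> * x)"
    by (intro Bochner_Integration.integrable_add integrable_mult_right m1 N.integrable_const)
  have "integrable std_normal_distribution (\<lambda>x. \<mu>\<^sup>2 + (2 * \<mu> * \<sigma>) * x + \<sigma>\<^sup>2 * x\<^sup>2)"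
    by (intro Bochner_Integration.integrable_add integrable_mult_right m1 m2 N.integrable_const)
  moreover have "(\<lambda>x. \<mu>\<^sup>2 + (2 * \<mu> * \<sigma>) * x + \<sigma>\<^sup>2 * x\<^sup>2) = (\<lambda>x. (\<mu> + \<sigma> * x)\<^sup>2)"
    by (simp add: fun_eq_iff power2_eq_square algebra_simps)
  ultimately have sq: "integrable std_normal_distribution (\<lambda>x. (\<mu> + \<sigma> * x)\<^sup>2)" by (simp only:)
  have b1: "(\<lambda>x::real. x) \<in> borel_measurable borel" by simp
  show "integrable M Y" using int(1)[OF b1] lin by (simp only:)
  have b2: "(\<lambda>x::real. (x - c)\<^sup>2) \<in> borel_measurable borel" for c by measurable
  show "integrable M (\<lambda>\<omega>. (Y \<omega>)\<^sup>2)" using int(1)[OF b2[of 0]] sq by (simp only: diff_0_right)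
  have "expectation Y = (\<integral>x. \<mu> + \<sigma> * x \<partial>std_normal_distribution)" by (rule int(2)[OF b1])
  also have "\<dots> = \<mu> + \<sigma> * 0"
    by (subst Bochner_Integration.integral_add)
       (simp_all only: integrable_mult_right m1 N.integrable_const integral_mult_right_zero lebesgue_integral_const N.prob_space scaleR_one)
  finally show "expectation Y = \<mu>" by simp
  have "expectation (\<lambda>\<omega>. (Y \<omega> - \<mu>)\<^sup>2) = (\<integral>x. (\<mu> + \<sigma> * x - \<mu>)\<^sup>2 \<partial>std_normal_distribution)"
    by (rule int(2)[OF b2])
  also have "\<dots> = \<sigma>\<^sup>2 * 1"
    by (simp only: add_diff_cancel_left' power_mult_distrib integral_mult_right_zero m2)
  finally show "expectation (\<lambda>\<omega>. (Y \<omega> - \<mu>)\<^sup>2) = \<sigma>\<^sup>2" by simp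
qed

text \<open>A characteristic function has modulus at most 1. This reads off the sign of a quadratic
  form directly from the characteristic function.\<close>

lemma (in prob_space) char_variance_nonneg:
  assumes "expectation (\<lambda>\<omega>. cis (Y \<omega>)) = of_real (exp (- v / 2))"
  shows "0 \<le> v"
proof -
  have "norm (expectation (\<lambda>\<omega>. cis (Y \<omega>))) \<le> expectation (\<lambda>\<omega>. norm (cis (Y \<omega>)))"
    by (rule integral_norm_bound)
  then have "exp (- v / 2) \<le> 1" unfolding assms by (simp add: prob_space)
  then show ?thesis by simp
qed

text \<open>Every linear combination is centred normal with variance given by the quadratic form;
  polarization then recovers the mixed moment.\<close>

lemma (in prob_space) covariance_eq_of_char:
  assumes [measurable]: "Y \<in> borel_measurable M" "Z \<in> borel_measurable M"
    and char: "\<And>a b. expectation (\<lambda>\<omega>. cis (a * Y \<omega> + b * Z \<omega>)) = of_real (exp (- (a\<^sup>2 * v + 2 * a * b * w + b\<^sup>2 * u) / 2))"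
  shows "covariance M Y Z = w"
proof -
  define q where "q a b = a\<^sup>2 * v + 2 * a * b * w + b\<^sup>2 * u" for a b
  have q0: "0 \<le> q a b" for a b
    unfolding q_def by (rule char_variance_nonneg[OF char])
  have lin [measurable]: "(\<lambda>\<omega>. a * Y \<omega> + b * Z \<omega>) \<in> borel_measurable M" for a b by measurable
  have law: "distr M borel (\<lambda>\<omega>. a * Y \<omega> + b * Z \<omega>) = normal_law 0 (sqrt (q a b))" for a b
  proof (rule distr_eq_normal_law[OF _ q0])
    show "expectation (\<lambda>\<omega>. cis (\<theta> * (a * Y \<omega> + b * Z \<omega>))) = of_real (exp (- \<theta>\<^sup>2 * q a b / 2))" for \<theta>
      using char[of "\<theta> * a" "\<theta> * b"] by (simp add: q_def algebra_simps power_mult_distrib power2_eq_square)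
  qed measurable
  have sq: "0 \<le> sqrt (q a b)" "(sqrt (q a b))\<^sup>2 = q a b" for a b using q0 by simp_all
  note mom = normal_law_moments[OF lin law sq(1), unfolded diff_0_right sq(2)]
  have Y: "integrable M Y" "expectation Y = 0" "integrable M (\<lambda>\<omega>. (Y \<omega>)\<^sup>2)"
    using mom(1,2,3)[of 1 0] by (simp_all only: mult_1 mult_zero_left add_0_right)
  have Z: "integrable M Z" "expectation Z = 0" "integrable M (\<lambda>\<omega>. (Z \<omega>)\<^sup>2)"
    using mom(1,2,3)[of 0 1] by (simp_all only: mult_1 mult_zero_left add_0_left)
  have "covariance M Y Z = expectation (\<lambda>\<omega>. Y \<omega> * Z \<omega>)" by (simp add: covariance_def Y Z)
  also have "\<dots> = expectation (\<lambda>\<omega>. ((1 * Y \<omega> + 1 * Z \<omega>)\<^sup>2 - (1 * Y \<omega> + - 1 * Z \<omega>)\<^sup>2) / 4)"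
    by (intro Bochner_Integration.integral_cong refl) (simp add: power2_eq_square algebra_simps)
  also have "\<dots> = (expectation (\<lambda>\<omega>. (1 * Y \<omega> + 1 * Z \<omega>)\<^sup>2) - expectation (\<lambda>\<omega>. (1 * Y \<omega> + - 1 * Z \<omega>)\<^sup>2)) / 4"
    using mom(2)[of 1 1] mom(2)[of 1 "- 1"]
    by (simp only: integral_divide_zero Bochner_Integration.integral_diff)
  also have "\<dots> = (q 1 1 - q 1 (- 1)) / 4"
    by (simp only: mom(4))
  also have "\<dots> = w" by (simp add: q_def)
  finally show ?thesis .
qed

text \<open>Each finite linear combination is normal, so only its mean and variance matter.
  Normality provides the integrability of the products, and stationarity reduces every mixed moment
  to a value of \<gamma>.\<close>

lemma stationary_gaussian_covariance:
  assumes M: "prob_space M" and X_gauss: "gaussian_process M UNIV X" and X_stat: "stationary_seq M X"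
    and X_mean: "\<And>n::int. prob_space.expectation M (X n) = 0"
    and X_var: "\<And>n. prob_space.variance M (X n) = 1"
    and \<gamma>_def: "\<And>n. \<gamma> n = prob_space.expectation M (\<lambda>\<omega>. X n \<omega> * X 0 \<omega>)"
  shows "std_gauss M X (\<lambda>i j. \<gamma> (i - j))" "\<gamma> (- n) = \<gamma> n"
proof -
  interpret prob_space M by (rule M)
  have X [measurable]: "X n \<in> borel_measurable M" for n using X_gauss by (simp add: gaussian_process_def)
  have lin: "\<exists>\<mu> \<sigma>. 0 \<le> \<sigma> \<and> distr M borel (\<lambda>\<omega>. \<Sum>i\<in>F. c i * X i \<omega>) = normal_law \<mu> \<sigma>" if "finite F" for F c
    using X_gauss that by (simp add: gaussian_process_def)
  have X_int: "integrable M (X n)" "integrable M (\<lambda>\<omega>. (X n \<omega>)\<^sup>2)" for n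
  proof -
    obtain \<mu> \<sigma> where "0 \<le> \<sigma>" "distr M borel (X n) = normal_law \<mu> \<sigma>"
      using lin[of "{n}" "\<lambda>_. 1"] by auto
    with normal_law_moments[OF X] show "integrable M (X n)" "integrable M (\<lambda>\<omega>. (X n \<omega>)\<^sup>2)" by blast+
  qed
  have XX_int: "integrable M (\<lambda>\<omega>. X i \<omega> * X j \<omega>)" for i j
    by (rule integral_Cauchy_Schwarz(1)) (simp_all add: X_int)
  have cov: "expectation (\<lambda>\<omega>. X i \<omega> * X j \<omega>) = \<gamma> (i - j)" for i j
  proof -
    let ?F = "{0, i - j}"
    let ?Q = "Pi\<^sub>M ?F (\<lambda>_. borel) :: (int \<Rightarrow> real) measure"
    have f: "(\<lambda>x. x (i - j) * x 0) \<in> borel_measurable ?Q" by simp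
    have E: "expectation (\<lambda>\<omega>. X (i - j + h) \<omega> * X (0 + h) \<omega>) =
        integral\<^sup>L (distr M ?Q (\<lambda>\<omega>. \<lambda>n\<in>?F. X (n + h) \<omega>)) (\<lambda>x. x (i - j) * x 0)" for h
      by (subst integral_distr[OF _ f]) (simp_all add: measurable_restrict)
    have D: "distr M ?Q (\<lambda>\<omega>. \<lambda>n\<in>?F. X (n + h) \<omega>) = distr M ?Q (\<lambda>\<omega>. \<lambda>n\<in>?F. X (n + 0) \<omega>)" for h
      using X_stat by (simp add: stationary_seq_def)
    \<comment> \<open>Shifting the pair of indices \<open>i - j\<close> and \<open>0\<close> by
      \<open>j\<close> produces \<open>i\<close> and \<open>j\<close>.\<close>
    have "expectation (\<lambda>\<omega>. X (i - j + j) \<omega> * X (0 + j) \<omega>) = expectation (\<lambda>\<omega>. X (i - j + 0) \<omega> * X (0 + 0) \<omega>)"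
      unfolding E D[of j] ..
    then show ?thesis by (simp add: \<gamma>_def)
  qed
  show "\<gamma> (- n) = \<gamma> n"
    using cov[of 0 n] cov[of n 0] by (simp add: mult.commute)
  have \<gamma>0: "\<gamma> 0 = 1" using cov[of 0 0] X_var[of 0] by (simp add: X_mean power2_eq_square)
  show "std_gauss M X (\<lambda>i j. \<gamma> (i - j))"
  proof (unfold_locales)
    show "\<gamma> (i - i) = 1" for i by (simp add: \<gamma>0)
    show "\<gamma> (i - j) = \<gamma> (j - i)" for i j using cov[of i j] cov[of j i] by (simp add: mult.commute)
    fix F :: "int set" and c :: "int \<Rightarrow> real" assume F: "finite F"
    let ?S = "\<lambda>\<omega>. \<Sum>i\<in>F. c i * X i \<omega>"
    obtain \<mu> \<sigma> where \<sigma>: "0 \<le> \<sigma>" "distr M borel ?S = normal_law \<mu> \<sigma>" using lin[OF F] by blast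
    have S: "?S \<in> borel_measurable M" by measurable
    note mom = normal_law_moments[OF S \<sigma>(2,1)]
    have \<mu>: "\<mu> = 0" using mom(3) X_int by (simp add: X_mean)
    have "\<sigma>\<^sup>2 = expectation (\<lambda>\<omega>. \<Sum>i\<in>F. \<Sum>j\<in>F. c i * c j * (X i \<omega> * X j \<omega>))"
      using mom(4) unfolding \<mu> by (simp add: power2_eq_square sum_product ac_simps)
    also have "\<dots> = (\<Sum>i\<in>F. \<Sum>j\<in>F. c i * c j * \<gamma> (i - j))" using XX_int by (simp add: cov)
    finally have v: "\<sigma>\<^sup>2 = (\<Sum>i\<in>F. \<Sum>j\<in>F. c i * c j * \<gamma> (i - j))" .
    have "expectation (\<lambda>\<omega>. cis (?S \<omega>)) = (\<integral>x. cis (1 * x) \<partial>normal_law \<mu> \<sigma>)"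
      unfolding \<sigma>(2)[symmetric] by (subst integral_distr) simp_all
    also have "\<dots> = of_real (exp (- \<sigma>\<^sup>2 / 2))"
      unfolding integral_cis_normal_law[OF \<sigma>(1)] \<mu> by simp
    finally show "expectation (\<lambda>\<omega>. cis (?S \<omega>)) = of_real (exp (- (\<Sum>i\<in>F. \<Sum>j\<in>F. c i * c j * \<gamma> (i - j)) / 2))"
      unfolding v .
  qed simp
qed

text \<open>For \<open>\<rho> = S S'\<close>, with \<open>S'\<close> the transpose of
  \<open>S\<close>, the rows of \<open>S\<close> combine independent Brownian motions into a process
  with cross-covariance \<rho>; the unit diagonal makes each component a standard one.\<close>

lemma brownian_motions_with_covariance:
  fixes \<rho> :: "nat \<Rightarrow> nat \<Rightarrow> real"
  assumes sym: "\<And>i j. i \<in> {1..J} \<Longrightarrow> j \<in> {1..J} \<Longrightarrow> \<rho> i j = \<rho> j i"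
    and psd: "\<And>c. 0 \<le> (\<Sum>i\<in>{1..J}. \<Sum>j\<in>{1..J}. c i * c j * \<rho> i j)"
    and diag: "\<And>j. j \<in> {1..J} \<Longrightarrow> \<rho> j j = 1"
  obtains B :: "nat \<Rightarrow> real \<Rightarrow> (nat \<Rightarrow> real) \<Rightarrow> real" where
    "\<And>j t. B j t \<in> borel_measurable bm_space"
    "\<And>j. j \<in> {1..J} \<Longrightarrow> standard_brownian_motion bm_space (B j)"
    "\<And>(A :: (nat \<times> real) set) c. finite A \<Longrightarrow> A \<subseteq> {1..J} \<times> {0..} \<Longrightarrow>
      bm_space.expectation (\<lambda>\<omega>. cis (\<Sum>a\<in>A. c a * B (fst a) (snd a) \<omega>)) =
      of_real (exp (- (\<Sum>a\<in>A. \<Sum>b\<in>A. c a * c b * (\<rho> (fst a) (fst b) * min (snd a) (snd b))) / 2))"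
proof -
  have shift: "(\<Sum>i<J. f (Suc i)) = (\<Sum>i\<in>{1..J}. f i)" for f :: "nat \<Rightarrow> real"
    by (rule sum.reindex_bij_witness[of _ "\<lambda>i. i - 1" Suc]) auto
  have "\<exists>S. \<forall>i<J. \<forall>j<J. \<rho> (Suc i) (Suc j) = (\<Sum>r<J. S i r * S j r)"
  proof (rule psd_factorization)
    show "\<rho> (Suc i) (Suc j) = \<rho> (Suc j) (Suc i)" if "i < J" "j < J" for i j using that by (intro sym) auto
    show "0 \<le> (\<Sum>i<J. \<Sum>j<J. c i * c j * \<rho> (Suc i) (Suc j))" for c
      using psd[of "\<lambda>i. c (i - 1)"] unfolding shift[symmetric] by simp
  qed
  then obtain S where S: "\<And>i j. i < J \<Longrightarrow> j < J \<Longrightarrow> \<rho> (Suc i) (Suc j) = (\<Sum>r<J. S i r * S j r)" by blast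
  have \<rho>: "\<rho> i j = (\<Sum>r<J. S (i - 1) r * S (j - 1) r)" if "i \<in> {1..J}" "j \<in> {1..J}" for i j
    using S[of "i - 1" "j - 1"] that by auto
  define B where "B j t \<omega> = (\<Sum>r<J. S (j - 1) r * bm r t \<omega>)" for j t \<omega>
  have meas [measurable]: "B j t \<in> borel_measurable bm_space" for j t unfolding B_def[abs_def] by measurable
  have char: "bm_space.expectation (\<lambda>\<omega>. cis (\<Sum>a\<in>A. c a * B (jf a) (tm a) \<omega>)) =
      of_real (exp (- (\<Sum>a\<in>A. \<Sum>b\<in>A. c a * c b * (\<rho> (jf a) (jf b) * min (tm a) (tm b))) / 2))"
    if A: "finite A" "\<And>a. a \<in> A \<Longrightarrow> jf a \<in> {1..J}" "\<And>a. a \<in> A \<Longrightarrow> 0 \<le> tm a"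
    for A :: "'b set" and c jf and tm :: "'b \<Rightarrow> real"
  proof -
    have "(\<Sum>a\<in>A. c a * B (jf a) (tm a) \<omega>) = (\<Sum>r<J. \<Sum>a\<in>A. (c a * S (jf a - 1) r) * bm r (tm a) \<omega>)" for \<omega>
      unfolding B_def sum_distrib_left mult.assoc by (rule sum.swap)
    moreover have "(\<Sum>r<J. \<Sum>a\<in>A. \<Sum>b\<in>A. (c a * S (jf a - 1) r) * (c b * S (jf b - 1) r) * min (tm a) (tm b)) =
        (\<Sum>a\<in>A. \<Sum>b\<in>A. c a * c b * (\<rho> (jf a) (jf b) * min (tm a) (tm b)))"
    proof -
      have "(\<Sum>r<J. \<Sum>a\<in>A. \<Sum>b\<in>A. (c a * S (jf a - 1) r) * (c b * S (jf b - 1) r) * min (tm a) (tm b)) =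
          (\<Sum>a\<in>A. \<Sum>r<J. \<Sum>b\<in>A. (c a * S (jf a - 1) r) * (c b * S (jf b - 1) r) * min (tm a) (tm b))"
        by (rule sum.swap)
      also have "\<dots> = (\<Sum>a\<in>A. \<Sum>b\<in>A. \<Sum>r<J. (c a * S (jf a - 1) r) * (c b * S (jf b - 1) r) * min (tm a) (tm b))"
        by (rule sum.cong[OF refl], rule sum.swap)
      also have "\<dots> = (\<Sum>a\<in>A. \<Sum>b\<in>A. c a * c b * (\<rho> (jf a) (jf b) * min (tm a) (tm b)))"
      proof (rule sum.cong[OF refl], rule sum.cong[OF refl])
        fix a b assume "a \<in> A" "b \<in> A"
        show "(\<Sum>r<J. (c a * S (jf a - 1) r) * (c b * S (jf b - 1) r) * min (tm a) (tm b)) =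
            c a * c b * (\<rho> (jf a) (jf b) * min (tm a) (tm b))"
          unfolding \<rho>[OF A(2)[OF \<open>a \<in> A\<close>] A(2)[OF \<open>b \<in> A\<close>]] sum_distrib_left sum_distrib_right
          by (simp add: ac_simps)
      qed
      finally show ?thesis .
    qed
    ultimately show ?thesis using char_bm[OF A(1,3), where R = J and d = "\<lambda>r a. c a * S (jf a - 1) r"] by simp
  qed
  show ?thesis
  proof (rule that[OF meas])
    fix j assume j: "j \<in> {1..J}"
    show "standard_brownian_motion bm_space (B j)"
    proof (rule standard_brownian_motionI[OF bm_space.prob_space_axioms meas])
      show "AE \<omega> in bm_space. B j 0 \<omega> = 0" by (simp add: B_def bm_0)
      have "AE \<omega> in bm_space. \<forall>r. continuous_on {0..} (\<lambda>t. bm r t \<omega>)"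
        unfolding AE_all_countable using AE_bm_convergence by (auto elim: eventually_mono)
      then show "AE \<omega> in bm_space. continuous_on {0..} (\<lambda>t. B j t \<omega>)"
        unfolding B_def by eventually_elim (intro continuous_intros, simp)
      show "bm_space.expectation (\<lambda>\<omega>. cis (\<Sum>i<n. c i * B j (t i) \<omega>)) =
          of_real (exp (- (\<Sum>i<n. \<Sum>l<n. c i * c l * min (t i) (t l)) / 2))"
        if "\<And>i. i < n \<Longrightarrow> 0 \<le> t i" for n :: nat and t c
        using char[of "{..<n}" "\<lambda>_. j" t c] that j diag[OF j] by simp
    qed
  next
    show "bm_space.expectation (\<lambda>\<omega>. cis (\<Sum>a\<in>A. c a * B (fst a) (snd a) \<omega>)) =
      of_real (exp (- (\<Sum>a\<in>A. \<Sum>b\<in>A. c a * c b * (\<rho> (fst a) (fst b) * min (snd a) (snd b))) / 2))"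
      if "finite A" "A \<subseteq> {1..J} \<times> {0..}" for A :: "(nat \<times> real) set" and c
      using that by (intro char) auto
  qed
qed

text \<open>Markov's inequality for the sum of squares, as a source of tightness.\<close>

lemma (in prob_space) exists_abs_gt_prob_le:
  assumes I: "finite I" and [measurable]: "\<And>i. i \<in> I \<Longrightarrow> Y i \<in> borel_measurable M"
    and int: "\<And>i. i \<in> I \<Longrightarrow> integrable M (\<lambda>\<omega>. (Y i \<omega>)\<^sup>2)" and R: "0 < R"
  shows "prob {\<omega>\<in>space M. \<exists>i\<in>I. R < \<bar>Y i \<omega>\<bar>} \<le> (\<Sum>i\<in>I. expectation (\<lambda>\<omega>. (Y i \<omega>)\<^sup>2)) / R\<^sup>2"
proof -
  let ?u = "\<lambda>\<omega>. \<Sum>i\<in>I. (Y i \<omega>)\<^sup>2"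
  have int_u: "integrable M ?u" using int by simp
  have "prob {\<omega>\<in>space M. \<exists>i\<in>I. R < \<bar>Y i \<omega>\<bar>} \<le> prob {\<omega>\<in>space M. R\<^sup>2 \<le> ?u \<omega>}"
  proof (rule finite_measure_mono)
    show "{\<omega>\<in>space M. \<exists>i\<in>I. R < \<bar>Y i \<omega>\<bar>} \<subseteq> {\<omega>\<in>space M. R\<^sup>2 \<le> ?u \<omega>}"
    proof safe
      fix \<omega> i assume "i \<in> I" "R < \<bar>Y i \<omega>\<bar>"
      then have "R\<^sup>2 \<le> (Y i \<omega>)\<^sup>2" using R by (intro abs_le_square_iff[THEN iffD1]) simp
      also have "\<dots> \<le> ?u \<omega>" using I \<open>i \<in> I\<close> by (intro member_le_sum) auto
      finally show "R\<^sup>2 \<le> ?u \<omega>" .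
    qed
    show "{\<omega>\<in>space M. R\<^sup>2 \<le> ?u \<omega>} \<in> events" by measurable
  qed
  also have "\<dots> \<le> expectation ?u / R\<^sup>2"
    by (rule integral_Markov_inequality_measure[OF int_u sets.empty_sets]) (use R in \<open>auto intro!: sum_nonneg\<close>)
  finally show ?thesis using int by simp
qed

theorem theorem3p1:
  fixes M :: "'a measure" and X :: "int \<Rightarrow> 'a \<Rightarrow> real" and \<gamma> :: "int \<Rightarrow> real"
    and L :: "real \<Rightarrow> real" and d :: real
    and J :: nat and G :: "nat \<Rightarrow> real \<Rightarrow> real" and k :: "nat \<Rightarrow> nat"
    and a :: "nat \<Rightarrow> real" and A :: "nat \<Rightarrow> nat \<Rightarrow> real"
  assumes M: "prob_space M"
    and X_gauss: "gaussian_process M UNIV X"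
    and X_stat: "stationary_seq M X"
    and X_mean: "\<And>n. prob_space.expectation M (X n) = 0"
    and X_var: "\<And>n. prob_space.variance M (X n) = 1"
    and \<gamma>_def: "\<And>n. \<gamma> n = prob_space.expectation M (\<lambda>\<omega>. X n \<omega> * X 0 \<omega>)"
    and d: "0 < d" "d < 1 / 2"
    and L: "slowly_varying L"
    and \<gamma>_L: "\<And>n::nat. 1 \<le> n \<Longrightarrow> \<gamma> (int n) = L (real n) * real n powr (2 * d - 1)"
    and J: "1 \<le> J"
    and G_L2: "\<And>j. j \<in> {1..J} \<Longrightarrow> G j \<in> L2_gauss"
    and G_mean: "\<And>j n. j \<in> {1..J} \<Longrightarrow> prob_space.expectation M (\<lambda>\<omega>. G j (X n \<omega>)) = 0"
    and G_rank: "\<And>j. j \<in> {1..J} \<Longrightarrow> has_hermite_rank (G j) (k j)"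
    and d_rank: "\<And>j. j \<in> {1..J} \<Longrightarrow> d < 1 / 2 * (1 - 1 / real (k j))"
    and a_pos: "\<And>j. j \<in> {1..J} \<Longrightarrow> 0 < a j"
    and A_def: "\<And>j N. j \<in> {1..J} \<Longrightarrow> A j N = a j * real N powr (1 / 2)"
    and A_norm: "\<And>j. j \<in> {1..J} \<Longrightarrow>
      (\<lambda>N. prob_space.variance M (\<lambda>\<omega>. inverse (A j N) * (\<Sum>n=1..N. G j (X (int n) \<omega>)))) \<longlonglongrightarrow> 1"
  shows "(\<forall>j\<in>{1..J}. \<forall>m\<ge>k j. (\<lambda>n. \<gamma> n ^ m) summable_on UNIV) \<and>
    (\<forall>i\<in>{1..J}. \<forall>j\<in>{1..J}. cov_term \<gamma> (G i) (G j) summable_on {max (k i) (k j)..}) \<and>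
    (\<exists>\<sigma> :: nat \<Rightarrow> real.
      (\<forall>j\<in>{1..J}. 0 < \<sigma> j \<and> (\<sigma> j)\<^sup>2 = (\<Sum>\<^sub>\<infinity>m\<in>{k j..}. cov_term \<gamma> (G j) (G j) m)) \<and>
      (\<exists>(P :: (nat \<Rightarrow> real) measure) (B :: nat \<Rightarrow> real \<Rightarrow> (nat \<Rightarrow> real) \<Rightarrow> real).
        prob_space P \<and>
        gaussian_process P ({1..J} \<times> {0<..}) (\<lambda>(j, t). B j t) \<and>
        (\<forall>j\<in>{1..J}. standard_brownian_motion P (B j)) \<and>
        (\<forall>i\<in>{1..J}. \<forall>j\<in>{1..J}. \<forall>s>0. \<forall>t>0.
          covariance P (B i s) (B j t) =
            min s t * (1 / (\<sigma> i * \<sigma> j) *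
              (\<Sum>\<^sub>\<infinity>m\<in>{max (k i) (k j)..}. cov_term \<gamma> (G i) (G j) m)) \<and>
          (\<lambda>N. covariance M (partial_sum_process X G A N i s) (partial_sum_process X G A N j t))
            \<longlonglongrightarrow> covariance P (B i s) (B j t)) \<and>
        fdd_converge {1..J} M (partial_sum_process X G A) P B))"
proof -
  note gauss = stationary_gaussian_covariance[OF M X_gauss X_stat X_mean X_var \<gamma>_def]
  have k_pos: "1 \<le> k j" if "j \<in> {1..J}" for j using G_rank[OF that] by (simp add: has_hermite_rank_def)
  define k0 where "k0 = Min (k ` {1..J})"
  have "k0 \<in> k ` {1..J}" unfolding k0_def using J by (intro Min_in) auto
  then obtain j0 where j0: "j0 \<in> {1..J}" "k0 = k j0" by blast
  have k0_le: "k0 \<le> k j" if "j \<in> {1..J}" for j using that by (simp add: k0_def)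
  have "stat_gauss M X \<gamma> k0"
  proof (intro stat_gauss.intro stat_gauss_axioms.intro gauss(1))
    show "1 \<le> k0" using k_pos[OF j0(1)] by (simp add: j0)
    then show "(\<lambda>n. \<bar>\<gamma> n\<bar> ^ k0) summable_on UNIV"
      using d_rank[OF j0(1)] unfolding j0(2) by (intro long_memory_power_summable[OF L \<gamma>_L gauss(2)])
  qed
  then interpret stat_gauss M X \<gamma> k0 .
  \<comment> \<open>The rank only concerns degrees from 1 on; degree 0 is covered by the assumption
    that \<open>G j (X n)\<close> has mean zero.\<close>
  have coeff0: "hermite_coeff (G j) m = 0" if j: "j \<in> {1..J}" and m: "m < k j" for j m
  proof (cases "m = 0")
    case True
    have "(\<integral>x. G j x \<partial>std_normal_distribution) = 0"
      using integral_X[OF L2_gaussD(1)[OF G_L2[OF j]], of 0] G_mean[OF j, of 0] by simp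
    then show ?thesis by (simp add: hermite_coeff_def True)
  next
    case False
    with G_rank[OF j] m show ?thesis by (simp add: has_hermite_rank_def)
  qed
  have G: "G j \<in> rank_ge" if "j \<in> {1..J}" for j
    using G_L2[OF that] coeff0[OF that] k0_le[OF that] by (auto simp: rank_ge_def)
  \<comment> \<open>Below the larger of the two ranks one coefficient vanishes, so restricting the
    range does not change the sum.\<close>
  have cov_sum: "(cov_term \<gamma> (G i) (G j) has_sum long_cov (G i) (G j)) {max (k i) (k j)..}"
    if "i \<in> {1..J}" "j \<in> {1..J}" for i j
  proof -
    have "cov_term \<gamma> (G i) (G j) m = 0" if "m < max (k i) (k j)" for m
      using that coeff0[OF \<open>i \<in> {1..J}\<close>, of m] coeff0[OF \<open>j \<in> {1..J}\<close>, of m] by (auto simp: cov_term_def less_max_iff_disj)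
    then show ?thesis
      using cov_term_has_sum[OF G[OF that(1)] G[OF that(2)]]
      by (subst has_sum_cong_neutral[where T = UNIV and g = "cov_term \<gamma> (G i) (G j)"]) auto
  qed
  \<comment> \<open>The constants \<open>a j\<close> move into the functions, which leaves the
    common normalization \<open>sqrt N\<close>.\<close>
  define K where "K j x = 1 / a j * G j x" for j x
  define \<rho> where "\<rho> i j = long_cov (K i) (K j)" for i j
  have K: "K j \<in> rank_ge" if "j \<in> {1..J}" for j
    unfolding K_def[abs_def] by (rule rank_ge_cmult[OF G[OF that]])
  note K2 = rank_geD(1)[OF K]
  have \<rho>_eq: "\<rho> i j = 1 / (a i * a j) * long_cov (G i) (G j)" for i j
    unfolding \<rho>_def K_def[abs_def] long_cov_cmult by simp
  define V where "V = partial_sum_process X G A"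
  have V_eq: "V N j t \<omega> = (\<Sum>n\<in>{1..\<lfloor>real N * t\<rfloor>}. K j (X n \<omega>)) / sqrt (real N)" if "j \<in> {1..J}" for N j t \<omega>
    by (simp add: V_def partial_sum_process_def A_def[OF that] K_def powr_half_sqrt sum_divide_distrib sum_distrib_left)
  have V_prod: "V N i s \<omega> * V N j t \<omega> =
      ((\<Sum>n\<in>{1..\<lfloor>real N * s\<rfloor>}. K i (X n \<omega>)) * (\<Sum>n\<in>{1..\<lfloor>real N * t\<rfloor>}. K j (X n \<omega>))) / real N"
    if "i \<in> {1..J}" "j \<in> {1..J}" for N i j s t \<omega>
    by (simp add: V_eq[OF that(1)] V_eq[OF that(2)])
  have V_meas: "V N j t \<in> borel_measurable M" if "j \<in> {1..J}" for N j t
    unfolding V_eq[OF that, abs_def] using L2_X(1)[OF K2[OF that]] by measurable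
  have V_mean: "expectation (V N j t) = 0" if "j \<in> {1..J}" for N j t
  proof -
    have "integrable M (\<lambda>\<omega>. K j (X n \<omega>))" "expectation (\<lambda>\<omega>. K j (X n \<omega>)) = 0" for n
      using expectation_abs_le_sqrt(1)[OF L2_X(1,2)[OF K2[OF that]]] G_mean[OF that] by (simp_all add: K_def)
    then show ?thesis unfolding V_eq[OF that, abs_def] by simp
  qed
  have V_int: "integrable M (\<lambda>\<omega>. V N i s \<omega> * V N j t \<omega>)" if "i \<in> {1..J}" "j \<in> {1..J}" for N i j s t
    unfolding V_prod[OF that] using expectation_sum_product(1)[OF K2[OF that(1)] K2[OF that(2)]] by simp
  have V_cov: "covariance M (V N i s) (V N j t) = expectation (\<lambda>\<omega>. V N i s \<omega> * V N j t \<omega>)"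
    if "i \<in> {1..J}" "j \<in> {1..J}" for N i j s t
    by (simp add: covariance_def V_mean[OF that(1)] V_mean[OF that(2)])
  have V_cov_lim: "(\<lambda>N. covariance M (V N i s) (V N j t)) \<longlonglongrightarrow> min s t * \<rho> i j"
    if "i \<in> {1..J}" "j \<in> {1..J}" "0 \<le> s" "0 \<le> t" for i j s t
    using partial_sum_cov_limit[OF K[OF that(1)] K[OF that(2)] that(3,4)]
    unfolding V_cov[OF that(1,2)] V_prod[OF that(1,2)] \<rho>_def by simp
  \<comment> \<open>At time 1 the covariance limit is \<open>\<rho> j j\<close>, while the assumed
    normalization makes the same sequence tend to 1. Solving for the long-run variance identifies it
    with the square of \<open>a j\<close>.\<close>
  have \<rho>_diag: "\<rho> j j = 1" if j: "j \<in> {1..J}" for j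
  proof -
    have "inverse (A j N) * (\<Sum>n=1..N. G j (X (int n) \<omega>)) = V N j 1 \<omega>" for N \<omega>
    proof -
      have "(\<Sum>n=1..N. G j (X (int n) \<omega>)) = (\<Sum>n\<in>{1..int N}. G j (X n \<omega>))"
        by (rule sum.reindex_bij_witness[of _ nat int]) auto
      then show ?thesis by (simp add: V_def partial_sum_process_def inverse_eq_divide)
    qed
    then have "(\<lambda>N. covariance M (V N j 1) (V N j 1)) \<longlonglongrightarrow> 1"
      using A_norm[OF j] by (simp add: covariance_def power2_eq_square)
    with V_cov_lim[OF j j, of 1 1] show ?thesis by (auto dest: LIMSEQ_unique)
  qed
  then have \<sigma>: "(a j)\<^sup>2 = (\<Sum>\<^sub>\<infinity>m\<in>{k j..}. cov_term \<gamma> (G j) (G j) m)" if "j \<in> {1..J}" for j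
    using infsumI[OF cov_sum[OF that that]] a_pos[OF that] that
    by (auto simp: \<rho>_eq field_simps power2_eq_square)
  obtain B :: "nat \<Rightarrow> real \<Rightarrow> (nat \<Rightarrow> real) \<Rightarrow> real" where B_meas: "\<And>j t. B j t \<in> borel_measurable bm_space"
    and B_bm: "\<And>j. j \<in> {1..J} \<Longrightarrow> standard_brownian_motion bm_space (B j)"
    and B_char: "\<And>(F :: (nat \<times> real) set) c. finite F \<Longrightarrow> F \<subseteq> {1..J} \<times> {0..} \<Longrightarrow>
      bm_space.expectation (\<lambda>\<omega>. cis (\<Sum>p\<in>F. c p * B (fst p) (snd p) \<omega>)) =
      of_real (exp (- (\<Sum>p\<in>F. \<Sum>q\<in>F. c p * c q * (\<rho> (fst p) (fst q) * min (snd p) (snd q))) / 2))"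
  proof (rule brownian_motions_with_covariance[of J \<rho>])
    show "\<rho> i j = \<rho> j i" if "i \<in> {1..J}" "j \<in> {1..J}" for i j
      unfolding \<rho>_def by (intro long_cov_commute K2 that)
    show "0 \<le> (\<Sum>i\<in>{1..J}. \<Sum>j\<in>{1..J}. c i * c j * \<rho> i j)" for c
      using long_cov_psd[of "{1..J}" "\<lambda>j x. c j * K j x"] by (simp add: long_cov_cmult rank_ge_cmult K \<rho>_def)
  qed (use \<rho>_diag in auto)
  have B_gauss: "gaussian_process bm_space ({1..J} \<times> {0<..}) (\<lambda>(j, t). B j t)"
    unfolding gaussian_process_def
  proof (intro conjI ballI allI impI)
    show "(case p of (j, t) \<Rightarrow> B j t) \<in> borel_measurable bm_space" for p
      by (cases p) (simp add: B_meas)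
    fix F :: "(nat \<times> real) set" and c assume "finite F \<and> F \<subseteq> {1..J} \<times> {0<..}"
    then have F: "finite F" "F \<subseteq> {1..J} \<times> {0..}" by auto
    define v where "v = (\<Sum>p\<in>F. \<Sum>q\<in>F. c p * c q * (\<rho> (fst p) (fst q) * min (snd p) (snd q)))"
    let ?Y = "\<lambda>\<omega>. \<Sum>p\<in>F. c p * B (fst p) (snd p) \<omega>"
    have v: "0 \<le> v" using bm_space.char_variance_nonneg[OF B_char[OF F, of c]] by (simp add: v_def)
    have "distr bm_space borel ?Y = normal_law 0 (sqrt v)"
    proof (rule bm_space.distr_eq_normal_law[OF _ v])
      show "?Y \<in> borel_measurable bm_space" using B_meas by measurable
      show "bm_space.expectation (\<lambda>\<omega>. cis (\<theta> * ?Y \<omega>)) = of_real (exp (- \<theta>\<^sup>2 * v / 2))" for \<theta>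
      proof -
        have "(\<Sum>p\<in>F. \<Sum>q\<in>F. (\<theta> * c p) * (\<theta> * c q) * (\<rho> (fst p) (fst q) * min (snd p) (snd q))) = \<theta>\<^sup>2 * v"
          by (simp add: v_def sum_distrib_left power2_eq_square ac_simps)
        with B_char[OF F, of "\<lambda>p. \<theta> * c p"] show ?thesis by (simp add: sum_distrib_left mult.assoc)
      qed
    qed
    then show "\<exists>\<mu> \<sigma>. 0 \<le> \<sigma> \<and> distr bm_space borel (\<lambda>\<omega>. \<Sum>p\<in>F. c p * (case p of (j, t) \<Rightarrow> B j t) \<omega>) = normal_law \<mu> \<sigma>"
      using v by (intro exI[of _ 0] exI[of _ "sqrt v"]) (simp add: case_prod_beta)
  qed
  have B_cov: "covariance bm_space (B i s) (B j t) = min s t * \<rho> i j"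
    if "i \<in> {1..J}" "j \<in> {1..J}" "0 < s" "0 < t" for i j s t
  proof (rule bm_space.covariance_eq_of_char[OF B_meas B_meas])
    fix x y :: real
    show "bm_space.expectation (\<lambda>\<omega>. cis (x * B i s \<omega> + y * B j t \<omega>)) =
        of_real (exp (- (x\<^sup>2 * s + 2 * x * y * (min s t * \<rho> i j) + y\<^sup>2 * t) / 2))"
    \<comment> \<open>If the two pairs coincide the index set has a single element, and the
      coefficients add up.\<close>
    proof (cases "(i, s) = (j, t)")
      case True
      then show ?thesis
        using B_char[of "{(i, s)}" "\<lambda>_. x + y"] that \<rho>_diag[OF that(1)]
        by (simp add: algebra_simps power2_eq_square)
    next
      case False
      then obtain c :: "nat \<times> real \<Rightarrow> real" where c: "c (i, s) = x" "c (j, t) = y"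
        using that[of "\<lambda>p. if p = (i, s) then x else y"] by auto
      show ?thesis
        using B_char[of "{(i, s), (j, t)}" c] that False c
          \<rho>_diag[OF that(1)] \<rho>_diag[OF that(2)] long_cov_commute[OF K2[OF that(1)] K2[OF that(2)]]
        by (simp add: algebra_simps power2_eq_square min.commute \<rho>_def)
    qed
  qed
  have fdd: "fdd_converge {1..J} M V bm_space B"
    unfolding fdd_converge_def
  proof (intro allI impI)
    fix T :: "real set" assume T: "finite T \<and> T \<subseteq> {0<..}"
    let ?I = "{1..J} \<times> T"
    have I: "finite ?I" "?I \<subseteq> {1..J} \<times> {0..}" using T by auto
    have IJ: "fst p \<in> {1..J}" "0 \<le> snd p" if "p \<in> ?I" for p using that I(2) by auto
    have char: "(\<lambda>N. expectation (\<lambda>\<omega>. cis (\<Sum>p\<in>?I. c p * V N (fst p) (snd p) \<omega>))) \<longlonglongrightarrow>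
        bm_space.expectation (\<lambda>\<omega>. cis (\<Sum>p\<in>?I. c p * B (fst p) (snd p) \<omega>))" for c
    proof -
      have "(\<Sum>p\<in>?I. \<Sum>n\<in>{1..\<lfloor>real N * snd p\<rfloor>}. c p * K (fst p) (X n \<omega>)) / sqrt (real N) =
          (\<Sum>p\<in>?I. c p * V N (fst p) (snd p) \<omega>)" for N \<omega>
        unfolding sum_divide_distrib[of _ ?I]
        by (rule sum.cong[OF refl]) (simp add: V_eq[OF IJ(1)] sum_distrib_left[symmetric])
      moreover have "(\<lambda>N. expectation (\<lambda>\<omega>. cis ((\<Sum>p\<in>?I. \<Sum>n\<in>{1..\<lfloor>real N * snd p\<rfloor>}. c p * K (fst p) (X n \<omega>)) / sqrt (real N)))) \<longlonglongrightarrow>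
          of_real (exp (- (\<Sum>p\<in>?I. \<Sum>q\<in>?I. min (snd p) (snd q) * long_cov (\<lambda>x. c p * K (fst p) x) (\<lambda>x. c q * K (fst q) x)) / 2))"
        by (rule rank_clt[OF I(1) rank_ge_cmult[OF K[OF IJ(1)]] IJ(2)])
      ultimately show ?thesis
        unfolding B_char[OF I] long_cov_cmult \<rho>_def[symmetric] by (simp add: ac_simps)
    qed
    \<comment> \<open>The sum of second moments converges, hence is bounded over all
      \<open>N\<close>; Markov's inequality then gives tightness uniformly in
      \<open>N\<close>.\<close>
    have second: "\<exists>C. \<forall>N. (\<Sum>p\<in>?I. expectation (\<lambda>\<omega>. (V N (fst p) (snd p) \<omega>)\<^sup>2)) \<le> C"
    proof -
      have "(\<lambda>N. \<Sum>p\<in>?I. covariance M (V N (fst p) (snd p)) (V N (fst p) (snd p))) \<longlonglongrightarrow>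
          (\<Sum>p\<in>?I. min (snd p) (snd p) * \<rho> (fst p) (fst p))"
        by (intro tendsto_sum V_cov_lim IJ)
      then have "Bseq (\<lambda>N. \<Sum>p\<in>?I. covariance M (V N (fst p) (snd p)) (V N (fst p) (snd p)))"
        by (rule convergent_imp_Bseq[OF convergentI])
      then obtain C where C: "\<And>N. \<bar>\<Sum>p\<in>?I. covariance M (V N (fst p) (snd p)) (V N (fst p) (snd p))\<bar> \<le> C"
        unfolding Bseq_def real_norm_def by blast
      have "(\<Sum>p\<in>?I. expectation (\<lambda>\<omega>. (V N (fst p) (snd p) \<omega>)\<^sup>2)) =
          (\<Sum>p\<in>?I. covariance M (V N (fst p) (snd p)) (V N (fst p) (snd p)))" for N
        by (rule sum.cong[OF refl]) (simp add: V_cov[OF IJ(1) IJ(1)] power2_eq_square)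
      then show ?thesis using abs_le_D1[OF C] by auto
    qed
    have "(\<lambda>N. \<integral>\<omega>. f (\<lambda>p\<in>?I. V N (fst p) (snd p) \<omega>) \<partial>M) \<longlonglongrightarrow> (\<integral>\<omega>. f (\<lambda>p\<in>?I. B (fst p) (snd p) \<omega>) \<partial>bm_space)"
      if f: "continuous_on (?I \<rightarrow>\<^sub>E UNIV) f" "bounded (f ` (?I \<rightarrow>\<^sub>E UNIV))" for f :: "(nat \<times> real \<Rightarrow> real) \<Rightarrow> real"
    proof (rule vec_levy_continuity[OF M bm_space.prob_space_axioms I(1) _ B_meas char _ f])
      show "V N (fst p) (snd p) \<in> borel_measurable M" if "p \<in> ?I" for N p by (rule V_meas[OF IJ(1)[OF that]])
      fix e :: real assume e: "0 < e"
      obtain C where C: "\<And>N. (\<Sum>p\<in>?I. expectation (\<lambda>\<omega>. (V N (fst p) (snd p) \<omega>)\<^sup>2)) \<le> C" using second by blast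
      \<comment> \<open>Here \<open>C \<le> e * R\<close>, so \<open>C / R\<^sup>2\<close> is at
        most \<open>e / R\<close>, and this is at most \<open>e\<close> since
        \<open>R \<ge> 1\<close>.\<close>
      have "prob {\<omega> \<in> space M. \<exists>p\<in>?I. R < \<bar>V N (fst p) (snd p) \<omega>\<bar>} \<le> e" if R: "max 1 (C / e) \<le> R" for R N
      proof -
        have R1: "1 \<le> R" "C \<le> e * R" using R e by (auto simp: field_simps)
        have "prob {\<omega> \<in> space M. \<exists>p\<in>?I. R < \<bar>V N (fst p) (snd p) \<omega>\<bar>} \<le>
            (\<Sum>p\<in>?I. expectation (\<lambda>\<omega>. (V N (fst p) (snd p) \<omega>)\<^sup>2)) / R\<^sup>2"
          using V_int[OF IJ(1) IJ(1)] R1 by (intro exists_abs_gt_prob_le I(1) V_meas IJ(1)) (auto simp: power2_eq_square)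
        also have "\<dots> \<le> e * R / R\<^sup>2" using C[of N] R1 by (intro divide_right_mono) auto
        also have "\<dots> \<le> e" using R1 e by (simp add: field_simps power2_eq_square)
        finally show ?thesis .
      qed
      then show "\<exists>R. \<forall>R'\<ge>R. \<forall>N. measure M {\<omega>\<in>space M. \<exists>p\<in>?I. R' < \<bar>V N (fst p) (snd p) \<omega>\<bar>} \<le> e" by blast
    qed
    then show "vec_conv_in_dist M (\<lambda>N (j, t). V N j t) bm_space (\<lambda>(j, t). B j t) ?I"
      unfolding vec_conv_in_dist_def case_prod_beta using V_meas[OF IJ(1)] B_meas by blast
  qed
  show ?thesis
  \<comment> \<open>The normalizing constants \<open>a j\<close> themselves are the witnesses for
    \<open>\<sigma> j\<close>.\<close>
  proof (intro conjI ballI allI impI exI[of _ a] exI[of _ bm_space] exI[of _ B])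
    show "(\<lambda>n. \<gamma> n ^ m) summable_on UNIV" if "j \<in> {1..J}" "k j \<le> m" for j m
      by (rule abs_summable_summable)
         (use \<gamma>_power_summable[of m] k0_le[OF that(1)] that(2) in \<open>simp add: power_abs\<close>)
    show "cov_term \<gamma> (G i) (G j) summable_on {max (k i) (k j)..}" if "i \<in> {1..J}" "j \<in> {1..J}" for i j
      using cov_sum[OF that] by (rule has_sum_imp_summable)
    fix i j and s t :: real assume ij: "i \<in> {1..J}" "j \<in> {1..J}" and st: "0 < s" "0 < t"
    show "covariance bm_space (B i s) (B j t) = min s t * (1 / (a i * a j) *
        (\<Sum>\<^sub>\<infinity>m\<in>{max (k i) (k j)..}. cov_term \<gamma> (G i) (G j) m))"
      unfolding B_cov[OF ij st] \<rho>_eq infsumI[OF cov_sum[OF ij]] ..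
    show "(\<lambda>N. covariance M (partial_sum_process X G A N i s) (partial_sum_process X G A N j t))
        \<longlonglongrightarrow> covariance bm_space (B i s) (B j t)"
      unfolding B_cov[OF ij st] V_def[symmetric] using V_cov_lim[OF ij] st by simp
  qed (use a_pos \<sigma> B_gauss B_bm fdd bm_space.prob_space_axioms in \<open>auto simp: V_def\<close>)
qed

end
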